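(* Let $c\ge 0$. For complex sequences $(a_n)_{n\ge1}$, $(b_m)_{m\ge1}$ with $|a_n|,|b_m|\le 1$ and real $T,z\ge 2$ put \[ S_c(T,z)=\sum_{\substack{n,m \text{ odd, square-free}\\ z<n\le T,\ z<m\le T\\ nm\le T}} (nm)^c a_n b_m \Big(\frac{n}{m}\Big). \] (i) For every $\epsilon>0$ there is a constant $C_{c,\epsilon}$, depending only on $c$ and $\epsilon$, such that for all $T,z\ge 2$ with $z\ge T^{1/3-\epsilon}$ and all such sequences, \[ |S_c(T,z)|\le C_{c,\epsilon}\,\frac{T^{1+c+\epsilon}}{z^{1/2}}. \] (ii) For every $\epsilon>0$ there is a constant $C'_{c,\epsilon}$, depending only on $c$ and $\epsilon$, such that for all $T,z\ge 2$ with $z\le T^{1/3-\epsilon}$ and all such sequences, \[ |S_c(T,z)|\le C'_{c,\epsilon}\,\frac{T^{1+c}(\log T)^3}{z^{1/2}}. \]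
   Context: $\big(\frac{n}{m}\big)$ denotes the Jacobi symbol, defined for integers $n$ and odd positive integers $m$. The sum runs over pairs $(n,m)$ of positive integers that are both odd and square-free. *)

theory Defs
  imports Complex_Main "HOL-Number_Theory.Number_Theory"
    "HOL-Computational_Algebra.Squarefree"
begin

(* Meaningful for odd positive m only; the product runs over the prime factors
   of m with multiplicity. *)
definition jacobi :: "int \<Rightarrow> nat \<Rightarrow> int" where
  "jacobi n m = (\<Prod>p\<in>#prime_factorization m. Legendre n (int p))"

lemma jacobi_1 [simp]: "jacobi n 1 = 1"
  by (simp add: jacobi_def)

lemma jacobi_prime: "prime p \<Longrightarrow> jacobi n p = Legendre n (int p)"
  by (simp add: jacobi_def prime_factorization_prime)

lemma jacobi_mult_right:
  "m > 0 \<Longrightarrow> k > 0 \<Longrightarrow> jacobi n (m * k) = jacobi n m * jacobi n k"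
  by (simp add: jacobi_def prime_factorization_mult)

definition hyperbolic_pairs :: "real \<Rightarrow> real \<Rightarrow> (nat \<times> nat) set" where
  "hyperbolic_pairs T z = {(n, m). odd n \<and> squarefree n \<and> odd m \<and> squarefree m \<and>
     z < real n \<and> real n \<le> T \<and> z < real m \<and> real m \<le> T \<and> real (n * m) \<le> T}"

(* The sum is never a junk value: its index set is always finite. *)
lemma finite_hyperbolic_pairs: "finite (hyperbolic_pairs T z)"
proof (rule finite_subset)
  show "hyperbolic_pairs T z \<subseteq> {..nat \<lfloor>T\<rfloor>} \<times> {..nat \<lfloor>T\<rfloor>}"
    by (auto simp: hyperbolic_pairs_def le_nat_floor)
qed auto

definition jacobi_sum ::
  "real \<Rightarrow> (nat \<Rightarrow> complex) \<Rightarrow> (nat \<Rightarrow> complex) \<Rightarrow> real \<Rightarrow> real \<Rightarrow> complex" where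
  "jacobi_sum c a b T z = (\<Sum>(n, m)\<in>hyperbolic_pairs T z.
     of_real (real (n * m) powr c) * a n * b m * of_int (jacobi (int n) m))"

end

theory Submission
  imports Defs "HOL-Probability.Probability" "HOL-Real_Asymp.Real_Asymp"
begin

text \<open>
The bound follows from Heath-Brown's large sieve for quadratic characters: the sum of
\<open>\<bar>\<Sum>n\<le>N. a n * (n/m)\<bar>\<^sup>2\<close> over odd squarefree \<open>m \<le> M\<close> is at most \<open>(M * N) powr \<eta> * (M + N)\<close> times the squared norm of \<open>a\<close>,
together with the elementary factor \<open>M + N\<^sup>2\<close> free of \<open>\<eta>\<close>, which suffices where one variable is below \<open>T powr (1/3)\<close>.
The condition \<open>n * m \<le> T\<close> is removed by a dyadic cutting of the range of the longer variable.

The large sieve is reached by improving the exponent in a factor \<open>M + N powr \<xi>\<close>, starting from \<open>\<xi> = 2\<close>.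
The outer sum is completed to all integers with weight \<open>exp (- m / M)\<close>, except those with squarefree part at most
\<open>K = N\<^sup>2 / M\<close>; opening the square gives characters modulo \<open>n1 * n2 / (gcd n1 n2)\<^sup>2\<close>, and by Poisson summation the completed sum
becomes a dual sum of length \<open>K\<close> minus the omitted terms. Grouping integers by their squarefree part \<open>k\<close>, the main terms
of both for \<open>k \<le> K\<close> cancel. What remains is bounded by the large sieve for \<open>k\<close> near \<open>K\<close> with exponent \<open>\<xi>\<close>, and this yields the
exponent \<open>2 - 1 / \<xi>\<close>; the iterates \<open>1 + 1 / j\<close> of \<open>2\<close> tend to 1.
\<close>

section \<open>Jacobi symbols\<close>

text \<open>Two obstacles shape the proof. Poisson summation brings in the root number of the
  character modulo \<open>qr n m\<close>, that is, the sign of a quadratic Gauss sum. The inner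
  variable is therefore split into four classes by its normalised Gauss sum; inside a class every
  quotient modulus is 1 modulo 4 and has root number 1. Secondly, the dual weight depends on n1 and
  n2 jointly. The weight \<open>exp (- l * m)\<close> is chosen because its Fourier transform is a
  rational function: on blocks of ratio 33/32 it expands into a geometric series whose terms are
  Schur multipliers of small norm. This takes the place of a Mellin transform, and every term is
  again a product of two large sieve sums. The cancellation of main terms is what makes the method
  work for small \<open>k\<close>: without it, \<open>k\<close> near 1 would cost about
  \<open>N * sqrt M\<close>, which exceeds the admissible \<open>M\<close> in the whole range
  \<open>M < N^2\<close>.\<close>

lemma Legendre_mult:
  assumes p: "prime p" "2 < p"
  shows "Legendre (a * b) (int p) = Legendre a p * Legendre b p"
proof -
  have e: "[Legendre c p = c ^ ((p - 1) div 2)] (mod p)" for c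
    using euler_criterion[of p c] p by simp
  have "[Legendre (a * b) p = a ^ ((p - 1) div 2) * b ^ ((p - 1) div 2)] (mod p)"
    using e[of "a * b"] by (simp add: power_mult_distrib)
  also have "[a ^ ((p - 1) div 2) * b ^ ((p - 1) div 2) = Legendre a p * Legendre b p] (mod p)"
    by (intro cong_mult cong_sym[OF e])
  \<comment> \<open>Both sides are congruent modulo \<open>p\<close> and at most 2 <
    \<open>p\<close> apart, hence equal.\<close>
  finally have "int p dvd Legendre (a * b) p - Legendre a p * Legendre b p"
    by (simp add: cong_iff_dvd_diff)
  moreover have "\<bar>Legendre (a * b) p - Legendre a p * Legendre b p\<bar> \<le> 2"
    by (auto simp: Legendre_def)
  ultimately have "Legendre (a * b) p - Legendre a p * Legendre b p = 0"
    using p dvd_imp_le_int[of "Legendre (a * b) p - Legendre a p * Legendre b p" "int p"] by linarith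
  then show ?thesis by simp
qed

lemma prime_factor_odd_gt_2: "odd n \<Longrightarrow> p \<in># prime_factorization n \<Longrightarrow> prime p \<and> 2 < (p::nat)"
proof -
  assume n: "odd n" "p \<in># prime_factorization n"
  then have p: "prime p" "p dvd n" by auto
  with n have "odd p" by (meson dvd_trans)
  then show ?thesis using p prime_ge_2_nat[of p] by (cases "p = 2") auto
qed

lemma jacobi_mult_left: "odd n \<Longrightarrow> jacobi (a * b) n = jacobi a n * jacobi b n"
proof -
  assume "odd n"
  have "image_mset (\<lambda>p. Legendre (a * b) (int p)) (prime_factorization n)
      = image_mset (\<lambda>p. Legendre a (int p) * Legendre b (int p)) (prime_factorization n)"
    by (intro image_mset_cong Legendre_mult) (use prime_factor_odd_gt_2[OF \<open>odd n\<close>] in blast)+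
  then show ?thesis by (simp add: jacobi_def prod_mset.distrib)
qed

lemma Legendre_cong: "[a = b] (mod p) \<Longrightarrow> Legendre a p = Legendre b p"
proof -
  assume ab: "[a = b] (mod p)"
  then have "[y = a] (mod p) \<longleftrightarrow> [y = b] (mod p)" "[a = y] (mod p) \<longleftrightarrow> [b = y] (mod p)" for y
    by (auto simp: Cong.cong_def)
  then show ?thesis by (simp add: Legendre_def QuadRes_def)
qed

lemma jacobi_cong: "[a = b] (mod int n) \<Longrightarrow> jacobi a n = jacobi b n"
  unfolding jacobi_def
  by (intro arg_cong[where f = prod_mset] image_mset_cong Legendre_cong)
     (auto elim!: cong_dvd_modulus)

lemma jacobi_values: "jacobi a n \<in> {-1, 0, 1}"
proof -
  have "prod_mset (image_mset (\<lambda>p. Legendre a (int p)) A) \<in> {-1, 0, 1}" for A :: "nat multiset"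
    by (induction A) (auto simp: Legendre_def)
  then show ?thesis by (simp add: jacobi_def)
qed

lemma jacobi_eq_0_iff: "n > 0 \<Longrightarrow> jacobi a n = 0 \<longleftrightarrow> \<not> coprime a (int n)"
proof -
  assume n: "n > 0"
  have L: "prime p \<Longrightarrow> Legendre a (int p) = 0 \<longleftrightarrow> int p dvd a" for p
    by (auto simp: Legendre_def cong_0_iff)
  have "jacobi a n = 0 \<longleftrightarrow> (\<exists>p\<in>prime_factors n. int p dvd a)"
  proof -
    have "jacobi a n = 0 \<longleftrightarrow> (\<exists>p\<in>prime_factors n. Legendre a (int p) = 0)"
      by (auto simp: jacobi_def prod_mset_zero_iff image_iff eq_commute[of 0])
    then show ?thesis using L by (meson in_prime_factors_imp_prime)
  qed
  also have "\<dots> \<longleftrightarrow> \<not> coprime a (int n)"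
  proof
    assume "\<exists>p\<in>prime_factors n. int p dvd a"
    then obtain p where p: "prime p" "p dvd n" "int p dvd a" by auto
    then have "int p dvd int n" by simp
    moreover have "\<not> is_unit (int p)" using p(1) not_prime_unit by auto
    ultimately show "\<not> coprime a (int n)" using p(3) coprime_common_divisor by blast
  next
    assume "\<not> coprime a (int n)"
    then have "gcd a (int n) \<noteq> 1" by (simp add: coprime_iff_gcd_eq_1)
    moreover define d where "d = nat (gcd a (int n))"
    ultimately have "d \<noteq> 1" by auto
    then obtain p where p: "prime p" "p dvd d" using prime_factor_nat by blast
    have "int d = gcd a (int n)" by (simp add: d_def)
    then have "int p dvd gcd a (int n)" using p(2) by (metis int_dvd_int_iff)
    then have "int p dvd a" "p dvd n" by auto
    then show "\<exists>p\<in>prime_factors n. int p dvd a" using p n by (auto simp: prime_factors_dvd)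
  qed
  finally show ?thesis .
qed

text \<open>Real values and natural arguments, with the modulus second, let the symbols serve
  directly as real matrix entries. The value at -1 modulo \<open>n\<close> is then written
  \<open>J (n - 1) n\<close>.\<close>

definition J :: "nat \<Rightarrow> nat \<Rightarrow> real" where
  "J k n = real_of_int (jacobi (int k) n)"

lemma J_1_right [simp]: "J k (Suc 0) = 1" by (simp add: J_def jacobi_def)
lemma J_mult_left: "odd n \<Longrightarrow> J (a * b) n = J a n * J b n"
  by (simp add: J_def jacobi_mult_left)
lemma J_mult_right: "m > 0 \<Longrightarrow> n > 0 \<Longrightarrow> J k (m * n) = J k m * J k n"
  by (simp add: J_def jacobi_mult_right)
lemma J_values: "J k n = -1 \<or> J k n = 0 \<or> J k n = 1"
  using jacobi_values[of "int k" n] by (auto simp: J_def)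
lemma abs_J_le: "\<bar>J k n\<bar> \<le> 1"
  using J_values[of k n] by auto
lemma J_eq_0_iff: "n > 0 \<Longrightarrow> J k n = 0 \<longleftrightarrow> \<not> coprime k n"
  by (simp add: J_def jacobi_eq_0_iff)
lemma J_cong: "[k = l] (mod n) \<Longrightarrow> J k n = J l n"
  using jacobi_cong[of "int k" "int l" n] by (simp add: J_def cong_int_iff)
lemma J_square: "n > 0 \<Longrightarrow> coprime k n \<Longrightarrow> J k n * J k n = 1"
  using J_values[of k n] J_eq_0_iff[of n k] by auto
lemma J_square_left: "odd n \<Longrightarrow> J (k * l\<^sup>2) n = (if coprime l n then J k n else 0)"
proof -
  assume n: "odd n"
  have "J (k * l\<^sup>2) n = J k n * (J l n * J l n)"
    using n by (simp add: power2_eq_square J_mult_left)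
  then show ?thesis using n J_square[of n l] J_eq_0_iff[of n l] odd_pos by auto
qed

text \<open>For odd arguments this is (-1)^((m-1)(n-1)/4), the sign of the reciprocity law,
  expressed through residues modulo 4.\<close>

definition sgn4 :: "nat \<Rightarrow> nat \<Rightarrow> real" where
  "sgn4 m n = (if m mod 4 = 3 \<and> n mod 4 = 3 then -1 else 1)"

lemma sgn4_commute: "sgn4 m n = sgn4 n m" by (auto simp: sgn4_def)

lemma odd_mod4: "odd (n::nat) \<Longrightarrow> n mod 4 = 1 \<or> n mod 4 = 3" by presburger

lemma sgn4_mult: assumes "odd a" "odd b" shows "sgn4 (a * b) n = sgn4 a n * sgn4 b n"
proof -
  have e: "(a * b) mod 4 = ((a mod 4) * (b mod 4)) mod 4" by (simp add: mod_mult_eq)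
  have "(a * b) mod 4 = 3 \<longleftrightarrow> (a mod 4 = 3) \<noteq> (b mod 4 = 3)"
    unfolding e using odd_mod4[OF assms(1)] odd_mod4[OF assms(2)] by (elim disjE) (simp_all only:, simp_all)
  then show ?thesis using odd_mod4[OF assms(1)] odd_mod4[OF assms(2)] by (auto simp: sgn4_def)
qed

section \<open>Quadratic reciprocity for odd moduli\<close>

lemma J_reciprocity_prime:
  assumes "prime p" "prime q" "odd p" "odd q" "p \<noteq> q"
  shows "J p q * J q p = sgn4 p q"
proof -
  have "Legendre p q * Legendre q p = (-1::int) ^ ((p - 1) div 2 * ((q - 1) div 2))"
    by (rule Quadratic_Reciprocity) (use assms prime_factor_odd_gt_2[of p p] prime_factor_odd_gt_2[of q q]
        in \<open>simp_all add: prime_factorization_prime\<close>)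
  moreover have "even ((p - 1) div 2) \<longleftrightarrow> p mod 4 \<noteq> 3" "even ((q - 1) div 2) \<longleftrightarrow> q mod 4 \<noteq> 3"
    using \<open>odd p\<close> \<open>odd q\<close> by presburger+
  ultimately show ?thesis using assms
    by (simp add: J_def jacobi_prime sgn4_def minus_one_power_iff flip: of_int_mult)
qed

lemma J_reciprocity_aux:
  assumes "prime p" "odd p"
  shows "odd n \<Longrightarrow> coprime p n \<Longrightarrow> J p n * J n p = sgn4 p n"
proof (induction n rule: prime_divisors_induct)
  case (unit x)
  have "J 1 p = J 1 p * J 1 p" using J_mult_left[of p 1 1] assms by simp
  moreover have "J 1 p \<noteq> 0" using J_eq_0_iff[of p 1] assms by (simp add: odd_pos)
  ultimately show ?case using unit by (simp add: sgn4_def)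
next
  case (factor q x)
  then have q: "odd q" "odd x" "coprime p x" "p \<noteq> q" "prime q" "q > 0" "x > 0"
    using assms by (auto simp: prime_gt_0_nat odd_pos)
  have "J p (q * x) * J (q * x) p = (J p q * J q p) * (J p x * J x p)"
    using q assms by (simp add: J_mult_right J_mult_left)
  also have "\<dots> = sgn4 p q * sgn4 p x"
    using factor q assms J_reciprocity_prime by auto
  also have "\<dots> = sgn4 p (q * x)"
    using q sgn4_mult sgn4_commute by metis
  finally show ?case .
qed auto

lemma J_reciprocity:
  "odd m \<Longrightarrow> odd n \<Longrightarrow> coprime m n \<Longrightarrow> J m n * J n m = sgn4 m n"
proof (induction m rule: prime_divisors_induct)
  case (unit x)
  have "J 1 n * J 1 n = 1" using unit by (intro J_square) (auto simp: odd_pos)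
  moreover have "J 1 n = J 1 n * J 1 n" using J_mult_left[of n 1 1] unit by simp
  ultimately show ?case using unit by (simp add: sgn4_def J_1_right)
next
  case (factor q x)
  then have q: "odd q" "odd x" "coprime q n" "coprime x n" "prime q" "q > 0" "x > 0" "n > 0"
    by (auto simp: prime_gt_0_nat odd_pos)
  have "J (q * x) n * J n (q * x) = (J q n * J n q) * (J x n * J n x)"
    using q factor.prems by (simp add: J_mult_right J_mult_left)
  also have "\<dots> = sgn4 q n * sgn4 x n"
    using factor q J_reciprocity_aux by auto
  also have "\<dots> = sgn4 (q * x) n"
    using q sgn4_mult by metis
  finally show ?case .
qed auto

text \<open>When the arguments have a common factor, both symbols vanish, so the law can be applied
  inside sums without a coprimality condition.\<close>

lemma J_flip: "odd m \<Longrightarrow> odd n \<Longrightarrow> J m n = sgn4 m n * J n m"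
proof (cases "coprime m n")
  case True
  assume o: "odd m" "odd n"
  have "J m n * J n m = sgn4 m n" using J_reciprocity o True by auto
  then show ?thesis using J_values[of n m] J_values[of m n] J_eq_0_iff[of m n] o True
    by (auto simp: sgn4_def odd_pos ac_simps split: if_splits)
next
  case False
  assume o: "odd m" "odd n"
  then show ?thesis using False J_eq_0_iff[of m n] J_eq_0_iff[of n m] by (auto simp: odd_pos ac_simps)
qed

lemma J_1_left [simp]: "odd n \<Longrightarrow> J (Suc 0) n = 1"
  using J_mult_left[of n 1 1] J_eq_0_iff[of n 1] by (auto simp: odd_pos)

section \<open>Gauss sums\<close>

text \<open>Chinese remainder theorem with the representatives \<open>v * x + u * y\<close>: in this
  parametrisation both the symbol and the additive character modulo \<open>u * v\<close>
  factor.\<close>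

lemma sum_mod_prod:
  fixes F :: "nat \<Rightarrow> 'a::comm_monoid_add"
  assumes "coprime u v" "u > 0" "v > 0"
  shows "(\<Sum>a<u * v. F a) = (\<Sum>x<u. \<Sum>y<v. F ((v * x + u * y) mod (u * v)))"
proof -
  let ?h = "\<lambda>(x, y). (v * x + u * y) mod (u * v)"
  have inj: "inj_on ?h ({..<u} \<times> {..<v})"
  proof (rule inj_onI, clarsimp)
    fix x y x' y' assume b: "x < u" "y < v" "x' < u" "y' < v"
      and e: "(v * x + u * y) mod (u * v) = (v * x' + u * y') mod (u * v)"
    then have c: "[v * x + u * y = v * x' + u * y'] (mod (u * v))" by (simp add: Cong.cong_def)
    have "[v * x + u * y = v * x' + u * y'] (mod u)" using c cong_modulus_mult_nat by blast
    then have "[v * x = v * x'] (mod u)" by (simp add: Cong.cong_def)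
    then have "[x = x'] (mod u)" using assms(1) by (simp add: cong_mult_lcancel_nat coprime_commute)
    then have 1: "x = x'" using b cong_less_modulus_unique_nat by blast
    have "[v * x + u * y = v * x' + u * y'] (mod v)" using c cong_modulus_mult_nat by (metis mult.commute)
    then have "[u * y = u * y'] (mod v)" by (simp add: Cong.cong_def)
    then have "[y = y'] (mod v)" using assms(1) by (simp add: cong_mult_lcancel_nat)
    then show "x = x' \<and> y = y'" using 1 b cong_less_modulus_unique_nat by blast
  qed
  have "?h ` ({..<u} \<times> {..<v}) = {..<u * v}"
  proof (rule card_subset_eq)
    show "?h ` ({..<u} \<times> {..<v}) \<subseteq> {..<u * v}" using assms by auto
    show "card (?h ` ({..<u} \<times> {..<v})) = card {..<u * v}" using card_image[OF inj] by simp
  qed auto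
  then have "(\<Sum>a<u * v. F a) = sum F (?h ` ({..<u} \<times> {..<v}))" by simp
  also have "\<dots> = sum (F \<circ> ?h) ({..<u} \<times> {..<v})" by (rule sum.reindex[OF inj])
  also have "\<dots> = (\<Sum>x<u. \<Sum>y<v. F ((v * x + u * y) mod (u * v)))"
    by (simp add: sum.cartesian_product case_prod_unfold)
  finally show ?thesis .
qed

section \<open>Additive characters and their orthogonality\<close>

definition e2pi :: "nat \<Rightarrow> nat \<Rightarrow> complex" where
  "e2pi a n = cis (2 * pi * real a / real n)"

lemma norm_e2pi [simp]: "norm (e2pi a n) = 1" by (simp add: e2pi_def)

lemma e2pi_add: "e2pi (a + b) n = e2pi a n * e2pi b n"
  by (simp add: e2pi_def cis_mult add_divide_distrib ring_distribs)

lemma e2pi_mult: "n > 0 \<Longrightarrow> e2pi (n * b) n = 1"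
proof -
  assume "n > 0"
  then have "2 * pi * real (n * b) / real n = 2 * pi * of_int (int b)" by simp
  then show ?thesis unfolding e2pi_def by (simp only: cis_multiple_2pi Ints_of_int)
qed

lemma e2pi_scale: "u > 0 \<Longrightarrow> e2pi (u * b) (u * n) = e2pi b n"
proof -
  assume "u > 0"
  then have "2 * pi * real (u * b) / real (u * n) = 2 * pi * real b / real n" by simp
  then show ?thesis unfolding e2pi_def by simp
qed

lemma e2pi_mod: "n > 0 \<Longrightarrow> e2pi (a mod n) n = e2pi a n"
proof -
  assume "n > 0"
  then have "e2pi (n * (a div n) + a mod n) n = e2pi (a mod n) n"
    unfolding e2pi_add by (simp add: e2pi_mult)
  then show ?thesis by simp
qed

lemma e2pi_cong: "n > 0 \<Longrightarrow> [a = b] (mod n) \<Longrightarrow> e2pi a n = e2pi b n"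
  by (metis Cong.cong_def e2pi_mod)

lemma e2pi_eq_1: "n > 0 \<Longrightarrow> e2pi a n = 1 \<Longrightarrow> n dvd a"
proof -
  assume n: "n > 0" "e2pi a n = 1"
  then have "cos (2 * pi * real a / real n) = 1" by (simp add: e2pi_def complex_eq_iff)
  then obtain x :: int where "2 * pi * real a / real n = real_of_int x * (2 * pi)"
    using cos_one_2pi_int by auto
  then have "real a = real_of_int x * real n" using n by (simp add: field_simps)
  then have "int a = x * int n" by (metis of_int_eq_iff of_int_mult of_int_of_nat_eq)
  then show ?thesis by (metis dvd_triv_right int_dvd_int_iff)
qed

lemma sum_e2pi: "n > 0 \<Longrightarrow> (\<Sum>m<n. e2pi (a * m) n) = (if n dvd a then of_nat n else 0)"
proof (cases "n dvd a")
  case True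
  assume "n > 0"
  then have "e2pi (a * m) n = 1" for m using True by (auto simp: e2pi_mult mult.assoc)
  then show ?thesis using True by simp
next
  case False
  assume n: "n > 0"
  have p: "e2pi (a * m) n = e2pi a n ^ m" for m
    by (induction m) (simp_all add: e2pi_add, simp add: e2pi_def)
  have "e2pi a n \<noteq> 1" using e2pi_eq_1 n False by blast
  moreover have "e2pi a n ^ n = 1" using p[of n] e2pi_mult[OF n, of a] by (simp add: mult.commute)
  ultimately show ?thesis using False by (simp add: p geometric_sum)
qed

lemma cnj_e2pi: "e2pi a n * e2pi b n = 1 \<Longrightarrow> cnj (e2pi b n) = e2pi a n"
proof -
  assume h: "e2pi a n * e2pi b n = 1"
  have "cnj (e2pi b n) * e2pi b n = 1" by (simp add: e2pi_def cis_cnj cis_mult)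
  then have "cnj (e2pi b n) * (e2pi a n * e2pi b n) = e2pi a n"
    by (metis mult.left_commute mult.right_neutral)
  then show ?thesis using h by simp
qed

definition gsum :: "nat \<Rightarrow> nat \<Rightarrow> complex" where
  "gsum n m = (\<Sum>a<n. of_real (J a n) * e2pi (a * m) n)"

lemma J_mod: "J (a mod n) n = J a n"
  by (rule J_cong) (simp add: Cong.cong_def)

text \<open>Under a = v x + u y the additive character becomes a product, while the symbols of
  \<open>v\<close> modulo \<open>u\<close> and of \<open>u\<close> modulo \<open>v\<close> split
  off. By reciprocity their product is \<open>sgn4 u v\<close>.\<close>

lemma gsum_mult:
  assumes "coprime u v" "odd u" "odd v"
  shows "gsum (u * v) m = of_real (J v u * J u v) * gsum u m * gsum v m"
proof -
  have pos: "u > 0" "v > 0" using assms by (auto simp: odd_pos)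
  have t: "of_real (J ((v * x + u * y) mod (u * v)) (u * v)) * e2pi ((v * x + u * y) mod (u * v) * m) (u * v)
     = of_real (J v u * J u v) * (of_real (J x u) * e2pi (x * m) u) * (of_real (J y v) * e2pi (y * m) v)" for x y
  proof -
    have 1: "J ((v * x + u * y) mod (u * v)) (u * v) = J (v * x + u * y) u * J (v * x + u * y) v"
      using pos by (simp add: J_mod J_mult_right)
    have 2: "J (v * x + u * y) u = J v u * J x u"
      using J_cong[of "v * x + u * y" "v * x" u] assms by (simp add: Cong.cong_def J_mult_left)
    have 3: "J (v * x + u * y) v = J u v * J y v"
      using J_cong[of "v * x + u * y" "u * y" v] assms by (simp add: Cong.cong_def J_mult_left)
    have "e2pi ((v * x + u * y) mod (u * v) * m) (u * v) = e2pi ((v * x + u * y) * m) (u * v)"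
      using pos by (intro e2pi_cong) (auto simp: Cong.cong_def mod_mult_left_eq)
    also have "\<dots> = e2pi (v * (x * m)) (v * u) * e2pi (u * (y * m)) (u * v)"
      by (simp add: e2pi_add algebra_simps)
    also have "\<dots> = e2pi (x * m) u * e2pi (y * m) v" using pos by (simp only: e2pi_scale)
    finally show ?thesis by (simp add: 1 2 3)
  qed
  show ?thesis
    unfolding gsum_def sum_mod_prod[OF assms(1) pos] t
    unfolding mult.assoc[of "of_real (J v u * J u v)"] sum_product
    by (simp only: sum_distrib_left)
qed

text \<open>If every nonzero class were a square, squaring would be a surjective and hence injective
  map of the nonzero classes, but 1 and \<open>p - 1\<close> have the same square.\<close>

lemma exists_nonresidue:
  assumes p: "prime p" "odd p"
  shows "\<exists>b. J b p = -1"
proof (rule ccontr)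
  assume no: "\<nexists>b. J b p = -1"
  have p2: "p > 2" using p prime_ge_2_nat[of p] by (cases "p = 2") auto
  have "(\<lambda>x. x\<^sup>2 mod p) ` {1..<p} \<subseteq> {1..<p}"
  proof safe
    fix x assume x: "x \<in> {1..<p}"
    then have "\<not> p dvd x" by (auto dest: dvd_imp_le)
    then have "\<not> p dvd x\<^sup>2" using p prime_dvd_power by blast
    then show "x\<^sup>2 mod p \<in> {1..<p}" using p2 by (auto simp: dvd_eq_mod_eq_0)
  qed
  moreover have "{1..<p} \<subseteq> (\<lambda>x. x\<^sup>2 mod p) ` {1..<p}"
  proof
    fix b assume b: "b \<in> {1..<p}"
    then have nb: "\<not> p dvd b" by (auto dest: dvd_imp_le)
    have "J b p \<noteq> 0" using J_eq_0_iff[of p b] p nb prime_imp_coprime[of p b]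
      by (auto simp: odd_pos coprime_commute)
    then have "J b p = 1" using no J_values by metis
    then have "Legendre (int b) (int p) = 1" using p by (simp add: J_def jacobi_prime)
    then have "QuadRes (int p) (int b)" by (auto simp: Legendre_def split: if_splits)
    then obtain y where y: "[y\<^sup>2 = int b] (mod int p)" by (auto simp: QuadRes_def)
    define x where "x = nat (y mod int p)"
    have x: "int x = y mod int p" using p2 by (simp add: x_def)
    have "[int x ^ 2 = int b] (mod int p)"
      using y by (simp add: x Cong.cong_def power_mod)
    then have xb: "[x\<^sup>2 = b] (mod p)" by (metis cong_int_iff of_nat_power)
    then have "x\<^sup>2 mod p = b" using b by (simp add: Cong.cong_def)
    moreover have "x < p" using x p2 by (metis of_nat_less_iff pos_mod_bound of_nat_0_less_iff order.strict_trans zero_less_numeral)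
    moreover have "x \<noteq> 0" using xb nb by (metis cong_0_iff cong_sym zero_power2)
    ultimately show "b \<in> (\<lambda>x. x\<^sup>2 mod p) ` {1..<p}" by (auto intro!: image_eqI[of _ _ x])
  qed
  ultimately have "inj_on (\<lambda>x. x\<^sup>2 mod p) {1..<p}"
    by (intro eq_card_imp_inj_on) auto
  moreover have "(p - 1)\<^sup>2 mod p = 1\<^sup>2 mod p"
  proof -
    obtain q where q: "p = q + 2" using p2 by (metis less_imp_add_positive add.commute)
    have "(p - 1)\<^sup>2 = 1 + q * p" unfolding q by (simp add: power2_eq_square algebra_simps)
    then show ?thesis by (metis mod_mult_self1 power_one)
  qed
  ultimately have "p - 1 = 1" using p2 by (auto simp: inj_on_def)
  then show False using p2 by simp
qed

lemma sum_mult_mod: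
  fixes F :: "nat \<Rightarrow> 'a::comm_monoid_add"
  assumes "coprime b n" "n > 0"
  shows "(\<Sum>a<n. F (a * b mod n)) = (\<Sum>a<n. F a)"
proof -
  have inj: "inj_on (\<lambda>a. a * b mod n) {..<n}"
  proof (rule inj_onI)
    fix x y assume h: "x \<in> {..<n}" "y \<in> {..<n}" "x * b mod n = y * b mod n"
    then have "[x * b = y * b] (mod n)" by (simp add: Cong.cong_def)
    then have "[x = y] (mod n)" using assms(1) by (simp add: cong_mult_rcancel_nat)
    then show "x = y" using h cong_less_modulus_unique_nat by auto
  qed
  have "(\<lambda>a. a * b mod n) ` {..<n} = {..<n}"
    using inj assms(2) by (intro endo_inj_surj) auto
  then have "(\<Sum>a<n. F a) = sum F ((\<lambda>a. a * b mod n) ` {..<n})" by simp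
  also have "\<dots> = (\<Sum>a<n. F (a * b mod n))" by (simp add: sum.reindex[OF inj])
  finally show ?thesis by simp
qed

text \<open>Multiplication by \<open>m\<close> permutes the residues, and this substitution pulls
  out \<open>J m n\<close>.\<close>

lemma gsum_coprime:
  assumes "odd n" "coprime m n"
  shows "gsum n m = of_real (J m n) * gsum n 1"
proof -
  have n: "n > 0" using assms by (simp add: odd_pos)
  have "gsum n 1 = (\<Sum>a<n. of_real (J (a * m mod n) n) * e2pi (a * m mod n) n)"
    using sum_mult_mod[OF assms(2) n, of "\<lambda>a. of_real (J a n) * e2pi a n"] by (simp add: gsum_def)
  also have "\<dots> = of_real (J m n) * gsum n m"
    using assms n by (simp add: gsum_def J_mod e2pi_mod J_mult_left sum_distrib_left mult_ac)
  finally have "of_real (J m n) * gsum n 1 = of_real (J m n * J m n) * gsum n m" by simp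
  then show ?thesis using J_square[OF n assms(2)] by simp
qed

lemma squarefree_imp_coprime: "squarefree (a * b) \<Longrightarrow> coprime a (b::nat)"
proof -
  assume s: "squarefree (a * b)"
  have "gcd a b ^ 2 dvd a * b" by (simp add: power2_eq_square mult_dvd_mono)
  with s have "gcd a b dvd 1" by (rule squarefreeD)
  then show ?thesis unfolding coprime_iff_gcd_eq_1 by (simp only: nat_dvd_1_iff_1)
qed

text \<open>A squarefree modulus makes the character primitive, so the formula persists when
  \<open>m\<close> and \<open>n\<close> have a common factor. By multiplicativity it suffices to
  treat a prime \<open>p\<close> dividing \<open>m\<close>, where the complete character sum
  vanishes.\<close>

lemma gsum_eq: "odd n \<Longrightarrow> squarefree n \<Longrightarrow> gsum n m = of_real (J m n) * gsum n 1"
proof (induction n rule: prime_divisors_induct)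
  case (unit x) then show ?case by (simp add: gsum_def e2pi_def)
next
  case (factor p x)
  have o: "odd p" "odd x" "squarefree x" using factor.prems squarefree_multD by auto
  have c: "coprime p x" using factor.prems squarefree_imp_coprime by blast
  have pos: "p > 0" "x > 0" using o by (auto simp: odd_pos)
  have P: "gsum p m = of_real (J m p) * gsum p 1"
  proof (cases "coprime m p")
    case False
    then have "p dvd m" using factor.hyps(1) prime_imp_coprime[of p m] by (auto simp: coprime_commute)
    then obtain k where k: "m = p * k" by blast
    have e: "gsum p m = of_real (\<Sum>a<p. J a p)"
    proof -
      have "e2pi (a * m) p = 1" for a using e2pi_mult[OF pos(1), of "a * k"] by (simp only: k mult.left_commute)
      then show ?thesis by (simp add: gsum_def)
    qed
    \<comment> \<open>Multiplying all residues by a nonresidue changes the sign of the complete sum,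
      which is therefore zero.\<close>
    obtain b where b: "J b p = -1" using exists_nonresidue factor.hyps o by blast
    then have "coprime b p" using J_eq_0_iff[of p b] pos by auto
    then have "(\<Sum>a<p. J a p) = (\<Sum>a<p. J (a * b mod p) p)"
      using sum_mult_mod[of b p "\<lambda>a. J a p"] pos by simp
    also have "\<dots> = - (\<Sum>a<p. J a p)" using o b by (simp add: J_mod J_mult_left sum_negf)
    finally have "(\<Sum>a<p. J a p) = 0" by simp
    moreover have "J m p = 0" using False J_eq_0_iff pos by auto
    ultimately show ?thesis using e by simp
  qed (use o gsum_coprime in blast)
  show ?case using factor.IH o pos c P by (simp add: gsum_mult J_mult_right)
qed auto

text \<open>Parseval: the sum of \<open>norm (gsum n m) ^ 2\<close> over all \<open>m\<close> is
  evaluated once by \<open>gsum_eq\<close> and once by orthogonality of the additive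
  characters.\<close>

lemma gsum_norm:
  assumes "odd n" "squarefree n"
  shows "norm (gsum n 1) ^ 2 = real n"
proof -
  have n: "n > 0" using assms by (simp add: odd_pos)
  \<comment> \<open>\<open>c\<close> is the totient of \<open>n\<close>. It appears in both
    evaluations and is cancelled at the end, which only takes \<open>c > 0\<close>.\<close>
  define c where "c = (\<Sum>m<n. (J m n)\<^sup>2)"
  have c: "c > 0"
  proof -
    have "0 < (J (1 mod n) n)\<^sup>2" using assms J_mod[of 1 n] by simp
    also have "\<dots> \<le> c" unfolding c_def using n by (auto intro!: member_le_sum)
    finally show ?thesis .
  qed
  have "of_real (c * norm (gsum n 1) ^ 2) = (\<Sum>m<n. gsum n m * cnj (gsum n m))"
  proof -
    have nm: "(norm (gsum n m))\<^sup>2 = (J m n)\<^sup>2 * (norm (gsum n 1))\<^sup>2" for m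
      by (subst gsum_eq[OF assms]) (simp add: norm_mult power_mult_distrib)
    have "c * norm (gsum n 1) ^ 2 = (\<Sum>m<n. (norm (gsum n m))\<^sup>2)"
      unfolding c_def sum_distrib_right by (rule sum.cong[OF refl]) (rule nm[symmetric])
    then show ?thesis by (simp only: of_real_sum complex_norm_square)
  qed
  also have "\<dots> = (\<Sum>m<n. \<Sum>a<n. \<Sum>b<n. of_real (J a n * J b n) * (e2pi (a * m) n * cnj (e2pi (b * m) n)))"
    unfolding gsum_def cnj_sum sum_product by (intro sum.cong refl) (simp add: mult_ac)
  also have "\<dots> = (\<Sum>a<n. \<Sum>b<n. of_real (J a n * J b n) * (\<Sum>m<n. e2pi (a * m) n * cnj (e2pi (b * m) n)))"
    (is "?l = _")
  proof -
    have "?l = (\<Sum>a<n. \<Sum>m<n. \<Sum>b<n. of_real (J a n * J b n) * (e2pi (a * m) n * cnj (e2pi (b * m) n)))"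
      by (rule sum.swap)
    also have "\<dots> = (\<Sum>a<n. \<Sum>b<n. \<Sum>m<n. of_real (J a n * J b n) * (e2pi (a * m) n * cnj (e2pi (b * m) n)))"
      by (rule sum.cong[OF refl], rule sum.swap)
    finally show ?thesis by (simp only: sum_distrib_left)
  qed
  also have "\<dots> = (\<Sum>a<n. \<Sum>b<n. if b = a then of_real (J a n * J b n) * of_nat n else 0)"
  proof (intro sum.cong refl)
    fix a b assume ab: "a \<in> {..<n}" "b \<in> {..<n}"
    \<comment> \<open>In natural numbers \<open>n - b\<close> stands for the residue of -b, so the
      conjugate character is again a value of \<open>e2pi\<close>.\<close>
    have e: "e2pi (a * m) n * cnj (e2pi (b * m) n) = e2pi ((a + (n - b)) * m) n" for m
    proof -
      have "e2pi ((n - b) * m) n * e2pi (b * m) n = 1"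
      proof -
        have "(n - b) * m + b * m = n * m" using ab by (simp add: distrib_right[symmetric])
        then show ?thesis by (simp only: e2pi_add[symmetric] e2pi_mult[OF n])
      qed
      then have "cnj (e2pi (b * m) n) = e2pi ((n - b) * m) n" by (rule cnj_e2pi)
      then show ?thesis by (simp only: distrib_right e2pi_add)
    qed
    have "n dvd a + (n - b) \<longleftrightarrow> b = a"
    proof
      assume "n dvd a + (n - b)"
      then obtain k where k: "a + (n - b) = n * k" by blast
      have ab': "a < n" "b < n" using ab by auto
      have "0 < n * k" unfolding k[symmetric] using ab' by linarith
      moreover have "n * k < n * 2" unfolding k[symmetric] using ab' by linarith
      ultimately have "0 < k" "k < 2" by simp_all
      then have "k = 1" by linarith
      then show "b = a" using k ab by simp
    qed (use ab in auto)
    then show "of_real (J a n * J b n) * (\<Sum>m<n. e2pi (a * m) n * cnj (e2pi (b * m) n)) =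
      (if b = a then of_real (J a n * J b n) * of_nat n else 0)"
      unfolding e sum_e2pi[OF n] by (cases "b = a") (simp_all only: if_True if_False mult_zero_right refl)
  qed
  also have "\<dots> = of_real (c * real n)"
  proof -
    have "(\<Sum>b<n. if b = a then of_real (J a n * J b n) * of_nat n else 0) = (of_real ((J a n)\<^sup>2 * real n) :: complex)"
      if "a \<in> {..<n}" for a
    proof -
      have "(\<Sum>b<n. if b = a then of_real (J a n * J b n) * of_nat n else 0) = (of_real (J a n * J a n) * of_nat n :: complex)"
        using that by (simp only: sum.delta[OF finite_lessThan] if_True)
      then show ?thesis by (simp only: power2_eq_square of_real_mult of_real_of_nat_eq)
    qed
    then have "(\<Sum>a<n. \<Sum>b<n. if b = a then of_real (J a n * J b n) * of_nat n else 0)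
        = (\<Sum>a<n. (of_real ((J a n)\<^sup>2 * real n) :: complex))" by (rule sum.cong[OF refl])
    then show ?thesis by (simp only: c_def sum_distrib_right of_real_sum)
  qed
  finally have "c * norm (gsum n 1) ^ 2 = c * real n" by (simp only: of_real_eq_iff)
  then show ?thesis using c by simp
qed

text \<open>The conjugate of the Gauss sum is its value at -1, hence \<open>J (n - 1) n\<close>
  times the Gauss sum itself; multiplying by the Gauss sum and using \<open>gsum_norm\<close> gives
  the square.\<close>

lemma gsum_square:
  assumes "odd n" "squarefree n"
  shows "gsum n 1 ^ 2 = of_real (J (n - 1) n) * of_nat n"
proof -
  have n: "n > 0" using assms by (simp add: odd_pos)
  have cp: "coprime (n - 1) n" using n coprime_diff_one_left_nat by blast
  have "cnj (gsum n 1) = gsum n (n - 1)"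
    unfolding gsum_def cnj_sum
  proof (intro sum.cong refl)
    fix a assume "a \<in> {..<n}"
    have "e2pi (a * (n - 1)) n * e2pi a n = 1"
    proof -
      have "a * (n - 1) + a = n * a" using n by (cases n) auto
      then show ?thesis by (simp only: e2pi_add[symmetric] e2pi_mult[OF n])
    qed
    then have "cnj (e2pi a n) = e2pi (a * (n - 1)) n" by (rule cnj_e2pi)
    then show "cnj (of_real (J a n) * e2pi (a * 1) n) = of_real (J a n) * e2pi (a * (n - 1)) n" by simp
  qed
  then have "cnj (gsum n 1) = of_real (J (n - 1) n) * gsum n 1"
    using gsum_coprime[OF assms(1) cp] by simp
  then have "of_real (J (n - 1) n) * gsum n 1 ^ 2 = cnj (gsum n 1) * gsum n 1"
    by (simp add: power2_eq_square)
  also have "\<dots> = of_nat n" using gsum_norm[OF assms] complex_norm_square[of "gsum n 1"] 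
    by (simp add: mult.commute)
  finally have e: "of_real (J (n - 1) n) * gsum n 1 ^ 2 = of_nat n" .
  have "gsum n 1 ^ 2 = of_real (J (n - 1) n * J (n - 1) n) * gsum n 1 ^ 2"
    by (simp only: J_square[OF n cp] of_real_1 mult_1)
  also have "\<dots> = of_real (J (n - 1) n) * (of_real (J (n - 1) n) * gsum n 1 ^ 2)"
    by (simp only: of_real_mult mult.assoc)
  finally show ?thesis by (simp only: e)
qed

lemma J_minus_one: "odd n \<Longrightarrow> jacobi (-1) n = (if n mod 4 = 3 then -1 else 1)"
proof (induction n rule: prime_divisors_induct)
  case (unit x) then show ?case by (simp add: jacobi_def)
next
  case (factor p x)
  have o: "odd p" "odd x" and pos: "p > 0" "x > 0" using factor.prems by (auto simp: odd_pos)
  have p2: "2 < p" using prime_factor_odd_gt_2[of p p] o factor.hyps by (simp add: prime_factorization_prime)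
  have "[Legendre (-1) p = (-1) ^ ((p - 1) div 2)] (mod p)"
    using euler_criterion factor.hyps p2 by blast
  moreover have "(-1) ^ ((p - 1) div 2) = (if p mod 4 = 3 then -1 else 1 :: int)"
    using o by (auto simp: minus_one_power_iff) presburger+
  ultimately have c: "[Legendre (-1) p = (if p mod 4 = 3 then -1 else 1)] (mod int p)" by simp
  then have "int p dvd Legendre (-1) p - (if p mod 4 = 3 then -1 else 1)" by (simp only: cong_iff_dvd_diff)
  moreover have "\<bar>Legendre (-1) p - (if p mod 4 = 3 then -1 else 1)\<bar> \<le> 2" by (auto simp: Legendre_def)
  ultimately have "Legendre (-1) p - (if p mod 4 = 3 then -1 else 1) = 0"
    using p2 dvd_imp_le_int[of "Legendre (-1) p - (if p mod 4 = 3 then -1 else 1)" "int p"] by linarith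
  then have P: "jacobi (-1) p = (if p mod 4 = 3 then -1 else 1)"
    using factor.hyps by (simp add: jacobi_prime)
  have s: "(if (p * x) mod 4 = 3 then -1 else (1::real)) = (if p mod 4 = 3 then -1 else 1) * (if x mod 4 = 3 then -1 else 1)"
    using sgn4_mult[OF o, of 3] by (simp only: sgn4_def) simp
  have "real_of_int (jacobi (-1) (p * x)) = real_of_int (if (p * x) mod 4 = 3 then -1 else 1)"
    using s P factor.IH o pos by (simp add: jacobi_mult_right split: if_splits)
  then show ?case by (simp only: of_int_eq_iff)
qed auto

lemma J_pred: "odd n \<Longrightarrow> J (n - 1) n = (if n mod 4 = 3 then -1 else 1)"
proof -
  assume o: "odd n"
  then have "n > 0" by (simp add: odd_pos)
  then have "[int (n - 1) = -1] (mod int n)" by (simp add: cong_iff_dvd_diff of_nat_diff)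
  then show ?thesis using jacobi_cong J_minus_one[OF o] by (simp add: J_def)
qed

lemma odd_mod4_cancel:
  assumes "odd d" "odd u" "odd v" "(d * u) mod 4 = (d * v) mod (4::nat)"
  shows "u mod 4 = v mod 4"
proof -
  have "[d * u = d * v] (mod 4)" using assms by (simp add: Cong.cong_def)
  moreover have "coprime d 4" using assms(1) coprime_power_right_iff[of d 2 2] by simp
  ultimately have "[u = v] (mod 4)" using cong_mult_lcancel_nat by blast
  then show ?thesis by (simp only: Cong.cong_def)
qed

text \<open>Two moduli in the same class modulo 4 whose Gauss sums have the same normalised value
  combine to a modulus with positive Gauss sum; this makes the evaluation of the sign superfluous.\<close>

lemma gsum_quotient:
  assumes o: "odd d" "odd u" "odd v" and sf: "squarefree (d * u)" "squarefree (d * v)"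
    and cp: "coprime u v" and m4: "(d * u) mod 4 = (d * v) mod 4"
    and g: "gsum (d * u) 1 / of_real (sqrt (d * u)) = gsum (d * v) 1 / of_real (sqrt (d * v))"
  shows "gsum (u * v) 1 = of_real (sqrt (u * v))" "(u * v) mod 4 = 1"
proof -
  have pos: "d > 0" "u > 0" "v > 0" using o by (auto simp: odd_pos)
  have uv: "u mod 4 = v mod 4" using odd_mod4_cancel o m4 by blast
  have "(u * v) mod 4 = ((u mod 4) * (u mod 4)) mod 4" using uv by (metis mod_mult_eq)
  then show uv1: "(u * v) mod 4 = 1" using odd_mod4[OF o(2)] by auto
  have cdu: "coprime d u" "coprime d v" using sf squarefree_imp_coprime by blast+
  have sfd: "squarefree d" "squarefree u" "squarefree v" using sf squarefree_multD by blast+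
  define tu tv td where "tu = gsum u 1" and "tv = gsum v 1" and "td = gsum d 1"
  define s where "s = gsum (d * u) 1 / of_real (sqrt (d * u))"
  have nz: "(of_real (sqrt (real (d * u))) :: complex) \<noteq> 0" "(of_real (sqrt (real (d * v))) :: complex) \<noteq> 0"
    using pos by auto
  have sq: "gsum (d * u) 1 = s * of_real (sqrt (d * u))" "gsum (d * v) 1 = s * of_real (sqrt (d * v))"
    using nonzero_eq_divide_eq[OF nz(1), THEN iffD1, OF s_def]
      nonzero_eq_divide_eq[OF nz(2), THEN iffD1, OF trans[OF s_def g]] by (simp_all only:)
  have "(of_real (sqrt (real (d * u))) :: complex)\<^sup>2 = of_nat (d * u)"
    by (simp only: of_real_power[symmetric] real_sqrt_pow2[OF of_nat_0_le_iff] of_real_of_nat_eq)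
  then have "s\<^sup>2 * of_nat (d * u) = gsum (d * u) 1 ^ 2"
    unfolding sq by (simp only: power_mult_distrib)
  also have "\<dots> = of_real (J (d * u - 1) (d * u)) * of_nat (d * u)"
    using gsum_square[of "d * u"] o sf by simp
  finally have s2: "s\<^sup>2 = of_real (J (d * u - 1) (d * u))" using pos by simp
  have e1: "gsum (d * u) 1 * gsum (d * v) 1 = of_real (J u d * J d u * (J v d * J d v)) * td\<^sup>2 * (tu * tv)"
    using gsum_mult[OF cdu(1) o(1,2)] gsum_mult[OF cdu(2) o(1,3)]
    by (simp add: tu_def tv_def td_def power2_eq_square mult_ac)
  have e2: "J u d * J d u * (J v d * J d v) = sgn4 d (u * v)"
    using J_reciprocity[OF o(1,2) cdu(1)] J_reciprocity[OF o(1,3) cdu(2)] sgn4_mult[OF o(2,3), of d]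
    by (simp add: mult_ac sgn4_commute)
  have e3: "sgn4 d (u * v) = 1" using uv1 by (simp add: sgn4_def)
  have e4: "td\<^sup>2 = of_real (J (d - 1) d) * of_nat d" using gsum_square[OF o(1) sfd(1)] by (simp add: td_def)
  have e5: "gsum (u * v) 1 = of_real (sgn4 u v) * (tu * tv)"
    using gsum_mult[OF cp o(2,3), of 1] J_reciprocity[OF o(2,3) cp] by (simp add: tu_def tv_def mult_ac)
  have "gsum (d * u) 1 * gsum (d * v) 1 = s\<^sup>2 * of_real (sqrt (d * u) * sqrt (d * v))"
    unfolding sq by (simp add: power2_eq_square mult_ac)
  also have "sqrt (d * u) * sqrt (d * v) = d * sqrt (u * v)"
    by (simp add: real_sqrt_mult)
  finally have e6: "of_real (J (d - 1) d) * of_nat d * (tu * tv) = of_real (J (d * u - 1) (d * u)) * of_real (d * sqrt (u * v))"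
    unfolding e1 e2 e3 e4 s2 by simp
  have k: "J (d * u - 1) (d * u) = J (d - 1) d * sgn4 u v"
  proof -
    have "sgn4 (d * u) 3 = sgn4 d 3 * sgn4 u 3" using sgn4_mult o by blast
    then show ?thesis using o uv by (simp add: J_pred sgn4_def del: One_nat_def)
  qed
  have nz': "J (d - 1) d \<noteq> 0" using o by (simp add: J_pred del: One_nat_def)
  have "of_real (J (d - 1) d) * of_nat d * (tu * tv) = of_real (J (d - 1) d) * of_nat d * of_real (sgn4 u v * sqrt (u * v))"
    unfolding e6 k by (simp add: mult_ac)
  then have "tu * tv = of_real (sgn4 u v * sqrt (u * v))" using nz' pos by simp
  \<comment> \<open>\<open>gsum_mult\<close> contributes a second factor \<open>sgn4 u v\<close>,
    and the two signs cancel.\<close>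
  then show "gsum (u * v) 1 = of_real (sqrt (u * v))" unfolding e5 by (simp add: sgn4_def)
qed

section \<open>Poisson summation\<close>

text \<open>Logarithmic derivative of the reflection formula rGamma(z) rGamma(1-z) = sin(pi
  z)/pi.\<close>

lemma Digamma_reflection_complex:
  fixes z :: complex
  assumes "z \<notin> \<int>"
  shows "Digamma (1 - z) - Digamma z = of_real pi * cot (of_real pi * z)"
proof -
  have nz: "z \<notin> \<int>\<^sub>\<le>\<^sub>0" "1 - z \<notin> \<int>\<^sub>\<le>\<^sub>0"
  proof -
    show "z \<notin> \<int>\<^sub>\<le>\<^sub>0" using assms nonpos_Ints_Int by blast
    have "1 - z \<notin> \<int>" using assms Ints_diff[of 1 "1 - z"] by auto
    then show "1 - z \<notin> \<int>\<^sub>\<le>\<^sub>0" using nonpos_Ints_Int by blast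
  qed
  have "((\<lambda>w. rGamma w * rGamma (1 - w)) has_field_derivative
      rGamma z * rGamma (1 - z) * (Digamma (1 - z) - Digamma z)) (at z)"
    using nz by (auto intro!: derivative_eq_intros simp: algebra_simps)
  moreover have "(\<lambda>w. rGamma w * rGamma (1 - w)) = (\<lambda>w::complex. sin (of_real pi * w) / of_real pi)"
    using rGamma_reflection_complex by auto
  moreover have "((\<lambda>w::complex. sin (of_real pi * w) / of_real pi) has_field_derivative cos (of_real pi * z)) (at z)"
    by (auto intro!: derivative_eq_intros)
  ultimately have "rGamma z * rGamma (1 - z) * (Digamma (1 - z) - Digamma z) = cos (of_real pi * z)"
    using DERIV_unique by metis
  then have e: "sin (of_real pi * z) * (Digamma (1 - z) - Digamma z) = of_real pi * cos (of_real pi * z)"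
    using rGamma_reflection_complex[of z] by (simp add: field_simps)
  have "rGamma z \<noteq> 0" "rGamma (1 - z) \<noteq> 0" using nz by (simp_all add: rGamma_eq_zero_iff)
  then have "sin (of_real pi * z) \<noteq> 0" using rGamma_reflection_complex[of z] by auto
  then show ?thesis using e by (simp add: cot_def field_simps)
qed

text \<open>Subtract the series of \<open>Digamma\<close> at \<open>z\<close> from the one at
  \<open>1 - z\<close>; the Euler constants cancel and the reflection formula evaluates the
  difference.\<close>

lemma cot_partial_fractions:
  fixes z :: complex
  assumes "z \<notin> \<int>"
  shows "(\<lambda>k. inverse (z + of_nat k) - inverse (of_nat (Suc k) - z)) sums (of_real pi * cot (of_real pi * z))"
proof -
  have z: "z \<noteq> 0" "1 - z \<noteq> 0" using assms by (auto simp: right_minus_eq)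
  have s: "(\<lambda>k. inverse (of_nat (Suc k)) - inverse (w + of_nat k)) sums (Digamma w + euler_mascheroni)"
    if "w \<noteq> 0" for w :: complex
    using summable_Digamma[OF that] that by (simp add: Digamma_def summable_sums)
  have "(\<lambda>k. (inverse (of_nat (Suc k)) - inverse (1 - z + of_nat k)) - (inverse (of_nat (Suc k)) - inverse (z + of_nat k)))
    sums ((Digamma (1 - z) + euler_mascheroni) - (Digamma z + euler_mascheroni))"
    by (intro sums_diff s z)
  then show ?thesis using Digamma_reflection_complex[OF assms] by (simp add: algebra_simps)
qed

lemma Im_cot:
  assumes "y > 0"
  shows "Im (cot (Complex x y)) = - sinh (2 * y) / (cosh (2 * y) - cos (2 * x))"
proof -
  let ?z = "Complex x y"
  have s: "sin ?z = Complex (sin x * cosh y) (cos x * sinh y)"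
    by (simp add: complex_eq_iff Re_sin Im_sin cosh_def sinh_def field_simps)
  have c: "cos ?z = Complex (cos x * cosh y) (- (sin x * sinh y))"
    by (simp add: complex_eq_iff Re_cos Im_cos cosh_def sinh_def field_simps)
  have cs: "(cosh y)\<^sup>2 = 1 + (sinh y)\<^sup>2" using cosh_square_eq[of y] by simp
  have sc: "(sin x)\<^sup>2 = 1 - (cos x)\<^sup>2" by (simp add: sin_squared_eq)
  have d: "(sin x * cosh y)\<^sup>2 + (cos x * sinh y)\<^sup>2 = (cosh (2 * y) - cos (2 * x)) / 2"
    unfolding power_mult_distrib cosh_double cos_double cs sc by (simp add: algebra_simps)
  have n: "cosh (2 * y) - cos (2 * x) > 0"
  proof -
    have "sinh y > 0" using assms by simp
    then have "cosh (2 * y) > 1" unfolding cosh_double cs by simp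
    then show ?thesis using cos_le_one[of "2 * x"] by linarith
  qed
  have "Im (cos ?z / sin ?z) = ((- (sin x * sinh y)) * (sin x * cosh y) - cos x * cosh y * (cos x * sinh y)) /
      ((sin x * cosh y)\<^sup>2 + (cos x * sinh y)\<^sup>2)"
    unfolding s c by (simp add: Im_divide)
  also have "(- (sin x * sinh y)) * (sin x * cosh y) - cos x * cosh y * (cos x * sinh y)
      = - (sinh y * cosh y) * ((sin x)\<^sup>2 + (cos x)\<^sup>2)"
  proof -
    have "- (a * d) * (a * e) - c * e * (c * d) = - (d * e) * (a\<^sup>2 + c\<^sup>2)" for a c d e :: real
      by (simp add: power2_eq_square algebra_simps)
    then show ?thesis .
  qed
  also have "\<dots> = - sinh (2 * y) / 2" by (simp add: sinh_double)
  finally show ?thesis unfolding d cot_def using n by (simp add: field_simps)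
qed

text \<open>Minus the imaginary part of the cotangent expansion. The left side is the half-plane
  Poisson kernel summed over all translates of \<open>x\<close> by integers, the right side its
  closed form.\<close>

lemma poisson_kernel_sums:
  fixes x y :: real
  assumes "y > 0"
  shows "(\<lambda>k. y / ((x + real k)\<^sup>2 + y\<^sup>2) + y / ((real (Suc k) - x)\<^sup>2 + y\<^sup>2)) sums
    (pi * sinh (2 * pi * y) / (cosh (2 * pi * y) - cos (2 * pi * x)))"
proof -
  let ?z = "Complex x y"
  have "?z \<notin> \<int>" using assms by (auto elim!: Ints_cases simp: complex_eq_iff)
  then have "(\<lambda>k. inverse (?z + of_nat k) - inverse (of_nat (Suc k) - ?z)) sums (of_real pi * cot (of_real pi * ?z))"
    by (rule cot_partial_fractions)
  then have "(\<lambda>k. - Im (inverse (?z + of_nat k) - inverse (of_nat (Suc k) - ?z))) sums (- Im (of_real pi * cot (of_real pi * ?z)))"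
    by (intro sums_minus sums_Im)
  moreover have "of_real pi * ?z = Complex (pi * x) (pi * y)" by (simp add: complex_eq_iff)
  moreover have "- Im (inverse (?z + of_nat k) - inverse (of_nat (Suc k) - ?z))
     = y / ((x + real k)\<^sup>2 + y\<^sup>2) + y / ((real (Suc k) - x)\<^sup>2 + y\<^sup>2)" for k
    by simp
  ultimately show ?thesis using Im_cot[of "pi * y" "pi * x"] assms
    by (simp add: mult.assoc mult.left_commute[of 2] add.commute)
qed

text \<open>Real part of a geometric series with ratio e^(-l+it). The same closed form as in
  \<open>poisson_kernel_sums\<close> appears for l = 2 pi y and t = 2 pi x; this coincidence is
  Poisson summation for the exponential weight.\<close>

lemma exp_cos_sums:
  assumes "l > 0"
  shows "(\<lambda>m. exp (- l * real (Suc m)) * cos (real (Suc m) * t)) sums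
     ((sinh l / (cosh l - cos t) - 1) / 2)"
proof -
  define q where "q = of_real (exp (- l)) * cis t"
  have nq: "norm q < 1" using assms by (simp add: q_def norm_mult)
  have "(\<lambda>m. q ^ m * q) sums (1 / (1 - q) * q)" using nq by (intro sums_mult2 geometric_sums)
  then have "(\<lambda>m. Re (q ^ Suc m)) sums Re (q / (1 - q))"
    by (intro sums_Re) (simp add: mult.commute)
  moreover have "Re (q ^ Suc m) = exp (- l * real (Suc m)) * cos (real (Suc m) * t)" for m
  proof -
    have "q ^ Suc m = of_real (exp (- l) ^ Suc m) * cis (real (Suc m) * t)"
      by (simp only: q_def power_mult_distrib Complex.DeMoivre of_real_power)
    moreover have "exp (- l) ^ Suc m = exp (- l * real (Suc m))"
      by (simp only: exp_of_nat_mult[symmetric] mult.commute)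
    ultimately show ?thesis by (simp del: power_Suc)
  qed
  moreover have "Re (q / (1 - q)) = (sinh l / (cosh l - cos t) - 1) / 2"
  proof -
    define E where "E = exp l"
    have E: "E > 1" using assms by (simp add: E_def)
    have a: "Re q = cos t / E" "Im q = sin t / E" by (simp_all add: q_def E_def exp_minus field_simps)
    have e: "1 - cos t / E = (E - cos t) / E" using E by (simp add: field_simps)
    define P where "P = E\<^sup>2 - 2 * E * cos t + 1"
    have d: "((E - cos t) / E)\<^sup>2 + (sin t / E)\<^sup>2 = P / E\<^sup>2"
      unfolding power_divide add_divide_distrib[symmetric] by (simp add: sin_squared_eq power2_diff P_def)
    have pos: "P > 0"
    proof -
      have "2 * E * cos t \<le> 2 * E * 1" using E by (intro mult_left_mono) auto
      moreover have "(E - 1)\<^sup>2 > 0" using E by simp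
      ultimately show ?thesis by (simp add: P_def power2_eq_square algebra_simps)
    qed
    have R: "Re (q / (1 - q)) = (cos t / E * (1 - cos t / E) - (sin t / E) * (sin t / E)) / ((1 - cos t / E)\<^sup>2 + (sin t / E)\<^sup>2)"
      by (simp add: Re_divide a)
    have "Re (q / (1 - q)) = (cos t / E * ((E - cos t) / E) - (sin t / E) * (sin t / E)) / (((E - cos t) / E)\<^sup>2 + (sin t / E)\<^sup>2)"
      using R unfolding e .
    also have "cos t / E * ((E - cos t) / E) - (sin t / E) * (sin t / E) = (cos t * (E - cos t) - (sin t)\<^sup>2) / E\<^sup>2"
      by (simp only: times_divide_times_eq power2_eq_square diff_divide_distrib[symmetric])
    also have "cos t * (E - cos t) - (sin t)\<^sup>2 = E * cos t - 1"
      by (simp add: sin_squared_eq algebra_simps) (simp add: power2_eq_square)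
    finally have 1: "Re (q / (1 - q)) = (E * cos t - 1) / P"
      unfolding d using E by simp
    have "2 * E * cosh l = E\<^sup>2 + 1" "2 * E * sinh l = E\<^sup>2 - 1"
      using E by (simp_all add: cosh_def sinh_def exp_minus E_def[symmetric] field_simps power2_eq_square)
    then have "sinh l = (E\<^sup>2 - 1) / (2 * E)" "cosh l - cos t = P / (2 * E)"
      using E by (simp_all add: P_def eq_divide_eq) (simp_all add: algebra_simps)
    then have 2: "sinh l / (cosh l - cos t) = (E\<^sup>2 - 1) / P"
      using E by simp
    have E2: "E\<^sup>2 = P + 2 * E * cos t - 1" by (simp add: P_def)
    show ?thesis unfolding 1 2 E2 using pos by (simp add: field_simps)
  qed
  ultimately show ?thesis by simp
qed

text \<open>The Fourier transform of exp(-l|x|) at the frequency h/r.\<close>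

definition dual_wt :: "real \<Rightarrow> real \<Rightarrow> real \<Rightarrow> real" where
  "dual_wt l r h = 2 * l / (l\<^sup>2 + 4 * pi\<^sup>2 * h\<^sup>2 / r\<^sup>2)"

lemma dual_wt_nonneg: "l > 0 \<Longrightarrow> dual_wt l r h \<ge> 0"
  by (auto simp: dual_wt_def intro!: divide_nonneg_nonneg add_nonneg_nonneg)

text \<open>\<open>poisson_kernel_sums\<close> at x = a/r and y = l/(2 pi). The two terms with index
  \<open>k\<close> together run over the absolute values of all integers congruent to
  \<open>a\<close> modulo \<open>r\<close>.\<close>

lemma dual_wt_block_sums:
  assumes l: "l > 0" and r: "r > (0::nat)"
  shows "(\<lambda>k. dual_wt l r (real (k * r + a)) + dual_wt l r (real (Suc k * r) - real a)) sums
    (sinh l / (cosh l - cos (2 * pi * real a / real r)))"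
proof -
  have "(\<lambda>k. (l / (2 * pi)) / ((real a / real r + real k)\<^sup>2 + (l / (2 * pi))\<^sup>2) +
      (l / (2 * pi)) / ((real (Suc k) - real a / real r)\<^sup>2 + (l / (2 * pi))\<^sup>2)) sums
    (pi * sinh (2 * pi * (l / (2 * pi))) / (cosh (2 * pi * (l / (2 * pi))) - cos (2 * pi * (real a / real r))))"
    using l by (intro poisson_kernel_sums) auto
  then have "(\<lambda>k. 1 / pi * ((l / (2 * pi)) / ((real a / real r + real k)\<^sup>2 + (l / (2 * pi))\<^sup>2) +
      (l / (2 * pi)) / ((real (Suc k) - real a / real r)\<^sup>2 + (l / (2 * pi))\<^sup>2))) sums
    (1 / pi * (pi * sinh (2 * pi * (l / (2 * pi))) / (cosh (2 * pi * (l / (2 * pi))) - cos (2 * pi * (real a / real r)))))"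
    by (rule sums_mult)
  moreover have g: "1 / pi * ((l / (2 * pi)) / ((h / real r)\<^sup>2 + (l / (2 * pi))\<^sup>2)) = dual_wt l r h" for h
  proof -
    have "(h / real r)\<^sup>2 + (l / (2 * pi))\<^sup>2 = (l\<^sup>2 + 4 * pi\<^sup>2 * h\<^sup>2 / r\<^sup>2) / (4 * pi\<^sup>2)"
      using r by (simp add: power_divide power_mult_distrib add_divide_distrib)
    then show ?thesis by (simp add: dual_wt_def power2_eq_square)
  qed
  have e1: "real a / real r + real k = real (k * r + a) / real r" for k using r by (simp add: field_simps)
  have e2: "real (Suc k) - real a / real r = (real (Suc k * r) - real a) / real r" for k
    using r by (simp add: field_simps)
  ultimately show ?thesis unfolding distrib_left e1 e2 g by simp
qed


lemma sum_J_eq_0: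
  assumes "odd r" "squarefree r" "r > 1"
  shows "(\<Sum>a<r. J a r) = 0"
proof -
  have "gsum r 0 = 0" using gsum_eq[OF assms(1,2), of 0] J_eq_0_iff[of r 0] assms by simp
  moreover have "gsum r 0 = of_real (\<Sum>a<r. J a r)" by (simp add: gsum_def e2pi_def)
  ultimately show ?thesis by (metis of_real_eq_0_iff)
qed

lemma J_add_mult: "J (k * r + a) r = J a r"
  by (rule J_cong) (simp add: Cong.cong_def)

text \<open>Fourier expansion of the symbol. With root number 1 the left side is real, so only the
  cosines survive.\<close>

lemma J_cos_expansion:
  assumes "odd r" "squarefree r" "gsum r 1 = of_real (sqrt (real r))"
  shows "J m r * sqrt r = (\<Sum>a<r. J a r * cos (real m * (2 * pi * real a / real r)))"
proof -
  have "of_real (J m r * sqrt r) = gsum r m" using gsum_eq[OF assms(1,2), of m] assms(3) by simp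
  then have "J m r * sqrt r = Re (gsum r m)" by (metis Re_complex_of_real)
  also have "\<dots> = (\<Sum>a<r. J a r * cos (real m * (2 * pi * real a / real r)))"
    by (simp add: gsum_def e2pi_def mult_ac)
  finally show ?thesis .
qed

text \<open>The functional equation of the even quadratic \<open>L\<close>-function, in the form of Poisson summation
  for the weight \<open>exp (- l * m)\<close>.\<close>

lemma J_poisson:
  assumes r: "odd r" "squarefree r" "r > 1" and g: "gsum r 1 = of_real (sqrt (real r))" and m4: "r mod 4 = 1"
    and l: "l > 0"
    and s: "(\<lambda>h. J h r * dual_wt l r (real h)) sums S"
  shows "(\<lambda>m. J (Suc m) r * exp (- l * real (Suc m))) sums (S / sqrt r)"
proof -
  define W where "W = dual_wt l r"
  define t where "t a = 2 * pi * real a / real r" for a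
  have r0: "r > 0" using r by simp
  have J0: "J 0 r = 0" using J_eq_0_iff[of r 0] r by simp
  have 1: "(\<lambda>m. \<Sum>a<r. J a r * (exp (- l * real (Suc m)) * cos (real (Suc m) * t a))) sums
      (\<Sum>a<r. J a r * ((sinh l / (cosh l - cos (t a)) - 1) / 2))"
    by (intro sums_sum sums_mult exp_cos_sums l)
  have 2: "(\<Sum>a<r. J a r * (exp (- l * real (Suc m)) * cos (real (Suc m) * t a))) = J (Suc m) r * exp (- l * real (Suc m)) * sqrt r" for m
  proof -
    have "(\<Sum>a<r. J a r * (exp (- l * real (Suc m)) * cos (real (Suc m) * t a)))
       = exp (- l * real (Suc m)) * (\<Sum>a<r. J a r * cos (real (Suc m) * t a))"
      unfolding sum_distrib_left by (rule sum.cong[OF refl]) (simp only: mult_ac)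
    also have "(\<Sum>a<r. J a r * cos (real (Suc m) * t a)) = J (Suc m) r * sqrt r"
      unfolding t_def by (rule J_cos_expansion[OF r(1,2) g, symmetric])
    finally show ?thesis by (simp only: mult_ac)
  qed
  \<comment> \<open>The constant term -1/2 of \<open>exp_cos_sums\<close> drops out because the
    complete character sum is zero; this is where \<open>r > 1\<close> enters.\<close>
  have 3: "(\<Sum>a<r. J a r * ((sinh l / (cosh l - cos (t a)) - 1) / 2)) = (\<Sum>a<r. J a r * (sinh l / (cosh l - cos (t a)))) / 2"
  proof -
    have "(\<Sum>a<r. J a r * ((sinh l / (cosh l - cos (t a)) - 1) / 2))
        = (\<Sum>a<r. (J a r * (sinh l / (cosh l - cos (t a))) - J a r) / 2)"
      by (rule sum.cong[OF refl]) (simp only: right_diff_distrib times_divide_eq_right mult_1_right)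
    also have "\<dots> = ((\<Sum>a<r. J a r * (sinh l / (cosh l - cos (t a)))) - (\<Sum>a<r. J a r)) / 2"
      by (simp only: sum_divide_distrib[symmetric] sum_subtractf)
    finally show ?thesis using sum_J_eq_0[OF r] by simp
  qed
  have b: "(\<lambda>k. \<Sum>a<r. J a r * (W (real (k * r + a)) + W (real (Suc k * r) - real a))) sums
      (\<Sum>a<r. J a r * (sinh l / (cosh l - cos (t a))))"
    unfolding W_def t_def by (intro sums_sum sums_mult dual_wt_block_sums l r0)
  have "(\<lambda>k. sum (\<lambda>h. J h r * W (real h)) {k * r..<k * r + r}) sums S"
    using sums_group[OF s[folded W_def] r0] .
  moreover have "sum (\<lambda>h. J h r * W (real h)) {k * r..<k * r + r} = (\<Sum>a<r. J a r * W (real (k * r + a)))" for k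
  proof -
    have "sum (\<lambda>h. J h r * W (real h)) {0 + k * r..<r + k * r} = (\<Sum>a\<in>{0..<r}. J (a + k * r) r * W (real (a + k * r)))"
      by (rule sum.shift_bounds_nat_ivl)
    also have "\<dots> = (\<Sum>a<r. J a r * W (real (k * r + a)))"
      using J_add_mult by (simp add: atLeast0LessThan add.commute)
    finally show ?thesis by (simp add: add.commute)
  qed
  ultimately have c1: "(\<lambda>k. \<Sum>a<r. J a r * W (real (k * r + a))) sums S" by simp
  \<comment> \<open>As \<open>r\<close> is 1 modulo 4, the character is even, and the reflection a
    -> r - a maps the second half of each block onto the first.\<close>
  have c2: "(\<Sum>a<r. J a r * W (real (Suc k * r) - real a)) = (\<Sum>a<r. J a r * W (real (k * r + a)))" for k
  proof -
    have z: "(\<Sum>a<r. f a) = (\<Sum>a\<in>{1..<r}. f a)" if "f 0 = 0" for f :: "nat \<Rightarrow> real"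
    proof -
      have "{..<r} = insert 0 {1..<r}" using r0 by auto
      then show ?thesis using that by simp
    qed
    have Jr: "J (r - a) r = J a r" if "a \<in> {1..<r}" for a
    proof -
      have "[int (r - a) = -1 * int a] (mod int r)" using that by (simp add: cong_iff_dvd_diff of_nat_diff)
      then have "jacobi (int (r - a)) r = jacobi (-1) r * jacobi (int a) r"
        using jacobi_cong jacobi_mult_left[OF r(1)] by metis
      then show ?thesis using J_minus_one[OF r(1)] m4 by (simp add: J_def)
    qed
    have "(\<Sum>a<r. J a r * W (real (Suc k * r) - real a)) = (\<Sum>a\<in>{1..<r}. J a r * W (real (Suc k * r) - real a))"
      by (rule z) (simp add: J0)
    also have "\<dots> = (\<Sum>a\<in>{1..<r}. J a r * W (real (k * r + a)))"
    proof (rule sum.reindex_bij_witness[of _ "\<lambda>a. r - a" "\<lambda>a. r - a"])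
      fix a assume a: "a \<in> {1..<r}"
      have "real (k * r + (r - a)) = real (Suc k * r) - real a" using a by (simp add: of_nat_diff)
      then show "J (r - a) r * W (real (k * r + (r - a))) = J a r * W (real (Suc k * r) - real a)"
        using Jr[OF a] by (simp only:)
    qed auto
    also have "\<dots> = (\<Sum>a<r. J a r * W (real (k * r + a)))" by (rule z[symmetric]) (simp add: J0)
    finally show ?thesis .
  qed
  have "(\<lambda>k. (\<Sum>a<r. J a r * W (real (k * r + a))) + (\<Sum>a<r. J a r * W (real (k * r + a)))) sums (S + S)"
    by (intro sums_add c1)
  then have "(\<lambda>k. \<Sum>a<r. J a r * (W (real (k * r + a)) + W (real (Suc k * r) - real a))) sums (S + S)"
    using c2 by (simp only: distrib_left sum.distrib)
  then have "(\<Sum>a<r. J a r * (sinh l / (cosh l - cos (t a)))) = S + S"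
    using b sums_unique2 by blast
  then have "(\<lambda>m. J (Suc m) r * exp (- l * real (Suc m)) * sqrt r) sums S"
    using 1 unfolding 2 3 by simp
  then have "(\<lambda>m. J (Suc m) r * exp (- l * real (Suc m)) * sqrt r / sqrt r) sums (S / sqrt r)"
    by (rule sums_divide)
  then show ?thesis using r0 by simp
qed

section \<open>The kernel and its expansion\<close>

text \<open>The integral test in quantitative form. It serves the quartic kernels and the Gaussians
  alike: that the integral exceeds the sum by at most \<open>f 0\<close> is what bounds the kernel
  once the main terms have cancelled.\<close>

lemma antimono_sum_integral:
  fixes f :: "real \<Rightarrow> real"
  assumes mono: "\<And>x y. 0 \<le> x \<Longrightarrow> x \<le> y \<Longrightarrow> f y \<le> f x" and nonneg: "\<And>x. 0 \<le> x \<Longrightarrow> 0 \<le> f x"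
    and int: "has_bochner_integral lborel (\<lambda>x. indicator {0..} x *\<^sub>R f x) I"
  shows "summable (\<lambda>m. f (real (Suc m)))" "(\<Sum>m. f (real (Suc m))) \<le> I" "I \<le> f 0 + (\<Sum>m. f (real (Suc m)))"
proof -
  define A where "A i = {real i..<real i + 1}" for i
  have U: "(\<Union>i. A i) = {0..}"
  proof safe
    fix x :: real assume "0 \<le> x"
    then have "x \<in> A (nat \<lfloor>x\<rfloor>)" unfolding A_def by (simp add: of_nat_nat)
    then show "x \<in> (\<Union>i. A i)" by blast
  qed (auto simp: A_def)
  have si: "set_integrable lborel {0..} f"
    using int unfolding set_integrable_def by (simp add: has_bochner_integral_iff)
  have disj: "A i \<inter> A j = {}" if "i \<noteq> j" for i j
    using that by (cases i j rule: linorder_cases) (auto simp: A_def)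
  have I: "I = (LINT x:{0..}|lborel. f x)"
    using int unfolding set_lebesgue_integral_def by (simp add: has_bochner_integral_integral_eq)
  define c where "c i = (LINT x:A i|lborel. f x)" for i
  have siA: "set_integrable lborel (A i) f" for i
    by (rule set_integrable_subset[OF si]) (auto simp: A_def)
  have cb: "f (real (Suc i)) \<le> c i \<and> c i \<le> f (real i)" for i
  proof -
    have k: "set_integrable lborel (A i) (\<lambda>_. z)" "(LINT x:A i|lborel. z) = z" for z :: real
      unfolding A_def set_integrable_def set_lebesgue_integral_def by auto
    have "(LINT x:A i|lborel. f (real (Suc i))) \<le> c i"
      unfolding c_def by (rule set_integral_mono[OF k(1) siA]) (auto simp: A_def intro!: mono)
    moreover have "c i \<le> (LINT x:A i|lborel. f (real i))"
      unfolding c_def by (rule set_integral_mono[OF siA k(1)]) (auto simp: A_def intro!: mono)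
    ultimately show ?thesis by (simp only: k(2))
  qed
  have c0: "c i \<ge> 0" for i using cb[of i] nonneg[of "real (Suc i)"] by simp
  have part: "(\<Sum>i<n. c i) = (LINT x:{0..<real n}|lborel. f x)" for n
  proof (induction n)
    case (Suc n)
    have "{0..<real (Suc n)} = {0..<real n} \<union> A n" by (auto simp: A_def)
    moreover have "(LINT x:{0..<real n} \<union> A n|lborel. f x) = (LINT x:{0..<real n}|lborel. f x) + (LINT x:A n|lborel. f x)"
      by (intro set_integral_Un siA set_integrable_subset[OF si]) (auto simp: A_def)
    ultimately show ?case using Suc by (simp add: c_def)
  qed (simp add: set_lebesgue_integral_def)
  have le: "(\<Sum>i<n. c i) \<le> I" for n
    unfolding part I set_lebesgue_integral_def
    by (rule integral_mono[OF set_integrable_subset[OF si, unfolded set_integrable_def] si[unfolded set_integrable_def]])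
       (auto simp: indicator_def nonneg)
  have sc: "summable c"
    by (rule summableI_nonneg_bounded[OF c0 le])
  show sm: "summable (\<lambda>m. f (real (Suc m)))"
    by (rule summable_comparison_test'[OF sc, of 0]) (use cb nonneg in auto)
  have "(\<Sum>m. f (real (Suc m))) \<le> suminf c" by (rule suminf_le[OF _ sm sc]) (use cb in auto)
  also have "suminf c \<le> I" by (rule suminf_le_const[OF sc le])
  finally show "(\<Sum>m. f (real (Suc m))) \<le> I" .
  have "I = suminf c"
    unfolding I c_def U[symmetric]
    by (rule lebesgue_integral_countable_add) (auto simp: A_def disj[unfolded A_def] U[unfolded A_def] si)
  also have "\<dots> \<le> (\<Sum>m. f (real m))"
    by (rule suminf_le[OF _ sc]) (use cb sm summable_Suc_iff[of "\<lambda>m. f (real m)"] in auto)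
  also have "\<dots> = f 0 + (\<Sum>m. f (real (Suc m)))"
    using suminf_split_head[of "\<lambda>m. f (real m)"] sm summable_Suc_iff[of "\<lambda>m. f (real m)"] by simp
  finally show "I \<le> f 0 + (\<Sum>m. f (real (Suc m)))" .
qed

section \<open>The Gaussian and quartic integrals\<close>

lemma gaussian_scaled:
  assumes "k > 0"
  shows "has_bochner_integral lborel (\<lambda>x. indicator {0..} x *\<^sub>R exp (- k * x\<^sup>2)) (sqrt pi / (2 * sqrt k))"
proof -
  have "has_bochner_integral lborel (\<lambda>x. indicator {0..} (0 + sqrt k * x) *\<^sub>R exp (- (0 + sqrt k * x)\<^sup>2)) (sqrt pi / 2 /\<^sub>R \<bar>sqrt k\<bar>)"
    using lborel_has_bochner_integral_real_affine_iff[of "sqrt k" "\<lambda>x. indicator {0..} x *\<^sub>R exp (- x\<^sup>2)" "sqrt pi / 2" 0]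
      gaussian_moment_0 assms by simp
  moreover have "indicator {0..} (0 + sqrt k * x) *\<^sub>R exp (- (0 + sqrt k * x)\<^sup>2) = indicator {0..} x *\<^sub>R exp (- k * x\<^sup>2)" for x :: real
    using assms by (simp add: indicator_def zero_le_mult_iff power_mult_distrib)
  ultimately show ?thesis using assms by (simp add: field_simps)
qed

lemma quartic_base:
  "has_bochner_integral lborel (\<lambda>x. indicator {0..} x *\<^sub>R (1 / (1 + x ^ 4))) (pi / (2 * sqrt 2))"
proof -
  define w where "w = sqrt (2::real)"
  have w: "w\<^sup>2 = 2" "w > 0" by (simp_all add: w_def)
  \<comment> \<open>Antiderivative by partial fractions from 1 + x^4 = (x^2 + w x + 1)(x^2 - w x +
    1) with w = sqrt 2.\<close>
  define F where "F x = (1 / (4 * w)) * (ln (x\<^sup>2 + w * x + 1) - ln (x\<^sup>2 - w * x + 1))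
     + (1 / (2 * w)) * (arctan (w * x + 1) + arctan (w * x - 1))" for x
  have pos: "x\<^sup>2 + w * x + 1 > 0" "x\<^sup>2 - w * x + 1 > 0" for x :: real
  proof -
    have "x\<^sup>2 + w * x + 1 = (x + w / 2)\<^sup>2 + 1 / 2" "x\<^sup>2 - w * x + 1 = (x - w / 2)\<^sup>2 + 1 / 2"
      using w by (simp_all add: power2_sum power2_diff power_divide)
    then show "x\<^sup>2 + w * x + 1 > 0" "x\<^sup>2 - w * x + 1 > 0" by (auto intro!: add_nonneg_pos)
  qed
  have D: "(F has_real_derivative 1 / (1 + x ^ 4)) (at x)" for x
  proof -
    let ?p = "x\<^sup>2 + w * x + 1" and ?m = "x\<^sup>2 - w * x + 1"
    have "(F has_real_derivative (1 / (4 * w)) * ((2 * x + w) / ?p - (2 * x - w) / ?m)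
      + (1 / (2 * w)) * (w / (1 + (w * x + 1)\<^sup>2) + w / (1 + (w * x - 1)\<^sup>2))) (at x)"
    proof -
      have d1: "((\<lambda>x. ln (x\<^sup>2 + w * x + 1)) has_real_derivative (2 * x + w) / ?p) (at x)"
        using pos by (auto intro!: derivative_eq_intros)
      have d2: "((\<lambda>x. ln (x\<^sup>2 - w * x + 1)) has_real_derivative (2 * x - w) / ?m) (at x)"
        using pos by (auto intro!: derivative_eq_intros)
      have d3: "((\<lambda>x. arctan (w * x + 1)) has_real_derivative w / (1 + (w * x + 1)\<^sup>2)) (at x)"
        by (auto intro!: derivative_eq_intros simp: divide_inverse)
      have d4: "((\<lambda>x. arctan (w * x - 1)) has_real_derivative w / (1 + (w * x - 1)\<^sup>2)) (at x)"
        by (auto intro!: derivative_eq_intros simp: divide_inverse)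
      show ?thesis unfolding F_def by (intro DERIV_add DERIV_cmult DERIV_diff d1 d2 d3 d4)
    qed
    moreover have "1 + (w * x + 1)\<^sup>2 = 2 * ?p" "1 + (w * x - 1)\<^sup>2 = 2 * ?m"
      using w by (simp_all add: power2_sum power2_diff power_mult_distrib)
    moreover have pm: "1 + x ^ 4 = ?p * ?m"
    proof -
      have "?p * ?m = (x\<^sup>2 + 1)\<^sup>2 - w\<^sup>2 * x\<^sup>2" by (simp add: power2_eq_square algebra_simps)
      then show ?thesis unfolding w by (simp add: power2_eq_square power4_eq_xxxx algebra_simps)
    qed
    moreover have "(1 / (4 * w)) * ((2 * x + w) / ?p - (2 * x - w) / ?m) + (1 / (2 * w)) * (w / (2 * ?p) + w / (2 * ?m)) = 1 / (?p * ?m)"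
    proof -
      have "(1 / (4 * w)) * ((2 * x + w) / ?p - (2 * x - w) / ?m) + (1 / (2 * w)) * (w / (2 * ?p) + w / (2 * ?m))
        = (((2 * x + w) * ?m - (2 * x - w) * ?p) + w * (?m + ?p)) / (4 * w * (?p * ?m))"
        using pos[of x] w(2) by (simp add: divide_simps) (simp add: algebra_simps)
      also have "((2 * x + w) * ?m - (2 * x - w) * ?p) + w * (?m + ?p) = 4 * w"
        by (simp add: power2_eq_square algebra_simps)
      finally show ?thesis using w(2) by simp
    qed
    ultimately show ?thesis by (simp only:)
  qed
  have lim: "(F \<longlongrightarrow> pi / (2 * w)) at_top"
  proof -
    have "((\<lambda>x::real. ln (x\<^sup>2 + w * x + 1) - ln (x\<^sup>2 - w * x + 1)) \<longlongrightarrow> 0) at_top"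
      unfolding w_def by real_asymp
    moreover have "((\<lambda>x::real. arctan (w * x + 1) + arctan (w * x - 1)) \<longlongrightarrow> pi) at_top"
      unfolding w_def by real_asymp
    ultimately have "(F \<longlongrightarrow> (1 / (4 * w)) * 0 + (1 / (2 * w)) * pi) at_top"
      unfolding F_def by (intro tendsto_intros)
    then show ?thesis by simp
  qed
  have F0: "F 0 = 0" by (simp add: F_def arctan_minus)
  have "(\<integral>\<^sup>+x. ennreal (1 / (1 + x ^ 4)) * indicator {0..} x \<partial>lborel) = ennreal (pi / (2 * w) - F 0)"
    by (rule nn_integral_FTC_atLeast[OF _ D _ lim]) (auto intro!: divide_nonneg_pos add_pos_nonneg)
  then have "(\<integral>\<^sup>+x. ennreal (indicator {0..} x *\<^sub>R (1 / (1 + x ^ 4))) \<partial>lborel) = ennreal (pi / (2 * w))"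
    by (simp add: F0 ennreal_mult'' mult.commute indicator_mult_ennreal)
  then show ?thesis unfolding w_def[symmetric]
    by (intro has_bochner_integral_nn_integral) (use w in \<open>auto intro!: add_nonneg_nonneg\<close>)
qed

lemma quartic_scaled:
  assumes "b > 0" "p > 0"
  shows "has_bochner_integral lborel (\<lambda>x. indicator {0..} x *\<^sub>R (1 / (b + p * x ^ 4)))
    (pi / (2 * sqrt 2) / (b * sqrt (sqrt (p / b))))"
proof -
  define s where "s = sqrt (sqrt (p / b))"
  have s: "s > 0" using assms by (simp add: s_def)
  have s4: "s ^ 4 = p / b"
  proof -
    have "s ^ 4 = (s\<^sup>2)\<^sup>2" by simp
    also have "\<dots> = p / b" using assms by (simp add: s_def)
    finally show ?thesis .
  qed
  have "has_bochner_integral lborel (\<lambda>x. indicator {0..} (0 + s * x) *\<^sub>R (1 / (1 + (0 + s * x) ^ 4))) (pi / (2 * sqrt 2) /\<^sub>R \<bar>s\<bar>)"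
    using lborel_has_bochner_integral_real_affine_iff[of s "\<lambda>x. indicator {0..} x *\<^sub>R (1 / (1 + x ^ 4))" "pi / (2 * sqrt 2)" 0]
      quartic_base s by simp
  then have "has_bochner_integral lborel (\<lambda>x. (1 / b) *\<^sub>R (indicator {0..} (0 + s * x) *\<^sub>R (1 / (1 + (0 + s * x) ^ 4))))
     ((1 / b) *\<^sub>R (pi / (2 * sqrt 2) /\<^sub>R \<bar>s\<bar>))"
    by (intro has_bochner_integral_scaleR_right) auto
  moreover have "(1 / b) *\<^sub>R (indicator {0..} (0 + s * x) *\<^sub>R (1 / (1 + (0 + s * x) ^ 4))) = indicator {0..} x *\<^sub>R (1 / (b + p * x ^ 4))" for x :: real
    using s assms by (simp add: indicator_def zero_le_mult_iff power_mult_distrib s4 distrib_left)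
  ultimately show ?thesis using s unfolding s_def[symmetric] by (simp add: field_simps)
qed

text \<open>Up to the sign (-1)^i, the i-th Taylor coefficient at v = 0 of v -> 1/(a (1+v) +
  y).\<close>

definition geo :: "real \<Rightarrow> nat \<Rightarrow> real \<Rightarrow> real" where
  "geo a i y = a ^ i / (a + y) ^ Suc i"

lemma geo_antimono: "a > 0 \<Longrightarrow> 0 \<le> y \<Longrightarrow> y \<le> z \<Longrightarrow> geo a i z \<le> geo a i y"
  unfolding geo_def by (intro divide_left_mono power_mono mult_pos_pos zero_less_power) auto

lemma geo_nonneg: "a > 0 \<Longrightarrow> 0 \<le> y \<Longrightarrow> geo a i y \<ge> 0"
  by (simp add: geo_def)

lemma geo_le: "a > 0 \<Longrightarrow> 0 \<le> y \<Longrightarrow> geo a i y \<le> 1 / (a + y)"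
proof -
  assume h: "a > 0" "0 \<le> y"
  then have "a ^ i \<le> (a + y) ^ i" by (intro power_mono) auto
  then have "a ^ i / (a + y) ^ Suc i \<le> (a + y) ^ i / (a + y) ^ Suc i"
    using h by (intro divide_right_mono) auto
  then show ?thesis using h by (simp add: geo_def)
qed

text \<open>A finite geometric series of ratio -v a/(a+y), at most \<open>v\<close> in absolute
  value. The remainder keeps the factor \<open>1 / (a + y)\<close>, so it can still be summed or
  integrated over \<open>y\<close>.\<close>

lemma geo_expansion:
  assumes "a > 0" "0 \<le> y" "0 \<le> v"
  shows "\<bar>1 / (a * (1 + v) + y) - (\<Sum>i<n. (-1) ^ i * v ^ i * geo a i y)\<bar> \<le> v ^ n * (1 / (a + y))"
proof -
  define q where "q = - 1 * v * (a / (a + y))"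
  have d: "a + y > 0" "a * (1 + v) + y > 0" using assms by (auto intro!: add_pos_nonneg mult_pos_pos)
  have q1: "1 - q = (a * (1 + v) + y) / (a + y)" using d by (simp add: q_def field_simps)
  have "(\<Sum>i<n. (-1) ^ i * v ^ i * geo a i y) = (\<Sum>i<n. q ^ i) / (a + y)"
    unfolding sum_divide_distrib using d
  proof (intro sum.cong refl)
    fix i
    have "q ^ i = (- 1) ^ i * v ^ i * (a ^ i / (a + y) ^ i)"
      by (simp only: q_def power_mult_distrib power_divide)
    then show "(- 1) ^ i * v ^ i * geo a i y = q ^ i / (a + y)"
      by (simp add: geo_def mult.commute)
  qed
  also have "(\<Sum>i<n. q ^ i) = (1 - q ^ n) / (1 - q)"
    using q1 d by (subst sum_gp_strict) auto
  also have "(1 - q ^ n) / (1 - q) / (a + y) = (1 - q ^ n) / (a * (1 + v) + y)"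
    unfolding q1 using d by simp
  finally have "1 / (a * (1 + v) + y) - (\<Sum>i<n. (-1) ^ i * v ^ i * geo a i y) = q ^ n / (a * (1 + v) + y)"
    by (simp add: diff_divide_distrib)
  also have "\<bar>\<dots>\<bar> = \<bar>q\<bar> ^ n / (a * (1 + v) + y)" using d by (simp add: power_abs)
  also have "\<dots> \<le> v ^ n / (a + y)"
  proof (intro frac_le power_mono)
    show "\<bar>q\<bar> \<le> v"
    proof -
      have "v * a \<le> v * (a + y)" using assms by (intro mult_left_mono) auto
      then show ?thesis using assms d by (simp add: q_def abs_mult field_simps)
    qed
    show "a + y \<le> a * (1 + v) + y" using assms by (simp add: distrib_left)
  qed (use assms d in auto)
  finally show ?thesis by simp
qed


section \<open>Quartic sums, their integrals, and expansion in the modulus\<close>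

definition quartic_sum :: "real \<Rightarrow> real \<Rightarrow> nat \<Rightarrow> real" where
  "quartic_sum a p i = (\<Sum>m. geo a i (p * real (Suc m) ^ 4))"

definition quartic_int :: "real \<Rightarrow> real \<Rightarrow> nat \<Rightarrow> real" where
  "quartic_int a p i = (\<integral>x. indicator {0..} x *\<^sub>R geo a i (p * x ^ 4) \<partial>lborel)"

text \<open>This is zeta(4), carried along as an unevaluated constant.\<close>

definition quartic_const :: real where
  "quartic_const = (\<Sum>m. 1 / real (Suc m) ^ 4)"

lemma summable_quartic: "summable (\<lambda>m. 1 / real (Suc m) ^ 4)"
proof -
  have q: "summable (\<lambda>m. 1 / real (Suc m) ^ 2)"
    using sums_summable[OF inverse_squares_sums] by (simp add: add.commute)
  have le: "norm (1 / real (Suc m) ^ 4) \<le> 1 / real (Suc m) ^ 2" for m :: nat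
  proof -
    have "real (Suc m) ^ 2 \<le> real (Suc m) ^ 4" by (rule power_increasing) simp_all
    then have "1 / real (Suc m) ^ 4 \<le> 1 / real (Suc m) ^ 2" by (intro divide_left_mono mult_pos_pos) simp_all
    then show ?thesis by simp
  qed
  show ?thesis by (rule summable_comparison_test'[OF q, of 0], rule le)
qed

lemma quartic_const_nonneg: "quartic_const \<ge> 0"
  unfolding quartic_const_def by (rule suminf_nonneg[OF summable_quartic]) simp

context
  fixes a p :: real
  assumes ap: "a > 0" "p > 0"
begin

lemma has_int_geo: "has_bochner_integral lborel (\<lambda>x. indicator {0..} x *\<^sub>R geo a i (p * x ^ 4)) (quartic_int a p i)"
proof -
  have "integrable lborel (\<lambda>x. indicator {0..} x *\<^sub>R geo a i (p * x ^ 4))"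
  proof (rule Bochner_Integration.integrable_bound)
    show "integrable lborel (\<lambda>x. indicator {0..} x *\<^sub>R (1 / (a + p * x ^ 4)))"
      using quartic_scaled[OF ap] by (simp add: has_bochner_integral_iff)
    show "AE x in lborel. norm (indicator {0..} x *\<^sub>R geo a i (p * x ^ 4)) \<le> norm (indicator {0..} x *\<^sub>R (1 / (a + p * x ^ 4)))"
      using ap geo_le[of a] geo_nonneg[of a] by (auto simp: indicator_def abs_of_nonneg)
  qed (simp add: geo_def)
  then show ?thesis by (simp add: has_bochner_integral_iff quartic_int_def)
qed

lemma quartic_int_le: "quartic_int a p i \<le> pi / (2 * sqrt 2) / (a * sqrt (sqrt (p / a)))"
  unfolding quartic_int_def quartic_scaled[OF ap, THEN has_bochner_integral_integral_eq, symmetric]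
proof (rule integral_mono)
  show "integrable lborel (\<lambda>x. indicator {0..} x *\<^sub>R geo a i (p * x ^ 4))"
    "integrable lborel (\<lambda>x. indicator {0..} x *\<^sub>R (1 / (a + p * x ^ 4)))"
    using has_int_geo quartic_scaled[OF ap] by (simp_all add: has_bochner_integral_iff)
  fix x :: real
  show "indicator {0..} x *\<^sub>R geo a i (p * x ^ 4) \<le> indicator {0..} x *\<^sub>R (1 / (a + p * x ^ 4))"
    using ap geo_le[of a "p * x ^ 4" i] by (auto simp: indicator_def)
qed

lemma geo_quartic_bounds:
  "summable (\<lambda>m. geo a i (p * real (Suc m) ^ 4))"
  "quartic_sum a p i \<le> quartic_int a p i" "quartic_int a p i \<le> 1 / a + quartic_sum a p i"
proof -
  have m: "geo a i (p * y ^ 4) \<le> geo a i (p * x ^ 4)" if "0 \<le> x" "x \<le> y" for x y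
    using ap that by (intro geo_antimono mult_left_mono power_mono) auto
  have n: "geo a i (p * x ^ 4) \<ge> 0" for x using ap by (intro geo_nonneg) auto
  note * = antimono_sum_integral[of "\<lambda>x. geo a i (p * x ^ 4)", OF m n has_int_geo]
  show "summable (\<lambda>m. geo a i (p * real (Suc m) ^ 4))" using *(1) .
  show "quartic_sum a p i \<le> quartic_int a p i" using *(2) unfolding quartic_sum_def .
  show "quartic_int a p i \<le> 1 / a + quartic_sum a p i" using *(3) ap unfolding quartic_sum_def by (simp add: geo_def)
qed

lemma quartic_sum_nonneg: "quartic_sum a p i \<ge> 0"
  unfolding quartic_sum_def using ap by (intro suminf_nonneg geo_quartic_bounds(1) geo_nonneg) auto

lemma quartic_sum_le: "quartic_sum a p i \<le> quartic_const / p"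
proof -
  have "quartic_sum a p i \<le> (\<Sum>m. 1 / real (Suc m) ^ 4 / p)"
    unfolding quartic_sum_def
  proof (rule suminf_le[OF _ geo_quartic_bounds(1) summable_divide[OF summable_quartic]])
    fix m
    have "geo a i (p * real (Suc m) ^ 4) \<le> 1 / (a + p * real (Suc m) ^ 4)" using ap by (intro geo_le) auto
    also have "\<dots> \<le> 1 / (p * real (Suc m) ^ 4)" using ap by (intro divide_left_mono mult_pos_pos add_pos_pos) auto
    finally show "geo a i (p * real (Suc m) ^ 4) \<le> 1 / real (Suc m) ^ 4 / p" by (simp add: mult.commute)
  qed
  also have "\<dots> = quartic_const / p" unfolding quartic_const_def by (rule suminf_divide[OF summable_quartic])
  finally show ?thesis .
qed

end

lemma sums_of_geometric_remainder:
  fixes f :: "nat \<Rightarrow> real"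
  assumes "0 \<le> v" "v < 1" "\<And>n. \<bar>S - (\<Sum>i<n. f i)\<bar> \<le> v ^ n * C"
  shows "f sums S"
proof -
  have "norm v < 1" using assms(1,2) by simp
  then have "(\<lambda>n. v ^ n * C) \<longlonglongrightarrow> 0"
    using tendsto_mult_right[OF LIMSEQ_power_zero, of v C] by (simp add: mult.commute)
  then have "(\<lambda>n. S - (\<Sum>i<n. f i)) \<longlonglongrightarrow> 0"
    by (rule Lim_null_comparison[rotated]) (use assms(3) in simp)
  from tendsto_diff[OF tendsto_const[of S] this]
  show ?thesis by (simp add: sums_def)
qed

text \<open>The remainder of \<open>geo_expansion\<close> is summed over \<open>m\<close>: it is
  \<open>v ^ n\<close> times a fixed convergent series, so the order of summation is exchanged only
  in finite sums over \<open>i\<close>.\<close>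

lemma quartic_sum_expansion:
  assumes "a > 0" "p > 0" "0 \<le> v" "v < 1"
  shows "(\<lambda>i. (-1) ^ i * v ^ i * quartic_sum a p i) sums (\<Sum>m. 1 / (a * (1 + v) + p * real (Suc m) ^ 4))"
proof (rule sums_of_geometric_remainder[OF assms(3,4)])
  fix n
  define y where "y m = p * real (Suc m) ^ 4" for m
  have y: "y m \<ge> 0" for m using assms by (simp add: y_def)
  have g0: "geo b 0 x = 1 / (b + x)" for b x by (simp add: geo_def)
  have av: "a * (1 + v) > 0" using assms by (simp add: mult_pos_pos add_pos_nonneg)
  have s1: "summable (\<lambda>m. 1 / (a * (1 + v) + y m))"
    using geo_quartic_bounds(1)[OF av assms(2), of 0] by (simp only: g0 y_def)
  have s0: "summable (\<lambda>m. 1 / (a + y m))"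
    using geo_quartic_bounds(1)[OF assms(1,2), of 0] by (simp only: g0 y_def)
  have si: "summable (\<lambda>m. (-1) ^ i * v ^ i * geo a i (y m))" for i
    using geo_quartic_bounds(1)[OF assms(1,2)] unfolding y_def by (intro summable_mult)
  have ss: "summable (\<lambda>m. \<Sum>i<n. (-1) ^ i * v ^ i * geo a i (y m))"
    by (rule summable_sum) (rule si)
  have "(\<Sum>i<n. (-1) ^ i * v ^ i * quartic_sum a p i) = (\<Sum>i<n. \<Sum>m. (-1) ^ i * v ^ i * geo a i (y m))"
    unfolding quartic_sum_def y_def
    by (rule sum.cong[OF refl]) (rule suminf_mult[OF geo_quartic_bounds(1)[OF assms(1,2)], symmetric])
  also have "\<dots> = (\<Sum>m. \<Sum>i<n. (-1) ^ i * v ^ i * geo a i (y m))"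
    by (rule suminf_sum[symmetric]) (rule si)
  finally have e: "(\<Sum>m. 1 / (a * (1 + v) + y m)) - (\<Sum>i<n. (-1) ^ i * v ^ i * quartic_sum a p i)
     = (\<Sum>m. 1 / (a * (1 + v) + y m) - (\<Sum>i<n. (-1) ^ i * v ^ i * geo a i (y m)))"
    using suminf_diff[OF s1 ss] by (simp only:)
  have b: "norm (1 / (a * (1 + v) + y m) - (\<Sum>i<n. (-1) ^ i * v ^ i * geo a i (y m))) \<le> v ^ n * (1 / (a + y m))" for m
    using geo_expansion[OF assms(1) y assms(3)] by simp
  have sb: "summable (\<lambda>m. v ^ n * (1 / (a + y m)))" using s0 by (rule summable_mult)
  have sn: "summable (\<lambda>m. norm (1 / (a * (1 + v) + y m) - (\<Sum>i<n. (-1) ^ i * v ^ i * geo a i (y m))))"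
    by (rule summable_comparison_test'[OF sb, of 0]) (use b in auto)
  have "\<bar>(\<Sum>m. 1 / (a * (1 + v) + y m)) - (\<Sum>i<n. (-1) ^ i * v ^ i * quartic_sum a p i)\<bar>
     \<le> (\<Sum>m. norm (1 / (a * (1 + v) + y m) - (\<Sum>i<n. (-1) ^ i * v ^ i * geo a i (y m))))"
    unfolding e using summable_norm[OF sn] by simp
  also have "\<dots> \<le> (\<Sum>m. v ^ n * (1 / (a + y m)))" by (rule suminf_le[OF b sn sb])
  also have "\<dots> = v ^ n * (\<Sum>m. 1 / (a + y m))" by (rule suminf_mult[OF s0])
  finally show "\<bar>(\<Sum>m. 1 / (a * (1 + v) + p * real (Suc m) ^ 4)) - (\<Sum>i<n. (-1) ^ i * v ^ i * quartic_sum a p i)\<bar>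
     \<le> v ^ n * (\<Sum>m. 1 / (a + p * real (Suc m) ^ 4))" unfolding y_def .
qed

lemma quartic_int_expansion:
  assumes "a > 0" "p > 0" "0 \<le> v" "v < 1"
  shows "(\<lambda>i. (-1) ^ i * v ^ i * quartic_int a p i) sums (pi / (2 * sqrt 2) / (a * (1 + v) * sqrt (sqrt (p / (a * (1 + v))))))"
proof (rule sums_of_geometric_remainder[OF assms(3,4)])
  fix n
  let ?I = "indicator {0..} :: real \<Rightarrow> real"
  have av: "a * (1 + v) > 0" using assms by (simp add: mult_pos_pos add_pos_nonneg)
  define D where "D x = ?I x *\<^sub>R (1 / (a * (1 + v) + p * x ^ 4)) - (\<Sum>i<n. ((-1) ^ i * v ^ i) *\<^sub>R (?I x *\<^sub>R geo a i (p * x ^ 4)))" for x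
  have h1: "has_bochner_integral lborel D (pi / (2 * sqrt 2) / (a * (1 + v) * sqrt (sqrt (p / (a * (1 + v)))))
       - (\<Sum>i<n. ((-1) ^ i * v ^ i) *\<^sub>R quartic_int a p i))"
    unfolding D_def
    by (rule has_bochner_integral_diff, rule quartic_scaled[OF av assms(2)], rule has_bochner_integral_sum,
        rule has_bochner_integral_scaleR_right, rule has_int_geo[OF assms(1,2)])
  have h2: "has_bochner_integral lborel (\<lambda>x. v ^ n *\<^sub>R (?I x *\<^sub>R (1 / (a + p * x ^ 4)))) (v ^ n *\<^sub>R (pi / (2 * sqrt 2) / (a * sqrt (sqrt (p / a)))))"
    by (rule has_bochner_integral_scaleR_right, rule quartic_scaled[OF assms(1,2)])
  have b: "\<bar>D x\<bar> \<le> v ^ n *\<^sub>R (?I x *\<^sub>R (1 / (a + p * x ^ 4)))" for x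
    using geo_expansion[OF assms(1) _ assms(3), of "p * x ^ 4" n] assms
    by (cases "x \<ge> 0") (auto simp: D_def indicator_def)
  have "\<bar>integral\<^sup>L lborel D\<bar> \<le> (\<integral>x. \<bar>D x\<bar> \<partial>lborel)" by (rule integral_abs_bound)
  also have "\<dots> \<le> (\<integral>x. v ^ n *\<^sub>R (?I x *\<^sub>R (1 / (a + p * x ^ 4))) \<partial>lborel)"
    using h1 h2 b by (intro integral_mono integrable_abs) (auto simp: has_bochner_integral_iff)
  finally show "\<bar>pi / (2 * sqrt 2) / (a * (1 + v) * sqrt (sqrt (p / (a * (1 + v))))) - (\<Sum>i<n. (-1) ^ i * v ^ i * quartic_int a p i)\<bar>
     \<le> v ^ n * (pi / (2 * sqrt 2) / (a * sqrt (sqrt (p / a))))"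
    using h1 h2 by (simp only: has_bochner_integral_iff real_scaleR_def)
qed


text \<open>For \<open>b = True\<close> both sums are compared with their integrals, which coincide by
  \<open>main_term_identity\<close>; the remainders are expanded around \<open>r = n\<^sup>2\<close> so that the dependence on the two moduli separates.\<close>

definition kernel :: "real \<Rightarrow> bool \<Rightarrow> real \<Rightarrow> real \<Rightarrow> real \<Rightarrow> real" where
  "kernel l b k f r = (\<Sum>m. dual_wt l r (k * (f * real (Suc m))\<^sup>2)) / sqrt r
     - (if b then \<Sum>m. exp (- l * (k * (f * real (Suc m))\<^sup>2)) else 0)"

text \<open>The coefficient of (-v)^i when the dual sum, reduced by its integral if
  \<open>b\<close>, is expanded at r^2 = n^4 (1+v), after removal of the factor (r/n^2)^(3/2). The
  quantities \<open>a\<close> and \<open>p\<close> come from clearing \<open>r^2\<close> in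
  \<open>dual_wt l r (k * (f * m)^2)\<close>.\<close>

definition kernel_coeff :: "real \<Rightarrow> bool \<Rightarrow> real \<Rightarrow> real \<Rightarrow> real \<Rightarrow> nat \<Rightarrow> real" where
  "kernel_coeff l b k f n i = (let a = l\<^sup>2 * n ^ 4; p = 4 * pi\<^sup>2 * k\<^sup>2 * f ^ 4 in
     2 * l * n ^ 3 * (if b then quartic_sum a p i - quartic_int a p i else quartic_sum a p i))"

text \<open>The part of \<open>kernel\<close> free of \<open>r\<close>: the integral taken off the
  dual sum equals the Gaussian integral, so it is added back here and set against the exponential
  sum.\<close>

definition kernel_const :: "real \<Rightarrow> bool \<Rightarrow> real \<Rightarrow> real \<Rightarrow> real" where
  "kernel_const l b k f = (if b then sqrt pi / (2 * sqrt (l * k * f\<^sup>2)) - (\<Sum>m. exp (- l * (k * (f * real (Suc m))\<^sup>2))) else 0)"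

lemma exp_sum_bounds:
  assumes "q > 0"
  shows "summable (\<lambda>m. exp (- q * (real (Suc m))\<^sup>2))"
    "(\<Sum>m. exp (- q * (real (Suc m))\<^sup>2)) \<le> sqrt pi / (2 * sqrt q)"
    "sqrt pi / (2 * sqrt q) \<le> 1 + (\<Sum>m. exp (- q * (real (Suc m))\<^sup>2))"
proof -
  have m: "exp (- q * y\<^sup>2) \<le> exp (- q * x\<^sup>2)" if "0 \<le> x" "x \<le> y" for x y :: real
    using assms that power_mono[of x y 2] by simp
  note * = antimono_sum_integral[of "\<lambda>x. exp (- q * x\<^sup>2)", OF m _ gaussian_scaled[OF assms]]
  show "summable (\<lambda>m. exp (- q * (real (Suc m))\<^sup>2))" by (rule *(1)) simp_all
  show "(\<Sum>m. exp (- q * (real (Suc m))\<^sup>2)) \<le> sqrt pi / (2 * sqrt q)" by (rule *(2)) simp_all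
  have "sqrt pi / (2 * sqrt q) \<le> exp (- q * 0\<^sup>2) + (\<Sum>m. exp (- q * (real (Suc m))\<^sup>2))" by (rule *(3)) simp_all
  then show "sqrt pi / (2 * sqrt q) \<le> 1 + (\<Sum>m. exp (- q * (real (Suc m))\<^sup>2))" by simp
qed

text \<open>The main terms of both sums coincide for every \<open>r\<close>. With h = k f^2 x^2 this
  expresses that |x|^(-1/2) is its own Fourier transform.\<close>

lemma main_term_identity:
  assumes "l > 0" "k > 0" "f > 0" "r > 0"
  shows "2 * l * (r * sqrt r) * (pi / (2 * sqrt 2) / (l\<^sup>2 * r\<^sup>2 * sqrt (sqrt (4 * pi\<^sup>2 * k\<^sup>2 * f ^ 4 / (l\<^sup>2 * r\<^sup>2)))))
     = sqrt pi / (2 * sqrt (l * k * f\<^sup>2))"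
proof -
  define q where "q = l * k * f\<^sup>2"
  define X where "X = sqrt pi"
  define Y where "Y = sqrt q"
  define R where "R = sqrt r"
  have pos: "X > 0" "Y > 0" "R > 0" using assms by (simp_all add: X_def Y_def R_def q_def)
  have sq: "X\<^sup>2 = pi" "Y\<^sup>2 = q" "R\<^sup>2 = r" using assms by (simp_all add: X_def Y_def R_def q_def)
  have "4 * pi\<^sup>2 * k\<^sup>2 * f ^ 4 / (l\<^sup>2 * r\<^sup>2) = (2 * pi * k * f\<^sup>2 / (l * r))\<^sup>2"
    by (simp add: power_divide power_mult_distrib)
  then have "sqrt (4 * pi\<^sup>2 * k\<^sup>2 * f ^ 4 / (l\<^sup>2 * r\<^sup>2)) = 2 * pi * k * f\<^sup>2 / (l * r)"
    using assms by (simp only: real_sqrt_abs) simp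
  also have "\<dots> = (sqrt 2 * X * Y / (l * R))\<^sup>2"
    using assms pos by (simp add: power_divide power_mult_distrib sq) (simp add: q_def power2_eq_square field_simps)
  finally have s: "sqrt (sqrt (4 * pi\<^sup>2 * k\<^sup>2 * f ^ 4 / (l\<^sup>2 * r\<^sup>2))) = sqrt 2 * X * Y / (l * R)"
    using assms pos by (simp only: real_sqrt_abs) simp
  have "2 * l * (r * R) * (pi / (2 * sqrt 2) / (l\<^sup>2 * r\<^sup>2 * (sqrt 2 * X * Y / (l * R)))) = X / (2 * Y)"
  proof -
    have "2 * l * (r * R) * (pi / (2 * sqrt 2) / (l\<^sup>2 * r\<^sup>2 * (sqrt 2 * X * Y / (l * R))))
       = (2 * l * (R\<^sup>2 * R) * X\<^sup>2 * (l * R)) / ((2 * (sqrt 2 * sqrt 2)) * (l\<^sup>2 * (R\<^sup>2)\<^sup>2) * (X * Y))"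
      unfolding sq using assms pos by (simp add: mult_ac)
    also have "\<dots> = X / (2 * Y)" using assms pos by (simp add: power2_eq_square)
    finally show ?thesis .
  qed
  then show ?thesis unfolding s X_def Y_def R_def q_def .
qed

lemma kernel_expansion:
  assumes pos: "l > 0" "k > 0" "f > 0" "n > 0" "r > 0" and v: "0 \<le> v" "v < 1" and r2: "r\<^sup>2 = n ^ 4 * (1 + v)"
  shows "(\<lambda>i. (r / n\<^sup>2) * sqrt (r / n\<^sup>2) * ((-1) ^ i * v ^ i * kernel_coeff l b k f n i)) sums
     (kernel l b k f r - kernel_const l b k f)"
proof -
  define a where "a = l\<^sup>2 * n ^ 4"
  define p where "p = 4 * pi\<^sup>2 * k\<^sup>2 * f ^ 4"
  have ap: "a > 0" "p > 0" using pos by (simp_all add: a_def p_def)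
  have av: "a * (1 + v) = l\<^sup>2 * r\<^sup>2" by (simp add: a_def r2)
  define S where "S = (\<Sum>m. 1 / (a * (1 + v) + p * real (Suc m) ^ 4))"
  define I where "I = pi / (2 * sqrt 2) / (a * (1 + v) * sqrt (sqrt (p / (a * (1 + v)))))"
  define t where "t = (r / n\<^sup>2) * sqrt (r / n\<^sup>2)"
  have tn: "t * n ^ 3 = r * sqrt r"
    using pos by (simp add: t_def real_sqrt_divide power2_eq_square power3_eq_cube)
  have sS: "(\<lambda>i. (-1) ^ i * v ^ i * quartic_sum a p i) sums S"
    unfolding S_def by (rule quartic_sum_expansion[OF ap v])
  have sI: "(\<lambda>i. (-1) ^ i * v ^ i * quartic_int a p i) sums I"
    unfolding I_def by (rule quartic_int_expansion[OF ap v])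
  have main: "2 * l * (t * n ^ 3) * I = sqrt pi / (2 * sqrt (l * k * f\<^sup>2))"
    unfolding tn I_def av p_def by (rule main_term_identity[OF pos(1,2,3,5)])
  have dual: "(\<Sum>m. dual_wt l r (k * (f * real (Suc m))\<^sup>2)) / sqrt r = 2 * l * (t * n ^ 3) * S"
  proof -
    have e: "dual_wt l r (k * (f * real (Suc m))\<^sup>2) = 2 * l * r\<^sup>2 * (1 / (a * (1 + v) + p * real (Suc m) ^ 4))" for m
    proof -
      have "l\<^sup>2 + 4 * pi\<^sup>2 * (k * (f * real (Suc m))\<^sup>2)\<^sup>2 / r\<^sup>2 = (a * (1 + v) + p * real (Suc m) ^ 4) / r\<^sup>2"
        unfolding av p_def using pos by (simp add: add_divide_distrib power_mult_distrib mult.assoc)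
      then show ?thesis unfolding dual_wt_def by simp
    qed
    have g0: "geo c 0 x = 1 / (c + x)" for c x by (simp add: geo_def)
    have "a * (1 + v) > 0" using ap v by (simp add: mult_pos_pos add_pos_nonneg)
    from geo_quartic_bounds(1)[OF this ap(2), of 0]
    have "summable (\<lambda>m. 1 / (a * (1 + v) + p * real (Suc m) ^ 4))" by (simp only: g0)
    then have "(\<Sum>m. dual_wt l r (k * (f * real (Suc m))\<^sup>2)) = 2 * l * r\<^sup>2 * S"
      unfolding e S_def by (rule suminf_mult)
    moreover have "r\<^sup>2 / sqrt r = r * sqrt r"
      using pos by (simp add: field_simps power2_eq_square)
    moreover have "2 * l * r\<^sup>2 * S / sqrt r = 2 * l * (r\<^sup>2 / sqrt r) * S" by simp
    ultimately show ?thesis unfolding tn by (simp only:)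
  qed
  show ?thesis
  proof (cases b)
    case True
    have "(\<lambda>i. 2 * l * (t * n ^ 3) * ((-1) ^ i * v ^ i * quartic_sum a p i - (-1) ^ i * v ^ i * quartic_int a p i)) sums
      (2 * l * (t * n ^ 3) * (S - I))"
      by (rule sums_mult[OF sums_diff[OF sS sI]])
    moreover have "2 * l * (t * n ^ 3) * ((-1) ^ i * v ^ i * quartic_sum a p i - (-1) ^ i * v ^ i * quartic_int a p i)
      = t * ((-1) ^ i * v ^ i * kernel_coeff l b k f n i)" for i
      using True by (simp add: kernel_coeff_def Let_def a_def p_def algebra_simps)
    moreover have "2 * l * (t * n ^ 3) * (S - I) = kernel l b k f r - kernel_const l b k f"
      unfolding right_diff_distrib main using True dual by (simp add: kernel_def kernel_const_def)
    ultimately show ?thesis unfolding t_def[symmetric] by simp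
  next
    case False
    have "(\<lambda>i. 2 * l * (t * n ^ 3) * ((-1) ^ i * v ^ i * quartic_sum a p i)) sums (2 * l * (t * n ^ 3) * S)"
      by (rule sums_mult[OF sS])
    moreover have "2 * l * (t * n ^ 3) * ((-1) ^ i * v ^ i * quartic_sum a p i)
      = t * ((-1) ^ i * v ^ i * kernel_coeff l b k f n i)" for i
      using False by (simp add: kernel_coeff_def Let_def a_def p_def algebra_simps)
    moreover have "2 * l * (t * n ^ 3) * S = kernel l b k f r - kernel_const l b k f"
      using False dual by (simp add: kernel_def kernel_const_def)
    ultimately show ?thesis unfolding t_def[symmetric] by simp
  qed
qed

lemma sqrt_pi_le_2: "sqrt pi \<le> 2"
proof -
  have "sqrt pi \<le> sqrt 4" using pi_less_4 by (intro real_sqrt_le_mono) simp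
  then show ?thesis by simp
qed

text \<open>For \<open>b = True\<close> the gap between integral and sum is at most the value
  \<open>1 / a\<close> at 0, and also at most the integral; this gives the two competing bounds. For
  \<open>b = False\<close> the sum is dominated by the convergent series of 1/m^4, which yields
  decay in \<open>k\<close>.\<close>

lemma kernel_coeff_bounds:
  assumes pos: "l > 0" "k > 0" "f > 0" "n > 0"
  shows "\<bar>kernel_coeff l True k f n i\<bar> \<le> 2 / (l * n)"
    "\<bar>kernel_coeff l True k f n i\<bar> \<le> 1 / sqrt (l * k * f\<^sup>2)"
    "\<bar>kernel_coeff l False k f n i\<bar> \<le> quartic_const * l * n ^ 3 / (k\<^sup>2 * f ^ 4)"
    "\<bar>kernel_const l True k f\<bar> \<le> 1" "\<bar>kernel_const l True k f\<bar> \<le> 1 / sqrt (l * k * f\<^sup>2)"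
    "kernel_const l False k f = 0"
proof -
  define a where "a = l\<^sup>2 * n ^ 4"
  define p where "p = 4 * pi\<^sup>2 * k\<^sup>2 * f ^ 4"
  have ap: "a > 0" "p > 0" using pos by (simp_all add: a_def p_def)
  have c: "2 * l * n ^ 3 \<ge> 0" using pos by simp
  have q: "l * k * f\<^sup>2 > 0" using pos by simp
  have half: "sqrt pi / (2 * sqrt (l * k * f\<^sup>2)) \<le> 1 / sqrt (l * k * f\<^sup>2)"
    using sqrt_pi_le_2 q by (simp add: field_simps)
  note B = geo_quartic_bounds[OF ap, of i] quartic_sum_nonneg[OF ap, of i] quartic_int_le[OF ap, of i]
  have kT: "\<bar>kernel_coeff l True k f n i\<bar> = 2 * l * n ^ 3 * (quartic_int a p i - quartic_sum a p i)"
  proof -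
    have "kernel_coeff l True k f n i = 2 * l * n ^ 3 * (quartic_sum a p i - quartic_int a p i)"
      by (simp add: kernel_coeff_def Let_def a_def p_def)
    then have "\<bar>kernel_coeff l True k f n i\<bar> = 2 * l * n ^ 3 * \<bar>quartic_sum a p i - quartic_int a p i\<bar>"
      by (simp only: abs_mult[of "2 * l * n ^ 3"] abs_of_nonneg[OF c])
    then show ?thesis using B by simp
  qed
  have "2 * l * n ^ 3 * (quartic_int a p i - quartic_sum a p i) \<le> 2 * l * n ^ 3 * (1 / a)"
    using B c by (intro mult_left_mono) auto
  also have "\<dots> = 2 / (l * n)"
    using pos by (simp add: a_def power2_eq_square power3_eq_cube power4_eq_xxxx)
  finally show "\<bar>kernel_coeff l True k f n i\<bar> \<le> 2 / (l * n)" unfolding kT .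
  have "2 * l * n ^ 3 * (quartic_int a p i - quartic_sum a p i) \<le> 2 * l * n ^ 3 * (pi / (2 * sqrt 2) / (a * sqrt (sqrt (p / a))))"
    using B c by (intro mult_left_mono) auto
  also have "\<dots> = sqrt pi / (2 * sqrt (l * k * f\<^sup>2))"
  proof -
    have "sqrt (n\<^sup>2) = n" "n\<^sup>2 * n = n ^ 3" using pos by (simp_all add: power2_eq_square power3_eq_cube)
    moreover have "l\<^sup>2 * (n\<^sup>2)\<^sup>2 = a" by (simp add: a_def)
    ultimately show ?thesis using main_term_identity[of l k f "n\<^sup>2"] pos unfolding p_def by simp
  qed
  also note half
  finally show "\<bar>kernel_coeff l True k f n i\<bar> \<le> 1 / sqrt (l * k * f\<^sup>2)" unfolding kT .
  have "kernel_coeff l False k f n i = 2 * l * n ^ 3 * quartic_sum a p i"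
    by (simp add: kernel_coeff_def Let_def a_def p_def)
  then have "\<bar>kernel_coeff l False k f n i\<bar> = 2 * l * n ^ 3 * quartic_sum a p i"
    using B by (simp only: abs_mult[of "2 * l * n ^ 3"] abs_of_nonneg[OF c] abs_of_nonneg)
  also have "\<dots> \<le> 2 * l * n ^ 3 * (quartic_const / p)"
    using c by (intro mult_left_mono quartic_sum_le ap)
  also have "\<dots> \<le> 2 * l * n ^ 3 * (quartic_const / (2 * (k\<^sup>2 * f ^ 4)))"
  proof (rule mult_left_mono[OF divide_left_mono c])
    have "1 \<le> pi\<^sup>2" using pi_gt3 by (intro one_le_power) linarith
    then have "2 * (k\<^sup>2 * f ^ 4) \<le> (4 * pi\<^sup>2) * (k\<^sup>2 * f ^ 4)" by (intro mult_right_mono) auto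
    then show "2 * (k\<^sup>2 * f ^ 4) \<le> p" by (simp add: p_def mult.assoc)
    show "0 \<le> quartic_const" by (rule quartic_const_nonneg)
    have z: "0 < 2 * (k\<^sup>2 * f ^ 4)" using pos by simp
    show "0 < p * (2 * (k\<^sup>2 * f ^ 4))" by (rule mult_pos_pos[OF ap(2) z])
  qed
  also have "\<dots> = quartic_const * l * n ^ 3 / (k\<^sup>2 * f ^ 4)" by simp
  finally show "\<bar>kernel_coeff l False k f n i\<bar> \<le> quartic_const * l * n ^ 3 / (k\<^sup>2 * f ^ 4)" .
  have e: "exp (- l * (k * (f * real (Suc m))\<^sup>2)) = exp (- (l * k * f\<^sup>2) * (real (Suc m))\<^sup>2)" for m
    by (simp add: power_mult_distrib mult_ac)
  note E = exp_sum_bounds[OF q, folded e]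
  have nn: "(\<Sum>m. exp (- l * (k * (f * real (Suc m))\<^sup>2))) \<ge> 0" by (rule suminf_nonneg[OF E(1)]) simp
  show "\<bar>kernel_const l True k f\<bar> \<le> 1" "\<bar>kernel_const l True k f\<bar> \<le> 1 / sqrt (l * k * f\<^sup>2)"
    using E nn half unfolding kernel_const_def by (simp_all only: if_True)
  show "kernel_const l False k f = 0" by (simp add: kernel_const_def)
qed

section \<open>Large sieve inequalities\<close>

text \<open>For nonnegative weights, \<open>B\<close> bounds the squared operator norm of the matrix
  with entries \<open>sqrt (w k) * X k n\<close>. As a predicate it can be weakened and restricted
  to subsets without computing a norm.\<close>

definition sieve_bound :: "'k set \<Rightarrow> ('k \<Rightarrow> real) \<Rightarrow> ('k \<Rightarrow> 'n \<Rightarrow> real) \<Rightarrow> 'n set \<Rightarrow> real \<Rightarrow> bool" where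
  "sieve_bound K w X E B \<longleftrightarrow> (\<forall>b::'n \<Rightarrow> complex.
     (\<Sum>k\<in>K. w k * (norm (\<Sum>n\<in>E. b n * of_real (X k n)))\<^sup>2) \<le> B * (\<Sum>n\<in>E. (norm (b n))\<^sup>2))"

lemma sieve_boundD:
  fixes b :: "'n \<Rightarrow> complex"
  shows "sieve_bound K w X E B \<Longrightarrow> (\<Sum>k\<in>K. w k * (norm (\<Sum>n\<in>E. b n * of_real (X k n)))\<^sup>2) \<le> B * (\<Sum>n\<in>E. (norm (b n))\<^sup>2)"
  unfolding sieve_bound_def by blast

text \<open>A matrix and its transpose have the same norm. With \<open>S\<close> the dual quadratic
  form, \<open>S = \<Sum>k\<in>K. b k * C k\<close>; Cauchy-Schwarz and the hypothesis for the
  coefficients \<open>cnj (A n)\<close> give S^2 <= |b|^2 B S.\<close>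

lemma duality:
  fixes X :: "'k \<Rightarrow> 'n \<Rightarrow> real"
  assumes "sieve_bound K (\<lambda>_. 1) X E B" "B \<ge> 0"
  shows "sieve_bound E (\<lambda>_. 1) (\<lambda>n k. X k n) K B"
  unfolding sieve_bound_def
proof
  fix b :: "'k \<Rightarrow> complex"
  define A where "A n = (\<Sum>k\<in>K. b k * of_real (X k n))" for n
  define C where "C k = (\<Sum>n\<in>E. cnj (A n) * of_real (X k n))" for k
  define S where "S = (\<Sum>n\<in>E. (norm (A n))\<^sup>2)"
  have S0: "S \<ge> 0" unfolding S_def by (intro sum_nonneg) simp
  have "of_real S = (\<Sum>n\<in>E. A n * cnj (A n))"
    by (simp only: S_def of_real_sum complex_norm_square)
  also have "\<dots> = (\<Sum>n\<in>E. \<Sum>k\<in>K. b k * (cnj (A n) * of_real (X k n)))"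
  proof (rule sum.cong[OF refl])
    fix n
    have "A n * c = (\<Sum>k\<in>K. b k * (c * of_real (X k n)))" for c
      unfolding A_def sum_distrib_right by (intro sum.cong refl) (simp add: mult_ac)
    then show "A n * cnj (A n) = (\<Sum>k\<in>K. b k * (cnj (A n) * of_real (X k n)))" .
  qed
  also have "\<dots> = (\<Sum>k\<in>K. \<Sum>n\<in>E. b k * (cnj (A n) * of_real (X k n)))" by (rule sum.swap)
  also have "\<dots> = (\<Sum>k\<in>K. b k * C k)" by (simp only: C_def sum_distrib_left)
  finally have "S = norm (\<Sum>k\<in>K. b k * C k)" using S0 by (metis norm_of_real abs_of_nonneg)
  also have "\<dots> \<le> (\<Sum>k\<in>K. \<bar>norm (b k)\<bar> * \<bar>norm (C k)\<bar>)" by (rule sum_norm_le) (simp add: norm_mult)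
  also have "\<dots> \<le> L2_set (\<lambda>k. norm (b k)) K * L2_set (\<lambda>k. norm (C k)) K" by (rule L2_set_mult_ineq)
  also have "\<dots> \<le> L2_set (\<lambda>k. norm (b k)) K * sqrt (B * S)"
  proof (intro mult_left_mono L2_set_nonneg)
    have "(\<Sum>k\<in>K. (norm (C k))\<^sup>2) \<le> B * S"
      using sieve_boundD[OF assms(1), of "\<lambda>n. cnj (A n)"] by (simp add: C_def S_def)
    then show "L2_set (\<lambda>k. norm (C k)) K \<le> sqrt (B * S)" unfolding L2_set_def by (rule real_sqrt_le_mono)
  qed
  finally have le: "S \<le> L2_set (\<lambda>k. norm (b k)) K * sqrt (B * S)" .
  have "S\<^sup>2 \<le> (L2_set (\<lambda>k. norm (b k)) K * sqrt (B * S))\<^sup>2" using le S0 by (rule power_mono)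
  also have "\<dots> = (\<Sum>k\<in>K. (norm (b k))\<^sup>2) * (B * S)"
    using assms S0 by (simp add: power_mult_distrib L2_set_def sum_nonneg)
  finally have "S * S \<le> (B * (\<Sum>k\<in>K. (norm (b k))\<^sup>2)) * S" by (simp add: power2_eq_square mult_ac)
  then have "S \<le> B * (\<Sum>k\<in>K. (norm (b k))\<^sup>2)"
  proof (cases "S = 0")
    case True then show ?thesis using assms by (simp add: sum_nonneg)
  next
    case False
    then show ?thesis using \<open>S * S \<le> _\<close> S0 by (metis mult_le_cancel_right order_le_less not_less)
  qed
  then show "(\<Sum>k\<in>E. 1 * (norm (\<Sum>n\<in>K. b n * of_real (X n k)))\<^sup>2) \<le> B * (\<Sum>n\<in>K. (norm (b n))\<^sup>2)"
    by (simp add: S_def A_def)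
qed

text \<open>Cauchy-Schwarz in \<open>k\<close>. Allowing two different weights is what later
  produces the symmetric factor \<open>1 / sqrt (f * g)\<close>.\<close>

lemma bilinear_base:
  fixes X :: "'k \<Rightarrow> 'n \<Rightarrow> real" and x y :: "'n \<Rightarrow> complex"
  assumes 1: "sieve_bound K w1 X E1 B1" and 2: "sieve_bound K w2 X E2 B2" and B: "B1 \<ge> 0" "B2 \<ge> 0"
    and w: "\<And>k. k \<in> K \<Longrightarrow> w1 k \<ge> 0" "\<And>k. k \<in> K \<Longrightarrow> w2 k \<ge> 0"
    and c: "\<And>k. k \<in> K \<Longrightarrow> \<bar>c k\<bar> \<le> sqrt (w1 k) * sqrt (w2 k)"
  shows "norm (\<Sum>k\<in>K. of_real (c k) * (\<Sum>n\<in>E1. x n * of_real (X k n)) * (\<Sum>m\<in>E2. y m * of_real (X k m)))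
     \<le> sqrt (B1 * B2) * L2_set (\<lambda>n. norm (x n)) E1 * L2_set (\<lambda>n. norm (y n)) E2"
proof -
  let ?x = "\<lambda>k. \<Sum>n\<in>E1. x n * of_real (X k n)" and ?y = "\<lambda>k. \<Sum>m\<in>E2. y m * of_real (X k m)"
  have l: "L2_set (\<lambda>k. sqrt (w1 k) * norm (?x k)) K \<le> sqrt B1 * L2_set (\<lambda>n. norm (x n)) E1"
    using real_sqrt_le_mono[OF sieve_boundD[OF 1, of x]] w B
    by (simp add: L2_set_def power_mult_distrib real_sqrt_mult cong: sum.cong)
  have r: "L2_set (\<lambda>k. sqrt (w2 k) * norm (?y k)) K \<le> sqrt B2 * L2_set (\<lambda>n. norm (y n)) E2"
    using real_sqrt_le_mono[OF sieve_boundD[OF 2, of y]] w B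
    by (simp add: L2_set_def power_mult_distrib real_sqrt_mult cong: sum.cong)
  have "norm (\<Sum>k\<in>K. of_real (c k) * ?x k * ?y k) \<le> (\<Sum>k\<in>K. \<bar>sqrt (w1 k) * norm (?x k)\<bar> * \<bar>sqrt (w2 k) * norm (?y k)\<bar>)"
  proof (rule sum_norm_le)
    fix k assume k: "k \<in> K"
    have "norm (of_real (c k) * ?x k * ?y k) = \<bar>c k\<bar> * (norm (?x k) * norm (?y k))" by (simp add: norm_mult)
    also have "\<dots> \<le> (sqrt (w1 k) * sqrt (w2 k)) * (norm (?x k) * norm (?y k))"
      by (rule mult_right_mono[OF c[OF k]]) simp
    also have "\<dots> = \<bar>sqrt (w1 k) * norm (?x k)\<bar> * \<bar>sqrt (w2 k) * norm (?y k)\<bar>"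
      using w k by (simp add: abs_mult)
    finally show "norm (of_real (c k) * ?x k * ?y k) \<le> \<bar>sqrt (w1 k) * norm (?x k)\<bar> * \<bar>sqrt (w2 k) * norm (?y k)\<bar>" .
  qed
  also have "\<dots> \<le> L2_set (\<lambda>k. sqrt (w1 k) * norm (?x k)) K * L2_set (\<lambda>k. sqrt (w2 k) * norm (?y k)) K"
    by (rule L2_set_mult_ineq)
  also have "\<dots> \<le> (sqrt B1 * L2_set (\<lambda>n. norm (x n)) E1) * (sqrt B2 * L2_set (\<lambda>n. norm (y n)) E2)"
    using B by (intro mult_mono l r mult_nonneg_nonneg L2_set_nonneg) auto
  finally show ?thesis using B by (simp add: real_sqrt_mult mult_ac)
qed

lemma L2_set_scale_le:
  assumes "\<And>n. n \<in> E \<Longrightarrow> \<bar>u n\<bar> \<le> q" "q \<ge> 0"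
  shows "L2_set (\<lambda>n. norm (x n * of_real (u n) :: complex)) E \<le> q * L2_set (\<lambda>n. norm (x n)) E"
proof -
  have "L2_set (\<lambda>n. norm (x n * of_real (u n))) E \<le> L2_set (\<lambda>n. q * norm (x n)) E"
  proof (rule L2_set_mono)
    fix n assume "n \<in> E"
    then show "norm (x n * of_real (u n)) \<le> q * norm (x n)"
      using mult_right_mono[OF assms(1), of n "norm (x n)"] by (simp add: norm_mult mult.commute)
  qed simp
  also have "\<dots> = q * L2_set (\<lambda>n. norm (x n)) E" by (rule L2_set_right_distrib[OF assms(2), symmetric])
  finally show ?thesis .
qed

text \<open>The kernel \<open>((1 + u n) * (1 + v m) - 1) ^ i\<close> is a Schur multiplier of exponentially small norm.\<close>

lemma bilinear_power:
  fixes X :: "'k \<Rightarrow> 'n \<Rightarrow> real" and x y :: "'n \<Rightarrow> complex"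
  assumes 1: "sieve_bound K w1 X E1 B1" and 2: "sieve_bound K w2 X E2 B2" and B: "B1 \<ge> 0" "B2 \<ge> 0"
    and w: "\<And>k. k \<in> K \<Longrightarrow> w1 k \<ge> 0" "\<And>k. k \<in> K \<Longrightarrow> w2 k \<ge> 0"
    and c: "\<And>k. k \<in> K \<Longrightarrow> \<bar>c k\<bar> \<le> sqrt (w1 k) * sqrt (w2 k)"
    and u: "\<And>n. n \<in> E1 \<Longrightarrow> \<bar>u n\<bar> \<le> q" and v: "\<And>n. n \<in> E2 \<Longrightarrow> \<bar>v n\<bar> \<le> q" and q: "q \<ge> 0"
  shows "norm (\<Sum>k\<in>K. \<Sum>n\<in>E1. \<Sum>m\<in>E2. x n * y m * of_real (X k n * X k m * (c k * ((1 + u n) * (1 + v m) - 1) ^ i)))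
     \<le> (2 * q + q\<^sup>2) ^ i * (sqrt (B1 * B2) * L2_set (\<lambda>n. norm (x n)) E1 * L2_set (\<lambda>n. norm (y n)) E2)"
proof (induction i arbitrary: x y)
  case 0
  have "(\<Sum>k\<in>K. \<Sum>n\<in>E1. \<Sum>m\<in>E2. x n * y m * of_real (X k n * X k m * (c k * ((1 + u n) * (1 + v m) - 1) ^ 0)))
    = (\<Sum>k\<in>K. of_real (c k) * (\<Sum>n\<in>E1. x n * of_real (X k n)) * (\<Sum>m\<in>E2. y m * of_real (X k m)))"
    unfolding mult.assoc unfolding sum_product unfolding sum_distrib_left
    by (intro sum.cong refl) simp
  then show ?case using bilinear_base[OF 1 2 B w c, of x y] by simp
next
  case (Suc i)
  define T where "T x y = (\<Sum>k\<in>K. \<Sum>n\<in>E1. \<Sum>m\<in>E2. x n * y m * of_real (X k n * X k m * (c k * ((1 + u n) * (1 + v m) - 1) ^ i)))" for x y :: "'n \<Rightarrow> complex"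
  let ?L = "\<lambda>x E. L2_set (\<lambda>n. norm (x n)) E"
  define b where "b = (2 * q + q\<^sup>2) ^ i * sqrt (B1 * B2)"
  have b0: "b \<ge> 0" using q B by (simp add: b_def)
  have IH: "norm (T x y) \<le> b * (?L x E1 * ?L y E2)" for x y
    using Suc.IH[of x y] by (simp add: T_def b_def mult_ac)
  let ?xu = "\<lambda>n. x n * of_real (u n)" and ?yv = "\<lambda>n. y n * of_real (v n)"
  have Lx: "?L ?xu E1 \<le> q * ?L x E1" using u q by (rule L2_set_scale_le)
  have Ly: "?L ?yv E2 \<le> q * ?L y E2" using v q by (rule L2_set_scale_le)
  \<comment> \<open>(1+u)(1+v) - 1 = u + v + u v: each summand factors over \<open>n\<close> and
    \<open>m\<close> and is absorbed into the coefficients, at the cost q, q and q^2.\<close>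
  have step: "(\<Sum>k\<in>K. \<Sum>n\<in>E1. \<Sum>m\<in>E2. x n * y m * of_real (X k n * X k m * (c k * ((1 + u n) * (1 + v m) - 1) ^ Suc i)))
     = T ?xu y + T x ?yv + T ?xu ?yv"
  proof -
    let ?t = "\<lambda>x y k n m. x n * y m * of_real (X k n * X k m * (c k * ((1 + u n) * (1 + v m) - 1) ^ i)) :: complex"
    have "x n * y m * of_real (X k n * X k m * (c k * ((1 + u n) * (1 + v m) - 1) ^ Suc i))
       = ?t ?xu y k n m + ?t x ?yv k n m + ?t ?xu ?yv k n m" for k n m
      by (simp add: algebra_simps)
    then show ?thesis unfolding T_def by (simp only: sum.distrib)
  qed
  have "norm (T ?xu y + T x ?yv + T ?xu ?yv) \<le> norm (T ?xu y) + norm (T x ?yv) + norm (T ?xu ?yv)"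
    by (intro order.trans[OF norm_triangle_ineq] add_right_mono norm_triangle_ineq)
  also have "\<dots> \<le> b * (q * (?L x E1 * ?L y E2)) + b * (q * (?L x E1 * ?L y E2)) + b * (q\<^sup>2 * (?L x E1 * ?L y E2))"
  proof (intro add_mono)
    have "?L ?xu E1 * ?L y E2 \<le> q * (?L x E1 * ?L y E2)"
      using mult_right_mono[OF Lx L2_set_nonneg[of "\<lambda>n. norm (y n)" E2]] by (simp add: mult_ac)
    then show "norm (T ?xu y) \<le> b * (q * (?L x E1 * ?L y E2))"
      using IH[of ?xu y] b0 by (meson mult_left_mono order.trans)
    have "?L x E1 * ?L ?yv E2 \<le> q * (?L x E1 * ?L y E2)"
      using mult_left_mono[OF Ly L2_set_nonneg[of "\<lambda>n. norm (x n)" E1]] by (simp add: mult_ac)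
    then show "norm (T x ?yv) \<le> b * (q * (?L x E1 * ?L y E2))"
      using IH[of x ?yv] b0 by (meson mult_left_mono order.trans)
    have "?L ?xu E1 * ?L ?yv E2 \<le> (q * ?L x E1) * (q * ?L y E2)"
      using Lx Ly q by (intro mult_mono L2_set_nonneg mult_nonneg_nonneg) auto
    also have "\<dots> = q\<^sup>2 * (?L x E1 * ?L y E2)" by (simp add: power2_eq_square mult_ac)
    finally show "norm (T ?xu ?yv) \<le> b * (q\<^sup>2 * (?L x E1 * ?L y E2))"
      using IH[of ?xu ?yv] b0 by (meson mult_left_mono order.trans)
  qed
  also have "\<dots> = (2 * q + q\<^sup>2) ^ Suc i * (sqrt (B1 * B2) * ?L x E1 * ?L y E2)"
    by (simp add: b_def algebra_simps)
  finally show ?case unfolding step .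
qed

text \<open>The terms of the expansion are bounded by \<open>bilinear_power\<close> with ratio 1/2.
  The constant is 9 = 4 * 2 + 1: a factor 4 from \<open>g\<close> and \<open>h\<close>, a factor 2
  from the geometric series, and 1 for the part \<open>d\<close>.\<close>

lemma bilinear_kernel:
  fixes X :: "'k \<Rightarrow> 'n \<Rightarrow> real" and x y :: "'n \<Rightarrow> complex"
  assumes 1: "sieve_bound K w1 X E1 B1" and 2: "sieve_bound K w2 X E2 B2" and B: "B1 \<ge> 0" "B2 \<ge> 0"
    and w: "\<And>k. k \<in> K \<Longrightarrow> w1 k \<ge> 0" "\<And>k. k \<in> K \<Longrightarrow> w2 k \<ge> 0"
    and c: "\<And>k i. k \<in> K \<Longrightarrow> \<bar>c k i\<bar> \<le> sqrt (w1 k) * sqrt (w2 k)"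
    and d: "\<And>k. k \<in> K \<Longrightarrow> \<bar>d k\<bar> \<le> sqrt (w1 k) * sqrt (w2 k)"
    and u: "\<And>n. n \<in> E1 \<Longrightarrow> \<bar>u n\<bar> \<le> q" and v: "\<And>n. n \<in> E2 \<Longrightarrow> \<bar>v n\<bar> \<le> q" and q: "q \<ge> 0" "2 * q + q\<^sup>2 \<le> 1 / 2"
    and g: "\<And>n. n \<in> E1 \<Longrightarrow> \<bar>g n\<bar> \<le> 2" "\<And>n. n \<in> E2 \<Longrightarrow> \<bar>h n\<bar> \<le> 2"
    and H: "\<And>k n m. k \<in> K \<Longrightarrow> n \<in> E1 \<Longrightarrow> m \<in> E2 \<Longrightarrow>
      (\<lambda>i. g n * h m * ((-1) ^ i * ((1 + u n) * (1 + v m) - 1) ^ i * c k i)) sums (H k n m - d k)"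
  shows "norm (\<Sum>k\<in>K. \<Sum>n\<in>E1. \<Sum>m\<in>E2. x n * y m * of_real (X k n * X k m * H k n m))
     \<le> 9 * (sqrt (B1 * B2) * L2_set (\<lambda>n. norm (x n)) E1 * L2_set (\<lambda>n. norm (y n)) E2)"
proof -
  let ?L = "\<lambda>x E. L2_set (\<lambda>n. norm (x n)) E"
  define Z where "Z = sqrt (B1 * B2) * ?L x E1 * ?L y E2"
  have Z0: "Z \<ge> 0" using B by (simp add: Z_def)
  let ?x = "\<lambda>n. x n * of_real (g n)" and ?y = "\<lambda>n. y n * of_real (h n)"
  define F where "F i = (\<Sum>k\<in>K. \<Sum>n\<in>E1. \<Sum>m\<in>E2. x n * y m * of_real (X k n * X k m * (g n * h m * ((-1) ^ i * ((1 + u n) * (1 + v m) - 1) ^ i * c k i))))" for i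
  define S where "S = (\<Sum>k\<in>K. \<Sum>n\<in>E1. \<Sum>m\<in>E2. x n * y m * of_real (X k n * X k m * (H k n m - d k)))"
  have FS: "F sums S" unfolding F_def S_def
    by (intro sums_sum sums_mult sums_of_real H)
  have Lx: "?L ?x E1 \<le> 2 * ?L x E1" using g(1) by (rule L2_set_scale_le) simp_all
  have Ly: "?L ?y E2 \<le> 2 * ?L y E2" using g(2) by (rule L2_set_scale_le) simp_all
  have Fi: "norm (F i) \<le> 4 * Z * (1 / 2) ^ i" for i
  proof -
    have "F i = (-1) ^ i * (\<Sum>k\<in>K. \<Sum>n\<in>E1. \<Sum>m\<in>E2. ?x n * ?y m * of_real (X k n * X k m * (c k i * ((1 + u n) * (1 + v m) - 1) ^ i)))"
      unfolding F_def sum_distrib_left by (intro sum.cong refl) (simp add: mult_ac)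
    then have "norm (F i) = norm (\<Sum>k\<in>K. \<Sum>n\<in>E1. \<Sum>m\<in>E2. ?x n * ?y m * of_real (X k n * X k m * (c k i * ((1 + u n) * (1 + v m) - 1) ^ i)))"
      by (simp add: norm_mult norm_power)
    also have "\<dots> \<le> (2 * q + q\<^sup>2) ^ i * (sqrt (B1 * B2) * ?L ?x E1 * ?L ?y E2)"
      by (rule bilinear_power[OF 1 2 B w c u v q(1)])
    also have "\<dots> \<le> (1 / 2) ^ i * (sqrt (B1 * B2) * (2 * ?L x E1) * (2 * ?L y E2))"
      using q B by (intro mult_mono power_mono Lx Ly mult_nonneg_nonneg L2_set_nonneg) auto
    finally show ?thesis by (simp add: Z_def mult_ac)
  qed
  have gs: "(\<lambda>i. 4 * Z * (1 / 2 :: real) ^ i) sums (4 * Z * (1 / (1 - 1 / 2)))"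
    by (intro sums_mult geometric_sums) simp
  have "norm S \<le> 8 * Z"
    using norm_suminf_le[OF Fi sums_summable[OF gs]] sums_unique[OF FS] sums_unique[OF gs] by simp
  \<comment> \<open>The part \<open>d\<close> is the case \<open>i = 0\<close>,
    \<open>u = v = 0\<close> of \<open>bilinear_power\<close>, where
    \<open>0 ^ 0 = 1\<close>.\<close>
  moreover have "norm (\<Sum>k\<in>K. \<Sum>n\<in>E1. \<Sum>m\<in>E2. x n * y m * of_real (X k n * X k m * (d k * ((1 + 0) * (1 + 0) - 1) ^ 0)))
     \<le> (2 * 0 + 0\<^sup>2) ^ 0 * Z"
    unfolding Z_def by (rule bilinear_power[OF 1 2 B w d]) simp_all
  moreover have "(\<Sum>k\<in>K. \<Sum>n\<in>E1. \<Sum>m\<in>E2. x n * y m * of_real (X k n * X k m * H k n m))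
     = S + (\<Sum>k\<in>K. \<Sum>n\<in>E1. \<Sum>m\<in>E2. x n * y m * of_real (X k n * X k m * (d k * ((1 + 0) * (1 + 0) - 1) ^ 0)))"
  proof -
    have "x n * y m * of_real (X k n * X k m * H k n m) = x n * y m * of_real (X k n * X k m * (H k n m - d k))
      + x n * y m * of_real (X k n * X k m * (d k * ((1 + 0) * (1 + 0) - 1) ^ 0))" for k n m
      by (simp add: algebra_simps)
    then show ?thesis unfolding S_def by (simp only: sum.distrib)
  qed
  ultimately show ?thesis unfolding Z_def[symmetric]
    using norm_triangle_ineq[of S "\<Sum>k\<in>K. \<Sum>n\<in>E1. \<Sum>m\<in>E2. x n * y m * of_real (X k n * X k m * (d k * ((1 + 0) * (1 + 0) - 1) ^ 0))"]
    by simp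
qed

section \<open>Large sieve bounds over odd squarefree numbers\<close>

definition osf :: "real \<Rightarrow> nat set" where "osf x = {n. odd n \<and> squarefree n \<and> real n \<le> x}"
text \<open>Even numbers are kept: the dual sums run over all positive integers, whose squarefree
  parts may be even.\<close>

definition sqf :: "real \<Rightarrow> nat set" where "sqf x = {n. squarefree n \<and> real n \<le> x}"

lemma finite_sqf [simp]: "finite (sqf x)"
proof -
  have "sqf x \<subseteq> {..nat \<lfloor>x\<rfloor>}" by (auto simp: sqf_def le_nat_floor)
  then show ?thesis using finite_subset by blast
qed

lemma finite_osf [simp]: "finite (osf x)"
proof -
  have "osf x \<subseteq> sqf x" by (auto simp: osf_def sqf_def)
  then show ?thesis by (rule finite_subset[OF _ finite_sqf])
qed

lemma sqf_pos: "n \<in> sqf x \<Longrightarrow> n > 0"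
  by (cases n) (auto simp: sqf_def)

text \<open>The outer variable, up to \<open>M\<close>, is the numerator of the symbol; the inner
  one, up to \<open>N\<close>, is its modulus.\<close>

definition LS :: "real \<Rightarrow> real \<Rightarrow> real \<Rightarrow> bool" where
  "LS M N B \<longleftrightarrow> sieve_bound (osf M) (\<lambda>_. 1) J (osf N) B"

lemma sieve_bound_mono_right: "sieve_bound K w X E B \<Longrightarrow> B \<le> B' \<Longrightarrow> sieve_bound K w X E B'"
  unfolding sieve_bound_def by (meson mult_right_mono order.trans sum_nonneg zero_le_power2)

lemma sieve_bound_subset_left:
  "sieve_bound K w X E B \<Longrightarrow> finite K \<Longrightarrow> K' \<subseteq> K \<Longrightarrow> (\<And>k. k \<in> K \<Longrightarrow> w k \<ge> 0) \<Longrightarrow> sieve_bound K' w X E B"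
proof -
  assume h: "sieve_bound K w X E B" "finite K" "K' \<subseteq> K" "\<And>k. k \<in> K \<Longrightarrow> w k \<ge> 0"
  show ?thesis unfolding sieve_bound_def
  proof
    fix b :: "'b \<Rightarrow> complex"
    have "(\<Sum>k\<in>K'. w k * (norm (\<Sum>n\<in>E. b n * of_real (X k n)))\<^sup>2) \<le> (\<Sum>k\<in>K. w k * (norm (\<Sum>n\<in>E. b n * of_real (X k n)))\<^sup>2)"
      using h by (intro sum_mono2) auto
    then show "(\<Sum>k\<in>K'. w k * (norm (\<Sum>n\<in>E. b n * of_real (X k n)))\<^sup>2) \<le> B * (\<Sum>n\<in>E. (norm (b n))\<^sup>2)"
      using sieve_boundD[OF h(1), of b] by linarith
  qed
qed

lemma sieve_bound_subset_right:
  assumes h: "sieve_bound K w X E B" "finite E" "E' \<subseteq> E"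
  shows "sieve_bound K w X E' B"
  unfolding sieve_bound_def
proof (rule allI)
  fix b :: "_ \<Rightarrow> complex"
  define b' where "b' n = (if n \<in> E' then b n else 0)" for n
  have "(\<Sum>n\<in>E. b' n * of_real (X k n)) = (\<Sum>n\<in>E'. b n * of_real (X k n))" for k
    using h by (intro sum.mono_neutral_cong_right) (auto simp: b'_def)
  moreover have "(\<Sum>n\<in>E. (norm (b' n))\<^sup>2) = (\<Sum>n\<in>E'. (norm (b n))\<^sup>2)"
    using h by (intro sum.mono_neutral_cong_right) (auto simp: b'_def)
  ultimately show "(\<Sum>k\<in>K. w k * (norm (\<Sum>n\<in>E'. b n * of_real (X k n)))\<^sup>2) \<le> B * (\<Sum>n\<in>E'. (norm (b n))\<^sup>2)"
    using sieve_boundD[OF h(1), of b'] by simp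
qed

lemma LS_mono: "LS M N B \<Longrightarrow> M' \<le> M \<Longrightarrow> N' \<le> N \<Longrightarrow> B \<le> B' \<Longrightarrow> LS M' N' B'"
  unfolding LS_def
proof -
  assume h: "sieve_bound (osf M) (\<lambda>_. 1) J (osf N) B" "M' \<le> M" "N' \<le> N" "B \<le> B'"
  have "osf M' \<subseteq> osf M" "osf N' \<subseteq> osf N" using h by (auto simp: osf_def)
  then have "sieve_bound (osf M') (\<lambda>_. 1) J (osf N') B"
    using sieve_bound_subset_left[OF sieve_bound_subset_right[OF h(1) finite_osf] finite_osf] by simp
  from this h(4) show "sieve_bound (osf M') (\<lambda>_. 1) J (osf N') B'" by (rule sieve_bound_mono_right)
qed

text \<open>Duality exchanges the variables and reciprocity turns the symbol back. For fixed
  \<open>n\<close> the reciprocity sign is either 1 for all \<open>k\<close> or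
  \<open>sgn4 3 k\<close>, so one of two coefficient sequences is met; adding both bounds gives the
  factor 2.\<close>

lemma LS_flip:
  assumes "LS M N B" "B \<ge> 0"
  shows "LS N M (2 * B)"
  unfolding LS_def sieve_bound_def
proof
  fix b :: "nat \<Rightarrow> complex"
  have D: "sieve_bound (osf N) (\<lambda>_. 1) (\<lambda>n k. J k n) (osf M) B"
    using assms unfolding LS_def by (rule duality)
  define b' where "b' k = b k * of_real (sgn4 3 k)" for k
  have nb: "norm (b' k) = norm (b k)" for k by (simp add: b'_def norm_mult sgn4_def)
  define L where "L n = (\<Sum>k\<in>osf M. b k * of_real (J n k))" for n
  define A where "A b n = (\<Sum>k\<in>osf M. b k * of_real (J k n))" for b :: "nat \<Rightarrow> complex" and n
  have le: "(norm (L n))\<^sup>2 \<le> (norm (A b n))\<^sup>2 + (norm (A b' n))\<^sup>2" if n: "n \<in> osf N" for n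
  proof -
    have f: "J n k = sgn4 n k * J k n" if "k \<in> osf M" for k
      using J_flip[of n k] n that by (simp add: osf_def)
    have "n mod 4 = 1 \<or> n mod 4 = 3" using odd_mod4[of n] n by (simp add: osf_def)
    then have "L n = A b n \<or> L n = A b' n"
    proof
      assume "n mod 4 = 1"
      then have "b k * of_real (J n k) = b k * of_real (J k n)" if "k \<in> osf M" for k
        unfolding f[OF that] by (simp add: sgn4_def)
      then have "L n = A b n" unfolding L_def A_def by (rule sum.cong[OF refl])
      then show ?thesis ..
    next
      assume "n mod 4 = 3"
      then have "b k * of_real (J n k) = b' k * of_real (J k n)" if "k \<in> osf M" for k
        unfolding f[OF that] by (simp add: sgn4_def b'_def)
      then have "L n = A b' n" unfolding L_def A_def by (rule sum.cong[OF refl])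
      then show ?thesis ..
    qed
    then show ?thesis
    proof
      assume "L n = A b n" then show ?thesis by (simp only: le_add_same_cancel1 zero_le_power2)
    next
      assume "L n = A b' n" then show ?thesis by (simp only: le_add_same_cancel2 zero_le_power2)
    qed
  qed
  have "(\<Sum>n\<in>osf N. (norm (L n))\<^sup>2) \<le> (\<Sum>n\<in>osf N. (norm (A b n))\<^sup>2 + (norm (A b' n))\<^sup>2)"
    by (rule sum_mono) (rule le)
  then have 1: "(\<Sum>n\<in>osf N. (norm (L n))\<^sup>2) \<le> (\<Sum>n\<in>osf N. (norm (A b n))\<^sup>2) + (\<Sum>n\<in>osf N. (norm (A b' n))\<^sup>2)"
    by (simp only: sum.distrib)
  have 2: "(\<Sum>n\<in>osf N. (norm (A b n))\<^sup>2) \<le> B * (\<Sum>k\<in>osf M. (norm (b k))\<^sup>2)"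
    using sieve_boundD[OF D, of b] by (simp only: A_def mult_1)
  have 3: "(\<Sum>n\<in>osf N. (norm (A b' n))\<^sup>2) \<le> B * (\<Sum>k\<in>osf M. (norm (b k))\<^sup>2)"
    using sieve_boundD[OF D, of b'] by (simp only: A_def mult_1 nb)
  have "(\<Sum>n\<in>osf N. (norm (L n))\<^sup>2) \<le> 2 * B * (\<Sum>k\<in>osf M. (norm (b k))\<^sup>2)"
    using 1 2 3 by linarith
  then show "(\<Sum>n\<in>osf N. 1 * (norm (\<Sum>k\<in>osf M. b k * of_real (J n k)))\<^sup>2) \<le> 2 * B * (\<Sum>k\<in>osf M. (norm (b k))\<^sup>2)"
    by (simp only: L_def mult_1)
qed

text \<open>An even squarefree number is 2 j with \<open>j\<close> odd and squarefree, and the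
  symbol of 2 is absorbed into the coefficients.\<close>

lemma LS_all:
  assumes "LS M N B" "B \<ge> 0"
  shows "sieve_bound (sqf M) (\<lambda>_. 1) J (osf N) (2 * B)"
  unfolding sieve_bound_def
proof
  fix b :: "nat \<Rightarrow> complex"
  define b' where "b' n = b n * of_real (J 2 n)" for n
  have nb: "(norm (b' n))\<^sup>2 \<le> (norm (b n))\<^sup>2" for n
    using mult_left_mono[OF abs_J_le[of 2 n] norm_ge_zero[of "b n"]] by (intro power_mono) (simp_all add: b'_def norm_mult)
  let ?A = "\<lambda>b k. (norm (\<Sum>n\<in>osf N. b n * of_real (J k n)))\<^sup>2"
  have e1: "(\<Sum>k\<in>sqf M. ?A b k) = (\<Sum>k\<in>osf M. ?A b k) + (\<Sum>k\<in>sqf M - osf M. ?A b k)"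
  proof -
    have "osf M \<subseteq> sqf M" by (auto simp: osf_def sqf_def)
    from sum.subset_diff[OF this finite_sqf, of "?A b"] show ?thesis by (simp only: add.commute)
  qed
  have e2: "(\<Sum>k\<in>sqf M - osf M. ?A b k) \<le> (\<Sum>k\<in>(\<lambda>k. 2 * k) ` osf M. ?A b k)"
  proof (rule sum_mono2)
    show "sqf M - osf M \<subseteq> (\<lambda>k. 2 * k) ` osf M"
    proof
      fix k assume k: "k \<in> sqf M - osf M"
      then obtain j where j: "k = 2 * j" by (auto simp: sqf_def osf_def)
      have "squarefree j" using k j squarefree_multD by (auto simp: sqf_def)
      moreover have "odd j" using squarefree_imp_coprime[of 2 j] k j by (auto simp: sqf_def)
      ultimately show "k \<in> (\<lambda>k. 2 * k) ` osf M" using k j by (auto simp: osf_def sqf_def)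
    qed
  qed auto
  have e3: "(\<Sum>k\<in>(\<lambda>k. 2 * k) ` osf M. ?A b k) = (\<Sum>k\<in>osf M. ?A b' k)"
  proof (subst sum.reindex)
    show "inj_on (\<lambda>k::nat. 2 * k) (osf M)" by (auto simp: inj_on_def)
    have "J (2 * k) n = J 2 n * J k n" if "n \<in> osf N" for k n using that J_mult_left[of n 2 k] by (auto simp: osf_def)
    then show "sum (?A b \<circ> (\<lambda>k. 2 * k)) (osf M) = (\<Sum>k\<in>osf M. ?A b' k)"
      by (simp add: b'_def mult.assoc cong: sum.cong)
  qed
  have e4: "(\<Sum>k\<in>osf M. ?A b k) + (\<Sum>k\<in>osf M. ?A b' k) \<le> B * (\<Sum>n\<in>osf N. (norm (b n))\<^sup>2) + B * (\<Sum>n\<in>osf N. (norm (b' n))\<^sup>2)"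
    using sieve_boundD[OF assms(1)[unfolded LS_def], of b] sieve_boundD[OF assms(1)[unfolded LS_def], of b'] by simp
  have e5: "B * (\<Sum>n\<in>osf N. (norm (b' n))\<^sup>2) \<le> B * (\<Sum>n\<in>osf N. (norm (b n))\<^sup>2)"
    using nb assms(2) by (intro mult_left_mono sum_mono) auto
  show "(\<Sum>k\<in>sqf M. 1 * (norm (\<Sum>n\<in>osf N. b n * of_real (J k n)))\<^sup>2) \<le> 2 * B * (\<Sum>n\<in>osf N. (norm (b n))\<^sup>2)"
    using e1 e2 e3 e4 e5 by simp
qed

section \<open>Positivity and the quadratic bound\<close>

text \<open>Cauchy-Schwarz over the classes loses their number, which is four for Gauss sum classes
  and logarithmic for blocks.\<close>

lemma sieve_bound_Union:
  fixes X :: "'k \<Rightarrow> 'n \<Rightarrow> real"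
  assumes "finite E" "finite C" "c ` E \<subseteq> C" and B: "\<And>z. z \<in> C \<Longrightarrow> sieve_bound K (\<lambda>_. 1) X {n\<in>E. c n = z} B"
  shows "sieve_bound K (\<lambda>_. 1) X E (real (card C) * B)"
  unfolding sieve_bound_def
proof (rule allI)
  fix b :: "'n \<Rightarrow> complex"
  define A where "A z k = (\<Sum>n\<in>{n\<in>E. c n = z}. b n * of_real (X k n))" for z k
  have s: "(\<Sum>n\<in>E. b n * of_real (X k n)) = (\<Sum>z\<in>C. A z k)" for k
    unfolding A_def by (rule sum.group[OF assms(1-3), symmetric])
  have sb: "(\<Sum>n\<in>E. (norm (b n))\<^sup>2) = (\<Sum>z\<in>C. \<Sum>n\<in>{n\<in>E. c n = z}. (norm (b n))\<^sup>2)"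
    by (rule sum.group[OF assms(1-3), symmetric])
  have "(norm (\<Sum>z\<in>C. A z k))\<^sup>2 \<le> real (card C) * (\<Sum>z\<in>C. (norm (A z k))\<^sup>2)" for k
  proof -
    have "(norm (\<Sum>z\<in>C. A z k))\<^sup>2 \<le> (\<Sum>z\<in>C. norm (A z k) * 1)\<^sup>2"
      by (intro power_mono) (simp_all add: norm_sum)
    also have "\<dots> \<le> (\<Sum>z\<in>C. (norm (A z k))\<^sup>2) * (\<Sum>z\<in>C. 1\<^sup>2)" by (rule Cauchy_Schwarz_ineq_sum)
    finally show ?thesis by (simp add: mult.commute)
  qed
  then have "(\<Sum>k\<in>K. (norm (\<Sum>z\<in>C. A z k))\<^sup>2) \<le> (\<Sum>k\<in>K. real (card C) * (\<Sum>z\<in>C. (norm (A z k))\<^sup>2))"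
    by (rule sum_mono)
  also have "\<dots> = real (card C) * (\<Sum>z\<in>C. \<Sum>k\<in>K. (norm (A z k))\<^sup>2)"
    by (subst sum.swap) (simp only: sum_distrib_left)
  also have "\<dots> \<le> real (card C) * (\<Sum>z\<in>C. B * (\<Sum>n\<in>{n\<in>E. c n = z}. (norm (b n))\<^sup>2))"
    using sieve_boundD[OF B, of _ b] by (intro mult_left_mono sum_mono) (simp_all add: A_def)
  also have "\<dots> = real (card C) * B * (\<Sum>n\<in>E. (norm (b n))\<^sup>2)"
    by (simp only: sb sum_distrib_left mult.assoc)
  finally show "(\<Sum>k\<in>K. 1 * (norm (\<Sum>n\<in>E. b n * of_real (X k n)))\<^sup>2) \<le> real (card C) * B * (\<Sum>n\<in>E. (norm (b n))\<^sup>2)"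
    by (simp only: s mult_1)
qed

text \<open>For squarefree arguments, the modulus of the primitive character that induces the
  product of the symbols modulo \<open>a\<close> and modulo \<open>b\<close>.\<close>

definition qr :: "nat \<Rightarrow> nat \<Rightarrow> nat" where
  "qr a b = (a div gcd a b) * (b div gcd a b)"

text \<open>The normalised Gauss sum, a fourth root of unity for odd squarefree \<open>n\<close>. It
  only labels classes: what is used is whether two of its values agree.\<close>

definition gcls :: "nat \<Rightarrow> complex" where
  "gcls n = gsum n 1 / of_real (sqrt (real n))"

lemma gcls_square:
  assumes "odd n" "squarefree n"
  shows "(gcls n)\<^sup>2 = of_real (J (n - 1) n)"
proof -
  have n: "n > 0" using assms by (simp add: odd_pos)
  have s: "(of_real (sqrt (real n)) :: complex)\<^sup>2 = of_nat n"
    by (simp only: of_real_power[symmetric] real_sqrt_pow2[OF of_nat_0_le_iff] of_real_of_nat_eq)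
  show ?thesis unfolding gcls_def power_divide s gsum_square[OF assms] using n by simp
qed

lemma gcls_range:
  assumes "odd n" "squarefree n"
  shows "gcls n \<in> {1, -1, \<i>, -\<i>}"
proof -
  have "(gcls n)\<^sup>2 = 1 \<or> (gcls n)\<^sup>2 = -1"
    unfolding gcls_square[OF assms] J_pred[OF assms(1)] by simp
  then show ?thesis
  proof
    assume "(gcls n)\<^sup>2 = 1" then show ?thesis by (auto simp: power2_eq_1_iff)
  next
    assume "(gcls n)\<^sup>2 = -1"
    then have "(gcls n - \<i>) * (gcls n + \<i>) = 0" by (simp add: power2_eq_square algebra_simps)
    then show ?thesis by (auto simp: eq_neg_iff_add_eq_0)
  qed
qed

lemma gcd_split:
  assumes "n > (0::nat)" "m > 0"
  obtains u v where "n = gcd n m * u" "m = gcd n m * v" "coprime u v" "n div gcd n m = u" "m div gcd n m = v"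
proof
  have g: "gcd n m > 0" using assms by simp
  show "n = gcd n m * (n div gcd n m)" "m = gcd n m * (m div gcd n m)" by simp_all
  show "coprime (n div gcd n m) (m div gcd n m)" using assms by (intro div_gcd_coprime) simp
qed simp_all

lemma qr_props:
  assumes n: "odd n" "squarefree n" "odd m" "squarefree m"
  shows "odd (qr n m)" "squarefree (qr n m)" "qr n m > 0" "qr n m = 1 \<longleftrightarrow> n = m"
    "real (qr n m) \<le> real n * real m"
proof -
  have pos: "n > 0" "m > 0" using n by (simp_all add: odd_pos)
  obtain u v where uv: "n = gcd n m * u" "m = gcd n m * v" "coprime u v" "n div gcd n m = u" "m div gcd n m = v"
    using gcd_split[OF pos] .
  have q: "qr n m = u * v" by (simp only: qr_def uv(4,5))
  have ou: "odd u" "odd v" using n uv(1,2) by (metis even_mult_iff)+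
  have sq: "squarefree u" "squarefree v" using n uv(1,2) by (metis squarefree_multD)+
  show "odd (qr n m)" using q ou by simp
  then show "qr n m > 0" by (rule odd_pos)
  show "squarefree (qr n m)" unfolding q using sq uv(3) by (intro squarefree_mult_coprime)
  show "qr n m = 1 \<longleftrightarrow> n = m"
  proof
    assume "qr n m = 1"
    then have "u = 1" "v = 1" using q by simp_all
    then show "n = m" using uv(1,2) by simp
  next
    assume "n = m" then show "qr n m = 1" using pos by (simp add: qr_def)
  qed
  have "qr n m \<le> n * m" unfolding qr_def by (intro mult_mono) simp_all
  then show "real (qr n m) \<le> real n * real m" by (metis of_nat_le_iff of_nat_mult)
qed

text \<open>Squaring the class gives the symbol of -1, so equal classes force \<open>n\<close> and
  \<open>m\<close> to agree modulo 4; then \<open>gsum_quotient\<close> applies with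
  \<open>d = gcd n m\<close>.\<close>

lemma qr_class:
  assumes n: "odd n" "squarefree n" "odd m" "squarefree m" and c: "gcls n = gcls m"
  shows "gsum (qr n m) 1 = of_real (sqrt (real (qr n m)))" "qr n m mod 4 = 1"
proof -
  have pos: "n > 0" "m > 0" using n by (simp_all add: odd_pos)
  obtain u v where uv: "n = gcd n m * u" "m = gcd n m * v" "coprime u v" "n div gcd n m = u" "m div gcd n m = v"
    using gcd_split[OF pos] .
  define d where "d = gcd n m"
  have uv': "n = d * u" "m = d * v" using uv(1,2) by (simp_all only: d_def)
  have q: "qr n m = u * v" by (simp only: qr_def uv(4,5))
  have o: "odd d" "odd u" "odd v" using n uv' by (metis even_mult_iff)+
  have "J (n - 1) n = J (m - 1) m"
    using gcls_square[OF n(1,2)] gcls_square[OF n(3,4)] c by (metis of_real_eq_iff)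
  then have "n mod 4 = m mod 4"
    unfolding J_pred[OF n(1)] J_pred[OF n(3)] using odd_mod4[OF n(1)] odd_mod4[OF n(3)] by (auto split: if_splits)
  then have m4: "(d * u) mod 4 = (d * v) mod 4" using uv' by simp
  have g: "gsum (d * u) 1 / of_real (sqrt (real (d * u))) = gsum (d * v) 1 / of_real (sqrt (real (d * v)))"
    using c unfolding gcls_def uv'[symmetric] .
  have sf: "squarefree (d * u)" "squarefree (d * v)" using n uv' by simp_all
  show "gsum (qr n m) 1 = of_real (sqrt (real (qr n m)))" "qr n m mod 4 = 1"
    using gsum_quotient[OF o sf uv(3) m4 g] unfolding q .
qed

text \<open>A prime dividing \<open>m\<close> and exactly one of \<open>n\<close>, \<open>n'\<close>
  makes the left side zero and the two gcds different. Otherwise the primes common to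
  \<open>n\<close> and \<open>n'\<close> but prime to \<open>m\<close> contribute a square equal to
  1.\<close>

lemma J_qr:
  assumes n: "odd n" "squarefree n" "odd n'" "squarefree n'"
  shows "J m (qr n n') = (if gcd n m = gcd n' m then J m (n div gcd n m) * J m (n' div gcd n' m) else 0)"
proof -
  have pos: "n > 0" "n' > 0" using n by (simp_all add: odd_pos)
  obtain u v where uv: "n = gcd n n' * u" "n' = gcd n n' * v" "coprime u v" "n div gcd n n' = u" "n' div gcd n n' = v"
    using gcd_split[OF pos] .
  define d where "d = gcd n n'"
  have uv': "n = d * u" "n' = d * v" using uv(1,2) by (simp_all only: d_def)
  have q: "qr n n' = u * v" by (simp only: qr_def uv(4,5))
  have o: "odd d" "odd u" "odd v" using n uv' by (metis even_mult_iff)+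
  have p: "d > 0" "u > 0" "v > 0" using o by (simp_all add: odd_pos)
  have cd: "coprime d u" "coprime d v" using n uv' squarefree_imp_coprime by metis+
  show ?thesis
  proof (cases "coprime m u \<and> coprime m v")
    case True
    have g: "gcd n m = gcd d m" "gcd n' m = gcd d m"
      unfolding uv' using True by (simp_all add: gcd_mult_right_right_cancel gcd_mult_left_right_cancel coprime_commute)
    define e where "e = gcd d m"
    have "e dvd d" unfolding e_def by simp
    then obtain d' where d': "d = e * d'" by blast
    have e0: "e > 0" "d' > 0" using p d' by (auto intro: Nat.gr0I)
    \<comment> \<open>Here squarefreeness enters: \<open>d = e * d'\<close> with
      \<open>e = gcd d m\<close> leaves no prime of \<open>m\<close> in \<open>d'\<close>.\<close>
    have "coprime d' m"
    proof -
      have "squarefree d" using n(2) uv'(1) squarefree_multD(1)[of d u] by simp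
      then have "squarefree (e * d')" by (rule back_subst[of squarefree, OF _ d'])
      then have c: "coprime e d'" by (rule squarefree_imp_coprime)
      have "d' dvd d" by (rule dvdI[of d d' e]) (rule trans[OF d' mult.commute])
      then have "gcd d' m dvd d" by (rule dvd_trans[OF gcd_dvd1])
      moreover have "gcd d' m dvd m" by (rule gcd_dvd2)
      ultimately have ge: "gcd d' m dvd e" unfolding e_def by (rule gcd_greatest)
      have "is_unit (gcd d' m)" by (rule coprime_common_divisor[OF c ge gcd_dvd1])
      then show ?thesis unfolding is_unit_gcd .
    qed
    then have Jd: "J m d' * J m d' = 1" using J_square[OF e0(2)] by (simp add: coprime_commute)
    have "n div e = d' * u" "n' div e = d' * v" unfolding uv' d' using e0 by simp_all
    then have "J m (n div e) * J m (n' div e) = (J m d' * J m d') * (J m u * J m v)"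
      using e0 p by (simp add: J_mult_right)
    then show ?thesis unfolding q g e_def[symmetric] Jd using p by (simp add: J_mult_right)
  next
    case False
    then have "\<not> coprime m (u * v)" by simp
    then have "J m (qr n n') = 0" unfolding q using J_eq_0_iff p by simp
    moreover have "gcd n m \<noteq> gcd n' m"
    proof
      assume e: "gcd n m = gcd n' m"
      from False consider "\<not> coprime m u" | "\<not> coprime m v" by blast
      then show False
      proof cases
        case 1
        then have "gcd m u \<noteq> 1" by (simp only: coprime_iff_gcd_eq_1 not_False_eq_True)
        then obtain z where z: "prime z" "z dvd gcd m u" using prime_factor_nat by blast
        then have "z dvd gcd n m" unfolding uv' by simp
        then have "z dvd gcd n' m" by (simp only: e)
        then have "z dvd n'" by (rule dvd_trans[OF _ gcd_dvd1])
        then have "z dvd d * v" by (simp only: uv'(2))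
        moreover have "coprime z d" using z cd coprime_divisors[of z u d d] by (simp add: coprime_commute)
        moreover have "coprime z v" using z uv(3) coprime_divisors[of z u v v] by simp
        ultimately have "is_unit z" using coprime_common_divisor[of z "d * v" z] by simp
        then show False using z by simp
      next
        case 2
        then have "gcd m v \<noteq> 1" by (simp only: coprime_iff_gcd_eq_1 not_False_eq_True)
        then obtain z where z: "prime z" "z dvd gcd m v" using prime_factor_nat by blast
        then have "z dvd gcd n' m" unfolding uv' by simp
        then have "z dvd gcd n m" by (simp only: e)
        then have "z dvd n" by (rule dvd_trans[OF _ gcd_dvd1])
        then have "z dvd d * u" by (simp only: uv'(1))
        moreover have "coprime z d" using z cd coprime_divisors[of z v d d] by (simp add: coprime_commute)
        moreover have "coprime z u" using z uv(3) coprime_divisors[of z v u u] by (simp add: coprime_commute)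
        ultimately have "is_unit z" using coprime_common_divisor[of z "d * u" z] by simp
        then show False using z by simp
      qed
    qed
    ultimately show ?thesis by simp
  qed
qed

text \<open>Extending \<open>J m n * J m n'\<close> by the primitive character \<open>J m (qr n n')\<close> keeps the quadratic form
  positive and only enlarges it, so common factors of the moduli need no separate treatment.\<close>

lemma quadratic_form_qr:
  assumes E: "finite E" "\<And>n. n \<in> E \<Longrightarrow> odd n \<and> squarefree n"
  shows "\<exists>q. (\<Sum>n\<in>E. \<Sum>n'\<in>E. a n * cnj (a n') * of_real (J m (qr n n'))) = of_real q \<and>
     (norm (\<Sum>n\<in>E. a n * of_real (J m n)))\<^sup>2 \<le> q"
proof -
  define G where "G = (\<lambda>n. gcd n m) ` E"
  define s where "s n = J m (n div gcd n m)" for n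
  \<comment> \<open>By \<open>J_qr\<close> the matrix is block diagonal in the value of
    \<open>gcd n m\<close>, each block having rank one, so the form is the sum of the squares of
    \<open>norm (A g)\<close>. The block \<open>g = 1\<close> is the original sum.\<close>
  define A where "A g = (\<Sum>n\<in>{n\<in>E. gcd n m = g}. a n * of_real (s n))" for g
  have fG: "finite G" using E by (simp add: G_def)
  have JQ: "a n * cnj (a n') * of_real (J m (qr n n'))
     = (if gcd n' m = gcd n m then (a n * of_real (s n)) * cnj (a n' * of_real (s n')) else 0)" if "n \<in> E" "n' \<in> E" for n n'
  proof -
    have "J m (qr n n') = (if gcd n m = gcd n' m then s n * s n' else 0)"
      using J_qr[of n n' m] E(2)[OF that(1)] E(2)[OF that(2)] unfolding s_def by simp
    then show ?thesis by (simp add: mult_ac)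
  qed
  have "(\<Sum>n\<in>E. \<Sum>n'\<in>E. a n * cnj (a n') * of_real (J m (qr n n')))
     = (\<Sum>n\<in>E. \<Sum>n'\<in>E. if gcd n' m = gcd n m then (a n * of_real (s n)) * cnj (a n' * of_real (s n')) else 0)"
    by (rule sum.cong[OF refl], rule sum.cong[OF refl], rule JQ)
  also have "\<dots> = (\<Sum>n\<in>E. (a n * of_real (s n)) * cnj (A (gcd n m)))"
  proof (rule sum.cong[OF refl])
    fix n
    have "(\<Sum>n'\<in>E. if gcd n' m = gcd n m then (a n * of_real (s n)) * cnj (a n' * of_real (s n')) else 0)
       = (\<Sum>n'\<in>{n'\<in>E. gcd n' m = gcd n m}. (a n * of_real (s n)) * cnj (a n' * of_real (s n')))"
      using E(1) by (rule sum.inter_filter[symmetric])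
    then show "(\<Sum>n'\<in>E. if gcd n' m = gcd n m then (a n * of_real (s n)) * cnj (a n' * of_real (s n')) else 0)
       = (a n * of_real (s n)) * cnj (A (gcd n m))" by (simp only: A_def cnj_sum sum_distrib_left)
  qed
  also have "\<dots> = (\<Sum>g\<in>G. \<Sum>n\<in>{n\<in>E. gcd n m = g}. (a n * of_real (s n)) * cnj (A (gcd n m)))"
    by (rule sum.group[symmetric]) (simp_all add: E(1) fG, simp add: G_def)
  also have "\<dots> = (\<Sum>g\<in>G. A g * cnj (A g))"
  proof (rule sum.cong[OF refl])
    fix g
    have "(\<Sum>n\<in>{n\<in>E. gcd n m = g}. (a n * of_real (s n)) * cnj (A (gcd n m)))
      = (\<Sum>n\<in>{n\<in>E. gcd n m = g}. (a n * of_real (s n)) * cnj (A g))" by (rule sum.cong) simp_all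
    moreover have "A g * z = (\<Sum>n\<in>{n\<in>E. gcd n m = g}. (a n * of_real (s n)) * z)" for z
      by (simp only: A_def sum_distrib_right)
    ultimately show "(\<Sum>n\<in>{n\<in>E. gcd n m = g}. (a n * of_real (s n)) * cnj (A (gcd n m))) = A g * cnj (A g)"
      by (simp only:)
  qed
  also have "\<dots> = of_real (\<Sum>g\<in>G. (norm (A g))\<^sup>2)"
    by (simp only: of_real_sum complex_norm_square)
  finally have Q: "(\<Sum>n\<in>E. \<Sum>n'\<in>E. a n * cnj (a n') * of_real (J m (qr n n'))) = of_real (\<Sum>g\<in>G. (norm (A g))\<^sup>2)" .
  have A1: "(\<Sum>n\<in>E. a n * of_real (J m n)) = A 1"
  proof -
    have "(\<Sum>n\<in>{n\<in>E. gcd n m = 1}. a n * of_real (J m n)) = (\<Sum>n\<in>E. a n * of_real (J m n))"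
    proof (rule sum.mono_neutral_left)
      show "\<forall>n\<in>E - {n\<in>E. gcd n m = 1}. a n * of_real (J m n) = 0"
      proof
        fix n assume n: "n \<in> E - {n\<in>E. gcd n m = 1}"
        then have "gcd n m \<noteq> 1" by (simp del: One_nat_def)
        then have "\<not> coprime m n" by (simp only: coprime_iff_gcd_eq_1 gcd.commute[of m n] not_False_eq_True)
        moreover have "n > 0" using n E(2)[of n] odd_pos by blast
        ultimately show "a n * of_real (J m n) = 0" by (simp add: J_eq_0_iff)
      qed
    qed (use E in auto)
    moreover have "A 1 = (\<Sum>n\<in>{n\<in>E. gcd n m = 1}. a n * of_real (J m n))"
      unfolding A_def by (intro sum.cong refl) (simp add: s_def)
    ultimately show ?thesis by simp
  qed
  have "(norm (A 1))\<^sup>2 \<le> (\<Sum>g\<in>G. (norm (A g))\<^sup>2)"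
  proof (cases "1 \<in> G")
    case True
    show ?thesis by (rule member_le_sum[OF True _ fG]) simp
  next
    case False
    have no: "\<not> (n \<in> E \<and> gcd n m = 1)" for n
    proof
      assume h: "n \<in> E \<and> gcd n m = 1"
      then have "gcd n m \<in> G" unfolding G_def by blast
      then have "1 \<in> G" by (simp only: conjunct2[OF h])
      then show False by (rule notE[OF False])
    qed
    have "{n\<in>E. gcd n m = 1} = {}"
      unfolding Collect_empty_eq by (rule allI) (rule no)
    then have "A 1 = 0" unfolding A_def by (simp only: sum.empty)
    then show ?thesis by (simp add: sum_nonneg)
  qed
  then show ?thesis unfolding Q A1 by blast
qed

section \<open>Exponentially weighted character sums\<close>

lemma exp_geometric_sums:
  assumes "l > 0"
  shows "(\<lambda>m. exp (- l * real (Suc m))) sums (1 / (exp l - 1))" "1 / (exp l - 1) \<le> 1 / l"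
proof -
  have "exp (- l) < 1" using assms by simp
  then have "(\<lambda>m. exp (- l) * exp (- l) ^ m) sums (exp (- l) * (1 / (1 - exp (- l))))"
    by (intro sums_mult geometric_sums) simp
  moreover have "exp (- l) * exp (- l) ^ m = exp (- l * real (Suc m))" for m
    by (simp only: exp_of_nat_mult[symmetric] mult_exp_exp) (simp add: algebra_simps)
  moreover have "exp (- l) * (1 / (1 - exp (- l))) = 1 / (exp l - 1)"
    by (simp add: exp_minus field_simps)
  ultimately show "(\<lambda>m. exp (- l * real (Suc m))) sums (1 / (exp l - 1))" by simp
  have "l \<le> exp l - 1" using exp_ge_add_one_self[of l] by linarith
  then show "1 / (exp l - 1) \<le> 1 / l" using assms by (intro divide_left_mono mult_pos_pos) auto
qed

text \<open>The predicate lets complete sums and sums over integers of large squarefree part be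
  treated alike. The index is shifted because the summation starts at 1.\<close>

definition theta_tail :: "real \<Rightarrow> (nat \<Rightarrow> bool) \<Rightarrow> nat \<Rightarrow> real" where
  "theta_tail l P r = (\<Sum>m. if P (Suc m) then J (Suc m) r * exp (- l * real (Suc m)) else 0)"

lemma theta_tail_sums:
  assumes "l > 0"
  shows "(\<lambda>m. if P (Suc m) then J (Suc m) r * exp (- l * real (Suc m)) else 0) sums theta_tail l P r"
proof -
  have le: "norm (if P (Suc m) then J (Suc m) r * exp (- l * real (Suc m)) else 0) \<le> exp (- l * real (Suc m))" for m
    using mult_right_mono[OF abs_J_le[of "Suc m" r], of "exp (- l * real (Suc m))"] by (simp add: abs_mult)
  have "summable (\<lambda>m. if P (Suc m) then J (Suc m) r * exp (- l * real (Suc m)) else 0)"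
    by (rule summable_comparison_test'[OF sums_summable[OF exp_geometric_sums(1)[OF assms]], of 0], rule le)
  then show ?thesis unfolding theta_tail_def by (rule summable_sums)
qed

text \<open>By \<open>quadratic_form_qr\<close> every integer selected by \<open>P\<close>
  contributes a nonnegative form that dominates the square on the left. Hence all integers outside
  \<open>K\<close> may be added freely.\<close>

lemma positivity:
  assumes E: "finite E" "\<And>n. n \<in> E \<Longrightarrow> odd n \<and> squarefree n" and l: "l > 0"
    and K: "finite K" "\<And>k. k \<in> K \<Longrightarrow> P k \<and> k > 0"
  shows "(\<Sum>k\<in>K. exp (- l * real k) * (norm (\<Sum>n\<in>E. a n * of_real (J k n)))\<^sup>2)
     \<le> Re (\<Sum>n\<in>E. \<Sum>n'\<in>E. a n * cnj (a n') * of_real (theta_tail l P (qr n n')))"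
proof -
  define Q where "Q m = Re (\<Sum>n\<in>E. \<Sum>n'\<in>E. a n * cnj (a n') * of_real (J m (qr n n')))" for m
  have Q: "(norm (\<Sum>n\<in>E. a n * of_real (J m n)))\<^sup>2 \<le> Q m" for m
  proof -
    obtain q where q: "(\<Sum>n\<in>E. \<Sum>n'\<in>E. a n * cnj (a n') * of_real (J m (qr n n'))) = of_real q"
      "(norm (\<Sum>n\<in>E. a n * of_real (J m n)))\<^sup>2 \<le> q"
      using quadratic_form_qr[OF E, of a m] by blast
    show ?thesis unfolding Q_def q(1) Re_complex_of_real by (rule q(2))
  qed
  then have Q0: "Q m \<ge> 0" for m using order.trans[OF zero_le_power2] by blast
  have "(\<lambda>m. Re (\<Sum>n\<in>E. \<Sum>n'\<in>E. a n * cnj (a n') * of_real (if P (Suc m) then J (Suc m) (qr n n') * exp (- l * real (Suc m)) else 0)))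
     sums Re (\<Sum>n\<in>E. \<Sum>n'\<in>E. a n * cnj (a n') * of_real (theta_tail l P (qr n n')))"
    by (rule sums_Re, rule sums_sum, rule sums_sum, rule sums_mult, rule sums_of_real, rule theta_tail_sums[OF l])
  moreover have "Re (\<Sum>n\<in>E. \<Sum>n'\<in>E. a n * cnj (a n') * of_real (if P (Suc m) then J (Suc m) (qr n n') * exp (- l * real (Suc m)) else 0))
     = (if P (Suc m) then exp (- l * real (Suc m)) * Q (Suc m) else 0)" for m
  proof (cases "P (Suc m)")
    case True
    have "(\<Sum>n\<in>E. \<Sum>n'\<in>E. a n * cnj (a n') * of_real (J (Suc m) (qr n n') * exp (- l * real (Suc m))))
       = of_real (exp (- l * real (Suc m))) * (\<Sum>n\<in>E. \<Sum>n'\<in>E. a n * cnj (a n') * of_real (J (Suc m) (qr n n')))"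
      unfolding sum_distrib_left by (intro sum.cong refl) (simp add: mult_ac)
    then show ?thesis using True by (simp add: Q_def)
  qed simp
  ultimately have S: "(\<lambda>m. if P (Suc m) then exp (- l * real (Suc m)) * Q (Suc m) else 0)
     sums Re (\<Sum>n\<in>E. \<Sum>n'\<in>E. a n * cnj (a n') * of_real (theta_tail l P (qr n n')))" by simp
  define K' where "K' = (\<lambda>k. k - 1) ` K"
  have "(\<Sum>k\<in>K. exp (- l * real k) * (norm (\<Sum>n\<in>E. a n * of_real (J k n)))\<^sup>2) \<le> (\<Sum>k\<in>K. exp (- l * real k) * Q k)"
    by (intro sum_mono mult_left_mono Q) simp
  also have "\<dots> = (\<Sum>m\<in>K'. if P (Suc m) then exp (- l * real (Suc m)) * Q (Suc m) else 0)"
    unfolding K'_def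
  proof (subst sum.reindex)
    show "inj_on (\<lambda>k. k - 1) K" using K(2) by (auto simp: inj_on_def) (metis Suc_pred)
    show "(\<Sum>k\<in>K. exp (- l * real k) * Q k) = sum ((\<lambda>m. if P (Suc m) then exp (- l * real (Suc m)) * Q (Suc m) else 0) \<circ> (\<lambda>k. k - 1)) K"
      using K(2) by (intro sum.cong refl) simp
  qed
  also have "\<dots> \<le> (\<Sum>m. if P (Suc m) then exp (- l * real (Suc m)) * Q (Suc m) else 0)"
    using K(1) Q0 by (intro sum_le_suminf sums_summable[OF S]) (auto simp: K'_def)
  also have "\<dots> = Re (\<Sum>n\<in>E. \<Sum>n'\<in>E. a n * cnj (a n') * of_real (theta_tail l P (qr n n')))"
    using sums_unique[OF S] by simp
  finally show ?thesis .
qed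

text \<open>Scaling to modulus 1 with x = l r, the block identity at \<open>a = 0\<close> evaluates
  the sum as coth(x/2)/2 - 1/x, and coth y <= 1 + 1/y.\<close>

lemma dual_wt_sums_le:
  assumes "l > 0" "r > (0::nat)"
  shows "summable (\<lambda>h. dual_wt l r (real (Suc h)))" "(\<Sum>h. dual_wt l r (real (Suc h))) \<le> real r / 2"
proof -
  define x where "x = l * real r"
  have x: "x > 0" using assms by (simp add: x_def)
  have e: "dual_wt l r h = real r * dual_wt x 1 h" for h
  proof -
    have "x\<^sup>2 + 4 * pi\<^sup>2 * h\<^sup>2 = (l\<^sup>2 + 4 * pi\<^sup>2 * h\<^sup>2 / (real r)\<^sup>2) * (real r)\<^sup>2"
      using assms by (simp add: x_def power_mult_distrib distrib_right)
    then show ?thesis using assms unfolding dual_wt_def by (simp add: x_def power2_eq_square)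
  qed
  define D where "D k = dual_wt x 1 (real k)" for k
  have D0: "D k \<ge> 0" for k unfolding D_def using x by (rule dual_wt_nonneg)
  have s: "(\<lambda>k. D k + D (Suc k)) sums (sinh x / (cosh x - 1))"
    using dual_wt_block_sums[OF x, of 1 0] by (simp add: D_def add.commute)
  have sm: "summable (\<lambda>k. D (Suc k))"
    by (rule summable_comparison_test'[OF sums_summable[OF s], of 0]) (use D0 in auto)
  have sm0: "summable D" using sm by (simp add: summable_Suc_iff)
  have "sinh x / (cosh x - 1) = (\<Sum>k. D k) + (\<Sum>k. D (Suc k))"
    using sums_unique[OF s] suminf_add[OF sm0 sm] by simp
  also have "(\<Sum>k. D k) = D 0 + (\<Sum>k. D (Suc k))" using suminf_split_head[OF sm0] by simp
  finally have t: "2 * (\<Sum>k. D (Suc k)) = sinh x / (cosh x - 1) - 2 / x"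
    using x by (simp add: D_def dual_wt_def power2_eq_square)
  have "sinh x / (cosh x - 1) \<le> 1 + 2 / x"
  proof -
    define y where "y = x / 2"
    have y: "y > 0" and xy: "x = 2 * y" using x by (simp_all add: y_def)
    have sy: "sinh y \<ge> y" "sinh y > 0"
    proof -
      show p: "sinh y > 0" using y by simp
      have "exp y \<ge> 1 + y" "exp (- y) \<le> 1 / (1 + y)"
        using exp_ge_add_one_self[of y] y by (simp_all add: exp_minus inverse_eq_divide frac_le)
      have "mono_on {0..} (\<lambda>t. sinh t - t :: real)"
      proof (rule mono_onI)
        fix s t :: real assume st: "s \<in> {0..}" "t \<in> {0..}" "s \<le> t"
        show "sinh s - s \<le> sinh t - t"
        proof (rule DERIV_nonneg_imp_nondecreasing[OF st(3)])
          fix z :: real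
          show "\<exists>w. ((\<lambda>t. sinh t - t) has_real_derivative w) (at z) \<and> 0 \<le> w"
            by (rule exI[of _ "cosh z - 1"]) (auto intro!: derivative_eq_intros simp: cosh_real_ge_1)
        qed
      qed
      then have "sinh 0 - 0 \<le> sinh y - y" by (rule mono_onD) (use y in simp_all)
      then show "sinh y \<ge> y" by simp
    qed
    have "cosh x - 1 = 2 * (sinh y)\<^sup>2" unfolding xy cosh_double using cosh_square_eq[of y] by simp
    moreover have "sinh x = 2 * sinh y * cosh y" unfolding xy by (rule sinh_double)
    ultimately have "sinh x / (cosh x - 1) = cosh y / sinh y" using sy by (simp add: power2_eq_square)
    also have "cosh y = sinh y + exp (- y)" using cosh_minus_sinh[of y] by simp
    also have "(sinh y + exp (- y)) / sinh y = 1 + exp (- y) / sinh y" using sy by (simp add: add_divide_distrib)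
    also have "exp (- y) / sinh y \<le> 1 / y" using sy y by (intro frac_le) auto
    finally show ?thesis using y by (simp add: xy)
  qed
  then have le: "(\<Sum>k. D (Suc k)) \<le> 1 / 2" using t by simp
  show "summable (\<lambda>h. dual_wt l r (real (Suc h)))"
    unfolding e using summable_mult[OF sm, of "real r"] by (simp only: D_def)
  have "(\<Sum>h. dual_wt l r (real (Suc h))) = real r * (\<Sum>k. D (Suc k))"
    unfolding e D_def[symmetric] by (rule suminf_mult[OF sm])
  also have "\<dots> \<le> real r * (1 / 2)" by (rule mult_left_mono[OF le]) simp
  finally show "(\<Sum>h. dual_wt l r (real (Suc h))) \<le> real r / 2" by simp
qed

text \<open>The last bound is trivial estimation on the dual side: weights of total mass at most
  \<open>r / 2\<close>, divided by \<open>sqrt r\<close>. For \<open>r = qr n m\<close> it is at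
  most \<open>N / 2\<close>, which is why the first large sieve has
  \<open>N\<^sup>2\<close>.\<close>

lemma J_poisson':
  assumes r: "odd r" "squarefree r" "r > 1" and g: "gsum r 1 = of_real (sqrt (real r))" and m4: "r mod 4 = 1"
    and l: "l > 0"
  shows "summable (\<lambda>h. J (Suc h) r * dual_wt l r (real (Suc h)))"
    "theta_tail l (\<lambda>_. True) r = (\<Sum>h. J (Suc h) r * dual_wt l r (real (Suc h))) / sqrt r"
    "\<bar>theta_tail l (\<lambda>_. True) r\<bar> \<le> sqrt r / 2"
proof -
  have r0: "r > 0" using r by simp
  note D = dual_wt_sums_le[OF l r0]
  have b: "norm (J (Suc h) r * dual_wt l r (real (Suc h))) \<le> dual_wt l r (real (Suc h))" for h
    using mult_right_mono[OF abs_J_le[of "Suc h" r] dual_wt_nonneg[OF l, of r "real (Suc h)"]] dual_wt_nonneg[OF l, of r "real (Suc h)"]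
    by (simp add: abs_mult)
  have sn: "summable (\<lambda>h. norm (J (Suc h) r * dual_wt l r (real (Suc h))))"
    by (rule summable_comparison_test'[OF D(1), of 0]) (use b in simp)
  then show sm: "summable (\<lambda>h. J (Suc h) r * dual_wt l r (real (Suc h)))" by (rule summable_norm_cancel)
  define S where "S = (\<Sum>h. J (Suc h) r * dual_wt l r (real (Suc h)))"
  have J0: "J 0 r = 0" using J_eq_0_iff[of r 0] r by simp
  have "(\<lambda>h. J h r * dual_wt l r (real h)) sums (S + J 0 r * dual_wt l r (real 0))"
    using summable_sums[OF sm] unfolding S_def by (rule sums_Suc)
  then have "(\<lambda>h. J h r * dual_wt l r (real h)) sums S" by (simp add: J0)
  from J_poisson[OF r g m4 l this]
  have e: "theta_tail l (\<lambda>_. True) r = S / sqrt r"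
    unfolding theta_tail_def by (simp add: sums_iff)
  then show "theta_tail l (\<lambda>_. True) r = (\<Sum>h. J (Suc h) r * dual_wt l r (real (Suc h))) / sqrt r" by (simp only: S_def)
  have "\<bar>S\<bar> \<le> (\<Sum>h. norm (J (Suc h) r * dual_wt l r (real (Suc h))))"
    unfolding S_def using summable_norm[OF sn] by simp
  also have "\<dots> \<le> (\<Sum>h. dual_wt l r (real (Suc h)))" by (rule suminf_le[OF b sn D(1)])
  also have "\<dots> \<le> real r / 2" by (rule D(2))
  finally have "\<bar>S\<bar> / sqrt r \<le> real r / 2 / sqrt r" by (intro divide_right_mono) simp_all
  also have "real r / 2 / sqrt r = sqrt r / 2" using r0 by (simp add: real_div_sqrt)
  finally show "\<bar>theta_tail l (\<lambda>_. True) r\<bar> \<le> sqrt r / 2" unfolding e by simp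
qed

lemma theta_tail_1:
  assumes "l > 0"
  shows "0 \<le> theta_tail l P 1" "theta_tail l P 1 \<le> 1 / l"
proof -
  have S: "(\<lambda>m. if P (Suc m) then exp (- l * real (Suc m)) else 0) sums theta_tail l P 1"
    using theta_tail_sums[OF assms, of P 1] by (simp cong: if_cong)
  show "0 \<le> theta_tail l P 1" by (rule sums_le[OF _ sums_zero S]) simp
  have "theta_tail l P 1 \<le> 1 / (exp l - 1)"
    by (rule sums_le[OF _ S exp_geometric_sums(1)[OF assms]]) simp
  then show "theta_tail l P 1 \<le> 1 / l" using exp_geometric_sums(2)[OF assms] by simp
qed


lemma gcls_split:
  assumes "finite E" "\<And>n. n \<in> E \<Longrightarrow> odd n \<and> squarefree n"
    "\<And>z. sieve_bound K (\<lambda>_. 1) X {n\<in>E. gcls n = z} B" "B \<ge> 0"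
  shows "sieve_bound K (\<lambda>_. 1) X E (4 * B)"
proof -
  define C where "C = {1, -1, \<i>, -\<i>}"
  have "gcls ` E \<subseteq> C" using gcls_range assms(2) unfolding C_def by blast
  then have b: "sieve_bound K (\<lambda>_. 1) X E (real (card C) * B)"
    using assms(1,3) by (intro sieve_bound_Union[of E C gcls]) (simp_all add: C_def)
  have "card C \<le> 4" unfolding C_def using card_insert_le_m1 by (simp add: card_insert_if)
  then have "real (card C) * B \<le> 4 * B" using assms(4) by (intro mult_right_mono) simp_all
  with b show ?thesis by (rule sieve_bound_mono_right)
qed

lemma double_sum_norm_le:
  fixes a :: "nat \<Rightarrow> complex"
  assumes "finite E" "c \<ge> 0" "\<And>n m. n \<in> E \<Longrightarrow> m \<in> E \<Longrightarrow> norm (t n m) \<le> norm (a n) * norm (a m) * c"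
  shows "norm (\<Sum>n\<in>E. \<Sum>m\<in>E. t n m) \<le> c * real (card E) * (\<Sum>n\<in>E. (norm (a n))\<^sup>2)"
proof -
  have "norm (\<Sum>n\<in>E. \<Sum>m\<in>E. t n m) \<le> (\<Sum>n\<in>E. \<Sum>m\<in>E. norm (a n) * norm (a m) * c)"
    using assms(3) by (intro sum_norm_le) auto
  also have "\<dots> = c * (\<Sum>n\<in>E. norm (a n) * 1)\<^sup>2"
    by (simp add: power2_eq_square sum_product sum_distrib_left mult_ac)
  also have "\<dots> \<le> c * ((\<Sum>n\<in>E. (norm (a n))\<^sup>2) * (\<Sum>n\<in>E. 1\<^sup>2))"
    by (rule mult_left_mono[OF Cauchy_Schwarz_ineq_sum assms(2)])
  finally show ?thesis by (simp add: mult_ac)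
qed

lemma card_osf_le: "N \<ge> 0 \<Longrightarrow> real (card (osf N)) \<le> N"
proof -
  assume N: "N \<ge> 0"
  have "osf N \<subseteq> {1..nat \<lfloor>N\<rfloor>}"
  proof
    fix n assume "n \<in> osf N"
    then have "odd n" "real n \<le> N" by (simp_all add: osf_def)
    then show "n \<in> {1..nat \<lfloor>N\<rfloor>}" using le_nat_floor odd_pos[of n] by auto
  qed
  then have "card (osf N) \<le> nat \<lfloor>N\<rfloor>" using card_mono[of "{1..nat \<lfloor>N\<rfloor>}" "osf N"] by simp
  then show ?thesis using N by linarith
qed

text \<open>With \<open>l = 1 / M\<close> the weight is at least exp(-1) >= 1/3 on the range. The
  diagonal contributes \<open>M\<close>; the off-diagonal entries are at most \<open>N / 2\<close>
  and there are at most \<open>N\<close> in a row. The constant is 12 = 3 * 4, from the weight and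
  the four Gauss sum classes.\<close>

theorem LS_quadratic:
  assumes "M > 0" "N \<ge> 0"
  shows "LS M N (12 * (M + N\<^sup>2))"
proof -
  define l where "l = 1 / M"
  have l: "l > 0" using assms by (simp add: l_def)
  have E0: "odd n \<and> squarefree n" if "n \<in> osf N" for n using that by (simp add: osf_def)
  have main: "sieve_bound (osf M) (\<lambda>_. 1) J {n\<in>osf N. gcls n = z} (3 * (M + N\<^sup>2))" for z
    unfolding sieve_bound_def
  proof (rule allI)
    fix a :: "nat \<Rightarrow> complex"
    define E where "E = {n\<in>osf N. gcls n = z}"
    have E: "finite E" "\<And>n. n \<in> E \<Longrightarrow> odd n \<and> squarefree n" using E0 by (auto simp: E_def)
    let ?A = "\<lambda>k. (norm (\<Sum>n\<in>E. a n * of_real (J k n)))\<^sup>2"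
    let ?n = "\<Sum>n\<in>E. (norm (a n))\<^sup>2"
    define t where "t n n' = (if n = n' then 0 else a n * cnj (a n') * of_real (theta_tail l (\<lambda>_. True) (qr n n')))" for n n'
    have n0: "?n \<ge> 0" by (intro sum_nonneg) simp
    have pos: "exp (-1) * (\<Sum>k\<in>osf M. ?A k) \<le> (\<Sum>k\<in>osf M. exp (- l * real k) * ?A k)"
      unfolding sum_distrib_left
    proof (intro sum_mono mult_right_mono)
      fix k assume "k \<in> osf M"
      then have "real k * l \<le> 1" using assms by (simp add: osf_def l_def)
      then show "exp (- 1) \<le> exp (- l * real k)" by (simp add: mult.commute)
    qed simp
    define F where "F = (\<Sum>n\<in>E. \<Sum>n'\<in>E. a n * cnj (a n') * of_real (theta_tail l (\<lambda>_. True) (qr n n')))"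
    have posF: "(\<Sum>k\<in>osf M. exp (- l * real k) * ?A k) \<le> Re F"
      unfolding F_def by (rule positivity[OF E l finite_osf]) (auto simp: osf_def odd_pos)
    define s where "s n = complex_of_real ((norm (a n))\<^sup>2 * theta_tail l (\<lambda>_. True) 1)" for n
    have q1: "qr n n = 1" if "n \<in> E" for n using qr_props(4)[of n n] E(2)[OF that] by simp
    have row: "(\<Sum>n'\<in>E. a n * cnj (a n') * of_real (theta_tail l (\<lambda>_. True) (qr n n'))) = (\<Sum>n'\<in>E. t n n') + s n"
      if n: "n \<in> E" for n
    proof -
      have "(\<Sum>n'\<in>E. a n * cnj (a n') * of_real (theta_tail l (\<lambda>_. True) (qr n n')))
        = (\<Sum>n'\<in>E. t n n' + (if n' = n then s n else 0))"
      proof (rule sum.cong[OF refl])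
        fix n' assume "n' \<in> E"
        show "a n * cnj (a n') * of_real (theta_tail l (\<lambda>_. True) (qr n n')) = t n n' + (if n' = n then s n else 0)"
        proof (cases "n' = n")
          case True
          then show ?thesis unfolding t_def s_def by (simp only: q1[OF n] complex_norm_square of_real_mult simp_thms if_True add_0_left)
        qed (simp add: t_def)
      qed
      then show ?thesis using E(1) n by (simp only: sum.distrib sum.delta if_True)
    qed
    have "F = (\<Sum>n\<in>E. (\<Sum>n'\<in>E. t n n') + s n)"
      unfolding F_def by (rule sum.cong[OF refl row])
    then have F: "Re F = Re (\<Sum>n\<in>E. \<Sum>n'\<in>E. t n n') + Re (\<Sum>n\<in>E. s n)"
      by (simp only: sum.distrib plus_complex.simps)
    have s: "Re (\<Sum>n\<in>E. s n) = ?n * theta_tail l (\<lambda>_. True) 1"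
      unfolding s_def by (simp only: Re_sum Re_complex_of_real sum_distrib_right)
    have "Re (\<Sum>n\<in>E. \<Sum>n'\<in>E. t n n') + ?n * theta_tail l (\<lambda>_. True) 1 \<le> N / 2 * N * ?n + ?n * M"
    proof (rule add_mono)
      have "norm (t n n') \<le> norm (a n) * norm (a n') * (N / 2)" if n: "n \<in> E" "n' \<in> E" for n n'
      proof (cases "n = n'")
        case False
        note p = qr_props[of n n'] qr_class[of n n']
        have N: "real n \<le> N" "real n' \<le> N" "gcls n = gcls n'" using n by (auto simp: E_def osf_def)
        have q: "qr n n' > 1" using p(3,4) E(2)[OF n(1)] E(2)[OF n(2)] False by simp
        have "\<bar>theta_tail l (\<lambda>_. True) (qr n n')\<bar> \<le> sqrt (qr n n') / 2"
          using p E(2)[OF n(1)] E(2)[OF n(2)] N(3) q by (intro J_poisson'(3) l) simp_all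
        also have "sqrt (qr n n') \<le> sqrt (N * N)"
          using p(5) E(2)[OF n(1)] E(2)[OF n(2)] N mult_mono[OF N(1,2)] assms by (intro real_sqrt_le_mono) simp
        finally have "\<bar>theta_tail l (\<lambda>_. True) (qr n n')\<bar> \<le> N / 2" using assms by simp
        then have "norm (a n) * norm (a n') * \<bar>theta_tail l (\<lambda>_. True) (qr n n')\<bar> \<le> norm (a n) * norm (a n') * (N / 2)"
          by (rule mult_left_mono) simp
        then show ?thesis using False by (simp add: t_def norm_mult)
      qed (use assms in \<open>simp add: t_def\<close>)
      then have "norm (\<Sum>n\<in>E. \<Sum>n'\<in>E. t n n') \<le> N / 2 * real (card E) * ?n"
        using assms by (intro double_sum_norm_le[OF E(1)]) simp_all
      also have "\<dots> \<le> N / 2 * N * ?n"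
      proof (intro mult_right_mono mult_left_mono n0)
        have "card E \<le> card (osf N)" by (rule card_mono) (auto simp: E_def)
        then show "real (card E) \<le> N" using card_osf_le[OF assms(2)] by linarith
      qed (use assms in simp)
      finally show "Re (\<Sum>n\<in>E. \<Sum>n'\<in>E. t n n') \<le> N / 2 * N * ?n"
        using complex_Re_le_cmod order.trans by blast
      show "?n * theta_tail l (\<lambda>_. True) 1 \<le> ?n * M"
        using theta_tail_1(2)[OF l, of "\<lambda>_. True"] n0 by (intro mult_left_mono) (simp_all add: l_def)
    qed
    moreover have "N / 2 * N * ?n + ?n * M = (N\<^sup>2 / 2 + M) * ?n" by (simp add: power2_eq_square algebra_simps)
    ultimately have 1: "exp (-1) * (\<Sum>k\<in>osf M. ?A k) \<le> (N\<^sup>2 / 2 + M) * ?n"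
      using pos posF unfolding F s by linarith
    have "1 / 3 \<le> exp (-1::real)"
      using exp_le by (simp add: exp_minus field_simps)
    then have "1 / 3 * (\<Sum>k\<in>osf M. ?A k) \<le> exp (-1) * (\<Sum>k\<in>osf M. ?A k)"
      by (rule mult_right_mono) (simp add: sum_nonneg)
    then have "(\<Sum>k\<in>osf M. ?A k) \<le> 3 * ((N\<^sup>2 / 2 + M) * ?n)" using 1 by linarith
    moreover have "(N\<^sup>2 / 2 + M) * ?n \<le> (M + N\<^sup>2) * ?n" by (rule mult_right_mono[OF _ n0]) simp
    ultimately have "(\<Sum>k\<in>osf M. ?A k) \<le> 3 * ((M + N\<^sup>2) * ?n)" by linarith
    then have "(\<Sum>k\<in>osf M. ?A k) \<le> 3 * (M + N\<^sup>2) * ?n" by (simp only: mult.assoc)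
    then show "(\<Sum>k\<in>osf M. 1 * (norm (\<Sum>n\<in>{n\<in>osf N. gcls n = z}. a n * of_real (J k n)))\<^sup>2)
       \<le> 3 * (M + N\<^sup>2) * (\<Sum>n\<in>{n\<in>osf N. gcls n = z}. (norm (a n))\<^sup>2)"
      unfolding E_def mult_1 .
  qed
  have "sieve_bound (osf M) (\<lambda>_. 1) J (osf N) (4 * (3 * (M + N\<^sup>2)))"
    using assms by (intro gcls_split main E0) simp_all
  then show ?thesis unfolding LS_def by simp
qed

section \<open>Grouping by squarefree part\<close>

text \<open>This is the Moebius function on squarefree numbers only; elsewhere it does not vanish.\<close>

definition moebius :: "nat \<Rightarrow> real" where
  "moebius n = (-1) ^ card (prime_factors n)"

definition ndiv :: "nat \<Rightarrow> nat" where
  "ndiv n = card {d. d dvd n}"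

lemma abs_moebius [simp]: "\<bar>moebius n\<bar> = 1"
  by (simp add: moebius_def)

lemma divisors_prime_mult:
  assumes p: "prime (p::nat)" "\<not> p dvd n"
  shows "{d. d dvd p * n} = {d. d dvd n} \<union> (\<lambda>d. p * d) ` {d. d dvd n}" "{d. d dvd n} \<inter> (\<lambda>d. p * d) ` {d. d dvd n} = {}"
proof -
  have "d dvd n \<or> (\<exists>c. d = p * c \<and> c dvd n)" if d: "d dvd p * n" for d
  proof (cases "p dvd d")
    case True
    then obtain c where c: "d = p * c" by (elim dvdE)
    have "c dvd n" using d p(1) unfolding c by (simp add: prime_gt_0_nat)
    with c show ?thesis by blast
  next
    case False
    then have "coprime p d" by (rule prime_imp_coprime[OF p(1)])
    then have "coprime d p" by (simp only: coprime_commute)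
    then have "d dvd n" using d by (simp add: coprime_dvd_mult_right_iff)
    then show ?thesis by blast
  qed
  moreover have "d dvd p * n" if "d dvd n" for d using that by (rule dvd_mult)
  moreover have "p * c dvd p * n" if "c dvd n" for c using that by simp
  ultimately show "{d. d dvd p * n} = {d. d dvd n} \<union> (\<lambda>d. p * d) ` {d. d dvd n}" by blast
  show "{d. d dvd n} \<inter> (\<lambda>d. p * d) ` {d. d dvd n} = {}"
  proof -
    have "\<not> p * c dvd n" for c using p(2) dvd_mult_left[of p c n] by blast
    then show ?thesis by blast
  qed
qed

lemma squarefree_induct [consumes 1, case_names one prime]:
  assumes "squarefree (n::nat)" and 1: "P 1"
    and step: "\<And>p n. prime p \<Longrightarrow> \<not> p dvd n \<Longrightarrow> squarefree n \<Longrightarrow> P n \<Longrightarrow> P (p * n)"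
  shows "P n"
  using assms(1)
proof (induction n rule: less_induct)
  case (less n)
  show ?case
  proof (cases "n = 1")
    case True
    show ?thesis unfolding True by (rule 1)
  next
    case False
    then obtain p where p: "prime p" "p dvd n" using prime_factor_nat by blast
    then obtain m where m: "n = p * m" by (elim dvdE)
    have sq: "squarefree (p * m)" using less.prems unfolding m .
    have cp: "coprime p m" using sq by (rule squarefree_imp_coprime)
    have nd: "\<not> p dvd m" using cp p(1) coprime_common_divisor[of p m p] not_prime_unit by auto
    have sm: "squarefree m" using sq by (rule squarefree_multD(2))
    have m0: "m > 0" using sm by (cases m) auto
    have "m < n" unfolding m using m0 prime_gt_1_nat[OF p(1)] by simp
    then have "P m" using less.IH sm by blast
    then show ?thesis unfolding m using step p(1) nd sm by blast
  qed
qed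

lemma moebius_prime_mult:
  assumes "prime p" "\<not> p dvd n" "n > 0"
  shows "moebius (p * n) = - moebius n"
proof -
  have "prime_factors (p * n) = insert p (prime_factors n)"
    using assms by (simp add: prime_factors_product prime_gt_0_nat prime_prime_factors)
  moreover have "p \<notin> prime_factors n" using assms(2) by (auto dest: in_prime_factors_imp_dvd)
  ultimately show ?thesis unfolding moebius_def by simp
qed

lemma finite_divisors: "n > 0 \<Longrightarrow> finite {d::nat. d dvd n}"
  by (rule finite_divisors_nat)

lemma sum_moebius:
  assumes "squarefree n"
  shows "(\<Sum>d\<in>{d. d dvd n}. moebius d) = (if n = 1 then 1 else 0)"
  using assms
proof (induction rule: squarefree_induct)
  case one
  have "{d::nat. d dvd 1} = {1}" by auto
  then show ?case by (simp add: moebius_def)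
next
  case (prime p n)
  have n0: "n > 0" using prime(3) by (cases n) auto
  have p0: "p > 0" using prime(1) by (rule prime_gt_0_nat)
  have f: "finite {d. d dvd n}" using n0 by (rule finite_divisors)
  have "(\<Sum>d\<in>{d. d dvd p * n}. moebius d) = (\<Sum>d\<in>{d. d dvd n}. moebius d) + (\<Sum>d\<in>(\<lambda>d. p * d) ` {d. d dvd n}. moebius d)"
    unfolding divisors_prime_mult(1)[OF prime(1,2)]
    by (rule sum.union_disjoint) (use f divisors_prime_mult(2)[OF prime(1,2)] in auto)
  also have "(\<Sum>d\<in>(\<lambda>d. p * d) ` {d. d dvd n}. moebius d) = (\<Sum>d\<in>{d. d dvd n}. moebius (p * d))"
    by (rule sum.reindex_cong[of "\<lambda>d. p * d"]) (use p0 in \<open>auto simp: inj_on_def\<close>)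
  also have "\<dots> = (\<Sum>d\<in>{d. d dvd n}. - moebius d)"
  proof (rule sum.cong[OF refl])
    fix d assume "d \<in> {d. d dvd n}"
    then have d: "d dvd n" by simp
    then have "\<not> p dvd d" "d > 0" using prime(2) dvd_trans n0 by (auto intro: Nat.gr0I)
    then show "moebius (p * d) = - moebius d" using prime(1) moebius_prime_mult by blast
  qed
  finally show ?case using prime_gt_1_nat[OF prime(1)] by (simp add: sum_negf)
qed

lemma ndiv_prime_mult:
  assumes "prime p" "\<not> p dvd n" "n > 0"
  shows "ndiv (p * n) = 2 * ndiv n"
proof -
  have f: "finite {d. d dvd n}" using assms(3) by (rule finite_divisors)
  have "card ((\<lambda>d. p * d) ` {d. d dvd n}) = card {d. d dvd n}"
    using prime_gt_0_nat[OF assms(1)] by (intro card_image) (auto simp: inj_on_def)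
  then show ?thesis unfolding ndiv_def divisors_prime_mult(1)[OF assms(1,2)]
    using card_Un_disjoint[OF f _ divisors_prime_mult(2)[OF assms(1,2)]] f by simp
qed

text \<open>Each prime doubles \<open>ndiv\<close>. From \<open>P = 2 powr (1 / \<eta>)\<close> on,
  p^\<eta> >= 2 pays for the doubling; the boundedly many smaller primes are charged to the
  constant.\<close>

lemma ndiv_bound:
  assumes "\<eta> > 0"
  shows "\<exists>C\<ge>1. \<forall>n. squarefree n \<longrightarrow> real (ndiv n) \<le> C * real n powr \<eta>"
proof -
  define P where "P = 2 powr (1 / \<eta>)"
  define S where "S n = {p \<in> prime_factors n. real p < P}" for n :: nat
  have le: "real (ndiv n) \<le> 2 ^ card (S n) * real n powr \<eta>" if "squarefree n" for n
    using that
  proof (induction rule: squarefree_induct)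
    case one
    have "{d::nat. d dvd 1} = {1}" by auto
    then show ?case by (simp add: ndiv_def S_def)
  next
    case (prime p n)
    have n0: "n > 0" using prime(3) by (cases n) auto
    have p0: "p > 0" using prime(1) by (rule prime_gt_0_nat)
    have pf: "prime_factors (p * n) = insert p (prime_factors n)"
      using prime n0 p0 by (simp add: prime_factors_product prime_prime_factors)
    have pn: "p \<notin> S n" using prime(2) by (auto simp: S_def dest: in_prime_factors_imp_dvd)
    have fS: "finite (S n)" by (simp add: S_def)
    have "real (ndiv (p * n)) = 2 * real (ndiv n)" using ndiv_prime_mult[OF prime(1,2) n0] by simp
    also have "\<dots> \<le> 2 * (2 ^ card (S n) * real n powr \<eta>)" using prime(4) by simp
    also have "\<dots> \<le> 2 ^ card (S (p * n)) * (real p powr \<eta> * real n powr \<eta>)"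
    proof (cases "real p < P")
      case True
      have "S (p * n) = insert p (S n)" using True by (auto simp: S_def pf)
      then have "card (S (p * n)) = Suc (card (S n))" using pn fS by simp
      moreover have "1 * real n powr \<eta> \<le> real p powr \<eta> * real n powr \<eta>"
        using p0 assms by (intro mult_right_mono ge_one_powr_ge_zero) simp_all
      ultimately show ?thesis by (simp add: mult.assoc)
    next
      case False
      have "S (p * n) = S n" using False by (auto simp: S_def pf)
      moreover have "2 \<le> real p powr \<eta>"
      proof -
        have "2 = P powr \<eta>" unfolding P_def using assms by (simp add: powr_powr)
        also have "\<dots> \<le> real p powr \<eta>" using False assms by (intro powr_mono2) (simp_all add: P_def)
        finally show ?thesis .
      qed
      then have "2 * (2 ^ card (S n) * real n powr \<eta>) \<le> real p powr \<eta> * (2 ^ card (S n) * real n powr \<eta>)"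
        by (rule mult_right_mono) simp
      ultimately show ?thesis by (simp only: mult.assoc mult.left_commute mult.commute)
    qed
    finally show ?case by (simp add: powr_mult)
  qed
  define k where "k = nat \<lceil>P\<rceil>"
  have ck: "card (S n) \<le> k" for n
  proof -
    have "S n \<subseteq> {..<k}"
    proof
      fix p assume "p \<in> S n"
      then have "real p < P" by (simp add: S_def)
      then have "real p < real k" unfolding k_def using real_nat_ceiling_ge[of P] by linarith
      then show "p \<in> {..<k}" by simp
    qed
    then show ?thesis using card_mono[of "{..<k}" "S n"] by simp
  qed
  have "real (ndiv n) \<le> 2 ^ k * real n powr \<eta>" if "squarefree n" for n
  proof -
    have "(2::real) ^ card (S n) \<le> 2 ^ k" using ck by (intro power_increasing) auto
    then have "2 ^ card (S n) * real n powr \<eta> \<le> 2 ^ k * real n powr \<eta>" by (intro mult_right_mono) auto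
    with le[OF that] show ?thesis by linarith
  qed
  then show ?thesis by (intro exI[of _ "2 ^ k"]) auto
qed

section \<open>Series over positive integers grouped by squarefree part\<close>

lemma squarefree_part_mult_square: "squarefree k \<Longrightarrow> m > 0 \<Longrightarrow> squarefree_part (k * m\<^sup>2) = (k::nat)"
proof -
  assume k: "squarefree k" and m: "m > 0"
  have k0: "k > 0" using k by (cases k) auto
  have "multiplicity p (squarefree_part (k * m\<^sup>2)) = multiplicity p k" if p: "prime p" for p
  proof -
    have "multiplicity p (squarefree_part (k * m\<^sup>2)) = multiplicity p (k * m\<^sup>2) mod 2"
      using p k0 m by (intro prime_multiplicity_squarefree_part)
    also have "multiplicity p (k * m\<^sup>2) = multiplicity p k + 2 * multiplicity p m"
      using p k0 m by (simp add: prime_elem_multiplicity_mult_distrib prime_elem_multiplicity_power_distrib)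
    also have "(multiplicity p k + 2 * multiplicity p m) mod 2 = multiplicity p k"
      using k0 k p squarefree_factorial_semiring''[of k] by (auto simp: le_Suc_eq)
    finally show ?thesis .
  qed
  then have "normalize (squarefree_part (k * m\<^sup>2)) = normalize k"
    using k0 by (intro multiplicity_eq_imp_eq) simp_all
  then show ?thesis by simp
qed

lemma sums_subsequence:
  fixes F :: "nat \<Rightarrow> real" and e :: "nat \<Rightarrow> nat"
  assumes F: "summable (\<lambda>h. \<bar>F (Suc h)\<bar>)" and e: "strict_mono e" "\<And>m. e m > 0"
    and P: "\<And>h. h > 0 \<Longrightarrow> P h \<longleftrightarrow> h \<in> range e"
  shows "(\<lambda>h. if P (Suc h) then F (Suc h) else 0) sums (\<Sum>m. F (e m))" "summable (\<lambda>m. F (e m))"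
proof -
  define f where "f h = (if P (Suc h) then F (Suc h) else 0)" for h
  \<comment> \<open>Series over positive integers are indexed through \<open>Suc\<close>, so the
    enumeration \<open>e\<close> is shifted down by one.\<close>
  define G where "G m = e m - 1" for m
  have SG: "Suc (G m) = e m" for m using e(2)[of m] by (simp add: G_def)
  have G: "strict_mono G"
  proof (rule strict_monoI)
    fix x y :: nat assume "x < y"
    then have "Suc (G x) < Suc (G y)" unfolding SG by (rule strict_monoD[OF e(1)])
    then show "G x < G y" by simp
  qed
  have z: "f h = 0" if "h \<notin> range G" for h
  proof -
    have "Suc h \<notin> range e"
    proof
      assume "Suc h \<in> range e"
      then obtain m where "Suc h = e m" by blast
      then have "h = G m" by (simp add: G_def flip: \<open>Suc h = e m\<close>)
      then show False using that by blast
    qed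
    then show ?thesis using P[of "Suc h"] by (simp add: f_def)
  qed
  have "norm (f h) \<le> \<bar>F (Suc h)\<bar>" for h by (simp add: f_def)
  then have "summable f" by (intro summable_comparison_test'[OF F, of 0])
  then have "(\<lambda>m. f (G m)) sums suminf f"
    using sums_mono_reindex[OF G, of f, OF z] by (simp add: summable_sums)
  moreover have "f (G m) = F (e m)" for m
    using P[of "e m"] e(2)[of m] by (simp add: f_def SG)
  ultimately have s: "(\<lambda>m. F (e m)) sums suminf f" by simp
  then show "summable (\<lambda>m. F (e m))" by (rule sums_summable)
  have "suminf f = (\<Sum>m. F (e m))" using sums_unique[OF s] .
  then show "(\<lambda>h. if P (Suc h) then F (Suc h) else 0) sums (\<Sum>m. F (e m))"
    using summable_sums[OF \<open>summable f\<close>] unfolding f_def by simp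
qed

lemma sums_squarefree_part:
  fixes F :: "nat \<Rightarrow> real"
  assumes F: "summable (\<lambda>h. \<bar>F (Suc h)\<bar>)" and k: "squarefree k"
  shows "(\<lambda>h. if squarefree_part (Suc h) = k then F (Suc h) else 0) sums (\<Sum>m. F (k * (Suc m)\<^sup>2))"
    "summable (\<lambda>m. F (k * (Suc m)\<^sup>2))"
proof -
  have k0: "k > 0" using k by (cases k) auto
  have m: "strict_mono (\<lambda>m. k * (Suc m)\<^sup>2)"
    by (rule strict_monoI) (use k0 in \<open>simp add: power_strict_mono\<close>)
  have p: "squarefree_part h = k \<longleftrightarrow> h \<in> range (\<lambda>m. k * (Suc m)\<^sup>2)" if h: "h > 0" for h
  proof
    assume e: "squarefree_part h = k"
    define s where "s = square_part h"
    have "s \<noteq> 0" using h by (simp add: s_def)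
    then obtain m where "s = Suc m" by (cases s) auto
    moreover have "h = k * s\<^sup>2" using squarefree_decompose[of h] e by (simp add: s_def)
    ultimately show "h \<in> range (\<lambda>m. k * (Suc m)\<^sup>2)" by blast
  next
    assume "h \<in> range (\<lambda>m. k * (Suc m)\<^sup>2)"
    then show "squarefree_part h = k" using squarefree_part_mult_square[OF k] by auto
  qed
  show "(\<lambda>h. if squarefree_part (Suc h) = k then F (Suc h) else 0) sums (\<Sum>m. F (k * (Suc m)\<^sup>2))"
    "summable (\<lambda>m. F (k * (Suc m)\<^sup>2))"
    using sums_subsequence[OF F m, of "\<lambda>h. squarefree_part h = k"] k0 p by simp_all
qed

lemma sums_squarefree_part_le:
  fixes F :: "nat \<Rightarrow> real"
  assumes F: "summable (\<lambda>h. \<bar>F (Suc h)\<bar>)"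
  shows "(\<lambda>h. if real (squarefree_part (Suc h)) \<le> X then F (Suc h) else 0) sums (\<Sum>k\<in>sqf X. \<Sum>m. F (k * (Suc m)\<^sup>2))"
proof -
  have "(\<lambda>h. \<Sum>k\<in>sqf X. if squarefree_part (Suc h) = k then F (Suc h) else 0) sums (\<Sum>k\<in>sqf X. \<Sum>m. F (k * (Suc m)\<^sup>2))"
    by (rule sums_sum) (simp add: sums_squarefree_part(1)[OF F] sqf_def)
  moreover have "(\<Sum>k\<in>sqf X. if squarefree_part (Suc h) = k then F (Suc h) else 0)
    = (if real (squarefree_part (Suc h)) \<le> X then F (Suc h) else 0)" for h
    by simp (simp add: sqf_def)
  ultimately show ?thesis by simp
qed

text \<open>The squarefree part divides \<open>h\<close>, so the truncation can miss only terms with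
  \<open>h > X\<close>, and the error is a tail of the absolutely convergent series. The bilinear
  estimates are thus needed for finite sums only, uniformly in \<open>X\<close>.\<close>

lemma suminf_squarefree_part_le_tendsto:
  fixes F :: "nat \<Rightarrow> real"
  assumes F: "summable (\<lambda>h. \<bar>F (Suc h)\<bar>)"
  shows "(\<lambda>X. \<Sum>k\<in>sqf (real X). \<Sum>m. F (k * (Suc m)\<^sup>2)) \<longlonglongrightarrow> (\<Sum>h. F (Suc h))"
proof -
  have sF: "summable (\<lambda>h. F (Suc h))" using F by (rule summable_rabs_cancel)
  have b: "\<bar>(\<Sum>k\<in>sqf (real X). \<Sum>m. F (k * (Suc m)\<^sup>2)) - (\<Sum>h. F (Suc h))\<bar>
    \<le> (\<Sum>h. \<bar>F (Suc h)\<bar>) - (\<Sum>h<X. \<bar>F (Suc h)\<bar>)" for X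
  proof -
    let ?g = "\<lambda>h. if real (squarefree_part (Suc h)) \<le> real X then F (Suc h) else 0"
    let ?b = "\<lambda>h. if h < X then 0 else \<bar>F (Suc h)\<bar>"
    have s: "(\<lambda>h. ?g h - F (Suc h)) sums ((\<Sum>k\<in>sqf (real X). \<Sum>m. F (k * (Suc m)\<^sup>2)) - (\<Sum>h. F (Suc h)))"
      by (intro sums_diff sums_squarefree_part_le[OF F] summable_sums[OF sF])
    have "(\<lambda>h. \<bar>F (Suc h)\<bar> - (if h \<in> {..<X} then \<bar>F (Suc h)\<bar> else 0)) sums ((\<Sum>h. \<bar>F (Suc h)\<bar>) - (\<Sum>h<X. \<bar>F (Suc h)\<bar>))"
      by (intro sums_diff summable_sums[OF F] sums_If_finite_set) simp
    moreover have "\<bar>F (Suc h)\<bar> - (if h \<in> {..<X} then \<bar>F (Suc h)\<bar> else 0) = ?b h" for h by simp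
    ultimately have t: "?b sums ((\<Sum>h. \<bar>F (Suc h)\<bar>) - (\<Sum>h<X. \<bar>F (Suc h)\<bar>))" by simp
    have le: "\<bar>?g h - F (Suc h)\<bar> \<le> ?b h" for h
    proof (cases "h < X")
      case True
      have "squarefree_part (Suc h) dvd Suc h"
        using dvd_triv_left[of "squarefree_part (Suc h)" "square_part (Suc h) ^ 2"] squarefree_decompose[of "Suc h"] by simp
      then have "squarefree_part (Suc h) \<le> X" using True dvd_imp_le[of _ "Suc h"] by fastforce
      then show ?thesis using True by simp
    qed simp
    have "\<bar>\<Sum>h. ?g h - F (Suc h)\<bar> \<le> (\<Sum>h. \<bar>?g h - F (Suc h)\<bar>)"
      by (rule summable_rabs, rule summable_comparison_test'[OF sums_summable[OF t], of 0]) (use le in simp)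
    also have "\<dots> \<le> suminf ?b"
      by (rule suminf_le[OF le _ sums_summable[OF t]], rule summable_comparison_test'[OF sums_summable[OF t], of 0]) (use le in simp)
    finally show ?thesis using sums_unique[OF s] sums_unique[OF t] by simp
  qed
  have "(\<lambda>X. \<Sum>h<X. \<bar>F (Suc h)\<bar>) \<longlonglongrightarrow> (\<Sum>h. \<bar>F (Suc h)\<bar>)" using F by (rule summable_LIMSEQ)
  then have "(\<lambda>X. (\<Sum>h. \<bar>F (Suc h)\<bar>) - (\<Sum>h<X. \<bar>F (Suc h)\<bar>)) \<longlonglongrightarrow> (\<Sum>h. \<bar>F (Suc h)\<bar>) - (\<Sum>h. \<bar>F (Suc h)\<bar>)"
    by (intro tendsto_diff tendsto_const)
  then have "(\<lambda>X. (\<Sum>h. \<bar>F (Suc h)\<bar>) - (\<Sum>h<X. \<bar>F (Suc h)\<bar>)) \<longlonglongrightarrow> 0" by simp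
  then have "(\<lambda>X. (\<Sum>k\<in>sqf (real X). \<Sum>m. F (k * (Suc m)\<^sup>2)) - (\<Sum>h. F (Suc h))) \<longlonglongrightarrow> 0"
    by (rule tendsto_0_le[where K = 1]) (rule always_eventually, rule allI, unfold real_norm_def mult_1_right, rule order.trans[OF b abs_ge_self])
  then show ?thesis by (simp add: LIM_zero_iff)
qed

lemma coprime_moebius:
  assumes "squarefree u"
  shows "(if coprime m u then 1 else 0) = (\<Sum>d\<in>{d. d dvd u}. if d dvd m then moebius d else 0)"
proof -
  have u: "u > 0" using assms by (cases u) auto
  have "(\<Sum>d\<in>{d. d dvd u}. if d dvd m then moebius d else 0) = (\<Sum>d\<in>{d \<in> {d. d dvd u}. d dvd m}. moebius d)"
    using finite_divisors[OF u] by (rule sum.inter_filter[symmetric])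
  also have "{d \<in> {d. d dvd u}. d dvd m} = {d. d dvd gcd m u}" by auto
  also have "(\<Sum>d\<in>{d. d dvd gcd m u}. moebius d) = (if gcd m u = 1 then 1 else 0)"
    by (rule sum_moebius) (use assms squarefree_mono in blast)
  finally show ?thesis by (simp only: coprime_iff_gcd_eq_1)
qed

text \<open>Moebius inversion is carried out for \<open>u\<close> and \<open>v\<close> separately.
  The divisor \<open>f\<close> then depends only on the first modulus and \<open>g\<close> only on
  the second, as a bilinear form requires.\<close>

lemma suminf_coprime:
  fixes F :: "nat \<Rightarrow> real"
  assumes F: "summable (\<lambda>h. \<bar>F (Suc h)\<bar>)" and u: "squarefree u" and v: "squarefree v" and uv: "coprime u v"
  shows "(\<Sum>m. if coprime (Suc m) (u * v) then F (Suc m) else 0)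
    = (\<Sum>f\<in>{d. d dvd u}. \<Sum>g\<in>{d. d dvd v}. moebius f * moebius g * (\<Sum>m. F (f * g * Suc m)))"
proof -
  have pos: "u > 0" "v > 0" using u v by (auto intro: Nat.gr0I)
  have s: "(\<lambda>m. \<Sum>f\<in>{d. d dvd u}. \<Sum>g\<in>{d. d dvd v}. moebius f * moebius g * (if f * g dvd Suc m then F (Suc m) else 0))
    sums (\<Sum>f\<in>{d. d dvd u}. \<Sum>g\<in>{d. d dvd v}. moebius f * moebius g * (\<Sum>m. F (f * g * Suc m)))"
  proof (rule sums_sum, rule sums_sum, rule sums_mult)
    fix f g assume "f \<in> {d. d dvd u}" "g \<in> {d. d dvd v}"
    then have fg: "f > 0" "g > 0" using pos by (auto intro: Nat.gr0I)
    have m: "strict_mono (\<lambda>m. f * g * Suc m)" by (rule strict_monoI) (use fg in simp)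
    have P: "f * g dvd h \<longleftrightarrow> h \<in> range (\<lambda>m. f * g * Suc m)" if "h > 0" for h
    proof
      assume "f * g dvd h"
      then obtain c where c: "h = f * g * c" by (elim dvdE)
      then have "c > 0" using that by (auto intro: Nat.gr0I)
      then have "h = f * g * Suc (c - 1)" using c by simp
      then show "h \<in> range (\<lambda>m. f * g * Suc m)" by (rule range_eqI)
    qed (auto simp: dvd_triv_left)
    show "(\<lambda>m. if f * g dvd Suc m then F (Suc m) else 0) sums (\<Sum>m. F (f * g * Suc m))"
      by (rule sums_subsequence(1)[OF F m _ P]) (use fg in simp_all)
  qed
  have "(\<Sum>f\<in>{d. d dvd u}. \<Sum>g\<in>{d. d dvd v}. moebius f * moebius g * (if f * g dvd m then x else 0))
    = (if coprime m (u * v) then x else 0)" for m x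
  proof -
    have "moebius f * moebius g * (if f * g dvd m then x else 0)
      = (if f dvd m then moebius f else 0) * (if g dvd m then moebius g else 0) * x" if "f dvd u" "g dvd v" for f g
    proof -
      have "coprime f g" using uv that by (rule coprime_divisors[rotated 2])
      then have "f * g dvd m \<longleftrightarrow> f dvd m \<and> g dvd m" using divides_mult dvd_mult_left dvd_mult_right by metis
      then show ?thesis by simp
    qed
    then have "(\<Sum>f\<in>{d. d dvd u}. \<Sum>g\<in>{d. d dvd v}. moebius f * moebius g * (if f * g dvd m then x else 0))
      = (\<Sum>f\<in>{d. d dvd u}. \<Sum>g\<in>{d. d dvd v}. (if f dvd m then moebius f else 0) * (if g dvd m then moebius g else 0) * x)"
      by (intro sum.cong refl) simp
    also have "\<dots> = (\<Sum>f\<in>{d. d dvd u}. if f dvd m then moebius f else 0) * (\<Sum>g\<in>{d. d dvd v}. if g dvd m then moebius g else 0) * x"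
      by (simp only: sum_product) (simp only: sum_distrib_right)
    also have "\<dots> = (if coprime m u then 1 else 0) * (if coprime m v then 1 else 0) * x"
      by (simp only: coprime_moebius[OF u] coprime_moebius[OF v])
    also have "\<dots> = (if coprime m (u * v) then x else 0)" by simp
    finally show ?thesis .
  qed
  with s show ?thesis by (simp only: sums_iff)
qed

text \<open>For \<open>b = True\<close> this is the dual sum over \<open>h = k * m\<^sup>2\<close> minus the part of the original sum that is not completed.\<close>

definition coprime_kernel :: "real \<Rightarrow> bool \<Rightarrow> nat \<Rightarrow> nat \<Rightarrow> real" where
  "coprime_kernel l b k r = (\<Sum>m. if coprime (Suc m) r then dual_wt l r (real (k * (Suc m)\<^sup>2)) else 0) / sqrt r
    - (if b then \<Sum>m. if coprime (Suc m) r then exp (- l * real (k * (Suc m)\<^sup>2)) else 0 else 0)"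

lemma summable_dual_exp:
  assumes "l > 0" "r > 0"
  shows "summable (\<lambda>h. \<bar>dual_wt l (real r) (real (Suc h))\<bar>)" "summable (\<lambda>h. \<bar>exp (- l * real (Suc h))\<bar>)"
  using dual_wt_sums_le(1)[OF assms] dual_wt_nonneg[OF assms(1)] sums_summable[OF exp_geometric_sums(1)[OF assms(1)]]
  by simp_all

lemma coprime_kernel_expand:
  assumes l: "l > 0" and k: "squarefree k" and u: "squarefree u" and v: "squarefree v" and uv: "coprime u v"
  shows "coprime_kernel l b k (u * v) =
    (\<Sum>f\<in>{d. d dvd u}. \<Sum>g\<in>{d. d dvd v}. moebius f * moebius g * kernel l b (real k) (real (f * g)) (real (u * v)))"
proof -
  define r where "r = u * v"
  have r: "r > 0" using u v by (auto intro!: Nat.gr0I simp: r_def)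
  define D where "D h = dual_wt l r (real (k * h\<^sup>2))" for h
  define E where "E h = exp (- l * real (k * h\<^sup>2))" for h
  have sD: "summable (\<lambda>h. \<bar>D (Suc h)\<bar>)"
    unfolding D_def using sums_squarefree_part(2)[of "\<lambda>h. \<bar>dual_wt l r (real h)\<bar>", OF _ k] summable_dual_exp(1)[OF l r] by simp
  have sE: "summable (\<lambda>h. \<bar>E (Suc h)\<bar>)"
    unfolding E_def using sums_squarefree_part(2)[of "\<lambda>h. \<bar>exp (- l * real h)\<bar>", OF _ k] summable_dual_exp(2)[OF l r] by simp
  define S where "S G = (\<Sum>f\<in>{d. d dvd u}. \<Sum>g\<in>{d. d dvd v}. moebius f * moebius g * G f g)" for G
  note D = suminf_coprime[OF sD u v uv, folded r_def S_def[of "\<lambda>f g. \<Sum>m. D (f * g * Suc m)"]]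
  note E = suminf_coprime[OF sE u v uv, folded r_def S_def[of "\<lambda>f g. \<Sum>m. E (f * g * Suc m)"]]
  have lin: "S (\<lambda>f g. G f g / c - (if b then H f g else 0)) = S G / c - (if b then S H else 0)" for G H c
    unfolding S_def by (simp add: sum_divide_distrib sum_subtractf right_diff_distrib)
  have "coprime_kernel l b k r = S (\<lambda>f g. (\<Sum>m. D (f * g * Suc m)) / sqrt r - (if b then \<Sum>m. E (f * g * Suc m) else 0))"
    unfolding lin D[symmetric] E[symmetric] by (simp add: coprime_kernel_def D_def E_def del: mult_Suc_right cong: if_cong)
  also have "(\<lambda>f g. (\<Sum>m. D (f * g * Suc m)) / sqrt r - (if b then \<Sum>m. E (f * g * Suc m) else 0))
     = (\<lambda>f g. kernel l b (real k) (real (f * g)) (real r))"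
    by (simp add: fun_eq_iff kernel_def D_def E_def del: mult_Suc_right)
  finally show ?thesis unfolding r_def S_def .
qed

text \<open>The symbol of k m^2 is that of \<open>k\<close> when \<open>m\<close> is coprime to
  \<open>r\<close> and zero otherwise, so after grouping both sums carry the common factor
  \<open>J k r\<close>. The condition \<open>K \<le> X\<close> ensures that all omitted terms lie in
  the range.\<close>

lemma sum_J_coprime_kernel:
  assumes l: "l > 0" and r: "odd r" and X: "K \<le> X"
  shows "(\<Sum>k\<in>sqf X. J k r * coprime_kernel l (real k \<le> K) k r)
    = (\<Sum>k\<in>sqf X. \<Sum>m. J (k * (Suc m)\<^sup>2) r * dual_wt l r (real (k * (Suc m)\<^sup>2))) / sqrt r
      - theta_tail l (\<lambda>m. real (squarefree_part m) \<le> K) r"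
proof -
  have r0: "r > 0" using r by (rule odd_pos)
  have J: "(\<Sum>m. J (k * (Suc m)\<^sup>2) r * w m) = J k r * (\<Sum>m. if coprime (Suc m) r then w m else 0)"
    if "summable (\<lambda>m. \<bar>w m\<bar>)" for k and w :: "nat \<Rightarrow> real"
  proof -
    have "summable (\<lambda>m. if coprime (Suc m) r then w m else 0)"
      by (rule summable_comparison_test'[OF that, of 0]) simp
    moreover have "J (k * (Suc m)\<^sup>2) r * w m = J k r * (if coprime (Suc m) r then w m else 0)" for m
      by (simp only: J_square_left[OF r]) simp
    ultimately show ?thesis by (simp add: suminf_mult)
  qed
  have sE: "summable (\<lambda>h. \<bar>J (Suc h) r * exp (- l * real (Suc h))\<bar>)"
    by (rule summable_comparison_test'[OF summable_dual_exp(2)[OF l r0], of 0])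
      (use abs_J_le in \<open>simp add: abs_mult mult_left_le_one_le\<close>)
  have "theta_tail l (\<lambda>m. real (squarefree_part m) \<le> K) r = (\<Sum>k\<in>sqf K. \<Sum>m. J (k * (Suc m)\<^sup>2) r * exp (- l * real (k * (Suc m)\<^sup>2)))"
    unfolding theta_tail_def using sums_squarefree_part_le[of "\<lambda>h. J h r * exp (- l * real h)", OF sE, of K] by (simp add: sums_iff)
  also have "\<dots> = (\<Sum>k\<in>sqf K. J k r * (\<Sum>m. if coprime (Suc m) r then exp (- l * real (k * (Suc m)\<^sup>2)) else 0))"
  proof (rule sum.cong[OF refl], rule J)
    fix k assume "k \<in> sqf K"
    then have "squarefree k" by (simp add: sqf_def)
    then show "summable (\<lambda>m. \<bar>exp (- l * real (k * (Suc m)\<^sup>2))\<bar>)"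
      using sums_squarefree_part(2)[of "\<lambda>h. \<bar>exp (- l * real h)\<bar>" k] summable_dual_exp(2)[OF l r0] by simp
  qed
  also have "\<dots> = (\<Sum>k\<in>sqf X. if real k \<le> K then J k r * (\<Sum>m. if coprime (Suc m) r then exp (- l * real (k * (Suc m)\<^sup>2)) else 0) else 0)"
  proof (subst sum.inter_filter[symmetric])
    have "{k \<in> sqf X. real k \<le> K} = sqf K" using X by (auto simp: sqf_def)
    then show "(\<Sum>k\<in>sqf K. J k r * (\<Sum>m. if coprime (Suc m) r then exp (- l * real (k * (Suc m)\<^sup>2)) else 0))
      = (\<Sum>k\<in>{k \<in> sqf X. real k \<le> K}. J k r * (\<Sum>m. if coprime (Suc m) r then exp (- l * real (k * (Suc m)\<^sup>2)) else 0))" by simp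
  qed simp
  finally have T: "theta_tail l (\<lambda>m. real (squarefree_part m) \<le> K) r
     = (\<Sum>k\<in>sqf X. if real k \<le> K then J k r * (\<Sum>m. if coprime (Suc m) r then exp (- l * real (k * (Suc m)\<^sup>2)) else 0) else 0)" .
  have D: "(\<Sum>k\<in>sqf X. \<Sum>m. J (k * (Suc m)\<^sup>2) r * dual_wt l r (real (k * (Suc m)\<^sup>2)))
     = (\<Sum>k\<in>sqf X. J k r * (\<Sum>m. if coprime (Suc m) r then dual_wt l r (real (k * (Suc m)\<^sup>2)) else 0))"
  proof (rule sum.cong[OF refl], rule J)
    fix k assume "k \<in> sqf X"
    then have "squarefree k" by (simp add: sqf_def)
    then show "summable (\<lambda>m. \<bar>dual_wt l r (real (k * (Suc m)\<^sup>2))\<bar>)"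
      using sums_squarefree_part(2)[of "\<lambda>h. \<bar>dual_wt l r (real h)\<bar>" k] summable_dual_exp(1)[OF l r0] by simp
  qed
  show ?thesis unfolding T D coprime_kernel_def sum_divide_distrib sum_subtractf[symmetric]
    by (rule sum.cong[OF refl]) (simp add: right_diff_distrib)
qed

lemma theta_tail_add:
  assumes "l > 0"
  shows "theta_tail l P r + theta_tail l (\<lambda>m. \<not> P m) r = theta_tail l (\<lambda>_. True) r"
proof -
  have "(\<lambda>m. (if P (Suc m) then J (Suc m) r * exp (- l * real (Suc m)) else 0) +
     (if \<not> P (Suc m) then J (Suc m) r * exp (- l * real (Suc m)) else 0)) sums (theta_tail l P r + theta_tail l (\<lambda>m. \<not> P m) r)"
    by (rule sums_add[OF theta_tail_sums[OF assms] theta_tail_sums[OF assms]])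
  moreover have "(if P (Suc m) then J (Suc m) r * exp (- l * real (Suc m)) else 0) +
     (if \<not> P (Suc m) then J (Suc m) r * exp (- l * real (Suc m)) else 0) = (if True then J (Suc m) r * exp (- l * real (Suc m)) else 0)" for m
    by simp
  ultimately show ?thesis using theta_tail_sums[OF assms, of "\<lambda>_. True" r] by (simp add: sums_iff)
qed

text \<open>For \<open>r > 1\<close> the complete sum equals its dual, so the dual minus the omitted
  terms is exactly the tail. For \<open>r = 1\<close>, the diagonal, the trivial character has a
  polar term; it is collected in \<open>\<delta>\<close>, whose bound \<open>1 / l\<close> becomes
  the summand \<open>M\<close> of the large sieve.\<close>

lemma sum_J_coprime_kernel_tendsto:
  assumes l: "l > 0" and r: "odd r" "squarefree r" and g: "r > 1 \<Longrightarrow> gsum r 1 = of_real (sqrt (real r)) \<and> r mod 4 = 1"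
  shows "\<exists>\<delta>. (r > 1 \<longrightarrow> \<delta> = 0) \<and> \<delta> \<le> 1 / l \<and>
    (\<lambda>X. \<Sum>k\<in>sqf (real X). J k r * coprime_kernel l (real k \<le> K) k r)
      \<longlonglongrightarrow> theta_tail l (\<lambda>m. \<not> real (squarefree_part m) \<le> K) r - \<delta>"
proof -
  have r0: "r > 0" using r by (simp add: odd_pos)
  define F where "F h = J h r * dual_wt l r (real h)" for h
  define S where "S = (\<Sum>h. F (Suc h)) / sqrt r"
  define \<delta> where "\<delta> = theta_tail l (\<lambda>_. True) r - S"
  have sF: "summable (\<lambda>h. \<bar>F (Suc h)\<bar>)"
    unfolding F_def by (rule summable_comparison_test'[OF summable_dual_exp(1)[OF l r0], of 0])
      (use abs_J_le dual_wt_nonneg[OF l] in \<open>simp add: abs_mult mult_left_le_one_le\<close>)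
  have "(\<lambda>X. (\<Sum>k\<in>sqf (real X). \<Sum>m. F (k * (Suc m)\<^sup>2)) / sqrt r - theta_tail l (\<lambda>m. real (squarefree_part m) \<le> K) r)
     \<longlonglongrightarrow> S - theta_tail l (\<lambda>m. real (squarefree_part m) \<le> K) r"
    unfolding S_def by (intro tendsto_diff tendsto_divide tendsto_const suminf_squarefree_part_le_tendsto[OF sF]) (use r0 in simp)
  moreover have "S - theta_tail l (\<lambda>m. real (squarefree_part m) \<le> K) r = theta_tail l (\<lambda>m. \<not> real (squarefree_part m) \<le> K) r - \<delta>"
    using theta_tail_add[OF l, of "\<lambda>m. real (squarefree_part m) \<le> K" r] by (simp add: \<delta>_def)
  moreover have ev: "\<forall>\<^sub>F X in sequentially. (\<Sum>k\<in>sqf (real X). \<Sum>m. F (k * (Suc m)\<^sup>2)) / sqrt r - theta_tail l (\<lambda>m. real (squarefree_part m) \<le> K) r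
      = (\<Sum>k\<in>sqf (real X). J k r * coprime_kernel l (real k \<le> K) k r)"
    using eventually_ge_at_top[of "nat \<lceil>K\<rceil>"]
  proof (rule eventually_mono)
    fix X assume "nat \<lceil>K\<rceil> \<le> X"
    then have "K \<le> real X" by linarith
    from sum_J_coprime_kernel[OF l r(1) this]
    show "(\<Sum>k\<in>sqf (real X). \<Sum>m. F (k * (Suc m)\<^sup>2)) / sqrt r - theta_tail l (\<lambda>m. real (squarefree_part m) \<le> K) r
      = (\<Sum>k\<in>sqf (real X). J k r * coprime_kernel l (real k \<le> K) k r)" by (simp add: F_def)
  qed
  ultimately have lim: "(\<lambda>X. (\<Sum>k\<in>sqf (real X). \<Sum>m. F (k * (Suc m)\<^sup>2)) / sqrt r - theta_tail l (\<lambda>m. real (squarefree_part m) \<le> K) r)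
     \<longlonglongrightarrow> theta_tail l (\<lambda>m. \<not> real (squarefree_part m) \<le> K) r - \<delta>" by (simp only:)
  have "(\<lambda>X. \<Sum>k\<in>sqf (real X). J k r * coprime_kernel l (real k \<le> K) k r)
      \<longlonglongrightarrow> theta_tail l (\<lambda>m. \<not> real (squarefree_part m) \<le> K) r - \<delta>"
    by (rule Lim_transform_eventually[OF lim ev])
  moreover have d0: "\<delta> = 0" if "r > 1"
    using J_poisson'(2)[OF r that] g[OF that] l by (simp add: \<delta>_def S_def F_def)
  moreover have "\<delta> \<le> 1 / l"
  proof (cases "r > 1")
    case False
    then have r1: "r = 1" using r0 by simp
    have "0 \<le> S" unfolding S_def F_def r1 using summable_dual_exp(1)[OF l, of 1] dual_wt_nonneg[OF l]
      by (intro divide_nonneg_nonneg suminf_nonneg) simp_all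
    then show ?thesis unfolding \<delta>_def r1 using theta_tail_1(2)[OF l, of "\<lambda>_. True"] by simp
  qed (use d0 l in simp)
  ultimately show ?thesis by blast
qed

section \<open>Separation of the two moduli by Moebius inversion\<close>

lemma gcd_div_eq:
  assumes "d dvd n" "d dvd m" "n > (0::nat)"
  shows "gcd (n div d) (m div d) = gcd n m div d" "gcd n m div d = 1 \<longleftrightarrow> d = gcd n m"
proof -
  obtain x y where xy: "n = d * x" "m = d * y" using assms by (elim dvdE)
  have "d > 0" using assms(3) unfolding xy by simp
  then show "gcd (n div d) (m div d) = gcd n m div d" unfolding xy by (simp add: gcd_mult_distrib_nat[symmetric])
  have "d dvd gcd n m" using assms by simp
  then obtain c where c: "gcd n m = d * c" by (elim dvdE)
  have "gcd n m > 0" using assms by simp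
  then have "d > 0" unfolding c by simp
  then show "gcd n m div d = 1 \<longleftrightarrow> d = gcd n m" unfolding c by auto
qed

text \<open>The condition on one variable: \<open>d\<close> is the candidate for the gcd,
  \<open>e\<close> detects by Moebius inversion that the cofactors are coprime, and \<open>f\<close>
  comes from the coprimality condition in \<open>coprime_kernel\<close>.\<close>

definition dvs :: "nat \<Rightarrow> nat \<Rightarrow> nat \<Rightarrow> nat \<Rightarrow> bool" where
  "dvs d e f n \<longleftrightarrow> d dvd n \<and> e dvd n div d \<and> f dvd n div d"

text \<open>\<open>d\<close> is the gcd exactly when the cofactors are coprime. Detecting this by a
  Moebius sum over \<open>e\<close> replaces the joint condition by one on \<open>n\<close> and one
  on \<open>m\<close>, with parameters ranging over \<open>{1..N}\<close> independently of
  both.\<close>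

lemma gcd_moebius_expand:
  fixes H :: "nat \<Rightarrow> nat \<Rightarrow> nat \<Rightarrow> real"
  assumes n: "squarefree n" "n \<le> N" and m: "squarefree m" "m \<le> N"
  shows "(\<Sum>d=1..N. \<Sum>e=1..N. \<Sum>f=1..N. \<Sum>g=1..N.
      if dvs d e f n \<and> dvs d e g m then moebius e * moebius f * moebius g * H d f g else 0)
    = (\<Sum>f\<in>{f. f dvd n div gcd n m}. \<Sum>g\<in>{g. g dvd m div gcd n m}. moebius f * moebius g * H (gcd n m) f g)"
proof -
  have pos: "n > 0" "m > 0" using n m by (auto intro: Nat.gr0I)
  define S where "S d = (\<Sum>f\<in>{f. f dvd n div d}. \<Sum>g\<in>{g. g dvd m div d}. moebius f * moebius g * H d f g)" for d
  have D: "{f \<in> {1..N}. f dvd x div d} = {f. f dvd x div d}" if "d dvd x" "x > 0" "x \<le> N" for x d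
  proof -
    have "x div d > 0" using that by (simp add: div_greater_zero_iff dvd_imp_le dvd_pos_nat)
    moreover have "x div d \<le> N" using that(3) div_le_dividend order.trans by blast
    ultimately show ?thesis by (auto dest: dvd_imp_le intro: Nat.gr0I)
  qed
  have inner: "(\<Sum>e=1..N. \<Sum>f=1..N. \<Sum>g=1..N.
      if dvs d e f n \<and> dvs d e g m then moebius e * moebius f * moebius g * H d f g else 0)
    = (if d = gcd n m then S d else 0)" if d: "d \<in> {1..N}" for d
  proof (cases "d dvd n \<and> d dvd m")
    case False
    then have "d \<noteq> gcd n m" by auto
    moreover have "(dvs d e f n \<and> dvs d e g m) = False" for e f g using False by (auto simp: dvs_def)
    ultimately show ?thesis by (simp only: if_False sum.neutral_const)
  next
    case True
    have "(\<Sum>f=1..N. \<Sum>g=1..N. if dvs d e f n \<and> dvs d e g m then moebius e * moebius f * moebius g * H d f g else 0)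
      = (if e dvd gcd n m div d then moebius e * S d else 0)" for e
    proof (cases "e dvd gcd n m div d")
      case False
      then have "\<not> (e dvd n div d \<and> e dvd m div d)" using gcd_div_eq(1)[of d n m] True pos by (metis gcd_greatest)
      then have "(dvs d e f n \<and> dvs d e g m) = False" for f g by (auto simp: dvs_def)
      then show ?thesis using False by (simp only: if_False sum.neutral_const)
    next
      case e: True
      then have ed: "e dvd n div d" "e dvd m div d" using gcd_div_eq(1)[of d n m] True pos by (metis dvd_trans gcd_dvd1 gcd_dvd2)+
      have "(\<Sum>f=1..N. \<Sum>g=1..N. if dvs d e f n \<and> dvs d e g m then moebius e * moebius f * moebius g * H d f g else 0)
        = (\<Sum>f=1..N. if f dvd n div d then (\<Sum>g=1..N. if g dvd m div d then moebius e * moebius f * moebius g * H d f g else 0) else 0)"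
        using True ed by (intro sum.cong refl) (auto simp: dvs_def)
      also have "\<dots> = (\<Sum>f\<in>{f. f dvd n div d}. \<Sum>g\<in>{g. g dvd m div d}. moebius e * moebius f * moebius g * H d f g)"
        by (simp only: sum.inter_filter[symmetric] finite_atLeastAtMost D True pos n m)
      also have "\<dots> = moebius e * S d" unfolding S_def sum_distrib_left by (simp only: mult.assoc)
      finally show ?thesis using e by simp
    qed
    then have "(\<Sum>e=1..N. \<Sum>f=1..N. \<Sum>g=1..N.
        if dvs d e f n \<and> dvs d e g m then moebius e * moebius f * moebius g * H d f g else 0)
      = (\<Sum>e=1..N. if e dvd gcd n m div d then moebius e * S d else 0)" by (simp only:)
    also have "\<dots> = (\<Sum>e\<in>{e. e dvd gcd n m div d}. moebius e * S d)"
    proof -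
      have "gcd n m \<le> N" using gcd_le1_nat[of n m] pos n by linarith
      moreover have "d dvd gcd n m" "gcd n m > 0" using True pos by simp_all
      ultimately show ?thesis by (simp only: sum.inter_filter[symmetric] finite_atLeastAtMost D)
    qed
    also have "\<dots> = (if gcd n m div d = 1 then 1 else 0) * S d"
    proof -
      have "gcd n m div d dvd n" using True by (metis div_dvd_div dvd_trans gcd_dvd1 gcd_greatest dvd_div_mult_self dvd_triv_left)
      then have "squarefree (gcd n m div d)" using n(1) squarefree_mono by blast
      from sum_moebius[OF this] show ?thesis by (simp only: sum_distrib_right[symmetric])
    qed
    finally show ?thesis using gcd_div_eq(2)[of d n m] True pos by simp
  qed
  have "gcd n m \<le> n" using pos by (intro gcd_le1_nat) simp
  then have "gcd n m \<le> N" using n(2) by linarith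
  then have g: "gcd n m \<in> {1..N}" using pos by (simp add: Suc_le_eq)
  have "(\<Sum>d=1..N. \<Sum>e=1..N. \<Sum>f=1..N. \<Sum>g=1..N.
      if dvs d e f n \<and> dvs d e g m then moebius e * moebius f * moebius g * H d f g else 0)
     = (\<Sum>d=1..N. if d = gcd n m then S d else 0)" by (rule sum.cong[OF refl inner])
  also have "\<dots> = S (gcd n m)" using g by (simp add: sum.delta)
  finally show ?thesis unfolding S_def .
qed

text \<open>\<open>S\<close> is a finite truncation of the dual variable, while \<open>K\<close>
  separates the \<open>k\<close> whose main terms are subtracted from the others.\<close>

definition kform :: "real \<Rightarrow> real \<Rightarrow> nat set \<Rightarrow> nat \<Rightarrow> nat \<Rightarrow> real" where
  "kform l K S n m = (\<Sum>k\<in>S. J k (qr n m) * coprime_kernel l (real k \<le> K) k (qr n m))"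

lemma kform_expand:
  assumes l: "l > 0" and S: "\<And>k. k \<in> S \<Longrightarrow> squarefree k"
    and n: "odd n" "squarefree n" "n \<le> N" and m: "odd m" "squarefree m" "m \<le> N"
  shows "kform l K S n m = (\<Sum>d=1..N. \<Sum>e=1..N. \<Sum>f=1..N. \<Sum>g=1..N.
      if dvs d e f n \<and> dvs d e g m then moebius e * moebius f * moebius g *
        (\<Sum>k\<in>S. J k (n div d) * J k (m div d) * kernel l (real k \<le> K) (real k) (real (f * g)) (real (n div d) * real (m div d))) else 0)"
proof -
  have pos: "n > 0" "m > 0" using n m by (simp_all add: odd_pos)
  obtain u v where uv: "n = gcd n m * u" "m = gcd n m * v" "coprime u v" "n div gcd n m = u" "m div gcd n m = v"
    using gcd_split[OF pos] .
  have q: "qr n m = u * v" by (simp only: qr_def uv(4,5))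
  have sq: "squarefree u" "squarefree v" using n(2) m(2) uv(1,2) by (metis squarefree_multD)+
  have uv0: "u > 0" "v > 0" using sq by (auto intro: Nat.gr0I)
  have "kform l K S n m = (\<Sum>k\<in>S. \<Sum>f\<in>{d. d dvd u}. \<Sum>g\<in>{d. d dvd v}.
      moebius f * moebius g * (J k u * J k v * kernel l (real k \<le> K) (real k) (real (f * g)) (real u * real v)))"
    unfolding kform_def q
  proof (rule sum.cong[OF refl])
    fix k assume "k \<in> S"
    show "J k (u * v) * coprime_kernel l (real k \<le> K) k (u * v) = (\<Sum>f\<in>{d. d dvd u}. \<Sum>g\<in>{d. d dvd v}.
      moebius f * moebius g * (J k u * J k v * kernel l (real k \<le> K) (real k) (real (f * g)) (real u * real v)))"
      unfolding coprime_kernel_expand[OF l S[OF \<open>k \<in> S\<close>] sq uv(3)] J_mult_right[OF uv0] sum_distrib_left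
      by (intro sum.cong refl) (simp add: mult_ac)
  qed
  also have "\<dots> = (\<Sum>f\<in>{d. d dvd u}. \<Sum>k\<in>S. \<Sum>g\<in>{d. d dvd v}.
      moebius f * moebius g * (J k u * J k v * kernel l (real k \<le> K) (real k) (real (f * g)) (real u * real v)))"
    by (rule sum.swap)
  also have "\<dots> = (\<Sum>f\<in>{d. d dvd u}. \<Sum>g\<in>{d. d dvd v}. \<Sum>k\<in>S.
      moebius f * moebius g * (J k u * J k v * kernel l (real k \<le> K) (real k) (real (f * g)) (real u * real v)))"
    by (rule sum.cong[OF refl sum.swap])
  also have "\<dots> = (\<Sum>f\<in>{d. d dvd u}. \<Sum>g\<in>{d. d dvd v}.
      moebius f * moebius g * (\<Sum>k\<in>S. J k u * J k v * kernel l (real k \<le> K) (real k) (real (f * g)) (real u * real v)))"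
    by (simp only: sum_distrib_left)
  finally show ?thesis unfolding gcd_moebius_expand[OF n(2,3) m(2,3)] uv(4,5) .
qed

lemma sum_four_swap:
  fixes F :: "nat \<Rightarrow> nat \<Rightarrow> nat \<Rightarrow> nat \<Rightarrow> nat \<Rightarrow> nat \<Rightarrow> complex"
  shows "(\<Sum>n\<in>E. \<Sum>m\<in>E. \<Sum>d\<in>A. \<Sum>e\<in>A. \<Sum>f\<in>A. \<Sum>g\<in>A. F d e f g n m)
    = (\<Sum>d\<in>A. \<Sum>e\<in>A. \<Sum>f\<in>A. \<Sum>g\<in>A. \<Sum>n\<in>E. \<Sum>m\<in>E. F d e f g n m)"
proof -
  have "(\<Sum>n\<in>E. \<Sum>m\<in>E. \<Sum>d\<in>A. \<Sum>e\<in>A. \<Sum>f\<in>A. \<Sum>g\<in>A. F d e f g n m)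
    = (\<Sum>p\<in>E \<times> E. \<Sum>t\<in>A \<times> A \<times> A \<times> A. F (fst t) (fst (snd t)) (fst (snd (snd t))) (snd (snd (snd t))) (fst p) (snd p))"
    by (simp only: sum.cartesian_product' fst_conv snd_conv)
  also have "\<dots> = (\<Sum>t\<in>A \<times> A \<times> A \<times> A. \<Sum>p\<in>E \<times> E. F (fst t) (fst (snd t)) (fst (snd (snd t))) (snd (snd (snd t))) (fst p) (snd p))"
    by (rule sum.swap)
  finally show ?thesis by (simp only: sum.cartesian_product' fst_conv snd_conv)
qed

lemma card_dvs_le:
  assumes "n > 0"
  shows "(\<Sum>d=1..N. \<Sum>e=1..N. \<Sum>f=1..N. if dvs d e f n then 1 else 0 :: real) \<le> real (ndiv n) ^ 3"
proof -
  define D where "D = {d. d dvd n}"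
  have fD: "finite D" using assms by (simp add: D_def)
  have dd: "x \<in> D" if "d dvd n" "x dvd n div d" for d x
    using that unfolding D_def by (metis div_dvd_iff_mult dvd_div_mult_self dvd_mult_left dvd_trans dvd_triv_left mem_Collect_eq)
  have "(\<Sum>d=1..N. \<Sum>e=1..N. \<Sum>f=1..N. if dvs d e f n then 1 else 0 :: real)
    \<le> (\<Sum>d=1..N. \<Sum>e=1..N. \<Sum>f=1..N. indicator D d * indicator D e * indicator D f)"
  proof (intro sum_mono)
    fix d e f :: nat
    show "(if dvs d e f n then 1 else 0 :: real) \<le> indicator D d * indicator D e * indicator D f"
    proof (cases "dvs d e f n")
      case True
      then have "d \<in> D" "e \<in> D" "f \<in> D" using dd[of d] unfolding dvs_def by (auto simp: D_def)
      then show ?thesis by simp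
    qed (simp add: indicator_def)
  qed
  also have "\<dots> = (\<Sum>d=1..N. indicator D d) * (\<Sum>d=1..N. indicator D d) * (\<Sum>d=1..N. indicator D d)"
    by (simp only: sum_distrib_left[symmetric] sum_distrib_right[symmetric])
  also have "(\<Sum>d=1..N. indicator D d :: real) = real (card ({1..N} \<inter> D))"
    by (simp add: indicator_def sum_of_bool_eq Int_def)
  also have "real (card ({1..N} \<inter> D)) * real (card ({1..N} \<inter> D)) * real (card ({1..N} \<inter> D)) \<le> real (ndiv n) * real (ndiv n) * real (ndiv n)"
  proof -
    have "card ({1..N} \<inter> D) \<le> ndiv n" unfolding ndiv_def D_def[symmetric] using fD by (intro card_mono) auto
    then show ?thesis by (intro mult_mono) auto
  qed
  finally show ?thesis by (simp add: power3_eq_cube)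
qed

text \<open>For fixed divisors the form is bounded by \<open>bil\<close>. Summation over the
  divisors costs a harmonic sum, from the factor \<open>1 / sqrt (f * g)\<close>, and
  \<open>D ^ 3\<close>, since each \<open>n\<close> satisfies \<open>dvs d e f n\<close> for at most
  \<open>ndiv n ^ 3\<close> triples.\<close>

lemma kform_bound:
  fixes a :: "nat \<Rightarrow> complex"
  assumes l: "l > 0" and S: "\<And>k. k \<in> S \<Longrightarrow> squarefree k" "finite S"
    and E: "finite E" "\<And>n. n \<in> E \<Longrightarrow> odd n \<and> squarefree n \<and> n \<le> N" and Y: "Y \<ge> 0"
    and D: "\<And>n. n \<in> E \<Longrightarrow> real (ndiv n) \<le> D"
    and bil: "\<And>d e f g. d \<in> {1..N} \<Longrightarrow> e \<in> {1..N} \<Longrightarrow> f \<in> {1..N} \<Longrightarrow> g \<in> {1..N} \<Longrightarrow>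
      norm (\<Sum>k\<in>S. \<Sum>n\<in>{n\<in>E. dvs d e f n}. \<Sum>m\<in>{m\<in>E. dvs d e g m}. a n * cnj (a m) * of_real (J k (n div d) * J k (m div d) *
        kernel l (real k \<le> K) (real k) (real (f * g)) (real (n div d) * real (m div d))))
      \<le> Y / sqrt (real f * real g) * L2_set (\<lambda>n. norm (a n)) {n\<in>E. dvs d e f n} * L2_set (\<lambda>n. norm (a n)) {n\<in>E. dvs d e g n}"
  shows "norm (\<Sum>n\<in>E. \<Sum>m\<in>E. a n * cnj (a m) * of_real (kform l K S n m))
    \<le> Y * (\<Sum>g=1..N. 1 / real g) * D ^ 3 * (\<Sum>n\<in>E. (norm (a n))\<^sup>2)"
proof -
  define Ed where "Ed d e f = {n\<in>E. dvs d e f n}" for d e f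
  define h where "h d f g n m k = J k (n div d) * J k (m div d) *
        kernel l (real k \<le> K) (real k) (real (f * g)) (real (n div d) * real (m div d))" for d f g n m k
  define F where "F d e f g n m = (if dvs d e f n \<and> dvs d e g m then
      of_real (moebius e * moebius f * moebius g) * (\<Sum>k\<in>S. a n * cnj (a m) * of_real (h d f g n m k)) else 0)" for d e f g n m
  define x where "x d e f = (\<Sum>n\<in>Ed d e f. (norm (a n))\<^sup>2)" for d e f
  have x0: "x d e f \<ge> 0" for d e f unfolding x_def by (intro sum_nonneg) simp
  have L2: "L2_set (\<lambda>n. norm (a n)) (Ed d e f) = sqrt (x d e f)" for d e f by (simp add: L2_set_def x_def)
  have kf: "a n * cnj (a m) * of_real (kform l K S n m) = (\<Sum>d=1..N. \<Sum>e=1..N. \<Sum>f=1..N. \<Sum>g=1..N. F d e f g n m)"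
    if "n \<in> E" "m \<in> E" for n m
  proof -
    have e: "kform l K S n m = (\<Sum>d=1..N. \<Sum>e=1..N. \<Sum>f=1..N. \<Sum>g=1..N.
      if dvs d e f n \<and> dvs d e g m then moebius e * moebius f * moebius g * (\<Sum>k\<in>S. h d f g n m k) else 0)"
      unfolding h_def by (rule kform_expand[OF l S(1)]) (use E(2)[OF that(1)] E(2)[OF that(2)] in simp_all)
    show ?thesis unfolding e of_real_sum sum_distrib_left
      by (intro sum.cong refl) (simp add: F_def sum_distrib_left mult_ac)
  qed
  have t: "norm (\<Sum>n\<in>E. \<Sum>m\<in>E. F d e f g n m) \<le> Y / 2 * (x d e f / real g + x d e g / real f)"
    if r: "d \<in> {1..N}" "e \<in> {1..N}" "f \<in> {1..N}" "g \<in> {1..N}" for d e f g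
  proof -
    have fg: "real f > 0" "real g > 0" using r by auto
    have "(\<Sum>n\<in>E. \<Sum>m\<in>E. F d e f g n m) = (\<Sum>n\<in>Ed d e f. \<Sum>m\<in>Ed d e g. of_real (moebius e * moebius f * moebius g) * (\<Sum>k\<in>S. a n * cnj (a m) * of_real (h d f g n m k)))"
    proof -
      have "(\<Sum>n\<in>E. \<Sum>m\<in>E. F d e f g n m) = (\<Sum>n\<in>E. if dvs d e f n then (\<Sum>m\<in>E. if dvs d e g m then of_real (moebius e * moebius f * moebius g) * (\<Sum>k\<in>S. a n * cnj (a m) * of_real (h d f g n m k)) else 0) else 0)"
        unfolding F_def by (intro sum.cong refl) auto
      then show ?thesis unfolding Ed_def by (simp only: sum.inter_filter[OF E(1), symmetric])
    qed
    also have "\<dots> = of_real (moebius e * moebius f * moebius g) * (\<Sum>n\<in>Ed d e f. \<Sum>m\<in>Ed d e g. \<Sum>k\<in>S. a n * cnj (a m) * of_real (h d f g n m k))"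
      by (simp only: sum_distrib_left)
    also have "(\<Sum>n\<in>Ed d e f. \<Sum>m\<in>Ed d e g. \<Sum>k\<in>S. a n * cnj (a m) * of_real (h d f g n m k))
       = (\<Sum>k\<in>S. \<Sum>n\<in>Ed d e f. \<Sum>m\<in>Ed d e g. a n * cnj (a m) * of_real (h d f g n m k))"
      (is "?l = ?r")
    proof -
      have "?l = (\<Sum>n\<in>Ed d e f. \<Sum>k\<in>S. \<Sum>m\<in>Ed d e g. a n * cnj (a m) * of_real (h d f g n m k))"
        by (rule sum.cong[OF refl sum.swap])
      also have "\<dots> = ?r" by (rule sum.swap)
      finally show ?thesis .
    qed
    finally have "norm (\<Sum>n\<in>E. \<Sum>m\<in>E. F d e f g n m) = norm (\<Sum>k\<in>S. \<Sum>n\<in>Ed d e f. \<Sum>m\<in>Ed d e g. a n * cnj (a m) * of_real (h d f g n m k))"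
      by (simp add: norm_mult abs_mult)
    also have "\<dots> \<le> Y / sqrt (real f * real g) * sqrt (x d e f) * sqrt (x d e g)"
      using bil[OF r] unfolding h_def Ed_def[symmetric] L2 .
    also have "\<dots> = Y * (sqrt (x d e f / real g) * sqrt (x d e g / real f))"
      by (simp add: real_sqrt_mult real_sqrt_divide mult_ac)
    \<comment> \<open>The pairing is crossed: the norm belonging to \<open>f\<close> is divided by
      \<open>g\<close> and conversely, so the divisor on which a norm does not depend is the one
      carrying the harmonic weight.\<close>
    also have "\<dots> \<le> Y * ((x d e f / real g + x d e g / real f) / 2)"
    proof (rule mult_left_mono[OF _ Y])
      have "0 \<le> x d e f / real g" "0 \<le> x d e g / real f" using x0 by simp_all
      from arith_geo_mean_sqrt[OF this]
      show "sqrt (x d e f / real g) * sqrt (x d e g / real f) \<le> (x d e f / real g + x d e g / real f) / 2"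
        by (simp only: real_sqrt_mult)
    qed
    finally show ?thesis by simp
  qed
  define s where "s = (\<Sum>g=1..N. 1 / real g)"
  have s0: "s \<ge> 0" unfolding s_def by (intro sum_nonneg) simp
  define X where "X = (\<Sum>d=1..N. \<Sum>e=1..N. \<Sum>f=1..N. x d e f)"
  have "norm (\<Sum>n\<in>E. \<Sum>m\<in>E. a n * cnj (a m) * of_real (kform l K S n m))
     = norm (\<Sum>n\<in>E. \<Sum>m\<in>E. \<Sum>d=1..N. \<Sum>e=1..N. \<Sum>f=1..N. \<Sum>g=1..N. F d e f g n m)"
    by (intro arg_cong[where f = norm] sum.cong[OF refl] kf)
  also have "\<dots> = norm (\<Sum>d=1..N. \<Sum>e=1..N. \<Sum>f=1..N. \<Sum>g=1..N. \<Sum>n\<in>E. \<Sum>m\<in>E. F d e f g n m)"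
    by (simp only: sum_four_swap)
  also have "\<dots> \<le> (\<Sum>d=1..N. \<Sum>e=1..N. \<Sum>f=1..N. \<Sum>g=1..N. Y / 2 * (x d e f / real g + x d e g / real f))"
    by (intro sum_norm_le t)
  also have "\<dots> = Y / 2 * (\<Sum>d=1..N. \<Sum>e=1..N. (\<Sum>f=1..N. \<Sum>g=1..N. x d e f / real g) + (\<Sum>f=1..N. \<Sum>g=1..N. x d e g / real f))"
    by (simp only: sum_distrib_left[symmetric] sum.distrib)
  also have "\<dots> = Y / 2 * (\<Sum>d=1..N. \<Sum>e=1..N. 2 * s * (\<Sum>f=1..N. x d e f))"
  proof -
    have 1: "(\<Sum>f=1..N. \<Sum>g=1..N. x d e f / real g) = s * (\<Sum>f=1..N. x d e f)" for d e
      unfolding s_def sum_product by (subst sum.swap) (simp add: mult.commute)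
    have 2: "(\<Sum>f=1..N. \<Sum>g=1..N. x d e g / real f) = s * (\<Sum>f=1..N. x d e f)" for d e
      unfolding s_def sum_product by simp
    show ?thesis by (simp only: 1 2 mult_2[symmetric] mult.assoc)
  qed
  also have "\<dots> = Y * s * X" unfolding X_def by (simp add: sum_distrib_left mult_ac)
  also have "X \<le> D ^ 3 * (\<Sum>n\<in>E. (norm (a n))\<^sup>2)"
  proof -
    have "X = (\<Sum>d=1..N. \<Sum>e=1..N. \<Sum>f=1..N. \<Sum>n\<in>E. (norm (a n))\<^sup>2 * (if dvs d e f n then 1 else 0))"
      unfolding X_def x_def Ed_def by (simp add: sum.inter_filter[OF E(1)] if_distrib cong: if_cong)
    also have "\<dots> = (\<Sum>n\<in>E. (norm (a n))\<^sup>2 * (\<Sum>d=1..N. \<Sum>e=1..N. \<Sum>f=1..N. if dvs d e f n then 1 else 0))"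
    proof -
      have "(\<Sum>d=1..N. \<Sum>e=1..N. \<Sum>f=1..N. \<Sum>n\<in>E. (norm (a n))\<^sup>2 * (if dvs d e f n then 1 else 0))
        = (\<Sum>p\<in>{1..N} \<times> {1..N} \<times> {1..N}. \<Sum>n\<in>E. (norm (a n))\<^sup>2 * (if dvs (fst p) (fst (snd p)) (snd (snd p)) n then 1 else 0))"
        by (simp only: sum.cartesian_product' fst_conv snd_conv)
      also have "\<dots> = (\<Sum>n\<in>E. \<Sum>p\<in>{1..N} \<times> {1..N} \<times> {1..N}. (norm (a n))\<^sup>2 * (if dvs (fst p) (fst (snd p)) (snd (snd p)) n then 1 else 0))"
        by (rule sum.swap)
      finally show ?thesis by (simp only: sum.cartesian_product' fst_conv snd_conv sum_distrib_left)
    qed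
    also have "\<dots> \<le> (\<Sum>n\<in>E. (norm (a n))\<^sup>2 * D ^ 3)"
    proof (intro sum_mono mult_left_mono)
      fix n assume n: "n \<in> E"
      then have "n > 0" using E(2) odd_pos by blast
      then have "(\<Sum>d=1..N. \<Sum>e=1..N. \<Sum>f=1..N. if dvs d e f n then 1 else 0 :: real) \<le> real (ndiv n) ^ 3"
        by (rule card_dvs_le)
      also have "\<dots> \<le> D ^ 3" using D[OF n] by (intro power_mono) simp_all
      finally show "(\<Sum>d=1..N. \<Sum>e=1..N. \<Sum>f=1..N. if dvs d e f n then 1 else 0 :: real) \<le> D ^ 3" .
    qed simp
    finally show ?thesis by (simp add: sum_distrib_left mult.commute)
  qed
  then have "Y * s * X \<le> Y * s * (D ^ 3 * (\<Sum>n\<in>E. (norm (a n))\<^sup>2))"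
    using Y s0 by (intro mult_left_mono) simp_all
  finally show ?thesis by (simp add: s_def mult.assoc)
qed

section \<open>The recursion for the exponent\<close>

definition large_sieve :: "real \<Rightarrow> bool" where
  "large_sieve \<xi> \<longleftrightarrow> (\<forall>\<eta>>0. \<exists>C>0. \<forall>M\<ge>1. \<forall>N\<ge>1. LS M N (C * (M * N) powr \<eta> * (M + N powr \<xi>)))"

text \<open>\<open>W j\<close> majorises the weight on the level 2^(j-1) < k <= 2^j and
  \<open>G j\<close> bounds the sum up to 2^j. The decay \<open>q ^ j\<close> makes the result
  independent of the size of \<open>S\<close>, which is essential because the truncation of the dual
  sum is unbounded.\<close>

lemma sum_dyadic_le:
  fixes A w :: "nat \<Rightarrow> real"
  assumes S: "finite S" "\<And>k. k \<in> S \<Longrightarrow> k > 0" and A: "\<And>k. k \<in> S \<Longrightarrow> A k \<ge> 0"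
    and W: "\<And>k j. k \<in> S \<Longrightarrow> real k \<le> 2 ^ j \<Longrightarrow> 2 ^ j < 2 * real k \<Longrightarrow> w k \<le> W j" "\<And>j. W j \<ge> 0"
    and G: "\<And>j. (\<Sum>k\<in>{k\<in>S. real k \<le> 2 ^ j}. A k) \<le> G j"
    and Z: "\<And>j. W j * G j \<le> Z * q ^ j" and q: "0 \<le> q" "q < 1" and Z0: "Z \<ge> 0"
  shows "(\<Sum>k\<in>S. w k * A k) \<le> Z / (1 - q)"
proof -
  define lev where "lev k = (LEAST j. k \<le> 2 ^ j)" for k :: nat
  have ex: "k \<le> 2 ^ k" for k :: nat using less_exp[of k] by simp
  have lev1: "k \<le> 2 ^ lev k" for k unfolding lev_def by (rule LeastI[of _ k]) (rule ex)
  have lev2: "2 ^ lev k < 2 * k" if "k > 0" for k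
  proof (cases "lev k")
    case (Suc j)
    then have "\<not> k \<le> 2 ^ j" using not_less_Least[of j "\<lambda>j. k \<le> 2 ^ j"] by (simp add: lev_def)
    then show ?thesis unfolding Suc by simp
  qed (use that in simp)
  define L where "L = lev ` S"
  have fL: "finite L" using S by (simp add: L_def)
  have "(\<Sum>k\<in>S. w k * A k) = (\<Sum>j\<in>L. \<Sum>k\<in>{k\<in>S. lev k = j}. w k * A k)"
    by (rule sum.group[symmetric, OF S(1) fL]) (simp add: L_def)
  also have "\<dots> \<le> (\<Sum>j\<in>L. Z * q ^ j)"
  proof (rule sum_mono)
    fix j assume "j \<in> L"
    have "(\<Sum>k\<in>{k\<in>S. lev k = j}. w k * A k) \<le> (\<Sum>k\<in>{k\<in>S. lev k = j}. W j * A k)"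
    proof (rule sum_mono)
      fix k assume k: "k \<in> {k\<in>S. lev k = j}"
      have "real k \<le> real (2 ^ j)" using lev1[of k] k by (simp only: of_nat_le_iff) auto
      moreover have "real (2 ^ j) < real (2 * k)" using lev2[of k] S(2)[of k] k by (simp only: of_nat_less_iff) auto
      ultimately have "w k \<le> W j" using W(1)[of k j] k by simp
      then show "w k * A k \<le> W j * A k" using A k by (intro mult_right_mono) auto
    qed
    also have "\<dots> \<le> W j * (\<Sum>k\<in>{k\<in>S. real k \<le> 2 ^ j}. A k)"
      unfolding sum_distrib_left[symmetric]
    proof (rule mult_left_mono[OF sum_mono2 W(2)])
      show "{k\<in>S. lev k = j} \<subseteq> {k\<in>S. real k \<le> 2 ^ j}"
      proof
        fix k assume k: "k \<in> {k\<in>S. lev k = j}"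
        have "real k \<le> real (2 ^ j)" using lev1[of k] k by (simp only: of_nat_le_iff) auto
        then show "k \<in> {k\<in>S. real k \<le> 2 ^ j}" using k by simp
      qed
    qed (use S A in auto)
    also have "\<dots> \<le> W j * G j" by (rule mult_left_mono[OF G W(2)])
    also have "\<dots> \<le> Z * q ^ j" by (rule Z)
    finally show "(\<Sum>k\<in>{k\<in>S. lev k = j}. w k * A k) \<le> Z * q ^ j" .
  qed
  also have "\<dots> = Z * (\<Sum>j\<in>L. q ^ j)" by (simp add: sum_distrib_left)
  also have "(\<Sum>j\<in>L. q ^ j) \<le> (\<Sum>j. q ^ j)"
    by (rule sum_le_suminf[OF _ fL]) (use q in \<open>auto simp: summable_geometric\<close>)
  also have "(\<Sum>j. q ^ j) = 1 / (1 - q)" using q by (intro suminf_geometric) simp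
  finally show ?thesis using Z0 by (simp add: mult_left_mono)
qed

text \<open>Write n = d f h. The symbol of \<open>k\<close> modulo \<open>f\<close> is bounded by 1
  and leaves the sum over \<open>n\<close>, so only the large sieve for the shorter variable
  \<open>h\<close> is needed.\<close>

lemma sieve_bound_scaled:
  assumes B: "sieve_bound K (\<lambda>_. 1) J (osf L) B" and d: "d > 0" "f > 0" and E: "finite E"
    "\<And>n. n \<in> E \<Longrightarrow> odd n \<and> squarefree n \<and> d dvd n \<and> f dvd n div d \<and> real (n div d) \<le> L * real f"
  shows "sieve_bound K (\<lambda>_. 1) (\<lambda>k n. J k (n div d)) E B"
  unfolding sieve_bound_def
proof (rule allI)
  fix b :: "nat \<Rightarrow> complex"
  define h where "h n = n div d div f" for n
  have n: "n = d * (f * h n)" if "n \<in> E" for n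
    using E(2)[OF that] d by (simp add: h_def)
  have inj: "inj_on h E" by (rule inj_onI) (metis n)
  have hosf: "h n \<in> osf L" if m: "n \<in> E" for n
  proof -
    have "real f * real (h n) \<le> L * real f" using E(2)[OF m] d n[OF m] by (metis nonzero_mult_div_cancel_left of_nat_mult less_numeral_extra(3))
    then have "real (h n) \<le> L" using d by (simp add: mult.commute)
    moreover have "odd (h n)" using E(2)[OF m] n[OF m] by (metis even_mult_iff)
    moreover have "squarefree (h n)" using E(2)[OF m] n[OF m] by (metis squarefree_multD(2))
    ultimately show ?thesis by (simp add: osf_def)
  qed
  define c where "c n = (if n \<in> h ` E then b (inv_into E h n) else 0)" for n
  have ch: "c (h n) = b n" if "n \<in> E" for n using that inj by (simp add: c_def)
  have tr: "(\<Sum>n\<in>osf L. c n * g n) = (\<Sum>n\<in>E. b n * g (h n))" for g :: "nat \<Rightarrow> complex"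
  proof -
    have "(\<Sum>n\<in>osf L. c n * g n) = (\<Sum>n\<in>h ` E. c n * g n)"
      by (rule sum.mono_neutral_right) (use hosf in \<open>auto simp: c_def\<close>)
    also have "\<dots> = (\<Sum>n\<in>E. c (h n) * g (h n))" by (rule sum.reindex_cong[OF inj refl refl])
    finally show ?thesis by (simp add: ch cong: sum.cong)
  qed
  have trn: "(\<Sum>n\<in>osf L. (norm (c n))\<^sup>2) = (\<Sum>n\<in>E. (norm (b n))\<^sup>2)"
  proof -
    have "(\<Sum>n\<in>osf L. (norm (c n))\<^sup>2) = (\<Sum>n\<in>h ` E. (norm (c n))\<^sup>2)"
      by (rule sum.mono_neutral_right) (use hosf in \<open>auto simp: c_def\<close>)
    also have "\<dots> = (\<Sum>n\<in>E. (norm (c (h n)))\<^sup>2)" by (rule sum.reindex_cong[OF inj refl refl])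
    finally show ?thesis by (simp add: ch cong: sum.cong)
  qed
  have le: "norm (\<Sum>n\<in>E. b n * of_real (J k (n div d))) \<le> norm (\<Sum>n\<in>osf L. c n * of_real (J k n))" for k
  proof -
    have "b n * of_real (J k (n div d)) = of_real (J k f) * (b n * of_real (J k (h n)))" if m: "n \<in> E" for n
    proof -
      have "h n > 0" using hosf[OF m] by (auto simp: osf_def intro: odd_pos)
      moreover have "n div d = f * h n" using n[OF m] d by (metis nonzero_mult_div_cancel_left less_numeral_extra(3))
      ultimately show ?thesis using d by (simp add: J_mult_right)
    qed
    then have "(\<Sum>n\<in>E. b n * of_real (J k (n div d))) = of_real (J k f) * (\<Sum>n\<in>E. b n * of_real (J k (h n)))"
      unfolding sum_distrib_left by (rule sum.cong[OF refl])
    then have "norm (\<Sum>n\<in>E. b n * of_real (J k (n div d))) = \<bar>J k f\<bar> * norm (\<Sum>n\<in>osf L. c n * of_real (J k n))"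
      unfolding tr by (simp add: norm_mult)
    then show ?thesis using mult_right_mono[OF abs_J_le[of k f] norm_ge_zero] by simp
  qed
  have "(\<Sum>k\<in>K. 1 * (norm (\<Sum>n\<in>E. b n * of_real (J k (n div d))))\<^sup>2) \<le> (\<Sum>k\<in>K. 1 * (norm (\<Sum>n\<in>osf L. c n * of_real (J k n)))\<^sup>2)"
    by (intro sum_mono mult_left_mono power_mono le) simp_all
  also have "\<dots> \<le> B * (\<Sum>n\<in>osf L. (norm (c n))\<^sup>2)" using B unfolding sieve_bound_def by blast
  finally show "(\<Sum>k\<in>K. 1 * (norm (\<Sum>n\<in>E. b n * of_real (J k (n div d))))\<^sup>2) \<le> B * (\<Sum>n\<in>E. (norm (b n))\<^sup>2)"
    unfolding trn .
qed

text \<open>The hypothesis is used directly and after \<open>LS_flip\<close>. Which bound is smaller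
  depends on the relative size of the variables, and the estimates below use both.\<close>

lemma LS_both:
  assumes H: "\<And>M N. M \<ge> 1 \<Longrightarrow> N \<ge> 1 \<Longrightarrow> LS M N (C * (M * N) powr \<eta> * (M + N powr \<xi>))" and C: "C > 0"
    and MN: "M \<ge> 1" "N \<ge> 1"
  shows "sieve_bound (sqf M) (\<lambda>_. 1) J (osf N) (4 * C * (M * N) powr \<eta> * min (N + M powr \<xi>) (M + N powr \<xi>))"
    "LS M N (2 * C * (M * N) powr \<eta> * (N + M powr \<xi>))"
proof -
  have C0: "C * (M * N) powr \<eta> * (M + N powr \<xi>) \<ge> 0" "C * (N * M) powr \<eta> * (N + M powr \<xi>) \<ge> 0"
    using C MN by simp_all
  have 1: "sieve_bound (sqf M) (\<lambda>_. 1) J (osf N) (2 * (C * (M * N) powr \<eta> * (M + N powr \<xi>)))"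
    by (rule LS_all[OF H[OF MN] C0(1)])
  have 2: "LS M N (2 * (C * (N * M) powr \<eta> * (N + M powr \<xi>)))"
    by (rule LS_flip[OF H[OF MN(2,1)] C0(2)])
  show "LS M N (2 * C * (M * N) powr \<eta> * (N + M powr \<xi>))" using 2 by (simp only: mult.assoc mult.commute[of N M])
  have 3: "sieve_bound (sqf M) (\<lambda>_. 1) J (osf N) (2 * (2 * (C * (N * M) powr \<eta> * (N + M powr \<xi>))))"
    by (rule LS_all[OF 2]) (use C0 in simp)
  show "sieve_bound (sqf M) (\<lambda>_. 1) J (osf N) (4 * C * (M * N) powr \<eta> * min (N + M powr \<xi>) (M + N powr \<xi>))"
  proof (cases "N + M powr \<xi> \<le> M + N powr \<xi>")
    case True
    then show ?thesis using 3 by (simp add: min_def mult.commute[of N M] mult.assoc)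
  next
    case False
    show ?thesis by (rule sieve_bound_mono_right[OF 1]) (use False C C0 MN in \<open>simp add: min_def mult.assoc\<close>)
  qed
qed

text \<open>Writing \<kappa>^\<eta> as \<kappa>^(2\<eta>) \<kappa>^(-\<eta>) and paying for the
  first factor with a power of 2 N leaves the decay in \<kappa> that makes the dyadic sum
  converge.\<close>

lemma powr_shift_le:
  assumes "\<eta> > 0" "\<kappa> \<ge> 1" "\<kappa> \<le> 2 * N" "0 < L" "L \<le> 2 * N" "N \<ge> (1::real)"
  shows "(\<kappa> * L) powr \<eta> \<le> (2 * N) powr (3 * \<eta>) * \<kappa> powr (- \<eta>)"
proof -
  have "(\<kappa> * L) powr \<eta> \<le> \<kappa> powr \<eta> * (2 * N) powr \<eta>"
  proof -
    have "(\<kappa> * L) powr \<eta> = \<kappa> powr \<eta> * L powr \<eta>" using assms by (simp add: powr_mult)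
    also have "\<dots> \<le> \<kappa> powr \<eta> * (2 * N) powr \<eta>" using assms by (intro mult_left_mono powr_mono2) simp_all
    finally show ?thesis .
  qed
  also have "\<kappa> powr \<eta> = \<kappa> powr (2 * \<eta>) * \<kappa> powr (- \<eta>)" by (simp add: powr_add[symmetric])
  also have "\<kappa> powr (2 * \<eta>) * \<kappa> powr (- \<eta>) * (2 * N) powr \<eta> \<le> (2 * N) powr (2 * \<eta>) * \<kappa> powr (- \<eta>) * (2 * N) powr \<eta>"
    using assms by (intro mult_right_mono powr_mono2) simp_all
  also have "\<dots> = (2 * N) powr (3 * \<eta>) * \<kappa> powr (- \<eta>)"
  proof -
    have "(2 * N) powr (3 * \<eta>) = (2 * N) powr (2 * \<eta>) * (2 * N) powr \<eta>" by (simp add: powr_add[symmetric])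
    then show ?thesis by simp
  qed
  finally show ?thesis .
qed

section \<open>Dyadic estimates for the kernel weights\<close>

lemma two_powr_le: "0 \<le> \<xi> \<Longrightarrow> \<xi> \<le> 2 \<Longrightarrow> 2 powr \<xi> \<le> (4::real)"
proof -
  assume "0 \<le> \<xi>" "\<xi> \<le> 2"
  then have "2 powr \<xi> \<le> 2 powr (2::real)" by (intro powr_mono) simp_all
  then show ?thesis by simp
qed

text \<open>The second term is the contribution near k = K: for K = N^2/M the factor
  \<open>M / N\<close> is \<open>sqrt (M / K)\<close>, the size of the kernel there, and K^\<xi>
  comes from the large sieve for the dual variable.\<close>

definition bd :: "real \<Rightarrow> real \<Rightarrow> real \<Rightarrow> real \<Rightarrow> real" where
  "bd M N K \<xi> = M + M / N * K powr \<xi>"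

context
  fixes M N K \<xi> \<eta> :: real
  assumes xi: "1 \<le> \<xi>" "\<xi> \<le> 2" and eta: "0 < \<eta>" "\<eta> \<le> 1 / 2"
    and NM: "1 \<le> N" "N \<le> M" "M \<le> N\<^sup>2" and K: "K = N\<^sup>2 / M"
begin

lemma K_bounds: "1 \<le> K" "K \<le> N" "K > 0" "M > 0" "N > 0" "N ^ 3 / (M * K\<^sup>2) = M / N" "sqrt (M / K) = M / N"
proof -
  show p: "M > 0" "N > 0" using NM by simp_all
  show "1 \<le> K" using NM p by (simp add: K)
  then show "K > 0" by simp
  have "N * N \<le> N * M" using NM by (intro mult_left_mono) simp_all
  then show "K \<le> N" using p by (simp add: K pos_divide_le_eq power2_eq_square)
  show "N ^ 3 / (M * K\<^sup>2) = M / N" using p by (simp add: K field_simps power2_eq_square power3_eq_cube)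
  have "M / K = (M / N)\<^sup>2" using p by (simp add: K power2_eq_square)
  then show "sqrt (M / K) = M / N" using p by simp
qed

text \<open>In the minimum, the first entry is paired with \<open>L\<close> and gives 4 M/f. The
  second is paired with \<kappa>^\<xi>; as \<xi> > 1/2, the product increases with \<kappa> and is
  worst at 2 K.\<close>

lemma weight_small:
  assumes k: "1 \<le> \<kappa>" "\<kappa> < 2 * K" and n: "0 < n" "n \<le> N" and f: "1 \<le> f" and L: "L = 2 * n / f" "1 \<le> L"
  shows "min (2 * M / n) (sqrt (2 * M / \<kappa>) / f) * ((\<kappa> * L) powr \<eta> * min (L + \<kappa> powr \<xi>) (\<kappa> + L powr \<xi>))
    \<le> 8 * ((2 * N) powr (3 * \<eta>) * \<kappa> powr (- \<eta>)) * bd M N K \<xi> / f"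
proof -
  note p = K_bounds
  have Ln: "L \<le> 2 * N"
  proof -
    have "2 * n / f \<le> 2 * n / 1" using f n by (intro divide_left_mono) simp_all
    then show ?thesis using n by (simp add: L(1))
  qed
  define P where "P = (\<kappa> * L) powr \<eta>"
  define mn where "mn = min (2 * M / n) (sqrt (2 * M / \<kappa>) / f)"
  have mn0: "0 \<le> mn" "mn \<le> 2 * M / n" "mn \<le> sqrt (2 * M / \<kappa>) / f" using p n f k by (auto simp: mn_def)
  have "mn * min (L + \<kappa> powr \<xi>) (\<kappa> + L powr \<xi>) \<le> mn * (L + \<kappa> powr \<xi>)"
    using mn0 by (intro mult_left_mono) simp_all
  also have "\<dots> = mn * L + mn * \<kappa> powr \<xi>" by (simp add: distrib_left)
  also have "\<dots> \<le> 2 * M / n * L + sqrt (2 * M / \<kappa>) / f * \<kappa> powr \<xi>"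
    using mn0 L by (intro add_mono mult_right_mono) simp_all
  also have "2 * M / n * L = 4 * M / f" using n by (simp add: L(1))
  also have "sqrt (2 * M / \<kappa>) / f * \<kappa> powr \<xi> \<le> 4 * (M / N * K powr \<xi>) / f"
  proof -
    have "sqrt (2 * M / \<kappa>) * \<kappa> powr \<xi> = sqrt (2 * M) * \<kappa> powr (\<xi> - 1 / 2)"
      using k p by (simp add: real_sqrt_divide powr_diff powr_half_sqrt)
    also have "\<dots> \<le> sqrt (2 * M) * (2 * K) powr (\<xi> - 1 / 2)"
      using k xi p by (intro mult_left_mono powr_mono2) simp_all
    also have "\<dots> = sqrt (2 * M) / sqrt (2 * K) * (2 * K) powr \<xi>"
      using p by (simp add: powr_diff powr_half_sqrt)
    also have "sqrt (2 * M) / sqrt (2 * K) = sqrt (M / K)" by (simp add: real_sqrt_divide real_sqrt_mult)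
    also have "sqrt (M / K) * (2 * K) powr \<xi> = M / N * (2 powr \<xi> * K powr \<xi>)" using p by (simp add: powr_mult)
    also have "\<dots> \<le> M / N * (4 * K powr \<xi>)"
      using two_powr_le xi p by (intro mult_left_mono mult_right_mono) simp_all
    finally have "sqrt (2 * M / \<kappa>) * \<kappa> powr \<xi> / f \<le> M / N * (4 * K powr \<xi>) / f"
      using f by (intro divide_right_mono) simp_all
    then show ?thesis by (simp add: mult_ac)
  qed
  finally have "mn * min (L + \<kappa> powr \<xi>) (\<kappa> + L powr \<xi>) \<le> 4 * bd M N K \<xi> / f"
    by (simp add: bd_def distrib_left add_divide_distrib)
  also have "\<dots> \<le> 8 * bd M N K \<xi> / f"
  proof (rule divide_right_mono)
    have "0 \<le> bd M N K \<xi>" using p(4,5) by (simp add: bd_def)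
    then show "4 * bd M N K \<xi> \<le> 8 * bd M N K \<xi>" by simp
  qed (use f in simp)
  finally have "P * (mn * min (L + \<kappa> powr \<xi>) (\<kappa> + L powr \<xi>)) \<le> P * (8 * bd M N K \<xi> / f)"
    by (intro mult_left_mono) (simp_all add: P_def)
  also have "\<dots> \<le> ((2 * N) powr (3 * \<eta>) * \<kappa> powr (- \<eta>)) * (8 * bd M N K \<xi> / f)"
    unfolding P_def using eta k p L Ln NM f by (intro mult_right_mono powr_shift_le) (simp_all add: bd_def)
  finally show ?thesis unfolding P_def mn_def by (simp add: mult_ac)
qed

text \<open>For \<kappa> <= N the bound L + \<kappa>^\<xi> divided by \<kappa>^2 is nonincreasing
  because \<xi> <= 2, so the worst case is \<kappa> = K. For \<kappa> > N the other bound \<kappa> +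
  L^\<xi> takes over.\<close>

lemma weight_large:
  assumes k: "1 \<le> \<kappa>" "K < \<kappa>" and n: "0 < n" "n \<le> N" and f: "1 \<le> f" and L: "L = 2 * n / f" "1 \<le> L" and Q: "Q \<ge> 0"
  shows "4 * Q * n ^ 3 / (M * \<kappa>\<^sup>2 * f) * ((\<kappa> * L) powr \<eta> * min (L + \<kappa> powr \<xi>) (\<kappa> + L powr \<xi>))
    \<le> 20 * Q * ((2 * N) powr (3 * \<eta>) * \<kappa> powr (- \<eta>)) * bd M N K \<xi> / f"
proof -
  note p = K_bounds
  have Ln: "L \<le> 2 * N"
  proof -
    have "2 * n / f \<le> 2 * n / 1" using f n by (intro divide_left_mono) simp_all
    then show ?thesis using n by (simp add: L(1))
  qed
  define P where "P = (\<kappa> * L) powr \<eta>"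
  define T where "T = (2 * N) powr (3 * \<eta>) * \<kappa> powr (- \<eta>)"
  define mn where "mn = min (L + \<kappa> powr \<xi>) (\<kappa> + L powr \<xi>)"
  have mn0: "0 \<le> mn" using k L by (simp add: mn_def)
  have main: "N ^ 3 / (M * \<kappa>\<^sup>2) * (P * mn) \<le> 5 * T * bd M N K \<xi>"
  proof (cases "\<kappa> \<le> N")
    case True
    have "P \<le> T" unfolding P_def T_def using eta k p L Ln NM True by (intro powr_shift_le) simp_all
    have "mn / \<kappa>\<^sup>2 \<le> (2 * N + \<kappa> powr \<xi>) / \<kappa>\<^sup>2" using Ln by (intro divide_right_mono) (simp_all add: mn_def)
    also have "\<dots> = 2 * N / \<kappa>\<^sup>2 + \<kappa> powr (\<xi> - 2)"
      using k by (simp add: add_divide_distrib powr_diff)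
    also have "\<dots> \<le> 2 * N / K\<^sup>2 + K powr (\<xi> - 2)"
    proof (intro add_mono divide_left_mono)
      show "\<kappa> powr (\<xi> - 2) \<le> K powr (\<xi> - 2)" using k p xi by (intro powr_mono2') simp_all
      show "K\<^sup>2 \<le> \<kappa>\<^sup>2" using k p by (intro power_mono) simp_all
    qed (use k p in simp_all)
    also have "\<dots> = (2 * N + K powr \<xi>) / K\<^sup>2" using p by (simp add: add_divide_distrib powr_diff)
    finally have 1: "mn / \<kappa>\<^sup>2 \<le> (2 * N + K powr \<xi>) / K\<^sup>2" .
    have "N ^ 3 / (M * \<kappa>\<^sup>2) * (P * mn) = N ^ 3 / M * (P * (mn / \<kappa>\<^sup>2))" by simp
    also have "\<dots> \<le> N ^ 3 / M * (T * ((2 * N + K powr \<xi>) / K\<^sup>2))"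
      using p \<open>P \<le> T\<close> 1 mn0 by (intro mult_left_mono mult_mono) (simp_all add: T_def)
    also have "\<dots> = T * (N ^ 3 / (M * K\<^sup>2) * (2 * N + K powr \<xi>))" by simp
    also have "N ^ 3 / (M * K\<^sup>2) * (2 * N + K powr \<xi>) = 2 * M + M / N * K powr \<xi>" unfolding p(6) using p by (simp add: distrib_left)
    also have "T * (2 * M + M / N * K powr \<xi>) \<le> T * (5 * bd M N K \<xi>)"
    proof (rule mult_left_mono)
      have "0 \<le> M / N * K powr \<xi>" using p by simp
      then show "2 * M + M / N * K powr \<xi> \<le> 5 * bd M N K \<xi>"
        using p(4) by (simp only: bd_def distrib_left)
    qed (simp add: T_def)
    finally show ?thesis by simp
  next
    case False
    then have kN: "N \<le> \<kappa>" by simp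
    have "L powr \<xi> \<le> (2 * N) powr \<xi>" using Ln L xi by (intro powr_mono2) simp_all
    also have "\<dots> = 2 powr \<xi> * N powr \<xi>" using p by (simp add: powr_mult)
    also have "\<dots> \<le> 4 * N powr \<xi>" using two_powr_le xi by (intro mult_right_mono) simp_all
    also have "N powr \<xi> = N * N powr (\<xi> - 1)" using p by (simp add: powr_diff)
    also have "4 * (N * N powr (\<xi> - 1)) \<le> 4 * (\<kappa> * N powr (\<xi> - 1))" using kN by (intro mult_left_mono mult_right_mono) simp_all
    finally have "L powr \<xi> \<le> 4 * (\<kappa> * N powr (\<xi> - 1))" .
    moreover have "\<kappa> * 1 \<le> \<kappa> * N powr (\<xi> - 1)" using k NM xi by (intro mult_left_mono ge_one_powr_ge_zero) simp_all
    ultimately have mn: "mn \<le> 5 * (\<kappa> * N powr (\<xi> - 1))" by (simp add: mn_def min_le_iff_disj)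
    have "P \<le> \<kappa> powr \<eta> * (2 * N) powr \<eta>" 
    proof -
      have "(\<kappa> * L) powr \<eta> = \<kappa> powr \<eta> * L powr \<eta>" using k L(2) by (simp add: powr_mult)
      also have "\<dots> \<le> \<kappa> powr \<eta> * (2 * N) powr \<eta>" using L(2) Ln eta by (intro mult_left_mono powr_mono2) simp_all
      finally show ?thesis unfolding P_def .
    qed
    \<comment> \<open>As \<eta> <= 1/2, the power 2 \<eta> - 1 is nonpositive and may be evaluated
      at N; the factor \<kappa>^(-\<eta>) is kept for the dyadic sum.\<close>
    also have "\<kappa> powr \<eta> = \<kappa> * (\<kappa> powr (2 * \<eta> - 1) * \<kappa> powr (- \<eta>))"
    proof -
      have "\<kappa> powr \<eta> = \<kappa> powr (1 + (2 * \<eta> - 1) + (- \<eta>))" by simp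
      also have "\<dots> = \<kappa> * (\<kappa> powr (2 * \<eta> - 1) * \<kappa> powr (- \<eta>))" unfolding powr_add using k by simp
      finally show ?thesis .
    qed
    also have "\<dots> * (2 * N) powr \<eta> \<le> \<kappa> * (N powr (2 * \<eta> - 1) * \<kappa> powr (- \<eta>)) * (2 * N) powr \<eta>"
      using k kN eta p by (intro mult_right_mono mult_left_mono powr_mono2') simp_all
    also have "N powr (2 * \<eta> - 1) = N powr (2 * \<eta>) / N" using p by (simp add: powr_diff)
    finally have P: "P \<le> \<kappa> / N * (N powr (2 * \<eta>) * (2 * N) powr \<eta> * \<kappa> powr (- \<eta>))" by (simp add: mult_ac)
    have "N powr (2 * \<eta>) * (2 * N) powr \<eta> * \<kappa> powr (- \<eta>) \<le> T"
    proof -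
      have "N powr (2 * \<eta>) \<le> (2 * N) powr (2 * \<eta>)" using p eta by (intro powr_mono2) simp_all
      then have "N powr (2 * \<eta>) * (2 * N) powr \<eta> * \<kappa> powr (- \<eta>) \<le> (2 * N) powr (2 * \<eta>) * (2 * N) powr \<eta> * \<kappa> powr (- \<eta>)"
        by (intro mult_right_mono) simp_all
      also have "(2 * N) powr (2 * \<eta>) * (2 * N) powr \<eta> = (2 * N) powr (3 * \<eta>)" by (simp add: powr_add[symmetric])
      finally show ?thesis unfolding T_def .
    qed
    then have P: "P \<le> \<kappa> / N * T" using order.trans[OF P mult_left_mono] k p by simp
    have T0: "T \<ge> 0" by (simp add: T_def)
    have "P * mn \<le> \<kappa> / N * T * (5 * (\<kappa> * N powr (\<xi> - 1)))"
      using P mn mn0 k p T0 by (intro mult_mono) simp_all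
    then have "N ^ 3 / (M * \<kappa>\<^sup>2) * (P * mn) \<le> N ^ 3 / (M * \<kappa>\<^sup>2) * (\<kappa> / N * T * (5 * (\<kappa> * N powr (\<xi> - 1))))"
      using p k by (intro mult_left_mono) simp_all
    also have "\<dots> = 5 * T * (N\<^sup>2 / M * N powr (\<xi> - 1))"
      using p k by (simp add: power2_eq_square power3_eq_cube)
    also have "N powr (\<xi> - 1) = N * N powr (\<xi> - 2)"
    proof -
      have "N powr (\<xi> - 1) = N powr (1 + (\<xi> - 2))" by simp
      then show ?thesis unfolding powr_add using p by simp
    qed
    also have "5 * T * (N\<^sup>2 / M * (N * N powr (\<xi> - 2))) \<le> 5 * T * (N\<^sup>2 / M * (N * K powr (\<xi> - 2)))"
      using p xi T0 by (intro mult_left_mono powr_mono2') simp_all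
    also have "N\<^sup>2 / M * (N * K powr (\<xi> - 2)) = N ^ 3 / (M * K\<^sup>2) * K powr \<xi>"
      using p(1-5) by (simp add: powr_diff power2_eq_square power3_eq_cube)
    also have "5 * T * (N ^ 3 / (M * K\<^sup>2) * K powr \<xi>) \<le> 5 * T * bd M N K \<xi>"
      unfolding p(6) using p T0 by (intro mult_left_mono) (simp_all add: bd_def)
    finally show ?thesis .
  qed
  have "4 * Q * n ^ 3 / (M * \<kappa>\<^sup>2 * f) * (P * mn) = 4 * Q / f * (n ^ 3 / (M * \<kappa>\<^sup>2) * (P * mn))" by (simp add: mult_ac)
  also have "\<dots> \<le> 4 * Q / f * (N ^ 3 / (M * \<kappa>\<^sup>2) * (P * mn))"
    using n p k f Q mn0 by (intro mult_left_mono mult_right_mono divide_right_mono power_mono) (simp_all add: P_def)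
  also have "\<dots> \<le> 4 * Q / f * (5 * T * bd M N K \<xi>)" using main f Q by (intro mult_left_mono) simp_all
  finally show ?thesis unfolding P_def mn_def T_def by simp
qed

end

text \<open>The bounds of \<open>kernel_coeff_bounds\<close> for l = 1/M, with only one of the two
  divisors retained. The kernel is dominated by the weight for \<open>f\<close> and by the one for
  \<open>g\<close>, hence by their geometric mean.\<close>

definition wt :: "real \<Rightarrow> real \<Rightarrow> real \<Rightarrow> real \<Rightarrow> nat \<Rightarrow> real" where
  "wt M K n f k = (if real k \<le> K then min (2 * M / n) (sqrt (M / real k) / f)
     else quartic_const * n ^ 3 / (M * (real k)\<^sup>2 * f))"

text \<open>4 C comes from \<open>LS_both\<close>, 8 and 20 from \<open>weight_small\<close> and
  \<open>weight_large\<close>, and the denominator from the sum over dyadic levels.\<close>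

definition wtc :: "real \<Rightarrow> real \<Rightarrow> real" where
  "wtc C \<eta> = 4 * C * (8 + 20 * quartic_const) / (1 - 2 powr (- \<eta>))"

lemma wt_nonneg: "M > 0 \<Longrightarrow> n > 0 \<Longrightarrow> f > 0 \<Longrightarrow> wt M K n f k \<ge> 0"
  using quartic_const_nonneg by (simp add: wt_def)

lemma sieve_bound_wt:
  assumes xi: "1 \<le> \<xi>" "\<xi> \<le> 2" and eta: "0 < \<eta>" "\<eta> \<le> 1 / 2"
    and NM: "1 \<le> N" "N \<le> M" "M \<le> N\<^sup>2" and K: "K = N\<^sup>2 / M"
    and H: "\<And>M N. M \<ge> 1 \<Longrightarrow> N \<ge> 1 \<Longrightarrow> LS M N (C * (M * N) powr \<eta> * (M + N powr \<xi>))" and C: "C > 0"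
    and df: "d > 0" "f > 0" and n0: "0 < n0" "n0 \<le> N"
    and E: "finite E" "\<And>n. n \<in> E \<Longrightarrow> odd n \<and> squarefree n \<and> d dvd n \<and> f dvd n div d \<and> real n \<le> 2 * n0"
  shows "sieve_bound (sqf X) (wt M K (n0 / d) f) (\<lambda>k n. J k (n div d)) E
     (wtc C \<eta> * (2 * N) powr (3 * \<eta>) * bd M N K \<xi> / f)"
proof (cases "E = {}")
  case True
  then show ?thesis by (simp add: sieve_bound_def)
next
  case False
  define n' where "n' = n0 / d"
  define L where "L = 2 * n' / f"
  have df': "real d \<ge> 1" "real f \<ge> 1" using df by simp_all
  have p: "M > 0" "n' > 0" using NM n0 df by (simp_all add: n'_def)
  have n'N: "n' \<le> N"
  proof -
    have "n0 / d \<le> n0 / 1" using n0 df' by (intro divide_left_mono) simp_all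
    then show ?thesis using n0 by (simp add: n'_def)
  qed
  have EL: "real (n div d) \<le> L * real f" if "n \<in> E" for n
  proof -
    have "real (n div d) = real n / real d" using E(2)[OF that] by (simp add: real_of_nat_div)
    also have "\<dots> \<le> 2 * n0 / d" using E(2)[OF that] by (intro divide_right_mono) simp_all
    finally show ?thesis using df by (simp add: L_def n'_def)
  qed
  \<comment> \<open>A member of \<open>E\<close> has f <= n/d <= L f, so \<open>L \<ge> 1\<close>
    and the large sieve hypothesis is applicable; this is why the empty set is treated
    apart.\<close>
  have L1: "L \<ge> 1"
  proof -
    obtain n where n: "n \<in> E" using False by blast
    have "n > 0" using E(2)[OF n] odd_pos by blast
    then have "n div d \<noteq> 0" using E(2)[OF n] by (simp add: dvd_div_eq_0_iff)
    then have "f \<le> n div d" using E(2)[OF n] by (simp add: dvd_imp_le)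
    then have "real f \<le> L * real f" using EL[OF n] by linarith
    then show ?thesis using df by simp
  qed
  note pars = xi eta NM K
  define q where "q = 2 powr (- \<eta>)"
  have q: "0 \<le> q" "q < 1" using eta powr_less_mono[of "- \<eta>" 0 2] by (simp_all add: q_def)
  define Q where "Q = quartic_const"
  have Q0: "Q \<ge> 0" unfolding Q_def by (rule quartic_const_nonneg)
  \<comment> \<open>A dyadic level may straddle \<open>K\<close>, so the majorants of both ranges
    are added.\<close>
  define W where "W j = (if 2 ^ j < 2 * K then min (2 * M / n') (sqrt (2 * M / 2 ^ j) / f) else 0)
     + (if K < 2 ^ j then 4 * Q * n' ^ 3 / (M * (2 ^ j)\<^sup>2 * f) else 0)" for j :: nat
  have bd0: "bd M N K \<xi> \<ge> 0" using NM by (simp add: bd_def)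
  show ?thesis unfolding n'_def[symmetric] sieve_bound_def
  proof (rule allI)
    fix b :: "nat \<Rightarrow> complex"
    define nb where "nb = (\<Sum>n\<in>E. (norm (b n))\<^sup>2)"
    have nb0: "nb \<ge> 0" unfolding nb_def by (intro sum_nonneg) simp
    define A where "A k = (norm (\<Sum>n\<in>E. b n * of_real (J k (n div d))))\<^sup>2" for k
    define G where "G j = 4 * C * ((2 ^ j * L) powr \<eta> * min (L + (2 ^ j) powr \<xi>) (2 ^ j + L powr \<xi>)) * nb" for j :: nat
    define Z where "Z = 4 * C * (8 + 20 * Q) * (2 * N) powr (3 * \<eta>) * bd M N K \<xi> / f * nb"
    have "(\<Sum>k\<in>sqf X. wt M K n' f k * A k) \<le> Z / (1 - q)"
    proof (rule sum_dyadic_le[where W = W and G = G and q = q])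
      fix k j assume k: "k \<in> sqf X" "real k \<le> 2 ^ j" "2 ^ j < 2 * real k"
      have k0: "real k > 0" using sqf_pos[OF k(1)] by simp
      show "wt M K n' f k \<le> W j"
      proof (cases "real k \<le> K")
        case True
        have "2 ^ j < 2 * K" using True k by linarith
        have "M / real k \<le> 2 * M / 2 ^ j" using k k0 p by (simp add: field_simps)
        then have "sqrt (M / real k) / f \<le> sqrt (2 * M / 2 ^ j) / f" by (intro divide_right_mono) simp_all
        then have "min (2 * M / n') (sqrt (M / real k) / f) \<le> min (2 * M / n') (sqrt (2 * M / 2 ^ j) / f)" by (rule min.mono[OF order_refl])
        then show ?thesis using True \<open>2 ^ j < 2 * K\<close> Q0 p by (simp add: wt_def W_def add_increasing2)
      next
        case False
        have "K < 2 ^ j" using False k by linarith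
        have "(2 ^ j)\<^sup>2 \<le> (2 * real k)\<^sup>2" using k by (intro power_mono) simp_all
        then have "Q * n' ^ 3 / (M * (real k)\<^sup>2 * f) \<le> Q * n' ^ 3 / (M * ((2 ^ j)\<^sup>2 / 4) * f)"
          using Q0 p k0 df by (intro divide_left_mono mult_right_mono mult_left_mono) (simp_all add: power_mult_distrib)
        also have "\<dots> = 4 * Q * n' ^ 3 / (M * (2 ^ j)\<^sup>2 * f)" by simp
        finally show ?thesis using False \<open>K < 2 ^ j\<close> p df by (simp add: wt_def W_def Q_def[symmetric] add_increasing)
      qed
    next
      fix j :: nat
      show "W j \<ge> 0" using p Q0 by (simp add: W_def)
      have "sieve_bound (sqf (2 ^ j)) (\<lambda>_. 1) (\<lambda>k n. J k (n div d)) E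
        (4 * C * (2 ^ j * L) powr \<eta> * min (L + (2 ^ j) powr \<xi>) (2 ^ j + L powr \<xi>))"
        by (rule sieve_bound_scaled[OF LS_both(1)[OF H C _ L1] df E(1)]) (use E(2) EL in auto)
      from sieve_boundD[OF this, of b]
      have "(\<Sum>k\<in>sqf (2 ^ j). A k) \<le> G j" by (simp add: A_def G_def nb_def mult.assoc)
      moreover have "(\<Sum>k\<in>{k\<in>sqf X. real k \<le> 2 ^ j}. A k) \<le> (\<Sum>k\<in>sqf (2 ^ j). A k)"
        by (rule sum_mono2) (auto simp: A_def, auto simp: sqf_def)
      ultimately show "(\<Sum>k\<in>{k\<in>sqf X. real k \<le> 2 ^ j}. A k) \<le> G j" by linarith
      define T where "T = (2 * N) powr (3 * \<eta>) * (2 ^ j) powr (- \<eta>)"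
      define R where "R = (2 ^ j * L) powr \<eta> * min (L + (2 ^ j) powr \<xi>) (2 ^ j + L powr \<xi>)"
      have qj: "(2 ^ j) powr (- \<eta>) = q ^ j"
        unfolding q_def by (simp add: powr_realpow[symmetric] powr_powr mult.commute)
      have T0: "T * bd M N K \<xi> / f \<ge> 0" using bd0 by (simp add: T_def)
      have "(if 2 ^ j < 2 * K then min (2 * M / n') (sqrt (2 * M / 2 ^ j) / f) else 0) * R \<le> 8 * T * bd M N K \<xi> / f"
        using weight_small[OF pars _ _ p(2) n'N df'(2) L_def L1, of "2 ^ j"] T0 unfolding R_def T_def by simp
      moreover have "(if K < 2 ^ j then 4 * Q * n' ^ 3 / (M * (2 ^ j)\<^sup>2 * f) else 0) * R \<le> 20 * Q * T * bd M N K \<xi> / f"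
        using weight_large[OF pars _ _ p(2) n'N df'(2) L_def L1 Q0, of "2 ^ j"] T0 Q0 mult_nonneg_nonneg[OF Q0 T0] unfolding R_def T_def by simp
      ultimately have "W j * R \<le> 8 * T * bd M N K \<xi> / f + 20 * Q * T * bd M N K \<xi> / f"
        unfolding W_def distrib_right by (rule add_mono)
      also have "\<dots> = (8 + 20 * Q) * T * bd M N K \<xi> / f" by (simp add: distrib_right add_divide_distrib)
      finally have "4 * C * nb * (W j * R) \<le> 4 * C * nb * ((8 + 20 * Q) * T * bd M N K \<xi> / f)"
        using C nb0 by (intro mult_left_mono) simp_all
      then show "W j * G j \<le> Z * q ^ j" unfolding G_def Z_def R_def[symmetric] T_def qj by (simp only: mult_ac times_divide_eq_left times_divide_eq_right)
    qed (use q sqf_pos C Q0 bd0 nb0 df in \<open>auto simp: A_def Z_def\<close>)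
    also have "Z / (1 - q) = wtc C \<eta> * (2 * N) powr (3 * \<eta>) * bd M N K \<xi> / f * nb"
      by (simp add: Z_def wtc_def q_def Q_def)
    finally show "(\<Sum>k\<in>sqf X. wt M K n' f k * (norm (\<Sum>n\<in>E. b n * of_real (J k (n div d))))\<^sup>2)
      \<le> wtc C \<eta> * (2 * N) powr (3 * \<eta>) * bd M N K \<xi> / f * (\<Sum>n\<in>E. (norm (b n))\<^sup>2)"
      by (simp only: A_def nb_def)
  qed
qed

lemma abs_le_sqrt_mult: "\<bar>c\<bar> \<le> a \<Longrightarrow> \<bar>c\<bar> \<le> b \<Longrightarrow> \<bar>c\<bar> \<le> sqrt a * sqrt (b::real)"
proof -
  assume "\<bar>c\<bar> \<le> a" "\<bar>c\<bar> \<le> b"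
  then have "\<bar>c\<bar> * \<bar>c\<bar> \<le> a * b" by (intro mult_mono) simp_all
  then have "sqrt (\<bar>c\<bar> * \<bar>c\<bar>) \<le> sqrt (a * b)" by (rule real_sqrt_le_mono)
  then show ?thesis by (simp add: real_sqrt_mult)
qed

text \<open>The bounds decrease in the product \<open>f * g\<close>, so either divisor may be
  dropped. Exchanging the roles of \<open>f\<close> and \<open>g\<close> gives the second majorant
  for the geometric mean in \<open>bilinear_kernel\<close>.\<close>

lemma le_wt:
  assumes M: "M > 0" and n: "0 < n" "n \<le> M" and k: "k > 0" and fg: "f \<ge> (1::real)" "g \<ge> 1"
  shows "\<bar>kernel_coeff (1 / M) (real k \<le> K) k (f * g) n i\<bar> \<le> wt M K n f k"
    "\<bar>kernel_const (1 / M) (real k \<le> K) k (f * g)\<bar> \<le> wt M K n f k"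
proof -
  have pos: "1 / M > 0" "real k > 0" "f * g > 0" "n > 0" using M n k fg by simp_all
  note kc = kernel_coeff_bounds[OF pos]
  have s: "1 / sqrt (1 / M * real k * (f * g)\<^sup>2) \<le> sqrt (M / real k) / f"
  proof -
    have "1 / sqrt (1 / M * real k * (f * g)\<^sup>2) = sqrt (M / real k) / (f * g)"
      using M fg by (simp add: real_sqrt_mult real_sqrt_divide)
    also have "\<dots> \<le> sqrt (M / real k) / (f * 1)"
      using M fg by (intro divide_left_mono mult_left_mono) simp_all
    finally show ?thesis by simp
  qed
  show "\<bar>kernel_coeff (1 / M) (real k \<le> K) k (f * g) n i\<bar> \<le> wt M K n f k"
  proof (cases "real k \<le> K")
    case True
    then show ?thesis using kc(1)[of i] kc(2)[of i] s by (simp add: wt_def)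
  next
    case False
    have "1 * f \<le> (f * g) ^ 4"
    proof -
      have "f * 1 \<le> f * g" using fg by (intro mult_left_mono) simp_all
      also have "\<dots> \<le> (f * g) ^ 4" using mult_mono[OF fg] fg by (intro self_le_power) simp_all
      finally show ?thesis by simp
    qed
    then have "quartic_const * (1 / M) * n ^ 3 / ((real k)\<^sup>2 * (f * g) ^ 4) \<le> quartic_const * (1 / M) * n ^ 3 / ((real k)\<^sup>2 * f)"
      using M n k fg quartic_const_nonneg by (intro divide_left_mono mult_left_mono) simp_all
    then show ?thesis using False kc(3)[of i] by (simp add: wt_def mult_ac)
  qed
  show "\<bar>kernel_const (1 / M) (real k \<le> K) k (f * g)\<bar> \<le> wt M K n f k"
  proof (cases "real k \<le> K")
    case True
    have "1 \<le> 2 * M / n" using M n by simp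
    then show ?thesis using True kc(4,5) s by (simp add: wt_def)
  next
    case False
    then show ?thesis using kc(6) wt_nonneg[OF M n(1), of f K k] fg by simp
  qed
qed

text \<open>\<open>bilinear_kernel\<close> for fixed divisors, with the kernel expanded around the
  square of \<open>n0 / d\<close>. Everything depending on both \<open>n\<close> and
  \<open>m\<close> then sits in the quantity v with 1 + v = (1 + u n)(1 + u m).\<close>

lemma bilinear_wt:
  fixes a :: "nat \<Rightarrow> complex"
  assumes xi: "1 \<le> \<xi>" "\<xi> \<le> 2" and eta: "0 < \<eta>" "\<eta> \<le> 1 / 2"
    and NM: "1 \<le> N" "N \<le> M" "M \<le> N\<^sup>2" and K: "K = N\<^sup>2 / M"
    and H: "\<And>M N. M \<ge> 1 \<Longrightarrow> N \<ge> 1 \<Longrightarrow> LS M N (C * (M * N) powr \<eta> * (M + N powr \<xi>))" and C: "C > 0"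
    and dfg: "d > 0" "f > 0" "g > 0" and n0: "0 < n0" "n0 \<le> N"
    and E: "finite E" "\<And>n. n \<in> E \<Longrightarrow> odd n \<and> squarefree n \<and> n0 \<le> real n \<and> real n \<le> 33 / 32 * n0"
  shows "norm (\<Sum>k\<in>sqf X. \<Sum>n\<in>{n\<in>E. dvs d e f n}. \<Sum>m\<in>{m\<in>E. dvs d e g m}. a n * cnj (a m) * of_real (J k (n div d) * J k (m div d) *
        kernel (1 / M) (real k \<le> K) (real k) (real (f * g)) (real (n div d) * real (m div d))))
      \<le> 9 * (wtc C \<eta> * (2 * N) powr (3 * \<eta>) * bd M N K \<xi>) / sqrt (real f * real g)
        * L2_set (\<lambda>n. norm (a n)) {n\<in>E. dvs d e f n} * L2_set (\<lambda>n. norm (a n)) {n\<in>E. dvs d e g n}"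
proof -
  define Y where "Y = wtc C \<eta> * (2 * N) powr (3 * \<eta>) * bd M N K \<xi>"
  define n' where "n' = n0 / d"
  have M: "M > 0" using NM by simp
  have n': "n' > 0" "n' \<le> M"
  proof -
    show "n' > 0" using n0 dfg by (simp add: n'_def)
    have "n0 / d \<le> n0 / 1" using n0 dfg by (intro divide_left_mono) simp_all
    then show "n' \<le> M" using n0 NM by (simp add: n'_def)
  qed
  have Y0: "Y \<ge> 0"
  proof -
    have "2 powr (- \<eta>) \<le> 1" using eta powr_mono[of "- \<eta>" 0 2] by simp
    then have "wtc C \<eta> \<ge> 0" using C quartic_const_nonneg by (simp add: wtc_def)
    then show ?thesis using NM by (simp add: Y_def bd_def)
  qed
  define E1 where "E1 f = {n\<in>E. dvs d e f n}" for f
  have S: "sieve_bound (sqf X) (wt M K n' f) (\<lambda>k n. J k (n div d)) (E1 f) (Y / f)" if "f > 0" for f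
    unfolding n'_def Y_def
  proof (rule sieve_bound_wt[OF xi eta NM K H C dfg(1) that n0])
    show "finite (E1 f)" using E(1) by (simp add: E1_def)
    fix n assume "n \<in> E1 f"
    then have "n \<in> E" "dvs d e f n" by (simp_all add: E1_def)
    then show "odd n \<and> squarefree n \<and> d dvd n \<and> f dvd n div d \<and> real n \<le> 2 * n0"
      using E(2)[of n] n0 by (simp add: dvs_def)
  qed
  define x where "x n = real n / n0" for n
  have x: "1 \<le> x n" "x n \<le> 33 / 32" if "n \<in> E" for n
    using E(2)[OF that] n0 by (simp_all add: x_def field_simps)
  \<comment> \<open>The block ratio 33/32 gives u <= (33/32)^2 - 1 < 7/100, and q = 7/100 satisfies
    the requirement 2 q + q^2 <= 1/2 of \<open>bilinear_kernel\<close>.\<close>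
  define u where "u n = (x n)\<^sup>2 - 1" for n
  have u: "0 \<le> u n" "u n \<le> 7 / 100" if "n \<in> E" for n
  proof -
    show "0 \<le> u n" using x[OF that] by (simp add: u_def)
    have "(x n)\<^sup>2 \<le> (33 / 32)\<^sup>2" using x[OF that] by (intro power_mono) simp_all
    then show "u n \<le> 7 / 100" by (simp add: u_def power2_eq_square)
  qed
  \<comment> \<open>The factor (r/n'^2)^(3/2) of \<open>kernel_expansion\<close> is multiplicative
    and equals \<open>h n * h m\<close>.\<close>
  define h where "h n = x n * sqrt (x n)" for n
  have h: "\<bar>h n\<bar> \<le> 2" if "n \<in> E" for n
  proof -
    have "sqrt (x n) \<le> sqrt ((33 / 32)\<^sup>2)" using x[OF that] by (intro real_sqrt_le_mono) (simp add: power2_eq_square)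
    then have "x n * sqrt (x n) \<le> 33 / 32 * (33 / 32)" using x[OF that] by (intro mult_mono) simp_all
    then show ?thesis using x[OF that] by (simp add: h_def)
  qed
  define Hk where "Hk k n m = kernel (1 / M) (real k \<le> K) (real k) (real f * real g) (real (n div d) * real (m div d))" for k n m
  have "norm (\<Sum>k\<in>sqf X. \<Sum>n\<in>E1 f. \<Sum>m\<in>E1 g. a n * cnj (a m) * of_real (J k (n div d) * J k (m div d) * Hk k n m))
     \<le> 9 * (sqrt (Y / f * (Y / g)) * L2_set (\<lambda>n. norm (a n)) (E1 f) * L2_set (\<lambda>n. norm (cnj (a n))) (E1 g))"
  proof (rule bilinear_kernel[where c = "\<lambda>k. kernel_coeff (1 / M) (real k \<le> K) (real k) (real f * real g) n'"
        and d = "\<lambda>k. kernel_const (1 / M) (real k \<le> K) (real k) (real f * real g)" and u = u and v = u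
        and q = "7 / 100" and g = h and h = h and x = a and y = "\<lambda>m. cnj (a m)" and X = "\<lambda>k n. J k (n div d)"])
    show "sieve_bound (sqf X) (wt M K n' f) (\<lambda>k n. J k (n div d)) (E1 f) (Y / f)" by (rule S[OF dfg(2)])
    show "sieve_bound (sqf X) (wt M K n' g) (\<lambda>k n. J k (n div d)) (E1 g) (Y / g)" by (rule S[OF dfg(3)])
    fix k assume "k \<in> sqf X"
    then have k: "k > 0" by (rule sqf_pos)
    have fg: "real f \<ge> 1" "real g \<ge> 1" using dfg by simp_all
    show "wt M K n' f k \<ge> 0" "wt M K n' g k \<ge> 0" using wt_nonneg[OF M n'(1)] dfg by simp_all
    show "\<bar>kernel_coeff (1 / M) (real k \<le> K) (real k) (real f * real g) n' i\<bar> \<le> sqrt (wt M K n' f k) * sqrt (wt M K n' g k)" for i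
      using le_wt(1)[OF M n' k fg, of K i] le_wt(1)[OF M n' k fg(2,1), of K i] by (intro abs_le_sqrt_mult) (simp_all add: mult.commute)
    show "\<bar>kernel_const (1 / M) (real k \<le> K) (real k) (real f * real g)\<bar> \<le> sqrt (wt M K n' f k) * sqrt (wt M K n' g k)"
      using le_wt(2)[OF M n' k fg, of K] le_wt(2)[OF M n' k fg(2,1), of K] by (intro abs_le_sqrt_mult) (simp_all add: mult.commute)
    fix n m assume "n \<in> E1 f" "m \<in> E1 g"
    then have nm: "n \<in> E" "m \<in> E" "d dvd n" "d dvd m" by (simp_all add: E1_def dvs_def)
    define v where "v = (1 + u n) * (1 + u m) - 1"
    have xd: "real (n div d) = n' * x n" "real (m div d) = n' * x m"
      using nm n0 by (simp_all add: real_of_nat_div x_def n'_def)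
    have r: "real (n div d) * real (m div d) / n'\<^sup>2 = x n * x m" unfolding xd using n' by (simp add: power2_eq_square)
    have r0: "real (n div d) * real (m div d) > 0" unfolding xd using n' x(1)[OF nm(1)] x(1)[OF nm(2)] by simp
    have r2: "(real (n div d) * real (m div d))\<^sup>2 = n' ^ 4 * (1 + v)"
      unfolding xd v_def u_def by (simp add: power2_eq_square numeral_eq_Suc)
    have "(1 + u n) * (1 + u m) \<ge> 1 * 1" using u[OF nm(1)] u[OF nm(2)] by (intro mult_mono) simp_all
    moreover have "(1 + u n) * (1 + u m) \<le> (1 + 7 / 100) * (1 + 7 / 100)" using u[OF nm(1)] u[OF nm(2)] by (intro mult_mono) simp_all
    ultimately have v: "0 \<le> v" "v < 1" by (simp_all add: v_def)
    have "(\<lambda>i. (x n * x m) * sqrt (x n * x m) * ((-1) ^ i * v ^ i * kernel_coeff (1 / M) (real k \<le> K) (real k) (real f * real g) n' i)) sums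
     (Hk k n m - kernel_const (1 / M) (real k \<le> K) (real k) (real f * real g))"
      using kernel_expansion[OF _ _ _ n'(1) r0 v r2, of "1 / M" "real k" "real f * real g" "real k \<le> K"] M k dfg
      unfolding Hk_def r by simp
    moreover have "(x n * x m) * sqrt (x n * x m) = h n * h m" by (simp add: h_def real_sqrt_mult)
    ultimately show "(\<lambda>i. h n * h m * ((-1) ^ i * ((1 + u n) * (1 + u m) - 1) ^ i * kernel_coeff (1 / M) (real k \<le> K) (real k) (real f * real g) n' i)) sums
     (Hk k n m - kernel_const (1 / M) (real k \<le> K) (real k) (real f * real g))" by (simp add: v_def)
  qed (use Y0 u h in \<open>auto simp: E1_def power2_eq_square\<close>)
  also have "sqrt (Y / f * (Y / g)) = Y / sqrt (real f * real g)"
    using Y0 by (simp add: real_sqrt_mult real_sqrt_divide)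
  finally show ?thesis unfolding Y_def[symmetric] Hk_def E1_def by (simp add: mult.assoc)
qed

text \<open>Only \<open>k > K\<close> are completed, to all integers of squarefree part above
  \<open>K\<close>. The resulting form is the limit of the truncated forms plus the diagonal defect
  \<open>\<delta>\<close>; the limit inherits the uniform bound of \<open>kform_bound\<close>, and
  the diagonal gives \<open>M\<close>. The factor 3 undoes the weight, which is at least 1/3 for l =
  1/M.\<close>

lemma class_block_bound:
  assumes xi: "1 \<le> \<xi>" "\<xi> \<le> 2" and eta: "0 < \<eta>" "\<eta> \<le> 1 / 2"
    and NM: "1 \<le> N" "N \<le> M" "M \<le> N\<^sup>2" and K: "K = N\<^sup>2 / M"
    and H: "\<And>M N. M \<ge> 1 \<Longrightarrow> N \<ge> 1 \<Longrightarrow> LS M N (C * (M * N) powr \<eta> * (M + N powr \<xi>))" and C: "C > 0"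
    and n0: "0 < n0" "n0 \<le> N"
    and E: "E \<subseteq> osf N" "\<And>n. n \<in> E \<Longrightarrow> n0 \<le> real n \<and> real n \<le> 33 / 32 * n0"
    and cls: "\<And>n m. n \<in> E \<Longrightarrow> m \<in> E \<Longrightarrow> gcls n = gcls m"
    and D: "\<And>n. n \<in> E \<Longrightarrow> real (ndiv n) \<le> D"
  shows "sieve_bound {k\<in>osf M. K < real k} (\<lambda>_. 1) J E
    (3 * (9 * (wtc C \<eta> * (2 * N) powr (3 * \<eta>) * bd M N K \<xi>) * (\<Sum>g=1..nat \<lfloor>N\<rfloor>. 1 / real g) * D ^ 3 + M))"
  unfolding sieve_bound_def
proof (rule allI)
  fix a :: "nat \<Rightarrow> complex"
  define l where "l = 1 / M"
  have l: "l > 0" using NM by (simp add: l_def)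
  have E0: "odd n" "squarefree n" "real n \<le> N" if "n \<in> E" for n using that E(1) by (auto simp: osf_def)
  have fE: "finite E" using E(1) finite_osf by (rule finite_subset)
  define Y where "Y = 9 * (wtc C \<eta> * (2 * N) powr (3 * \<eta>) * bd M N K \<xi>)"
  have Y0: "Y \<ge> 0"
  proof -
    have "2 powr (- \<eta>) \<le> 1" using eta powr_mono[of "- \<eta>" 0 2] by simp
    then have "wtc C \<eta> \<ge> 0" using C quartic_const_nonneg by (simp add: wtc_def)
    then show ?thesis using NM by (simp add: Y_def bd_def)
  qed
  define nb where "nb = (\<Sum>n\<in>E. (norm (a n))\<^sup>2)"
  have nb0: "nb \<ge> 0" unfolding nb_def by (intro sum_nonneg) simp
  define B where "B = Y * (\<Sum>g=1..nat \<lfloor>N\<rfloor>. 1 / real g) * D ^ 3 * nb"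
  define Q where "Q X = (\<Sum>n\<in>E. \<Sum>m\<in>E. a n * cnj (a m) * of_real (kform l K (sqf (real X)) n m))" for X :: nat
  have QB: "norm (Q X) \<le> B" for X
    unfolding Q_def B_def nb_def
  proof (rule kform_bound[OF l _ finite_sqf fE _ Y0 D])
    fix n assume "n \<in> E"
    then show "odd n \<and> squarefree n \<and> n \<le> nat \<lfloor>N\<rfloor>" using E0[of n] by (simp add: le_nat_floor)
  next
    fix d e f g assume "d \<in> {1..nat \<lfloor>N\<rfloor>}" "f \<in> {1..nat \<lfloor>N\<rfloor>}" "g \<in> {1..nat \<lfloor>N\<rfloor>}"
    then have dfg: "d > 0" "f > 0" "g > 0" by simp_all
    show "norm (\<Sum>k\<in>sqf (real X). \<Sum>n\<in>{n\<in>E. dvs d e f n}. \<Sum>m\<in>{m\<in>E. dvs d e g m}. a n * cnj (a m) * of_real (J k (n div d) * J k (m div d) *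
        kernel l (real k \<le> K) (real k) (real (f * g)) (real (n div d) * real (m div d))))
      \<le> Y / sqrt (real f * real g) * L2_set (\<lambda>n. norm (a n)) {n\<in>E. dvs d e f n} * L2_set (\<lambda>n. norm (a n)) {n\<in>E. dvs d e g n}"
      unfolding Y_def l_def
      by (rule bilinear_wt[OF xi eta NM K H C dfg n0 fE]) (use E0 E(2) in auto)
  qed (simp add: sqf_def)
  define tail where "tail = theta_tail l (\<lambda>m. \<not> real (squarefree_part m) \<le> K)"
  have "\<exists>\<delta>. (qr n m > 1 \<longrightarrow> \<delta> = 0) \<and> \<delta> \<le> 1 / l \<and> (\<lambda>X. kform l K (sqf (real X)) n m) \<longlonglongrightarrow> tail (qr n m) - \<delta>"
    if "n \<in> E" "m \<in> E" for n m
    unfolding kform_def tail_def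
    by (rule sum_J_coprime_kernel_tendsto[OF l])
      (use qr_props[of n m] qr_class[of n m] E0[OF that(1)] E0[OF that(2)] cls[OF that] in simp_all)
  then obtain \<delta> where \<delta>: "\<And>n m. n \<in> E \<Longrightarrow> m \<in> E \<Longrightarrow> (qr n m > 1 \<longrightarrow> \<delta> n m = 0) \<and> \<delta> n m \<le> 1 / l \<and>
      (\<lambda>X. kform l K (sqf (real X)) n m) \<longlonglongrightarrow> tail (qr n m) - \<delta> n m" by metis
  define R where "R = (\<Sum>n\<in>E. \<Sum>m\<in>E. a n * cnj (a m) * of_real (tail (qr n m) - \<delta> n m))"
  have "Q \<longlonglongrightarrow> R"
    unfolding Q_def R_def by (intro tendsto_sum tendsto_mult tendsto_const tendsto_of_real) (use \<delta> in blast)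
  then have "(\<lambda>X. Re (Q X)) \<longlonglongrightarrow> Re R" by (rule tendsto_Re)
  then have RB: "Re R \<le> B"
    by (rule LIMSEQ_le_const2) (use QB complex_Re_le_cmod order.trans in blast)
  \<comment> \<open>\<open>qr n m = 1\<close> only for \<open>n = m\<close>, so the defect lives on
    the diagonal.\<close>
  have diag: "(\<Sum>n\<in>E. \<Sum>m\<in>E. a n * cnj (a m) * of_real (\<delta> n m)) = (\<Sum>n\<in>E. of_real ((norm (a n))\<^sup>2 * \<delta> n n))"
  proof (rule sum.cong[OF refl])
    fix n assume n: "n \<in> E"
    have "(\<Sum>m\<in>E. a n * cnj (a m) * of_real (\<delta> n m)) = (\<Sum>m\<in>E. if m = n then of_real ((norm (a n))\<^sup>2 * \<delta> n n) else 0)"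
    proof (rule sum.cong[OF refl])
      fix m assume m: "m \<in> E"
      show "a n * cnj (a m) * of_real (\<delta> n m) = (if m = n then of_real ((norm (a n))\<^sup>2 * \<delta> n n) else 0)"
      proof (cases "m = n")
        case True
        then show ?thesis by (simp only: complex_norm_square of_real_mult if_True refl)
      next
        case False
        have "qr n m \<noteq> 1" "qr n m > 0" using qr_props(3,4)[of n m] E0[OF n] E0[OF m] False by simp_all
        then have "\<delta> n m = 0" using \<delta>[OF n m] by simp
        then show ?thesis using False by simp
      qed
    qed
    then show "(\<Sum>m\<in>E. a n * cnj (a m) * of_real (\<delta> n m)) = of_real ((norm (a n))\<^sup>2 * \<delta> n n)"
      using fE n by (simp only: sum.delta if_True)
  qed
  have T: "(\<Sum>n\<in>E. \<Sum>m\<in>E. a n * cnj (a m) * of_real (tail (qr n m))) = R + (\<Sum>n\<in>E. of_real ((norm (a n))\<^sup>2 * \<delta> n n))"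
    unfolding diag[symmetric] R_def sum.distrib[symmetric] by (intro sum.cong refl) (simp add: algebra_simps)
  have "Re (\<Sum>n\<in>E. \<Sum>m\<in>E. a n * cnj (a m) * of_real (tail (qr n m))) = Re R + (\<Sum>n\<in>E. (norm (a n))\<^sup>2 * \<delta> n n)"
    unfolding T by (simp only: plus_complex.simps Re_sum Re_complex_of_real)
  also have "(\<Sum>n\<in>E. (norm (a n))\<^sup>2 * \<delta> n n) \<le> (\<Sum>n\<in>E. (norm (a n))\<^sup>2 * M)"
    using \<delta> by (intro sum_mono mult_left_mono) (simp_all add: l_def)
  also have "(\<Sum>n\<in>E. (norm (a n))\<^sup>2 * M) = M * nb" by (simp add: nb_def sum_distrib_left mult.commute)
  finally have up: "Re (\<Sum>n\<in>E. \<Sum>m\<in>E. a n * cnj (a m) * of_real (tail (qr n m))) \<le> B + M * nb" using RB by linarith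
  define S where "S = {k\<in>osf M. K < real k}"
  define A where "A k = (norm (\<Sum>n\<in>E. a n * of_real (J k n)))\<^sup>2" for k
  have pos: "(\<Sum>k\<in>S. exp (- l * real k) * A k) \<le> Re (\<Sum>n\<in>E. \<Sum>m\<in>E. a n * cnj (a m) * of_real (tail (qr n m)))"
    unfolding A_def tail_def
  proof (rule positivity[OF fE _ l])
    show "finite S" by (simp add: S_def)
    fix k assume "k \<in> S"
    then have k: "odd k" "squarefree k" "K < real k" by (simp_all add: S_def osf_def)
    have "squarefree_part k = k" using squarefree_part_mult_square[of k 1] k by simp
    then show "\<not> real (squarefree_part k) \<le> K \<and> k > 0" using k by (simp add: odd_pos)
  qed (use E0 in simp)
  have "1 / 3 * (\<Sum>k\<in>S. A k) \<le> (\<Sum>k\<in>S. exp (- l * real k) * A k)"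
    unfolding sum_distrib_left
  proof (intro sum_mono mult_right_mono)
    fix k assume "k \<in> S"
    then have "real k * l \<le> 1" using NM by (simp add: S_def osf_def l_def)
    then have "exp (- 1) \<le> exp (- l * real k)" by (simp add: mult.commute)
    moreover have "1 / 3 \<le> exp (-1::real)" using exp_le by (simp add: exp_minus field_simps)
    ultimately show "1 / 3 \<le> exp (- l * real k)" by linarith
  qed (simp add: A_def)
  then have "1 / 3 * (\<Sum>k\<in>S. A k) \<le> B + M * nb" by (rule order.trans[OF _ order.trans[OF pos up]])
  from mult_left_mono[OF this, of 3] have "(\<Sum>k\<in>S. A k) \<le> 3 * (B + M * nb)" by simp
  also have "3 * (B + M * nb) = 3 * (Y * (\<Sum>g=1..nat \<lfloor>N\<rfloor>. 1 / real g) * D ^ 3 + M) * nb"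
    by (simp add: B_def algebra_simps)
  finally show "(\<Sum>k\<in>{k\<in>osf M. K < real k}. 1 * (norm (\<Sum>n\<in>E. a n * of_real (J k n)))\<^sup>2)
    \<le> 3 * (9 * (wtc C \<eta> * (2 * N) powr (3 * \<eta>) * bd M N K \<xi>) * (\<Sum>g=1..nat \<lfloor>N\<rfloor>. 1 / real g) * D ^ 3 + M) * (\<Sum>n\<in>E. (norm (a n))\<^sup>2)"
    unfolding S_def A_def nb_def Y_def mult_1 .
qed

section \<open>Logarithmic losses and the decomposition into blocks\<close>

lemma ln_le_powr: "\<eta> > 0 \<Longrightarrow> x \<ge> 1 \<Longrightarrow> ln x \<le> x powr \<eta> / (\<eta>::real)"
proof -
  assume h: "\<eta> > (0::real)" "x \<ge> 1"
  have "\<eta> * ln x = ln (x powr \<eta>)" using h by (simp add: ln_powr)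
  also have "\<dots> \<le> x powr \<eta> - 1" using h by (intro ln_le_minus_one) simp
  finally have "\<eta> * ln x \<le> x powr \<eta>" by simp
  then show ?thesis using h by (simp add: pos_le_divide_eq mult.commute)
qed

lemma sum_inverse_le: "n \<ge> 1 \<Longrightarrow> (\<Sum>g=1..n. 1 / real g) \<le> 1 + ln (real n)"
proof (induction n rule: nat_induct_at_least)
  case (Suc n)
  have "ln (real n / real (Suc n)) \<le> real n / real (Suc n) - 1"
    using Suc(1) by (intro ln_le_minus_one) simp
  also have "\<dots> = - (1 / real (Suc n))" by (simp add: field_simps)
  finally have "1 / real (Suc n) \<le> ln (real (Suc n)) - ln (real n)"
    using Suc(1) by (simp add: ln_div)
  moreover have "(\<Sum>g=1..Suc n. 1 / real g) = (\<Sum>g=1..n. 1 / real g) + 1 / real (Suc n)" by simp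
  ultimately show ?case using Suc(2) by linarith
qed simp

lemma sum_inverse_le_powr:
  assumes "\<eta> > 0" "N \<ge> 1"
  shows "(\<Sum>g=1..nat \<lfloor>N\<rfloor>. 1 / real g) \<le> (1 + 1 / \<eta>) * N powr \<eta>"
proof -
  have n1: "nat \<lfloor>N\<rfloor> \<ge> 1" using assms by (simp add: le_nat_iff)
  have nN: "real (nat \<lfloor>N\<rfloor>) \<le> N" using assms by simp
  have "(\<Sum>g=1..nat \<lfloor>N\<rfloor>. 1 / real g) \<le> 1 + ln (real (nat \<lfloor>N\<rfloor>))" by (rule sum_inverse_le[OF n1])
  also have "ln (real (nat \<lfloor>N\<rfloor>)) \<le> ln N" using nN n1 by (subst ln_le_cancel_iff) linarith+
  also have "ln N \<le> N powr \<eta> / \<eta>" by (rule ln_le_powr[OF assms])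
  also have "1 \<le> N powr \<eta>" using assms by (intro ge_one_powr_ge_zero) simp_all
  finally show ?thesis by (simp add: distrib_right)
qed

text \<open>The ratio 33/32 is the one under which the kernel expansion converges. There are at most
  1 + 33 ln N blocks, because ln(33/32) >= 1/33, and four Gauss sum classes in each.\<close>

lemma geometric_blocks:
  assumes eta: "\<eta> > 0" and N: "N \<ge> 1" and E: "finite E" "\<And>n. n \<in> E \<Longrightarrow> odd n \<and> squarefree n \<and> real n \<le> N"
    and B: "B \<ge> 0"
    and *: "\<And>z n0 E'. 0 < n0 \<Longrightarrow> n0 \<le> N \<Longrightarrow> E' \<subseteq> E \<Longrightarrow> (\<And>n. n \<in> E' \<Longrightarrow> gcls n = z \<and> n0 \<le> real n \<and> real n \<le> 33 / 32 * n0)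
       \<Longrightarrow> sieve_bound K (\<lambda>_. 1) X E' B"
  shows "sieve_bound K (\<lambda>_. 1) X E (4 * (1 + 33 / \<eta>) * N powr \<eta> * B)"
proof -
  define c where "c n = nat \<lfloor>log (33 / 32) (real n)\<rfloor>" for n :: nat
  define L where "L = nat \<lfloor>log (33 / 32) N\<rfloor>"
  have n0: "real n \<ge> 1" if "n \<in> E" for n using E(2)[OF that] odd_pos[of n] by simp
  have lo: "(33 / 32) ^ c n \<le> real n" "real n \<le> 33 / 32 * (33 / 32) ^ c n" if "n \<in> E" for n
  proof -
    have g: "log (33 / 32) (real n) \<ge> 0" using n0[OF that] by simp
    have "(33 / 32) powr (real (c n)) \<le> (33 / 32 :: real) powr (log (33 / 32) (real n))"
      using g by (intro powr_mono) (simp_all add: c_def)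
    then show "(33 / 32) ^ c n \<le> real n" using n0[OF that] by (simp add: powr_realpow)
    have "log (33 / 32) (real n) \<le> 1 + real (c n)" using g unfolding c_def by linarith
    then have "(33 / 32 :: real) powr (log (33 / 32) (real n)) \<le> (33 / 32) powr (1 + real (c n))"
      by (intro powr_mono) simp_all
    then show "real n \<le> 33 / 32 * (33 / 32) ^ c n" using n0[OF that] by (simp add: powr_add powr_realpow)
  qed
  have cL: "c n \<in> {..L}" if "n \<in> E" for n
  proof -
    have "log (33 / 32) (real n) \<le> log (33 / 32) N" using n0[OF that] E(2)[OF that] N by simp
    then show ?thesis unfolding c_def L_def by (simp add: nat_mono floor_mono)
  qed
  have "sieve_bound K (\<lambda>_. 1) X E (real (card {..L}) * (4 * B))"
  proof (rule sieve_bound_Union[OF E(1), of _ c])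
    fix j assume "j \<in> {..L}"
    show "sieve_bound K (\<lambda>_. 1) X {n\<in>E. c n = j} (4 * B)"
    proof (rule gcls_split[OF _ _ _ B])
      fix z
      show "sieve_bound K (\<lambda>_. 1) X {n \<in> {n\<in>E. c n = j}. gcls n = z} B"
      proof (cases "{n \<in> {n\<in>E. c n = j}. gcls n = z} = {}")
        case True
        show ?thesis unfolding True by (simp add: sieve_bound_def)
      next
        case False
        then obtain m where m: "m \<in> E" "c m = j" by blast
        show ?thesis
        proof (rule *[of "(33 / 32) ^ j" _ z])
          show "(33 / 32) ^ j \<le> N" using lo(1)[OF m(1)] E(2)[OF m(1)] unfolding m(2) by linarith
        qed (use lo in auto)
      qed
    qed (use E in auto)
  qed (use cL in auto)
  then show ?thesis
  proof (rule sieve_bound_mono_right)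
    have "real (card {..L}) \<le> 1 + log (33 / 32) N" using N by (simp add: L_def)
    also have "log (33 / 32) N = ln N / ln (33 / 32)" by (simp add: log_def)
    also have "\<dots> \<le> ln N / (1 / 33)"
    proof (rule divide_left_mono)
      have "ln (32 / 33 :: real) \<le> 32 / 33 - 1" by (rule ln_le_minus_one) simp
      moreover have "ln (33 / 32 :: real) = - ln (32 / 33)" using ln_inverse[of "32 / 33 :: real"] by simp
      ultimately show "1 / 33 \<le> ln (33 / 32 :: real)" by linarith
    qed (use N in simp_all)
    also have "\<dots> = 33 * ln N" by simp
    also have "\<dots> \<le> 33 * (N powr \<eta> / \<eta>)" using ln_le_powr[OF eta N] by simp
    also have "1 + 33 * (N powr \<eta> / \<eta>) \<le> (1 + 33 / \<eta>) * N powr \<eta>"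
      using ge_one_powr_ge_zero[of N \<eta>] N eta by (simp add: distrib_right)
    finally have "real (card {..L}) * (4 * B) \<le> (1 + 33 / \<eta>) * N powr \<eta> * (4 * B)"
      using B by (intro mult_right_mono) simp_all
    then show "real (card {..L}) * (4 * B) \<le> 4 * (1 + 33 / \<eta>) * N powr \<eta> * B" by (simp add: mult_ac)
  qed
qed

text \<open>The exponent 8 \<eta> collects 3 \<eta> from the dual large sieve, \<eta> from the
  harmonic sum, 3 \<eta> from the divisor function and \<eta> from the number of blocks.\<close>

lemma large_sieve_recursion:
  assumes xi: "1 \<le> \<xi>" "\<xi> \<le> 2" and H: "large_sieve \<xi>" and eta: "0 < \<eta>" "\<eta> \<le> 1 / 2"
  shows "\<exists>C>0. \<forall>M N. 1 \<le> N \<longrightarrow> N \<le> M \<longrightarrow> M \<le> N\<^sup>2 \<longrightarrow> LS M N (C * N powr (8 * \<eta>) * bd M N (N\<^sup>2 / M) \<xi>)"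
proof -
  obtain C where C0: "C > 0" and C': "\<forall>M\<ge>1. \<forall>N\<ge>1. LS M N (C * (M * N) powr \<eta> * (M + N powr \<xi>))"
    using H[unfolded large_sieve_def, rule_format, OF eta(1)] by (elim exE conjE) (rule that)
  note C = C0 C'[rule_format]
  obtain D where D: "D \<ge> 1" "\<And>n. squarefree n \<Longrightarrow> real (ndiv n) \<le> D * real n powr \<eta>"
    using ndiv_bound[OF eta(1)] by blast
  define w where "w = wtc C \<eta> * 2 powr (3 * \<eta>)"
  have w0: "w \<ge> 0"
  proof -
    have "2 powr (- \<eta>) \<le> 1" using eta powr_mono[of "- \<eta>" 0 2] by simp
    then show ?thesis using C(1) quartic_const_nonneg by (simp add: w_def wtc_def)
  qed
  define C1 where "C1 = 3 * (9 * w * (1 + 1 / \<eta>) * D ^ 3 + 1)"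
  define C2 where "C2 = 4 * (1 + 33 / \<eta>) * C1 + 2 * C"
  have C1: "C1 \<ge> 0" using w0 eta D(1) by (simp add: C1_def)
  have C2: "C2 > 0" using C1 C eta by (simp add: C2_def add_nonneg_pos)
  have "LS M N (C2 * N powr (8 * \<eta>) * bd M N (N\<^sup>2 / M) \<xi>)" if NM: "1 \<le> N" "N \<le> M" "M \<le> N\<^sup>2" for M N
  proof -
    define K where "K = N\<^sup>2 / M"
    note Kb = K_bounds[OF xi eta NM K_def]
    define b where "b = bd M N K \<xi>"
    have bM: "b \<ge> M" using NM by (simp add: b_def bd_def)
    have b0: "b \<ge> 0" using bM NM by linarith
    have N1: "N powr e \<ge> 1" if "e \<ge> 0" for e using NM that by (intro ge_one_powr_ge_zero) simp_all
    define B where "B = C1 * N powr (7 * \<eta>) * b"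
    have B0: "B \<ge> 0" using C1 b0 by (simp add: B_def)
    have Osf: "odd n \<and> squarefree n \<and> real n \<le> N" if "n \<in> osf N" for n using that by (simp add: osf_def)
    have large: "sieve_bound {k\<in>osf M. K < real k} (\<lambda>_. 1) J (osf N) (4 * (1 + 33 / \<eta>) * N powr \<eta> * B)"
    proof (rule geometric_blocks[OF eta(1) NM(1) finite_osf Osf B0])
      fix z n0 E assume h: "0 < n0" "n0 \<le> N" "E \<subseteq> osf N"
        "\<And>n. n \<in> E \<Longrightarrow> gcls n = z \<and> n0 \<le> real n \<and> real n \<le> 33 / 32 * n0"
      have nd: "real (ndiv n) \<le> D * N powr \<eta>" if "n \<in> E" for n
      proof -
        have n: "squarefree n" "real n \<le> N" using that h(3) by (auto simp: osf_def)
        have "real (ndiv n) \<le> D * real n powr \<eta>" by (rule D(2)[OF n(1)])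
        also have "\<dots> \<le> D * N powr \<eta>" using n(2) D(1) eta by (intro mult_left_mono powr_mono2) simp_all
        finally show ?thesis .
      qed
      have "sieve_bound {k\<in>osf M. K < real k} (\<lambda>_. 1) J E
         (3 * (9 * (wtc C \<eta> * (2 * N) powr (3 * \<eta>) * bd M N K \<xi>) * (\<Sum>g=1..nat \<lfloor>N\<rfloor>. 1 / real g) * (D * N powr \<eta>) ^ 3 + M))"
        by (rule class_block_bound[OF xi eta NM K_def C(2,1) h(1-3) _ _ nd]) (use h(4) in auto)
      then show "sieve_bound {k\<in>osf M. K < real k} (\<lambda>_. 1) J E B"
      proof (rule sieve_bound_mono_right)
        define s where "s = (\<Sum>g=1..nat \<lfloor>N\<rfloor>. 1 / real g)"
        have s: "s \<le> (1 + 1 / \<eta>) * N powr \<eta>" unfolding s_def by (rule sum_inverse_le_powr[OF eta(1) NM(1)])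
        have w: "wtc C \<eta> * (2 * N) powr (3 * \<eta>) * bd M N K \<xi> = w * N powr (3 * \<eta>) * b"
          using NM by (simp add: w_def b_def powr_mult)
        have n3: "(D * N powr \<eta>) ^ 3 = D ^ 3 * N powr (3 * \<eta>)"
        proof -
          have "(N powr \<eta>) ^ 3 = N powr (3 * \<eta>)" by (simp add: power3_eq_cube powr_add[symmetric])
          then show ?thesis by (simp only: power_mult_distrib)
        qed
        have "9 * (w * N powr (3 * \<eta>) * b) * s * (D ^ 3 * N powr (3 * \<eta>))
           \<le> 9 * (w * N powr (3 * \<eta>) * b) * ((1 + 1 / \<eta>) * N powr \<eta>) * (D ^ 3 * N powr (3 * \<eta>))"
          using s w0 b0 D(1) by (intro mult_right_mono mult_left_mono) simp_all
        also have "\<dots> = 9 * w * (1 + 1 / \<eta>) * D ^ 3 * (N powr (3 * \<eta>) * N powr \<eta> * N powr (3 * \<eta>)) * b" by (simp add: mult_ac)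
        also have "N powr (3 * \<eta>) * N powr \<eta> * N powr (3 * \<eta>) = N powr (7 * \<eta>)" by (simp add: powr_add[symmetric])
        finally have 1: "9 * (w * N powr (3 * \<eta>) * b) * s * (D ^ 3 * N powr (3 * \<eta>)) \<le> 9 * w * (1 + 1 / \<eta>) * D ^ 3 * N powr (7 * \<eta>) * b" .
        have "1 * M \<le> N powr (7 * \<eta>) * b" using N1[of "7 * \<eta>"] eta bM NM by (intro mult_mono) simp_all
        then have "3 * (9 * (w * N powr (3 * \<eta>) * b) * s * (D ^ 3 * N powr (3 * \<eta>)) + M)
          \<le> 3 * (9 * w * (1 + 1 / \<eta>) * D ^ 3 * N powr (7 * \<eta>) * b + N powr (7 * \<eta>) * b)"
          by (intro mult_left_mono add_mono 1) simp_all
        also have "\<dots> = B" by (simp add: B_def C1_def distrib_right)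
        finally show "3 * (9 * (wtc C \<eta> * (2 * N) powr (3 * \<eta>) * bd M N K \<xi>) * (\<Sum>g=1..nat \<lfloor>N\<rfloor>. 1 / real g) * (D * N powr \<eta>) ^ 3 + M) \<le> B"
          unfolding w n3 s_def[symmetric] .
      qed
    qed
    \<comment> \<open>The outer variables up to \<open>K\<close> were left out of the completion.
      The flipped hypothesis covers them at a cost below the target, since K <= N <= M.\<close>
    have small: "LS K N (2 * C * (K * N) powr \<eta> * (N + K powr \<xi>))"
      by (rule LS_both(2)[OF C(2,1) Kb(1) NM(1)])
    have e8: "N powr \<eta> * N powr (7 * \<eta>) = N powr (8 * \<eta>)" by (simp add: powr_add[symmetric])
    have smb: "2 * C * (K * N) powr \<eta> * (N + K powr \<xi>) \<le> 2 * C * N powr (8 * \<eta>) * b"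
    proof -
      have "(K * N) powr \<eta> \<le> (N * N) powr \<eta>" using Kb NM eta by (intro powr_mono2 mult_right_mono) simp_all
      also have "(N * N) powr \<eta> = N powr (2 * \<eta>)" using NM by (simp add: powr_mult powr_add[symmetric])
      also have "N powr (2 * \<eta>) \<le> N powr (8 * \<eta>)" using NM eta by (intro powr_mono) simp_all
      finally have 1: "(K * N) powr \<eta> \<le> N powr (8 * \<eta>)" .
      have "1 * K powr \<xi> \<le> M / N * K powr \<xi>" using NM by (intro mult_right_mono) simp_all
      then have 2: "N + K powr \<xi> \<le> b" using NM unfolding b_def bd_def by linarith
      have "(K * N) powr \<eta> * (N + K powr \<xi>) \<le> N powr (8 * \<eta>) * b"
        using 1 2 NM by (intro mult_mono) simp_all
      then show ?thesis using C(1) by (simp add: mult.assoc)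
    qed
    show ?thesis unfolding LS_def sieve_bound_def
    proof (rule allI)
      fix a :: "nat \<Rightarrow> complex"
      let ?A = "\<lambda>k. (norm (\<Sum>n\<in>osf N. a n * of_real (J k n)))\<^sup>2"
      let ?n = "\<Sum>n\<in>osf N. (norm (a n))\<^sup>2"
      have n0: "?n \<ge> 0" by (intro sum_nonneg) simp
      have "(\<Sum>k\<in>osf M. ?A k) \<le> (\<Sum>k\<in>osf K \<union> {k\<in>osf M. K < real k}. ?A k)"
      proof (rule sum_mono2)
        show "osf M \<subseteq> osf K \<union> {k\<in>osf M. K < real k}" by (auto simp: osf_def)
      qed simp_all
      also have "\<dots> = (\<Sum>k\<in>osf K. ?A k) + (\<Sum>k\<in>{k\<in>osf M. K < real k}. ?A k)"
      proof (rule sum.union_disjoint)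
        show "osf K \<inter> {k\<in>osf M. K < real k} = {}" by (auto simp: osf_def)
      qed simp_all
      also have "\<dots> \<le> 2 * C * (K * N) powr \<eta> * (N + K powr \<xi>) * ?n + 4 * (1 + 33 / \<eta>) * N powr \<eta> * B * ?n"
        using sieve_boundD[OF small[unfolded LS_def], of a] sieve_boundD[OF large, of a] by (intro add_mono) simp_all
      also have "\<dots> \<le> 2 * C * N powr (8 * \<eta>) * b * ?n + 4 * (1 + 33 / \<eta>) * N powr \<eta> * B * ?n"
        using smb n0 by (intro add_right_mono mult_right_mono)
      also have "\<dots> = (2 * C * N powr (8 * \<eta>) + 4 * (1 + 33 / \<eta>) * C1 * (N powr \<eta> * N powr (7 * \<eta>))) * b * ?n"
        unfolding B_def by (simp add: algebra_simps)
      also have "\<dots> = C2 * N powr (8 * \<eta>) * b * ?n" unfolding e8 C2_def by (simp add: algebra_simps)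
      finally show "(\<Sum>k\<in>osf M. 1 * ?A k) \<le> C2 * N powr (8 * \<eta>) * bd M N (N\<^sup>2 / M) \<xi> * ?n"
        by (simp add: b_def K_def)
    qed
  qed
  with C2 show ?thesis by blast
qed

section \<open>Iteration of the exponent\<close>

lemma large_sieve_2: "large_sieve 2"
  unfolding large_sieve_def
proof (intro allI impI)
  fix \<eta> :: real assume eta: "\<eta> > 0"
  have "LS M N (12 * (M * N) powr \<eta> * (M + N powr 2))" if MN: "M \<ge> 1" "N \<ge> 1" for M N
  proof (rule LS_mono[OF LS_quadratic[of M N] order_refl order_refl])
    have "1 * 1 \<le> M * N" using MN by (intro mult_mono) simp_all
    then have "1 \<le> (M * N) powr \<eta>" using eta by (intro ge_one_powr_ge_zero) simp_all
    then have "1 * (M + N\<^sup>2) \<le> (M * N) powr \<eta> * (M + N\<^sup>2)" using MN by (intro mult_right_mono) simp_all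
    then show "12 * (M + N\<^sup>2) \<le> 12 * (M * N) powr \<eta> * (M + N powr 2)" using MN by simp
  qed (use MN in simp_all)
  then show "\<exists>C>0. \<forall>M\<ge>1. \<forall>N\<ge>1. LS M N (C * (M * N) powr \<eta> * (M + N powr 2))"
    by (intro exI[of _ 12]) simp
qed

text \<open>Raising \<open>M\<close> to at least N^\<zeta> with \<zeta> = 2 - 1/\<xi> makes N^2/M at
  most N^(1/\<xi>), so that K^\<xi> <= N and both terms of \<open>bd\<close> are at most
  \<open>M1\<close>. If \<open>M1\<close> exceeds N^2, then so does \<open>M\<close>, and
  \<open>LS_quadratic\<close> suffices.\<close>

lemma large_sieve_step:
  assumes xi: "1 \<le> \<xi>" "\<xi> \<le> 2" and H: "large_sieve \<xi>"
  shows "large_sieve (2 - 1 / \<xi>)"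
  unfolding large_sieve_def
proof (intro allI impI)
  fix \<eta> :: real assume eta: "\<eta> > 0"
  define e where "e = min (\<eta> / 8) (1 / 2)"
  have e: "0 < e" "e \<le> 1 / 2" "8 * e \<le> \<eta>" using eta by (simp_all add: e_def min_def)
  obtain C where C: "C > 0" and R: "\<forall>M N. 1 \<le> N \<longrightarrow> N \<le> M \<longrightarrow> M \<le> N\<^sup>2 \<longrightarrow> LS M N (C * N powr (8 * e) * bd M N (N\<^sup>2 / M) \<xi>)"
    using large_sieve_recursion[OF xi H e(1,2)] by blast
  define \<zeta> where "\<zeta> = 2 - 1 / \<xi>"
  have z: "1 \<le> \<zeta>" "\<zeta> \<le> 2" using xi by (simp_all add: \<zeta>_def)
  have "LS M N ((2 * C + 24) * (M * N) powr \<eta> * (M + N powr \<zeta>))" if MN: "M \<ge> 1" "N \<ge> 1" for M N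
  proof -
    have "1 * 1 \<le> M * N" using MN by (intro mult_mono) simp_all
    then have p1: "1 \<le> (M * N) powr \<eta>" using eta by (intro ge_one_powr_ge_zero) simp_all
    define M1 where "M1 = max M (N powr \<zeta>)"
    have "N powr 1 \<le> N powr \<zeta>" using MN z by (intro powr_mono) simp_all
    then have M1: "M \<le> M1" "N \<le> M1" "N powr \<zeta> \<le> M1" "M1 > 0" "M1 \<le> M + N powr \<zeta>" using MN by (simp_all add: M1_def)
    have z0: "N powr \<zeta> \<ge> 0" by simp
    show ?thesis
    proof (cases "M1 \<le> N\<^sup>2")
      case True
      have "N\<^sup>2 / M1 \<le> N\<^sup>2 / N powr \<zeta>" using M1 MN by (intro divide_left_mono) simp_all
      also have "\<dots> = N powr (1 / \<xi>)" using MN by (simp add: \<zeta>_def powr_diff)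
      finally have "(N\<^sup>2 / M1) powr \<xi> \<le> (N powr (1 / \<xi>)) powr \<xi>" using xi M1 by (intro powr_mono2) simp_all
      also have "\<dots> = N" using xi MN by (simp add: powr_powr)
      finally have "M1 / N * (N\<^sup>2 / M1) powr \<xi> \<le> M1 / N * N" using M1 MN by (intro mult_left_mono) simp_all
      then have b: "bd M1 N (N\<^sup>2 / M1) \<xi> \<le> 2 * M1" using MN by (simp add: bd_def)
      have b0: "0 \<le> bd M1 N (N\<^sup>2 / M1) \<xi>" using M1 MN by (simp add: bd_def)
      have "LS M1 N (C * N powr (8 * e) * bd M1 N (N\<^sup>2 / M1) \<xi>)" using R MN M1 True by blast
      then show ?thesis
      proof (rule LS_mono[OF _ M1(1) order_refl])
        have "N powr (8 * e) \<le> N powr \<eta>" using e MN by (intro powr_mono) simp_all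
        also have "\<dots> \<le> (M * N) powr \<eta>" using MN eta by (intro powr_mono2) simp_all
        finally have "N powr (8 * e) * bd M1 N (N\<^sup>2 / M1) \<xi> \<le> (M * N) powr \<eta> * (2 * M1)"
          using b b0 by (intro mult_mono) simp_all
        also have "\<dots> \<le> (M * N) powr \<eta> * (2 * (M + N powr \<zeta>))" using M1(5) by (intro mult_left_mono) simp_all
        finally have "C * (N powr (8 * e) * bd M1 N (N\<^sup>2 / M1) \<xi>) \<le> C * ((M * N) powr \<eta> * (2 * (M + N powr \<zeta>)))"
          using C by (intro mult_left_mono) simp_all
        also have "\<dots> = 2 * C * ((M * N) powr \<eta> * (M + N powr \<zeta>))" by simp
        also have "\<dots> \<le> (2 * C + 24) * ((M * N) powr \<eta> * (M + N powr \<zeta>))"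
          using MN z0 by (intro mult_right_mono) simp_all
        finally show "C * N powr (8 * e) * bd M1 N (N\<^sup>2 / M1) \<xi> \<le> (2 * C + 24) * (M * N) powr \<eta> * (M + N powr \<zeta>)"
          by (simp only: mult.assoc)
      qed
    next
      case False
      have "N powr \<zeta> \<le> N powr 2" using z MN by (intro powr_mono) simp_all
      then have N2: "N\<^sup>2 \<le> M" using False MN by (simp add: M1_def max_def split: if_splits)
      show ?thesis
      proof (rule LS_mono[OF LS_quadratic[of M N] order_refl order_refl])
        have "12 * (M + N\<^sup>2) \<le> 24 * (1 * (M + N powr \<zeta>))" by (rule order.trans[of _ "24 * M"]) (use N2 in simp_all)
        also have "\<dots> \<le> (2 * C + 24) * ((M * N) powr \<eta> * (M + N powr \<zeta>))"
          using C p1 MN z0 by (intro mult_mono mult_nonneg_nonneg add_nonneg_nonneg) simp_all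
        finally show "12 * (M + N\<^sup>2) \<le> (2 * C + 24) * (M * N) powr \<eta> * (M + N powr \<zeta>)" by (simp only: mult.assoc)
      qed (use MN in simp_all)
    qed
  qed
  then show "\<exists>C>0. \<forall>M\<ge>1. \<forall>N\<ge>1. LS M N (C * (M * N) powr \<eta> * (M + N powr (2 - 1 / \<xi>)))"
    unfolding \<zeta>_def using C by (intro exI[of _ "2 * C + 24"]) simp
qed

lemma large_sieve_Suc: "large_sieve (1 + 1 / real (Suc j))"
proof (induction j)
  case 0
  show ?case using large_sieve_2 by simp
next
  case (Suc j)
  have "large_sieve (2 - 1 / (1 + 1 / real (Suc j)))" by (rule large_sieve_step[OF _ _ Suc]) simp_all
  also have "2 - 1 / (1 + 1 / real (Suc j)) = 1 + 1 / real (Suc (Suc j))" by (simp add: field_simps)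
  finally show ?case .
qed

text \<open>The exponent 1 is only a limit of the iteration, but stopping at an exponent below 1 +
  \<eta>/2 leaves an excess N^(\<eta>/2) that the factor \<open>(M * N) powr \<eta>\<close>
  absorbs.\<close>

theorem large_sieve_1: "large_sieve 1"
  unfolding large_sieve_def
proof (intro allI impI)
  fix \<eta> :: real assume eta: "\<eta> > 0"
  obtain j :: nat where j: "inverse (real (Suc j)) < \<eta> / 2" using reals_Archimedean[of "\<eta> / 2"] eta by auto
  define \<xi> where "\<xi> = 1 + 1 / real (Suc j)"
  have e2: "\<eta> / 2 > 0" using eta by simp
  have xi: "\<xi> \<le> 1 + \<eta> / 2" using j by (simp add: \<xi>_def inverse_eq_divide)
  obtain C where C: "C > 0" and R: "\<forall>M\<ge>1. \<forall>N\<ge>1. LS M N (C * (M * N) powr (\<eta> / 2) * (M + N powr \<xi>))"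
    using large_sieve_Suc[of j, folded \<xi>_def, unfolded large_sieve_def, rule_format, OF e2] by (elim exE conjE) (rule that)
  have "LS M N (C * (M * N) powr \<eta> * (M + N powr 1))" if MN: "M \<ge> 1" "N \<ge> 1" for M N
  proof (rule LS_mono[OF R[rule_format, OF MN] order_refl order_refl])
    have "1 * 1 \<le> M * N" using MN by (intro mult_mono) simp_all
    then have p1: "1 \<le> (M * N) powr (\<eta> / 2)" using eta by (intro ge_one_powr_ge_zero) simp_all
    have "N powr \<xi> \<le> N powr (1 + \<eta> / 2)" using xi MN by (intro powr_mono) simp_all
    also have "\<dots> = N powr (\<eta> / 2) * N" using MN by (simp add: powr_add)
    also have "\<dots> \<le> (M * N) powr (\<eta> / 2) * N" using MN eta by (intro mult_right_mono powr_mono2) simp_all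
    finally have "M + N powr \<xi> \<le> (M * N) powr (\<eta> / 2) * M + (M * N) powr (\<eta> / 2) * N"
      using add_mono[OF mult_right_mono[OF p1, of M]] MN by simp
    then have "(M * N) powr (\<eta> / 2) * (M + N powr \<xi>) \<le> (M * N) powr (\<eta> / 2) * ((M * N) powr (\<eta> / 2) * (M + N))"
      by (intro mult_left_mono) (simp_all add: distrib_left)
    also have "\<dots> = (M * N) powr \<eta> * (M + N)" by (simp add: mult.assoc[symmetric] powr_add[symmetric])
    finally show "C * (M * N) powr (\<eta> / 2) * (M + N powr \<xi>) \<le> C * (M * N) powr \<eta> * (M + N powr 1)"
      using C MN by (simp add: mult.assoc)
  qed
  then show "\<exists>C>0. \<forall>M\<ge>1. \<forall>N\<ge>1. LS M N (C * (M * N) powr \<eta> * (M + N powr 1))"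
    using C by (intro exI[of _ C]) simp
qed

section \<open>Summation over the hyperbolic region\<close>

text \<open>Rademacher--Menshov: cutting the inner variable at a point depending on the outer one costs
  only a logarithm, by halving the range.\<close>

lemma sieve_bound_prefix:
  fixes b :: "nat \<Rightarrow> complex" and Y :: "'k \<Rightarrow> nat"
  assumes "finite K" "sieve_bound K (\<lambda>_. 1) X E B" "E \<subseteq> {s..<s + 2 ^ L}" "B \<ge> 0"
  shows "L2_set (\<lambda>k. norm (\<Sum>n\<in>{n\<in>E. n < Y k}. b n * of_real (X k n))) K \<le> (real L + 1) * (sqrt B * L2_set (\<lambda>n. norm (b n)) E)"
  using assms
proof (induction L arbitrary: s E K)
  case 0
  have full: "L2_set (\<lambda>k. norm (\<Sum>n\<in>E. b n * of_real (X k n))) K \<le> sqrt B * L2_set (\<lambda>n. norm (b n)) E"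
    unfolding L2_set_def real_sqrt_mult[symmetric] using sieve_boundD[OF 0(2), of b] by (intro real_sqrt_le_mono) simp
  have "L2_set (\<lambda>k. norm (\<Sum>n\<in>{n\<in>E. n < Y k}. b n * of_real (X k n))) K \<le> L2_set (\<lambda>k. norm (\<Sum>n\<in>E. b n * of_real (X k n))) K"
  proof (rule L2_set_mono)
    fix k
    have "E \<subseteq> {s}" using 0(3) by auto
    then have "{n\<in>E. n < Y k} = E \<or> {n\<in>E. n < Y k} = {}" by auto
    then show "norm (\<Sum>n\<in>{n\<in>E. n < Y k}. b n * of_real (X k n)) \<le> norm (\<Sum>n\<in>E. b n * of_real (X k n))"
      by (elim disjE) (simp_all only: order_refl sum.empty norm_zero norm_ge_zero)
  qed simp
  with full show ?case by simp
next
  case (Suc L)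
  define m where "m = s + 2 ^ L"
  define E1 where "E1 = {n\<in>E. n < m}"
  define E2 where "E2 = {n\<in>E. m \<le> n}"
  have fE: "finite E" using Suc.prems(3) by (rule finite_subset) simp
  have E12: "E1 \<subseteq> {s..<s + 2 ^ L}" "E2 \<subseteq> {m..<m + 2 ^ L}" "E1 \<subseteq> E" "E2 \<subseteq> E" "finite E1" "finite E2" "E1 \<inter> E2 = {}" "E1 \<union> E2 = E"
    using Suc.prems(3) fE by (auto simp: E1_def E2_def m_def)
  define F where "F E k = (\<Sum>n\<in>{n\<in>E. n < Y k}. b n * of_real (X k n))" for E k
  define N where "N E = (\<Sum>n\<in>E. (norm (b n))\<^sup>2)" for E
  have N0: "N E \<ge> 0" for E unfolding N_def by (intro sum_nonneg) simp
  have NE: "N E = N E1 + N E2"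
    unfolding N_def E12(8)[symmetric] by (rule sum.union_disjoint[OF E12(5,6,7)])
  have L2: "L2_set (\<lambda>n. norm (b n)) A = sqrt (N A)" for A by (simp add: L2_set_def N_def)
  define K1 where "K1 = {k\<in>K. Y k \<le> m}"
  define K2 where "K2 = {k\<in>K. m < Y k}"
  have K12: "finite K1" "finite K2" "K1 \<subseteq> K" "K2 \<subseteq> K" "K1 \<inter> K2 = {}" "K1 \<union> K2 = K"
    using Suc.prems(1) by (auto simp: K1_def K2_def)
  have sb: "sieve_bound K' (\<lambda>_. 1) X E' B" if "K' \<subseteq> K" "E' \<subseteq> E" for K' E'
    by (rule sieve_bound_subset_left[OF sieve_bound_subset_right[OF Suc.prems(2) fE that(2)] Suc.prems(1) that(1)]) simp
  have pre: "(\<Sum>k\<in>K'. (norm (F E' k))\<^sup>2) \<le> (real L + 1)\<^sup>2 * B * N E'"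
    if "K' \<subseteq> K" "E' \<subseteq> E" "E' \<subseteq> {s'..<s' + 2 ^ L}" for K' E' s'
  proof -
    have "sqrt (\<Sum>k\<in>K'. (norm (F E' k))\<^sup>2) \<le> (real L + 1) * sqrt (B * N E')"
      using Suc.IH[OF finite_subset[OF that(1) Suc.prems(1)] sb[OF that(1,2)] that(3) Suc.prems(4)]
      unfolding L2_set_def F_def N_def real_sqrt_mult .
    then have "(sqrt (\<Sum>k\<in>K'. (norm (F E' k))\<^sup>2))\<^sup>2 \<le> ((real L + 1) * sqrt (B * N E'))\<^sup>2"
      by (rule power_mono) (simp add: sum_nonneg)
    then show ?thesis using Suc.prems(4) N0[of E'] by (simp add: sum_nonneg power_mult_distrib mult.assoc)
  qed
  \<comment> \<open>\<open>u\<close> is the cut sum inside the half that contains the cutting point,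
    handled by induction on disjoint sets of \<open>k\<close>. \<open>v\<close> is the complete
    lower half where the cut lies beyond it; it is an uncut sum and adds just one more
    \<open>sqrt B\<close>.\<close>
  define u where "u k = (if Y k \<le> m then F E1 k else F E2 k)" for k
  define v where "v k = (if Y k \<le> m then 0 else (\<Sum>n\<in>E1. b n * of_real (X k n)))" for k
  have F: "F E k = u k + v k" for k
  proof (cases "Y k \<le> m")
    case True
    then have "{n\<in>E. n < Y k} = {n\<in>E1. n < Y k}" by (auto simp: E1_def)
    then show ?thesis using True by (simp add: F_def u_def v_def)
  next
    case False
    then have "{n\<in>E. n < Y k} = {n\<in>E2. n < Y k} \<union> E1" by (auto simp: E1_def E2_def)
    moreover have "(\<Sum>n\<in>{n\<in>E2. n < Y k} \<union> E1. b n * of_real (X k n)) = (\<Sum>n\<in>{n\<in>E2. n < Y k}. b n * of_real (X k n)) + (\<Sum>n\<in>E1. b n * of_real (X k n))"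
      by (rule sum.union_disjoint) (use E12 in auto)
    ultimately show ?thesis using False by (simp add: F_def u_def v_def)
  qed
  have "L2_set (\<lambda>k. norm (F E k)) K \<le> L2_set (\<lambda>k. norm (u k) + norm (v k)) K"
    by (rule L2_set_mono) (simp_all add: F norm_triangle_ineq)
  also have "\<dots> \<le> L2_set (\<lambda>k. norm (u k)) K + L2_set (\<lambda>k. norm (v k)) K" by (rule L2_set_triangle_ineq)
  also have "L2_set (\<lambda>k. norm (u k)) K \<le> (real L + 1) * sqrt (B * N E)"
  proof -
    have "(\<Sum>k\<in>K. (norm (u k))\<^sup>2) = (\<Sum>k\<in>K1. (norm (u k))\<^sup>2) + (\<Sum>k\<in>K2. (norm (u k))\<^sup>2)"
      unfolding K12(6)[symmetric] by (rule sum.union_disjoint[OF K12(1,2,5)])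
    also have "(\<Sum>k\<in>K1. (norm (u k))\<^sup>2) = (\<Sum>k\<in>K1. (norm (F E1 k))\<^sup>2)" by (rule sum.cong) (auto simp: K1_def u_def)
    also have "(\<Sum>k\<in>K2. (norm (u k))\<^sup>2) = (\<Sum>k\<in>K2. (norm (F E2 k))\<^sup>2)" by (rule sum.cong) (auto simp: K2_def u_def)
    also have "(\<Sum>k\<in>K1. (norm (F E1 k))\<^sup>2) + (\<Sum>k\<in>K2. (norm (F E2 k))\<^sup>2) \<le> (real L + 1)\<^sup>2 * B * N E1 + (real L + 1)\<^sup>2 * B * N E2"
      by (rule add_mono[OF pre[OF K12(3) E12(3,1)] pre[OF K12(4) E12(4,2)]])
    also have "\<dots> = (real L + 1)\<^sup>2 * (B * N E)" by (simp add: NE algebra_simps)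
    finally have "sqrt (\<Sum>k\<in>K. (norm (u k))\<^sup>2) \<le> sqrt ((real L + 1)\<^sup>2 * (B * N E))" by (rule real_sqrt_le_mono)
    then show ?thesis by (simp add: L2_set_def real_sqrt_mult)
  qed
  also have "L2_set (\<lambda>k. norm (v k)) K \<le> sqrt (B * N E)"
  proof -
    have "(\<Sum>k\<in>K. (norm (v k))\<^sup>2) \<le> (\<Sum>k\<in>K. 1 * (norm (\<Sum>n\<in>E1. b n * of_real (X k n)))\<^sup>2)"
      by (intro sum_mono) (simp add: v_def)
    also have "\<dots> \<le> B * N E1" using sb[OF order_refl E12(3)] unfolding sieve_bound_def N_def by blast
    also have "\<dots> \<le> B * N E" using NE N0[of E2] Suc.prems(4) by (intro mult_left_mono) simp_all
    finally show ?thesis unfolding L2_set_def by (rule real_sqrt_le_mono)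
  qed
  finally show ?case unfolding F_def L2 real_sqrt_mult by (simp add: algebra_simps)
qed

lemma L2_set_const_le:
  assumes "\<And>i. i \<in> A \<Longrightarrow> 0 \<le> f i \<and> f i \<le> c" "real (card A) \<le> n" "finite A" "c \<ge> 0"
  shows "L2_set f A \<le> sqrt n * c"
proof -
  have "(\<Sum>i\<in>A. (f i)\<^sup>2) \<le> (\<Sum>i\<in>A. c\<^sup>2)" using assms(1) by (intro sum_mono power_mono) auto
  also have "\<dots> = real (card A) * c\<^sup>2" by simp
  also have "\<dots> \<le> n * c\<^sup>2" using assms(2) by (intro mult_right_mono) simp_all
  finally have "L2_set f A \<le> sqrt (n * c\<^sup>2)" unfolding L2_set_def by (rule real_sqrt_le_mono)
  then show ?thesis using assms(4) by (simp add: real_sqrt_mult)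
qed

text \<open>The shorter variable is split dyadically at N <= sqrt T, leaving the longer one up to
  T/N. The trivial norms of the coefficients multiply to \<open>(2 * T) powr (c + 1 / 2)\<close> for
  every N. One logarithm counts the dyadic blocks, the other is the price of the cut
  \<open>k * n \<le> T\<close>.\<close>

lemma hyperbolic_region_bound:
  fixes \<alpha> \<beta> :: "nat \<Rightarrow> complex" and X :: "nat \<Rightarrow> nat \<Rightarrow> real"
  assumes T: "T \<ge> 2" and c: "c \<ge> 0" and V: "V \<ge> 0"
    and P: "P \<subseteq> osf (sqrt T)" "\<And>k. k \<in> P \<Longrightarrow> z < real k" and E: "E \<subseteq> osf T"
    and ab: "\<And>k. k \<in> P \<Longrightarrow> norm (\<alpha> k) \<le> 1" "\<And>n. n \<in> E \<Longrightarrow> norm (\<beta> n) \<le> 1"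
    and S: "\<And>N. 1 \<le> N \<Longrightarrow> z < 2 * N \<Longrightarrow> N\<^sup>2 \<le> T \<Longrightarrow> sieve_bound (osf (2 * N)) (\<lambda>_. 1) X (osf (T / N)) V"
  shows "norm (\<Sum>k\<in>P. \<Sum>n\<in>{n\<in>E. real (k * n) \<le> T}. of_real (real (k * n) powr c) * \<alpha> k * \<beta> n * of_real (X k n))
    \<le> 6 * (log 2 T)\<^sup>2 * ((2 * T) powr (c + 1 / 2) * sqrt V)"
proof -
  define lev where "lev k = nat \<lfloor>log 2 (real k)\<rfloor>" for k :: nat
  define Lg where "Lg = log 2 T"
  have Lg: "Lg \<ge> 1" using T by (simp add: Lg_def le_log_iff)
  define J where "J = nat \<lfloor>Lg\<rfloor>"
  have fP: "finite P" using P(1) finite_osf by (rule finite_subset)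
  have fE: "finite E" using E finite_osf by (rule finite_subset)
  have P1: "real k \<ge> 1" "real k \<le> sqrt T" if "k \<in> P" for k
  proof -
    have "odd k" "real k \<le> sqrt T" using that P(1) by (auto simp: osf_def)
    then show "real k \<ge> 1" "real k \<le> sqrt T" using odd_pos[of k] by simp_all
  qed
  have sqT: "sqrt T \<le> T" using T by (intro real_le_lsqrt) (simp_all add: power2_eq_square)
  have lo: "2 ^ lev k \<le> real k" "real k \<le> 2 * 2 ^ lev k" "lev k \<le> J" if "k \<in> P" for k
  proof -
    have g: "log 2 (real k) \<ge> 0" using P1(1)[OF that] by simp
    have "2 powr (real (lev k)) \<le> (2 :: real) powr (log 2 (real k))" using g by (intro powr_mono) (simp_all add: lev_def)
    then show "2 ^ lev k \<le> real k" using P1(1)[OF that] by (simp add: powr_realpow)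
    have "log 2 (real k) \<le> 1 + real (lev k)" using g unfolding lev_def by linarith
    then have "(2 :: real) powr (log 2 (real k)) \<le> 2 powr (1 + real (lev k))" by (intro powr_mono) simp_all
    then show "real k \<le> 2 * 2 ^ lev k" using P1(1)[OF that] by (simp add: powr_add powr_realpow)
    have "log 2 (real k) \<le> Lg" using P1[OF that] sqT by (simp add: Lg_def)
    then show "lev k \<le> J" unfolding lev_def J_def by (simp add: nat_mono floor_mono)
  qed
  define G where "G k = (\<Sum>n\<in>{n\<in>E. real (k * n) \<le> T}. of_real (real (k * n) powr c) * \<alpha> k * \<beta> n * of_real (X k n))" for k
  define W where "W = 3 * Lg * ((2 * T) powr (c + 1 / 2) * sqrt V)"
  have W0: "W \<ge> 0" using Lg V by (simp add: W_def)
  have block: "norm (\<Sum>k\<in>{k\<in>P. lev k = j}. G k) \<le> W" for j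
  proof (cases "{k\<in>P. lev k = j} = {}")
    case True
    show ?thesis unfolding True using W0 by simp
  next
    case False
    then obtain k0 where k0: "k0 \<in> P" "lev k0 = j" by blast
    define N :: real where "N = 2 ^ j"
    define Q where "Q = {k\<in>P. lev k = j}"
    have fQ: "finite Q" using fP by (simp add: Q_def)
    have N1: "N \<ge> 1" by (simp add: N_def)
    have NQ: "N \<le> real k" "real k \<le> 2 * N" if "k \<in> Q" for k using lo[of k] that by (auto simp: Q_def N_def)
    have NT: "N \<le> sqrt T" using lo(1)[OF k0(1)] P1(2)[OF k0(1)] unfolding k0(2) N_def by linarith
    then have "N\<^sup>2 \<le> (sqrt T)\<^sup>2" using N1 by (intro power_mono) simp_all
    then have N2: "N\<^sup>2 \<le> T" using T by simp
    have zN: "z < 2 * N" using lo(2)[OF k0(1)] P(2)[OF k0(1)] unfolding k0(2) N_def by linarith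
    define E' where "E' = {n\<in>E. real n \<le> T / N}"
    have E'osf: "E' \<subseteq> osf (T / N)" using E by (auto simp: E'_def osf_def)
    have Qosf: "Q \<subseteq> osf (2 * N)" using P(1) NQ(2) by (auto simp: Q_def osf_def)
    have sb: "sieve_bound Q (\<lambda>_. 1) X E' V"
      by (rule sieve_bound_subset_left[OF sieve_bound_subset_right[OF S[OF N1 zN N2] finite_osf E'osf] finite_osf Qosf]) simp
    define L where "L = J + 1"
    have E'L: "E' \<subseteq> {0..<0 + 2 ^ L}"
    proof
      fix n assume n: "n \<in> E'"
      have "T / N \<le> T / 1" using N1 T by (intro divide_left_mono) simp_all
      then have "real n \<le> T" using n by (simp add: E'_def)
      also have "T = 2 powr Lg" using T by (simp add: Lg_def)
      also have "\<dots> < 2 powr (real L)" using Lg unfolding L_def J_def by (intro powr_less_mono) linarith+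
      also have "\<dots> = real (2 ^ L)" by (simp add: powr_realpow)
      finally have "n < 2 ^ L" by (simp only: of_nat_less_iff)
      then show "n \<in> {0..<0 + 2 ^ L}" by simp
    qed
    \<comment> \<open>The strict inequality \<open>n < Y k\<close> encodes n <= T/k, in the shape
      that \<open>sieve_bound_prefix\<close> expects.\<close>
    define Y where "Y k = nat \<lfloor>T / real k\<rfloor> + 1" for k
    define be where "be n = \<beta> n * of_real (real n powr c)" for n
    define aa where "aa k = \<alpha> k * of_real (real k powr c)" for k
    define F where "F k = (\<Sum>n\<in>{n\<in>E'. n < Y k}. be n * of_real (X k n))" for k
    have GF: "G k = aa k * F k" if k: "k \<in> Q" for k
    proof -
      have k0: "real k > 0" using NQ[OF k] N1 by linarith
      have "{n\<in>E. real (k * n) \<le> T} = {n\<in>E'. n < Y k}"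
      proof -
        have "real (k * n) \<le> T \<longleftrightarrow> real n \<le> T / real k" for n using k0 by (simp add: pos_le_divide_eq mult.commute)
        moreover have "T / real k \<le> T / N"
          using NQ[OF k] N1 T by (intro divide_left_mono mult_pos_pos) simp_all
        moreover have "n < Y k \<longleftrightarrow> real n \<le> T / real k" for n
        proof
          assume "n < Y k"
          then have "real n \<le> real (nat \<lfloor>T / real k\<rfloor>)" by (simp add: Y_def)
          also have "\<dots> \<le> T / real k" using T k0 by (intro of_nat_floor) simp
          finally show "real n \<le> T / real k" .
        next
          assume "real n \<le> T / real k"
          then show "n < Y k" unfolding Y_def using le_nat_floor[of n "T / real k"] by simp
        qed
        ultimately show ?thesis unfolding E'_def by (intro Collect_cong) (metis mem_Collect_eq order.trans)
      qed
      then show ?thesis unfolding G_def F_def aa_def be_def sum_distrib_left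
        by (intro sum.cong) (simp_all add: powr_mult mult_ac)
    qed
    have "norm (\<Sum>k\<in>Q. G k) = norm (\<Sum>k\<in>Q. aa k * F k)" by (simp add: GF cong: sum.cong)
    also have "\<dots> \<le> (\<Sum>k\<in>Q. \<bar>norm (aa k)\<bar> * \<bar>norm (F k)\<bar>)" by (rule sum_norm_le) (simp add: norm_mult)
    also have "\<dots> \<le> L2_set (\<lambda>k. norm (aa k)) Q * L2_set (\<lambda>k. norm (F k)) Q" by (rule L2_set_mult_ineq)
    also have "\<dots> \<le> (sqrt (2 * N) * (2 * N) powr c) * ((real L + 1) * (sqrt V * (sqrt (T / N) * (T / N) powr c)))"
    proof (rule mult_mono)
      show "L2_set (\<lambda>k. norm (aa k)) Q \<le> sqrt (2 * N) * (2 * N) powr c"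
      proof (rule L2_set_const_le[OF _ _ fQ])
        fix k assume k: "k \<in> Q"
        have "norm (\<alpha> k) * real k powr c \<le> 1 * (2 * N) powr c"
          using ab(1)[of k] k NQ[OF k] c by (intro mult_mono powr_mono2) (simp_all add: Q_def)
        then show "0 \<le> norm (aa k) \<and> norm (aa k) \<le> (2 * N) powr c" by (simp add: aa_def norm_mult)
      next
        have "card Q \<le> card (osf (2 * N))" by (rule card_mono[OF finite_osf Qosf])
        then show "real (card Q) \<le> 2 * N" using card_osf_le[of "2 * N"] N1 by linarith
      qed simp
      have "L2_set (\<lambda>k. norm (F k)) Q \<le> (real L + 1) * (sqrt V * L2_set (\<lambda>n. norm (be n)) E')"
        unfolding F_def by (rule sieve_bound_prefix[OF fQ sb E'L V])
      also have "\<dots> \<le> (real L + 1) * (sqrt V * (sqrt (T / N) * (T / N) powr c))"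
      proof (intro mult_left_mono L2_set_const_le)
        fix n assume n: "n \<in> E'"
        have "norm (\<beta> n) * real n powr c \<le> 1 * (T / N) powr c"
          using ab(2)[of n] n c by (intro mult_mono powr_mono2) (simp_all add: E'_def)
        then show "0 \<le> norm (be n) \<and> norm (be n) \<le> (T / N) powr c" by (simp add: be_def norm_mult)
      next
        have "card E' \<le> card (osf (T / N))" by (rule card_mono[OF finite_osf E'osf])
        then show "real (card E') \<le> T / N" using card_osf_le[of "T / N"] N1 T by fastforce
      qed (use fE V in \<open>simp_all add: E'_def\<close>)
      finally show "L2_set (\<lambda>k. norm (F k)) Q \<le> (real L + 1) * (sqrt V * (sqrt (T / N) * (T / N) powr c))" .
    qed (use N1 in \<open>simp_all add: L2_set_nonneg\<close>)
    also have "\<dots> = (real L + 1) * ((sqrt (2 * N) * sqrt (T / N)) * ((2 * N) powr c * (T / N) powr c) * sqrt V)" by (simp only: mult_ac)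
    also have "sqrt (2 * N) * sqrt (T / N) = sqrt (2 * T)" unfolding real_sqrt_mult[symmetric] using N1 by simp
    also have "(2 * N) powr c * (T / N) powr c = (2 * T) powr c"
    proof -
      have "(2 * N) powr c * (T / N) powr c = (2 * N * (T / N)) powr c" by (rule powr_mult[symmetric])
      then show ?thesis using N1 by simp
    qed
    also have "sqrt (2 * T) * (2 * T) powr c = (2 * T) powr (c + 1 / 2)" using T by (simp add: powr_add powr_half_sqrt)
    also have "(real L + 1) * ((2 * T) powr (c + 1 / 2) * sqrt V) \<le> (3 * Lg) * ((2 * T) powr (c + 1 / 2) * sqrt V)"
    proof (rule mult_right_mono)
      have "real J \<le> Lg" using Lg by (simp add: J_def)
      then show "real L + 1 \<le> 3 * Lg" using Lg by (simp add: L_def)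
    qed (use V in simp)
    finally show ?thesis unfolding Q_def W_def .
  qed
  have "(\<Sum>k\<in>P. G k) = (\<Sum>j\<in>{..J}. \<Sum>k\<in>{k\<in>P. lev k = j}. G k)"
    by (rule sum.group[symmetric, OF fP]) (use lo(3) in auto)
  also have "norm \<dots> \<le> (\<Sum>j\<in>{..J}. W)" by (rule sum_norm_le) (rule block)
  also have "\<dots> = (real J + 1) * W" by simp
  also have "\<dots> \<le> (2 * Lg) * W"
  proof (rule mult_right_mono[OF _ W0])
    have "real J \<le> Lg" using Lg by (simp add: J_def)
    then show "real J + 1 \<le> 2 * Lg" using Lg by simp
  qed
  also have "\<dots> = 6 * Lg\<^sup>2 * ((2 * T) powr (c + 1 / 2) * sqrt V)" by (simp add: W_def power2_eq_square)
  finally show ?thesis unfolding G_def Lg_def .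
qed

text \<open>Of two factors with product at most \<open>T\<close>, one is at most sqrt T. The pairs
  are split into those with n <= sqrt T and those with n > sqrt T, where then m <= sqrt T; in the
  second part the short variable is the modulus, hence the use of \<open>duality\<close>. Since both
  variables exceed \<open>z\<close>, only \<open>N\<close> with z < 2 N occur.\<close>

lemma jacobi_sum_le:
  fixes a b :: "nat \<Rightarrow> complex"
  assumes T: "T \<ge> 2" and z: "z \<ge> 2" and c: "c \<ge> 0" and V: "V \<ge> 0"
    and ab: "\<forall>n\<ge>1. norm (a n) \<le> 1" "\<forall>m\<ge>1. norm (b m) \<le> 1"
    and S: "\<And>N. 1 \<le> N \<Longrightarrow> z < 2 * N \<Longrightarrow> N\<^sup>2 \<le> T \<Longrightarrow> LS (T / N) (2 * N) V \<and> LS (2 * N) (T / N) V"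
  shows "norm (jacobi_sum c a b T z) \<le> 12 * (log 2 T)\<^sup>2 * ((2 * T) powr (c + 1 / 2) * sqrt V)"
proof -
  define E where "E = {n\<in>osf T. z < real n}"
  define O1 where "O1 = {n\<in>osf (sqrt T). z < real n}"
  define E2 where "E2 = {n\<in>E. sqrt T < real n}"
  define t where "t n m = of_real (real (n * m) powr c) * a n * b m * of_real (J n m)" for n m
  have sqT: "sqrt T \<le> T" using T by (intro real_le_lsqrt) (simp_all add: power2_eq_square)
  have fin: "finite E" "finite O1" "finite E2" by (simp_all add: E_def O1_def E2_def)
  have O1E: "O1 \<subseteq> E" using sqT by (auto simp: O1_def E_def osf_def)
  have prod: "real (n * m) \<le> T \<Longrightarrow> sqrt T < real n \<Longrightarrow> real m \<le> sqrt T" for n m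
  proof (rule ccontr)
    assume h: "real (n * m) \<le> T" "sqrt T < real n" "\<not> real m \<le> sqrt T"
    have "0 < real n" using h(2) real_sqrt_ge_zero[of T] T by linarith
    then have "sqrt T * sqrt T < real n * real m" using h T by (intro mult_strict_mono) simp_all
    then show False using h T by simp
  qed
  have ge1: "n \<ge> 1" if "n \<in> E" for n using that odd_pos[of n] by (auto simp: E_def osf_def)
  have HP: "hyperbolic_pairs T z = Sigma O1 (\<lambda>n. {m\<in>E. real (n * m) \<le> T}) \<union> (\<lambda>(m, n). (n, m)) ` Sigma O1 (\<lambda>m. {n\<in>E2. real (m * n) \<le> T})"
    (is "_ = ?A \<union> ?B")
  proof (rule Set.equalityI; rule subsetI)
    fix p assume p: "p \<in> hyperbolic_pairs T z"
    obtain n m where nm: "p = (n, m)" by (cases p)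
    have h: "n \<in> E" "m \<in> E" "real (n * m) \<le> T" using p unfolding nm hyperbolic_pairs_def by (simp_all add: E_def osf_def)
    show "p \<in> ?A \<union> ?B"
    proof (cases "real n \<le> sqrt T")
      case True
      then have "n \<in> O1" using h by (simp add: O1_def E_def osf_def)
      then show ?thesis using h nm by simp
    next
      case False
      then have "real m \<le> sqrt T" using prod[OF h(3)] by simp
      then have "m \<in> O1" using h by (simp add: O1_def E_def osf_def)
      moreover have "n \<in> E2" using False h by (simp add: E2_def)
      ultimately have "(m, n) \<in> Sigma O1 (\<lambda>m. {n\<in>E2. real (m * n) \<le> T})" using h by (simp add: mult.commute)
      then show ?thesis unfolding nm by (rule UnI2[OF image_eqI[rotated]]) simp
    qed
  next
    fix p assume "p \<in> ?A \<union> ?B"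
    then obtain n m where "p = (n, m)" "n \<in> E" "m \<in> E" "real (n * m) \<le> T"
      using O1E by (auto simp: E2_def mult.commute)
    then show "p \<in> hyperbolic_pairs T z" by (simp add: hyperbolic_pairs_def E_def osf_def)
  qed
  have "jacobi_sum c a b T z = (\<Sum>p\<in>hyperbolic_pairs T z. t (fst p) (snd p))"
    unfolding jacobi_sum_def t_def J_def by (rule sum.cong) (auto simp: case_prod_beta)
  also have "\<dots> = (\<Sum>p\<in>?A. t (fst p) (snd p)) + (\<Sum>p\<in>?B. t (fst p) (snd p))"
    unfolding HP by (rule sum.union_disjoint) (use fin in \<open>auto simp: O1_def E2_def osf_def\<close>)
  also have "(\<Sum>p\<in>?A. t (fst p) (snd p)) = (\<Sum>n\<in>O1. \<Sum>m\<in>{m\<in>E. real (n * m) \<le> T}. t n m)"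
    using fin by (subst sum.Sigma) (auto simp: case_prod_beta)
  also have "(\<Sum>p\<in>?B. t (fst p) (snd p)) = (\<Sum>m\<in>O1. \<Sum>n\<in>{n\<in>E2. real (m * n) \<le> T}. t n m)"
    using fin by (subst sum.reindex) (auto simp: inj_on_def sum.Sigma case_prod_beta)
  finally have e: "jacobi_sum c a b T z = (\<Sum>n\<in>O1. \<Sum>m\<in>{m\<in>E. real (n * m) \<le> T}. t n m)
    + (\<Sum>m\<in>O1. \<Sum>n\<in>{n\<in>E2. real (m * n) \<le> T}. t n m)" .
  define R where "R = 6 * (log 2 T)\<^sup>2 * ((2 * T) powr (c + 1 / 2) * sqrt V)"
  have O1: "O1 \<subseteq> osf (sqrt T)" "\<And>k. k \<in> O1 \<Longrightarrow> z < real k" by (auto simp: O1_def)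
  have E: "E \<subseteq> osf T" "E2 \<subseteq> osf T" by (auto simp: E_def E2_def)
  have na: "norm (a n) \<le> 1" "norm (b n) \<le> 1" if "n \<in> E" for n using ab ge1[OF that] by simp_all
  have "norm (\<Sum>n\<in>O1. \<Sum>m\<in>{m\<in>E. real (n * m) \<le> T}. of_real (real (n * m) powr c) * a n * b m * of_real (J n m)) \<le> R"
    unfolding R_def
  proof (rule hyperbolic_region_bound[OF T c V O1 E(1)])
    fix N :: real assume "1 \<le> N" "z < 2 * N" "N\<^sup>2 \<le> T"
    from S[OF this] show "sieve_bound (osf (2 * N)) (\<lambda>_. 1) J (osf (T / N)) V" by (simp add: LS_def)
  qed (use na O1E in auto)
  then have 1: "norm (\<Sum>n\<in>O1. \<Sum>m\<in>{m\<in>E. real (n * m) \<le> T}. t n m) \<le> R" unfolding t_def .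
  have "norm (\<Sum>m\<in>O1. \<Sum>n\<in>{n\<in>E2. real (m * n) \<le> T}. of_real (real (m * n) powr c) * b m * a n * of_real (J n m)) \<le> R"
    unfolding R_def
  proof (rule hyperbolic_region_bound[OF T c V O1 E(2), where X = "\<lambda>m n. J n m"])
    fix N :: real assume "1 \<le> N" "z < 2 * N" "N\<^sup>2 \<le> T"
    from S[OF this] have "sieve_bound (osf (T / N)) (\<lambda>_. 1) J (osf (2 * N)) V" by (simp add: LS_def)
    then show "sieve_bound (osf (2 * N)) (\<lambda>_. 1) (\<lambda>m n. J n m) (osf (T / N)) V"
      by (rule duality[OF _ V])
  qed (use na O1E in \<open>auto simp: E2_def\<close>)
  then have 2: "norm (\<Sum>m\<in>O1. \<Sum>n\<in>{n\<in>E2. real (m * n) \<le> T}. t n m) \<le> R"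
    unfolding t_def by (simp add: mult_ac)
  have "norm (jacobi_sum c a b T z) \<le> R + R" unfolding e by (rule norm_triangle_mono[OF 1 2])
  then show ?thesis by (simp add: R_def mult_ac)
qed

text \<open>As N^2 <= T, the length T/N dominates N, and the optimal large sieve factor T/N + 2 N is
  of order T/N.\<close>

lemma large_sieve_hyperbolic:
  assumes "\<eta> > 0"
  shows "\<exists>C>0. \<forall>T N. 1 \<le> N \<longrightarrow> N\<^sup>2 \<le> T \<longrightarrow> LS (T / N) (2 * N) (C * T powr \<eta> * (T / N)) \<and> LS (2 * N) (T / N) (C * T powr \<eta> * (T / N))"
proof -
  obtain C where C: "C > 0" and R: "\<forall>M\<ge>1. \<forall>N\<ge>1. LS M N (C * (M * N) powr \<eta> * (M + N powr 1))"
    using large_sieve_1[unfolded large_sieve_def, rule_format, OF assms] by (elim exE conjE) (rule that)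
  define C' where "C' = 6 * C * 2 powr \<eta>"
  have C': "C' > 0" using C by (simp add: C'_def)
  have "LS (T / N) (2 * N) (C' * T powr \<eta> * (T / N)) \<and> LS (2 * N) (T / N) (C' * T powr \<eta> * (T / N))"
    if NT: "1 \<le> N" "N\<^sup>2 \<le> T" for T N
  proof -
    have N0: "N > 0" using NT by simp
    have NN: "N * N \<le> T" using NT by (simp add: power2_eq_square)
    have "N * 1 \<le> N * N" using NT by (intro mult_left_mono) simp_all
    then have "N \<le> T" using NN by linarith
    then have T1: "N \<le> T / N" "1 \<le> T / N" "T > 0" using NN NT by (simp_all add: pos_le_divide_eq)
    have mn: "T / N * (2 * N) = 2 * T" using N0 by simp
    have "LS (T / N) (2 * N) (C * (T / N * (2 * N)) powr \<eta> * (T / N + (2 * N) powr 1))"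
      by (rule R[rule_format]) (use T1 NT in simp_all)
    then have 1: "LS (T / N) (2 * N) (C * (2 * T) powr \<eta> * (T / N + 2 * N))" unfolding mn using N0 by simp
    have b: "C * (2 * T) powr \<eta> * (T / N + 2 * N) \<le> C' / 2 * T powr \<eta> * (T / N)"
    proof -
      have "C * (2 * T) powr \<eta> * (T / N + 2 * N) \<le> C * (2 * T) powr \<eta> * (3 * (T / N))"
        using C T1 by (intro mult_left_mono) simp_all
      also have "\<dots> = C' / 2 * T powr \<eta> * (T / N)" using T1 by (simp add: C'_def powr_mult)
      finally show ?thesis .
    qed
    have b0: "0 \<le> C * (2 * T) powr \<eta> * (T / N + 2 * N)" "0 \<le> C' / 2 * T powr \<eta> * (T / N)" using C C' T1 N0 by simp_all
    have "LS (2 * N) (T / N) (2 * (C * (2 * T) powr \<eta> * (T / N + 2 * N)))" by (rule LS_flip[OF 1 b0(1)])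
    moreover have "2 * (C * (2 * T) powr \<eta> * (T / N + 2 * N)) \<le> C' * T powr \<eta> * (T / N)" using mult_left_mono[OF b, of 2] by simp
    moreover have "C * (2 * T) powr \<eta> * (T / N + 2 * N) \<le> C' * T powr \<eta> * (T / N)"
    proof -
      have "x \<le> 2 * x" if "0 \<le> x" for x :: real using that by simp
      from order.trans[OF b this[OF b0(2)]] show ?thesis by simp
    qed
    ultimately show ?thesis using 1 LS_mono[OF _ order_refl order_refl] by blast
  qed
  with C' show ?thesis by blast
qed

text \<open>N^3 <= T means N^2 <= T/N, so the quadratic bound is already of optimal order and
  carries no power loss. The constant is 12 * 5 = 60, doubled by \<open>LS_flip\<close>.\<close>

lemma large_sieve_hyperbolic_small:
  assumes N: "1 \<le> N" "N ^ 3 \<le> T"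
  shows "LS (T / N) (2 * N) (120 * (T / N))" "LS (2 * N) (T / N) (120 * (T / N))"
proof -
  have N0: "N > 0" using N by simp
  have NT: "N\<^sup>2 \<le> T / N" using N N0 by (simp add: pos_le_divide_eq power2_eq_square power3_eq_cube)
  have "0 < N\<^sup>2" using N0 by simp
  then have T0: "T / N > 0" using NT by linarith
  have 1: "LS (T / N) (2 * N) (12 * (T / N + (2 * N)\<^sup>2))" using LS_quadratic[OF T0, of "2 * N"] N0 by simp
  have le: "12 * (T / N + (2 * N)\<^sup>2) \<le> 60 * (T / N)" using NT by (simp add: power_mult_distrib)
  have b0: "0 \<le> 12 * (T / N + (2 * N)\<^sup>2)" using T0 by simp
  show "LS (T / N) (2 * N) (120 * (T / N))"
    by (rule LS_mono[OF 1 order_refl order_refl]) (use le T0 in linarith)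
  show "LS (2 * N) (T / N) (120 * (T / N))"
    by (rule LS_mono[OF LS_flip[OF 1 b0] order_refl order_refl]) (use le in linarith)
qed

lemma final_shape:
  assumes T: "T \<ge> 2" and z: "z \<ge> 2" and c: "c \<ge> 0" and A: "A \<ge> 0"
  shows "12 * (log 2 T)\<^sup>2 * ((2 * T) powr (c + 1 / 2) * sqrt (A * (T / z)))
     = 12 * 2 powr (c + 1 / 2) / (ln 2)\<^sup>2 * sqrt A * ((ln T)\<^sup>2 * T powr (1 + c) / z powr (1 / 2))"
proof -
  have "sqrt (A * (T / z)) = sqrt A * (T powr (1 / 2) / z powr (1 / 2))"
    using T z by (simp add: real_sqrt_mult real_sqrt_divide powr_half_sqrt)
  moreover have "(2 * T) powr (c + 1 / 2) = 2 powr (c + 1 / 2) * T powr (c + 1 / 2)" using T by (simp add: powr_mult)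
  moreover have "T powr (1 + c) = T powr (c + 1 / 2) * T powr (1 / 2)" by (simp add: powr_add[symmetric] add.commute)
  ultimately show ?thesis by (simp add: log_def power_divide)
qed

theorem theorem1p3:
  fixes c :: real
  assumes "c \<ge> 0"
  shows "(\<forall>\<epsilon>::real. \<epsilon> > 0 \<longrightarrow>
            (\<exists>C::real. \<forall>(T::real) (z::real) (a::nat \<Rightarrow> complex) (b::nat \<Rightarrow> complex).
               T \<ge> 2 \<longrightarrow> z \<ge> 2 \<longrightarrow> z \<ge> T powr (1/3 - \<epsilon>) \<longrightarrow>
               (\<forall>n\<ge>1. norm (a n) \<le> 1) \<longrightarrow> (\<forall>m\<ge>1. norm (b m) \<le> 1) \<longrightarrow>
               norm (jacobi_sum c a b T z) \<le> C * (T powr (1 + c + \<epsilon>) / z powr (1/2))))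
       \<and> (\<forall>\<epsilon>::real. \<epsilon> > 0 \<longrightarrow>
            (\<exists>C::real. \<forall>(T::real) (z::real) (a::nat \<Rightarrow> complex) (b::nat \<Rightarrow> complex).
               T \<ge> 2 \<longrightarrow> z \<ge> 2 \<longrightarrow> z \<le> T powr (1/3 - \<epsilon>) \<longrightarrow>
               (\<forall>n\<ge>1. norm (a n) \<le> 1) \<longrightarrow> (\<forall>m\<ge>1. norm (b m) \<le> 1) \<longrightarrow>
               norm (jacobi_sum c a b T z) \<le> C * (T powr (1 + c) * ln T ^ 3 / z powr (1/2))))"
proof (intro conjI allI impI)
  fix \<epsilon> :: real assume eps: "\<epsilon> > 0"
  obtain C where C: "C > 0" and H: "\<forall>T N. 1 \<le> N \<longrightarrow> N\<^sup>2 \<le> T \<longrightarrow> LS (T / N) (2 * N) (C * T powr \<epsilon> * (T / N)) \<and> LS (2 * N) (T / N) (C * T powr \<epsilon> * (T / N))"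
    using large_sieve_hyperbolic[OF eps] by (elim exE conjE) (rule that)
  define D where "D = 12 * 2 powr (c + 1 / 2) / (ln 2)\<^sup>2 * sqrt (2 * C)"
  have D: "D \<ge> 0" using C by (simp add: D_def)
  \<comment> \<open>Half of \<epsilon> goes to the square root of the large sieve loss, the other
    half to (ln T)^2 <= (4/\<epsilon>)^2 T^(\<epsilon>/2).\<close>
  define G where "G = D * (4 / \<epsilon>)\<^sup>2"
  show "\<exists>C::real. \<forall>(T::real) (z::real) (a::nat \<Rightarrow> complex) (b::nat \<Rightarrow> complex).
               T \<ge> 2 \<longrightarrow> z \<ge> 2 \<longrightarrow> z \<ge> T powr (1/3 - \<epsilon>) \<longrightarrow>
               (\<forall>n\<ge>1. norm (a n) \<le> 1) \<longrightarrow> (\<forall>m\<ge>1. norm (b m) \<le> 1) \<longrightarrow>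
               norm (jacobi_sum c a b T z) \<le> C * (T powr (1 + c + \<epsilon>) / z powr (1/2))"
  proof (intro exI[of _ G] allI impI)
    fix T z :: real and a b :: "nat \<Rightarrow> complex"
    assume T: "T \<ge> 2" and z: "z \<ge> 2" and a: "\<forall>n\<ge>1. norm (a n) \<le> 1" and b: "\<forall>m\<ge>1. norm (b m) \<le> 1"
    define V where "V = 2 * C * T powr \<epsilon> * (T / z)"
    have V: "V \<ge> 0" using C T z by (simp add: V_def)
    have LV: "LS (T / N) (2 * N) V \<and> LS (2 * N) (T / N) V" if N: "1 \<le> N" "z < 2 * N" "N\<^sup>2 \<le> T" for N
    proof -
      have "T / N \<le> T / (z / 2)" using N T z by (intro divide_left_mono) simp_all
      then have "C * T powr \<epsilon> * (T / N) \<le> C * T powr \<epsilon> * (T / (z / 2))" using C by (intro mult_left_mono) simp_all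
      also have "\<dots> = V" by (simp add: V_def)
      finally have "C * T powr \<epsilon> * (T / N) \<le> V" .
      then show ?thesis using H[rule_format, OF N(1,3)] LS_mono[OF _ order_refl order_refl] by blast
    qed
    have "norm (jacobi_sum c a b T z) \<le> 12 * (log 2 T)\<^sup>2 * ((2 * T) powr (c + 1 / 2) * sqrt V)"
      by (rule jacobi_sum_le[OF T z assms V a b LV])
    also have "\<dots> = 12 * 2 powr (c + 1 / 2) / (ln 2)\<^sup>2 * sqrt (2 * C * T powr \<epsilon>) * ((ln T)\<^sup>2 * T powr (1 + c) / z powr (1 / 2))"
      unfolding V_def by (rule final_shape[OF T z assms]) (use C in simp)
    also have "sqrt (2 * C * T powr \<epsilon>) = sqrt (2 * C) * T powr (\<epsilon> / 2)"
      using T by (simp add: real_sqrt_mult powr_half_sqrt_powr)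
    also have "12 * 2 powr (c + 1 / 2) / (ln 2)\<^sup>2 * (sqrt (2 * C) * T powr (\<epsilon> / 2)) * ((ln T)\<^sup>2 * T powr (1 + c) / z powr (1 / 2))
       = D * ((ln T)\<^sup>2 * (T powr (\<epsilon> / 2) * T powr (1 + c))) / z powr (1 / 2)" by (simp add: D_def mult_ac)
    also have "\<dots> \<le> D * ((T powr (\<epsilon> / 4) / (\<epsilon> / 4))\<^sup>2 * (T powr (\<epsilon> / 2) * T powr (1 + c))) / z powr (1 / 2)"
      using D T eps ln_le_powr[of "\<epsilon> / 4" T] by (intro divide_right_mono mult_left_mono mult_right_mono power_mono) simp_all
    also have "(T powr (\<epsilon> / 4) / (\<epsilon> / 4))\<^sup>2 = (4 / \<epsilon>)\<^sup>2 * T powr (\<epsilon> / 2)"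
      by (simp add: power2_eq_square powr_add[symmetric])
    also have "(4 / \<epsilon>)\<^sup>2 * T powr (\<epsilon> / 2) * (T powr (\<epsilon> / 2) * T powr (1 + c)) = (4 / \<epsilon>)\<^sup>2 * T powr (1 + c + \<epsilon>)"
      by (simp add: mult.assoc powr_add[symmetric] add.commute)
    finally show "norm (jacobi_sum c a b T z) \<le> G * (T powr (1 + c + \<epsilon>) / z powr (1/2))" by (simp add: G_def mult.assoc)
  qed
next
  fix \<epsilon> :: real assume eps: "\<epsilon> > 0"
  obtain C where C: "C > 0" and H: "\<forall>T N. 1 \<le> N \<longrightarrow> N\<^sup>2 \<le> T \<longrightarrow> LS (T / N) (2 * N) (C * T powr \<epsilon> * (T / N)) \<and> LS (2 * N) (T / N) (C * T powr \<epsilon> * (T / N))"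
    using large_sieve_hyperbolic[OF eps] by (elim exE conjE) (rule that)
  \<comment> \<open>240 covers the blocks with N^3 <= T, where T/N <= 2 T/z, and \<open>C\<close>
    the longer ones.\<close>
  define A where "A = 240 + C"
  have A: "A \<ge> 0" using C by (simp add: A_def)
  define D where "D = 12 * 2 powr (c + 1 / 2) / (ln 2)\<^sup>2 * sqrt A"
  have D: "D \<ge> 0" using A by (simp add: D_def)
  show "\<exists>C::real. \<forall>(T::real) (z::real) (a::nat \<Rightarrow> complex) (b::nat \<Rightarrow> complex).
               T \<ge> 2 \<longrightarrow> z \<ge> 2 \<longrightarrow> z \<le> T powr (1/3 - \<epsilon>) \<longrightarrow>
               (\<forall>n\<ge>1. norm (a n) \<le> 1) \<longrightarrow> (\<forall>m\<ge>1. norm (b m) \<le> 1) \<longrightarrow>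
               norm (jacobi_sum c a b T z) \<le> C * (T powr (1 + c) * ln T ^ 3 / z powr (1/2))"
  proof (intro exI[of _ "D / ln 2"] allI impI)
    fix T z :: real and a b :: "nat \<Rightarrow> complex"
    assume T: "T \<ge> 2" and z: "z \<ge> 2" and zT: "z \<le> T powr (1/3 - \<epsilon>)"
      and a: "\<forall>n\<ge>1. norm (a n) \<le> 1" and b: "\<forall>m\<ge>1. norm (b m) \<le> 1"
    define V where "V = A * (T / z)"
    have Tz: "T / z \<ge> 0" using T z by simp
    have V: "V \<ge> 0" using A Tz unfolding V_def by (rule mult_nonneg_nonneg)
    have LV: "LS (T / N) (2 * N) V \<and> LS (2 * N) (T / N) V" if N: "1 \<le> N" "z < 2 * N" "N\<^sup>2 \<le> T" for N
    proof (cases "N ^ 3 \<le> T")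
      case True
      have "T / N \<le> T / (z / 2)" using N T z by (intro divide_left_mono) simp_all
      then have "120 * (T / N) \<le> 240 * (T / z)" by simp
      also have "\<dots> \<le> V" unfolding V_def A_def using C Tz by (intro mult_right_mono) simp_all
      finally have "120 * (T / N) \<le> V" .
      then show ?thesis using large_sieve_hyperbolic_small[OF N(1) True] LS_mono[OF _ order_refl order_refl] by blast
    next
      case False
      have "T powr (1 / 3) \<le> (N ^ 3) powr (1 / 3)" using False T by (intro powr_mono2) simp_all
      also have "N ^ 3 = N powr 3" using N by simp
      also have "(N powr 3) powr (1 / 3) = N" unfolding powr_powr using N by simp
      finally have n3: "T powr (1 / 3) \<le> N" .
      \<comment> \<open>Beyond T^(1/3) the block length exceeds z T^\<epsilon>, so the loss
        T^\<epsilon> of the large sieve is recovered in T/N.\<close>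
      have "z * T powr \<epsilon> \<le> T powr (1/3 - \<epsilon>) * T powr \<epsilon>" using zT by (intro mult_right_mono) simp_all
      also have "\<dots> = T powr (1 / 3)" by (simp add: powr_add[symmetric])
      finally have "z * T powr \<epsilon> \<le> N" using n3 by simp
      then have "T powr \<epsilon> \<le> N / z" using z by (simp add: pos_le_divide_eq mult.commute)
      then have "T powr \<epsilon> / N \<le> N / z / N" using N by (intro divide_right_mono) simp_all
      then have "T powr \<epsilon> / N \<le> 1 / z" using N by simp
      then have "C * T * (T powr \<epsilon> / N) \<le> C * T * (1 / z)" using C T by (intro mult_left_mono) simp_all
      then have "C * T powr \<epsilon> * (T / N) \<le> C * (T / z)" by (simp add: mult_ac)
      also have "\<dots> \<le> V" unfolding V_def A_def using Tz by (intro mult_right_mono) simp_all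
      finally have "C * T powr \<epsilon> * (T / N) \<le> V" .
      then show ?thesis using H[rule_format, OF N(1,3)] LS_mono[OF _ order_refl order_refl] by blast
    qed
    have "norm (jacobi_sum c a b T z) \<le> 12 * (log 2 T)\<^sup>2 * ((2 * T) powr (c + 1 / 2) * sqrt V)"
      by (rule jacobi_sum_le[OF T z assms V a b LV])
    also have "\<dots> = D * ((ln T)\<^sup>2 * T powr (1 + c) / z powr (1 / 2))"
      unfolding V_def D_def by (rule final_shape[OF T z assms A])
    \<comment> \<open>The estimate so far has (ln T)^2; a factor \<open>ln T / ln 2\<close>, at
      least 1, is inserted to reach the cube.\<close>
    also have "\<dots> = D * ((ln T)\<^sup>2 * 1 * T powr (1 + c) / z powr (1 / 2))" by simp
    also have "\<dots> \<le> D * ((ln T)\<^sup>2 * (ln T / ln 2) * T powr (1 + c) / z powr (1 / 2))"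
      using D T by (intro mult_left_mono divide_right_mono mult_right_mono) simp_all
    also have "\<dots> = D / ln 2 * (T powr (1 + c) * ln T ^ 3 / z powr (1/2))"
      by (simp add: power2_eq_square power3_eq_cube)
    finally show "norm (jacobi_sum c a b T z) \<le> D / ln 2 * (T powr (1 + c) * ln T ^ 3 / z powr (1/2))" .
  qed
qed

end
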